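(* Let $k$ be a perfect field of positive characteristic $p$. (i) For a discrete group $\Gamma$, the proalgebraic completion $\Gamma^{\mathrm{alg}}$ over $k$ is a perfect group scheme over $k$. (ii) Let $X$ be a connected topological space and $x_0\in X$ a point. Then the proalgebraic fundamental group $\pi_k(X,x_0)$ over $k$ is a perfect group scheme over $k$.
   Context: An affine group scheme $G=\mathrm{Spec}\,A$ over $k$ is perfect if the $p$-power map $a\mapsto a^p$ is bijective on $A$. The proalgebraic completion $\Gamma^{\mathrm{alg}}$ of a discrete group $\Gamma$ over $k$ is the Tannakian dual of the category $\mathrm{Rep}(\Gamma)$ of representations of $\Gamma$ on finite-dimensional $k$-vector spaces with its forgetful fibre functor. $\mathbf{Loc}_k(X)$ is the category of local systems (locally constant sheaves) of finite-dimensional $k$-vector spaces on $X$. For $X$ connected and $x_0\in X$ it is a neutral Tannakian category over $k$ with fibre functor $\omega_{x_0}(\mathcal{E})=\mathcal{E}_{x_0}$ (stalk), and $\pi_k(X,x_0)=\underline{\mathrm{Aut}}^\otimes(\omega_{x_0})$ is its Tannakian dual, an affine group scheme over $k$. *)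

theory Defs
  imports
    "Jordan_Normal_Form.Missing_VectorSpace"
    "HOL-Algebra.AbelCoset"
    "HOL-Analysis.Abstract_Topology"
begin

text \<open>
  Vector spaces and algebras over a field \<open>k\<close> are records of type \<open>('k, 'v) module\<close> subject to the
  locales \<^locale>\<open>vectorspace\<close> and \<^locale>\<open>algebra\<close> (the latter are commutative with unit, the
  zero ring being allowed). For vector spaces the fields \<open>mult\<close> and \<open>one\<close> of the record are junk.
\<close>

section \<open>Perfect fields\<close>

definition has_characteristic :: "('k, 'z) ring_scheme \<Rightarrow> nat \<Rightarrow> bool" where
  "has_characteristic k p \<longleftrightarrow> (\<forall>m::nat. [m] \<cdot>\<^bsub>k\<^esub> \<one>\<^bsub>k\<^esub> = \<zero>\<^bsub>k\<^esub> \<longleftrightarrow> p dvd m)"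

text \<open>A field is perfect if it has characteristic 0, or characteristic \<open>p > 0\<close> and every element
  is a \<open>p\<close>-th power.\<close>

definition perfect_field :: "('k, 'z) ring_scheme \<Rightarrow> bool" where
  "perfect_field k \<longleftrightarrow> field k \<and>
     (\<forall>p>0. has_characteristic k p \<longrightarrow> (\<forall>c\<in>carrier k. \<exists>d\<in>carrier k. d [^]\<^bsub>k\<^esub> p = c))"


section \<open>Linear algebra\<close>

definition fd_space :: "'k ring \<Rightarrow> ('k, 'v) module \<Rightarrow> bool" where
  "fd_space k V \<longleftrightarrow> vectorspace k V \<and> vectorspace.fin_dim k V"

definition bilinear_maps ::
  "('r, 'z) ring_scheme \<Rightarrow> ('r, 'a) module \<Rightarrow> ('r, 'b) module \<Rightarrow> ('r, 'c) module \<Rightarrow> ('a \<Rightarrow> 'b \<Rightarrow> 'c) set"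
where
  "bilinear_maps R M N P =
     {\<beta>. (\<forall>x\<in>carrier M. \<beta> x \<in> LinearCombinations.module_hom R N P) \<and>
         (\<forall>y\<in>carrier N. (\<lambda>x. \<beta> x y) \<in> LinearCombinations.module_hom R M P)}"

text \<open>\<open>\<beta> : V \<times> W \<rightarrow> T\<close> is a tensor product: it is the universal bilinear map. The target \<open>Z\<close> ranges
  over the vector spaces on the same type as \<open>T\<close>.\<close>

definition is_tensor_product ::
  "'k ring \<Rightarrow> ('k, 'v) module \<Rightarrow> ('k, 'v) module \<Rightarrow> ('k, 'v) module \<Rightarrow> ('v \<Rightarrow> 'v \<Rightarrow> 'v) \<Rightarrow> bool"
where
  "is_tensor_product k V W T \<beta> \<longleftrightarrow> \<beta> \<in> bilinear_maps k V W T \<and>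
     (\<forall>(Z :: ('k, 'v) module) \<gamma>. vectorspace k Z \<and> \<gamma> \<in> bilinear_maps k V W Z \<longrightarrow>
        (\<exists>f\<in>LinearCombinations.module_hom k T Z.
           (\<forall>x\<in>carrier V. \<forall>y\<in>carrier W. f (\<beta> x y) = \<gamma> x y) \<and>
           (\<forall>f'\<in>LinearCombinations.module_hom k T Z.
              (\<forall>x\<in>carrier V. \<forall>y\<in>carrier W. f' (\<beta> x y) = \<gamma> x y) \<longrightarrow>
              (\<forall>t\<in>carrier T. f' t = f t))))"

definition free_module :: "('r, 'z) ring_scheme \<Rightarrow> 'b set \<Rightarrow> ('r, 'b \<Rightarrow> 'r) module" where
  "free_module R S =
     \<lparr>carrier = {f. f \<in> S \<rightarrow> carrier R \<and> (\<forall>s. s \<notin> S \<longrightarrow> f s = \<zero>\<^bsub>R\<^esub>) \<and> finite {s. f s \<noteq> \<zero>\<^bsub>R\<^esub>}},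
      mult = undefined, one = undefined,
      zero = (\<lambda>_. \<zero>\<^bsub>R\<^esub>),
      add = (\<lambda>f g s. f s \<oplus>\<^bsub>R\<^esub> g s),
      smult = (\<lambda>r f s. r \<otimes>\<^bsub>R\<^esub> f s)\<rparr>"

definition free_gen :: "('r, 'z) ring_scheme \<Rightarrow> 'b \<Rightarrow> 'b \<Rightarrow> 'r" where
  "free_gen R b = (\<lambda>s. if s = b then \<one>\<^bsub>R\<^esub> else \<zero>\<^bsub>R\<^esub>)"

definition quotient_module :: "('r, 'a) module \<Rightarrow> 'a set \<Rightarrow> ('r, 'a set) module" where
  "quotient_module M N =
     \<lparr>carrier = a_rcosets\<^bsub>M\<^esub> N,
      mult = undefined, one = undefined,
      zero = N,
      add = (\<lambda>C D. C <+>\<^bsub>M\<^esub> D),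
      smult = (\<lambda>r C. \<Union>x\<in>C. N +>\<^bsub>M\<^esub> (r \<odot>\<^bsub>M\<^esub> x))\<rparr>"

text \<open>The base change \<open>V \<otimes>\<^sub>k R\<close> as an \<open>R\<close>-module: the free \<open>R\<close>-module on the symbols \<open>v \<otimes> 1\<close> modulo
  \<open>(v + w) \<otimes> 1 = v \<otimes> 1 + w \<otimes> 1\<close> and \<open>cv \<otimes> 1 = (c 1\<^sub>R) \<sqdot> (v \<otimes> 1)\<close>.\<close>

definition base_change_relations ::
  "'k ring \<Rightarrow> ('k, 'r) module \<Rightarrow> ('k, 'v) module \<Rightarrow> ('v \<Rightarrow> 'r) set"
where
  "base_change_relations k R V =
     (let F = free_module R (carrier V) in
     LinearCombinations.module.span R F
      ({free_gen R (v \<oplus>\<^bsub>V\<^esub> w) \<ominus>\<^bsub>F\<^esub> (free_gen R v \<oplus>\<^bsub>F\<^esub> free_gen R w)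
          | v w. v \<in> carrier V \<and> w \<in> carrier V} \<union>
       {free_gen R (c \<odot>\<^bsub>V\<^esub> v) \<ominus>\<^bsub>F\<^esub> ((c \<odot>\<^bsub>R\<^esub> \<one>\<^bsub>R\<^esub>) \<odot>\<^bsub>F\<^esub> free_gen R v)
          | c v. c \<in> carrier k \<and> v \<in> carrier V}))"

definition base_change ::
  "'k ring \<Rightarrow> ('k, 'r) module \<Rightarrow> ('k, 'v) module \<Rightarrow> ('r, ('v \<Rightarrow> 'r) set) module"
where
  "base_change k R V =
     quotient_module (free_module R (carrier V)) (base_change_relations k R V)"

text \<open>The element \<open>v \<otimes> 1\<close> of \<open>V \<otimes>\<^sub>k R\<close>.\<close>

definition base_elt ::
  "'k ring \<Rightarrow> ('k, 'r) module \<Rightarrow> ('k, 'v) module \<Rightarrow> 'v \<Rightarrow> ('v \<Rightarrow> 'r) set"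
where
  "base_elt k R V v =
     base_change_relations k R V +>\<^bsub>free_module R (carrier V)\<^esub> free_gen R v"


section \<open>Tensor automorphisms of a fibre functor\<close>

text \<open>
  The data of a tensor category with a fibre functor \<open>\<omega>\<close> to vector spaces, as far as they enter
  the definition of \<open>Aut\<^sup>\<otimes>(\<omega>)\<close>:
  \<^item> \<open>Fib V\<close> is \<open>\<omega>(V)\<close>, and \<open>Mor V W\<close> is the set of the maps \<open>\<omega>(f)\<close> for the morphisms \<open>f : V \<rightarrow> W\<close>;
  \<^item> \<open>Tens V W T\<close> is the set of the bilinear maps \<open>\<omega>(V) \<times> \<omega>(W) \<rightarrow> \<omega>(T)\<close> that are induced by the
    structures of a tensor product of \<open>V\<close> and \<open>W\<close> on the object \<open>T\<close> (there may be none or many);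
  \<^item> \<open>Unit U\<close> is the set of the elements of \<open>\<omega>(U)\<close> that correspond to \<open>1 \<in> k = \<omega>(\<one>)\<close> under the
    isomorphisms between the unit object and \<open>U\<close>.
  No choice of a tensor product for each pair of objects is needed: by naturality, compatibility
  with one choice is the same as compatibility with all.
\<close>

record ('o, 'k, 'v) fibre_functor =
  Obj :: "'o set"
  Fib :: "'o \<Rightarrow> ('k, 'v) module"
  Mor :: "'o \<Rightarrow> 'o \<Rightarrow> ('v \<Rightarrow> 'v) set"
  Tens :: "'o \<Rightarrow> 'o \<Rightarrow> 'o \<Rightarrow> ('v \<Rightarrow> 'v \<Rightarrow> 'v) set"
  Unit :: "'o \<Rightarrow> 'v set"

text \<open>\<open>Aut\<^sup>\<otimes>(\<omega>)(R)\<close>: families of \<open>R\<close>-linear automorphisms \<open>\<eta>\<^sub>V\<close> of \<open>\<omega>(V) \<otimes> R\<close>, natural in \<open>V\<close>, with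
  \<open>\<eta>\<^bsub>V \<otimes> W\<^esub> = \<eta>\<^sub>V \<otimes> \<eta>\<^sub>W\<close> and \<open>\<eta>\<^sub>\<one> = id\<close>. The \<open>R\<close>-linear map \<open>g\<close> below is \<open>\<omega>(f) \<otimes> R\<close>, and the
  \<open>R\<close>-bilinear map \<open>B\<close> is the one that identifies \<open>(\<omega>(V) \<otimes> R) \<otimes>\<^sub>R (\<omega>(W) \<otimes> R)\<close> with
  \<open>\<omega>(V \<otimes> W) \<otimes> R\<close>; both are determined by their values on the elements \<open>v \<otimes> 1\<close>.\<close>

definition tensor_automorphisms ::
  "'k ring \<Rightarrow> ('o, 'k, 'v) fibre_functor \<Rightarrow> ('k, 'r) module \<Rightarrow>
   ('o \<Rightarrow> ('v \<Rightarrow> 'r) set \<Rightarrow> ('v \<Rightarrow> 'r) set) set"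
where
  "tensor_automorphisms k \<omega> R =
    {\<eta> \<in> extensional (Obj \<omega>).
       (\<forall>V\<in>Obj \<omega>. let VR = base_change k R (Fib \<omega> V) in
          \<eta> V \<in> extensional (carrier VR) \<and>
          \<eta> V \<in> LinearCombinations.module_hom R VR VR \<and>
          bij_betw (\<eta> V) (carrier VR) (carrier VR)) \<and>
       (\<forall>V\<in>Obj \<omega>. \<forall>W\<in>Obj \<omega>. \<forall>f\<in>Mor \<omega> V W.
          let VR = base_change k R (Fib \<omega> V); WR = base_change k R (Fib \<omega> W) in
          \<forall>g\<in>LinearCombinations.module_hom R VR WR.
            (\<forall>v\<in>carrier (Fib \<omega> V). g (base_elt k R (Fib \<omega> V) v) = base_elt k R (Fib \<omega> W) (f v)) \<longrightarrow>
            (\<forall>x\<in>carrier VR. \<eta> W (g x) = g (\<eta> V x))) \<and>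
       (\<forall>V\<in>Obj \<omega>. \<forall>W\<in>Obj \<omega>. \<forall>T\<in>Obj \<omega>. \<forall>\<beta>\<in>Tens \<omega> V W T.
          let VR = base_change k R (Fib \<omega> V); WR = base_change k R (Fib \<omega> W);
              TR = base_change k R (Fib \<omega> T) in
          \<forall>B\<in>bilinear_maps R VR WR TR.
            (\<forall>v\<in>carrier (Fib \<omega> V). \<forall>w\<in>carrier (Fib \<omega> W).
               B (base_elt k R (Fib \<omega> V) v) (base_elt k R (Fib \<omega> W) w)
                 = base_elt k R (Fib \<omega> T) (\<beta> v w)) \<longrightarrow>
            (\<forall>x\<in>carrier VR. \<forall>y\<in>carrier WR. \<eta> T (B x y) = B (\<eta> V x) (\<eta> W y))) \<and>
       (\<forall>U\<in>Obj \<omega>. \<forall>u\<in>Unit \<omega> U.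
          \<eta> U (base_elt k R (Fib \<omega> U) u) = base_elt k R (Fib \<omega> U) u)}"

definition tensor_aut_group ::
  "'k ring \<Rightarrow> ('o, 'k, 'v) fibre_functor \<Rightarrow> ('k, 'r) module \<Rightarrow>
   ('o \<Rightarrow> ('v \<Rightarrow> 'r) set \<Rightarrow> ('v \<Rightarrow> 'r) set) monoid"
where
  "tensor_aut_group k \<omega> R =
     \<lparr>carrier = tensor_automorphisms k \<omega> R,
      mult = (\<lambda>\<eta> \<theta>. \<lambda>V\<in>Obj \<omega>. compose (carrier (base_change k R (Fib \<omega> V))) (\<eta> V) (\<theta> V)),
      one = (\<lambda>V\<in>Obj \<omega>. \<lambda>x\<in>carrier (base_change k R (Fib \<omega> V)). x)\<rparr>"

text \<open>\<open>\<theta> \<in> Aut\<^sup>\<otimes>(\<omega>)(S)\<close> is the image of \<open>\<eta> \<in> Aut\<^sup>\<otimes>(\<omega>)(R)\<close> under \<open>\<phi> : R \<rightarrow> S\<close>. The map \<open>m\<close> below is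
  \<open>id \<otimes> \<phi> : \<omega>(V) \<otimes> R \<rightarrow> \<omega>(V) \<otimes> S\<close>.\<close>

definition tensor_aut_induced ::
  "'k ring \<Rightarrow> ('o, 'k, 'v) fibre_functor \<Rightarrow> ('k, 'r) module \<Rightarrow> ('k, 's) module \<Rightarrow> ('r \<Rightarrow> 's) \<Rightarrow>
   ('o \<Rightarrow> ('v \<Rightarrow> 'r) set \<Rightarrow> ('v \<Rightarrow> 'r) set) \<Rightarrow> ('o \<Rightarrow> ('v \<Rightarrow> 's) set \<Rightarrow> ('v \<Rightarrow> 's) set) \<Rightarrow> bool"
where
  "tensor_aut_induced k \<omega> R S \<phi> \<eta> \<theta> \<longleftrightarrow>
     (\<forall>V\<in>Obj \<omega>. let VR = base_change k R (Fib \<omega> V); VS = base_change k S (Fib \<omega> V) in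
        \<forall>m\<in>carrier VR \<rightarrow> carrier VS.
          (\<forall>x\<in>carrier VR. \<forall>y\<in>carrier VR. m (x \<oplus>\<^bsub>VR\<^esub> y) = m x \<oplus>\<^bsub>VS\<^esub> m y) \<and>
          (\<forall>r\<in>carrier R. \<forall>x\<in>carrier VR. m (r \<odot>\<^bsub>VR\<^esub> x) = \<phi> r \<odot>\<^bsub>VS\<^esub> m x) \<and>
          (\<forall>v\<in>carrier (Fib \<omega> V). m (base_elt k R (Fib \<omega> V) v) = base_elt k S (Fib \<omega> V) v) \<longrightarrow>
          (\<forall>x\<in>carrier VR. \<theta> V (m x) = m (\<eta> V x)))"


section \<open>Affine group schemes and Tannakian duals\<close>

definition alg_hom :: "'k ring \<Rightarrow> ('k, 'r) module \<Rightarrow> ('k, 's) module \<Rightarrow> ('r \<Rightarrow> 's) set" where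
  "alg_hom k R S =
     ring_hom R S \<inter> LinearCombinations.module_hom k R S \<inter> extensional (carrier R)"

text \<open>An affine group scheme \<open>Spec A\<close> by its functor of points: \<open>G\<close> is a group structure on
  \<open>Hom(A, R)\<close>, functorial in the \<open>k\<close>-algebra \<open>R\<close>. Since the type of \<open>R\<close> has to be fixed, the
  algebras \<open>R\<close> are those on the type \<open>'a\<close> of \<open>A\<close>. So the functor of points still determines \<open>A\<close>
  among the algebras on \<open>'a\<close>, by the Yoneda lemma; \<open>'a\<close> is arbitrary.\<close>

definition affine_group_scheme ::
  "'k ring \<Rightarrow> ('k, 'a) module \<Rightarrow> (('k, 'a) module \<Rightarrow> ('a \<Rightarrow> 'a) monoid) \<Rightarrow> bool"
where
  "affine_group_scheme k A G \<longleftrightarrow> algebra k A \<and>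
     (\<forall>R. algebra k R \<longrightarrow> group (G R) \<and> carrier (G R) = alg_hom k A R) \<and>
     (\<forall>R S \<phi>. algebra k R \<and> algebra k S \<and> \<phi> \<in> alg_hom k R S \<longrightarrow>
        (\<lambda>h. compose (carrier A) \<phi> h) \<in> hom (G R) (G S))"

definition perfect_group_scheme ::
  "nat \<Rightarrow> 'k ring \<Rightarrow> ('k, 'a) module \<Rightarrow> (('k, 'a) module \<Rightarrow> ('a \<Rightarrow> 'a) monoid) \<Rightarrow> bool"
where
  "perfect_group_scheme p k A G \<longleftrightarrow> affine_group_scheme k A G \<and>
     bij_betw (\<lambda>a. a [^]\<^bsub>A\<^esub> p) (carrier A) (carrier A)"

text \<open>\<open>Spec A\<close>, with group structure \<open>G\<close>, represents \<open>Aut\<^sup>\<otimes>(\<omega>)\<close>.\<close>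

definition tannakian_dual ::
  "'k ring \<Rightarrow> ('o, 'k, 'v) fibre_functor \<Rightarrow>
   ('k, 'a) module \<Rightarrow> (('k, 'a) module \<Rightarrow> ('a \<Rightarrow> 'a) monoid) \<Rightarrow> bool"
where
  "tannakian_dual k \<omega> A G \<longleftrightarrow> affine_group_scheme k A G \<and>
     (\<exists>\<Phi>. (\<forall>R. algebra k R \<longrightarrow> \<Phi> R \<in> iso (G R) (tensor_aut_group k \<omega> R)) \<and>
          (\<forall>R S \<phi>. algebra k R \<and> algebra k S \<and> \<phi> \<in> alg_hom k R S \<longrightarrow>
             (\<forall>h\<in>carrier (G R).
                tensor_aut_induced k \<omega> R S \<phi> (\<Phi> R h) (\<Phi> S (compose (carrier A) \<phi> h)))))"


section \<open>Representations of a discrete group\<close>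

definition fd_representation ::
  "'k ring \<Rightarrow> ('g, 'z) monoid_scheme \<Rightarrow> ('k, 'v) module \<times> ('g \<Rightarrow> 'v \<Rightarrow> 'v) \<Rightarrow> bool"
where
  "fd_representation k \<Gamma> = (\<lambda>(V, \<rho>). fd_space k V \<and>
     (\<forall>g\<in>carrier \<Gamma>. \<rho> g \<in> LinearCombinations.module_hom k V V) \<and>
     (\<forall>v\<in>carrier V. \<rho> \<one>\<^bsub>\<Gamma>\<^esub> v = v) \<and>
     (\<forall>g\<in>carrier \<Gamma>. \<forall>h\<in>carrier \<Gamma>. \<forall>v\<in>carrier V. \<rho> (g \<otimes>\<^bsub>\<Gamma>\<^esub> h) v = \<rho> g (\<rho> h v)))"

text \<open>The category \<open>Rep(\<Gamma>)\<close> of representations on finite-dimensional spaces carried by subsets of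
  the type \<open>'v\<close>, with its forgetful functor.\<close>

definition Rep ::
  "'v itself \<Rightarrow> 'k ring \<Rightarrow> ('g, 'z) monoid_scheme \<Rightarrow>
   (('k, 'v) module \<times> ('g \<Rightarrow> 'v \<Rightarrow> 'v), 'k, 'v) fibre_functor"
where
  "Rep _ k \<Gamma> =
     \<lparr>Obj = {X. fd_representation k \<Gamma> X},
      Fib = fst,
      Mor = (\<lambda>(V, \<rho>) (W, \<sigma>). {f \<in> LinearCombinations.module_hom k V W.
               \<forall>g\<in>carrier \<Gamma>. \<forall>v\<in>carrier V. f (\<rho> g v) = \<sigma> g (f v)}),
      Tens = (\<lambda>(V, \<rho>) (W, \<sigma>) (T, \<tau>). {\<beta>. is_tensor_product k V W T \<beta> \<and>
               (\<forall>g\<in>carrier \<Gamma>. \<forall>v\<in>carrier V. \<forall>w\<in>carrier W. \<tau> g (\<beta> v w) = \<beta> (\<rho> g v) (\<sigma> g w))}),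
      Unit = (\<lambda>(U, \<upsilon>). {u \<in> carrier U. bij_betw (\<lambda>c. c \<odot>\<^bsub>U\<^esub> u) (carrier k) (carrier U) \<and>
               (\<forall>g\<in>carrier \<Gamma>. \<upsilon> g u = u)})\<rparr>"

definition is_proalgebraic_completion ::
  "'v itself \<Rightarrow> 'k ring \<Rightarrow> ('g, 'z) monoid_scheme \<Rightarrow>
   ('k, 'a) module \<Rightarrow> (('k, 'a) module \<Rightarrow> ('a \<Rightarrow> 'a) monoid) \<Rightarrow> bool"
where
  "is_proalgebraic_completion T k \<Gamma> A G \<longleftrightarrow> tannakian_dual k (Rep T k \<Gamma>) A G"


section \<open>Local systems\<close>

text \<open>\<open>Sec F U\<close> is the space of sections over \<open>U\<close>, and \<open>Res F U V\<close> is the restriction from \<open>U\<close> to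
  \<open>V \<subseteq> U\<close>. Only the values on open sets matter.\<close>

record ('x, 'k, 's) presheaf =
  Sec :: "'x set \<Rightarrow> ('k, 's) module"
  Res :: "'x set \<Rightarrow> 'x set \<Rightarrow> 's \<Rightarrow> 's"

definition presheaf_of_spaces :: "'k ring \<Rightarrow> 'x topology \<Rightarrow> ('x, 'k, 's) presheaf \<Rightarrow> bool" where
  "presheaf_of_spaces k X F \<longleftrightarrow>
     (\<forall>U. openin X U \<longrightarrow> vectorspace k (Sec F U)) \<and>
     (\<forall>U V. openin X U \<and> openin X V \<and> V \<subseteq> U \<longrightarrow>
        Res F U V \<in> LinearCombinations.module_hom k (Sec F U) (Sec F V)) \<and>
     (\<forall>U. openin X U \<longrightarrow> (\<forall>s\<in>carrier (Sec F U). Res F U U s = s)) \<and>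
     (\<forall>U V W. openin X U \<and> openin X V \<and> openin X W \<and> W \<subseteq> V \<and> V \<subseteq> U \<longrightarrow>
        (\<forall>s\<in>carrier (Sec F U). Res F V W (Res F U V s) = Res F U W s))"

definition sheaf_of_spaces :: "'k ring \<Rightarrow> 'x topology \<Rightarrow> ('x, 'k, 's) presheaf \<Rightarrow> bool" where
  "sheaf_of_spaces k X F \<longleftrightarrow> presheaf_of_spaces k X F \<and>
     (\<forall>\<U> s. (\<forall>U\<in>\<U>. openin X U) \<and> (\<forall>U\<in>\<U>. s U \<in> carrier (Sec F U)) \<and>
        (\<forall>U\<in>\<U>. \<forall>V\<in>\<U>. Res F U (U \<inter> V) (s U) = Res F V (U \<inter> V) (s V)) \<longrightarrow>
        (\<exists>!t. t \<in> carrier (Sec F (\<Union>\<U>)) \<and> (\<forall>U\<in>\<U>. Res F (\<Union>\<U>) U t = s U)))"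

definition sheaf_morphism ::
  "'k ring \<Rightarrow> 'x topology \<Rightarrow> ('x, 'k, 's) presheaf \<Rightarrow> ('x, 'k, 't) presheaf \<Rightarrow>
   ('x set \<Rightarrow> 's \<Rightarrow> 't) \<Rightarrow> bool"
where
  "sheaf_morphism k X E F h \<longleftrightarrow>
     (\<forall>U. openin X U \<longrightarrow> h U \<in> LinearCombinations.module_hom k (Sec E U) (Sec F U)) \<and>
     (\<forall>U V. openin X U \<and> openin X V \<and> V \<subseteq> U \<longrightarrow>
        (\<forall>s\<in>carrier (Sec E U). h V (Res E U V s) = Res F U V (h U s)))"

definition sheaf_isomorphism ::
  "'k ring \<Rightarrow> 'x topology \<Rightarrow> ('x, 'k, 's) presheaf \<Rightarrow> ('x, 'k, 't) presheaf \<Rightarrow>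
   ('x set \<Rightarrow> 's \<Rightarrow> 't) \<Rightarrow> bool"
where
  "sheaf_isomorphism k X E F h \<longleftrightarrow> sheaf_morphism k X E F h \<and>
     (\<forall>U. openin X U \<longrightarrow> bij_betw (h U) (carrier (Sec E U)) (carrier (Sec F U)))"

text \<open>The constant sheaf with value \<open>V\<close>; its sections are the locally constant functions.\<close>

definition constant_sheaf ::
  "'x topology \<Rightarrow> ('k, 'v) module \<Rightarrow> ('x, 'k, 'x \<Rightarrow> 'v) presheaf"
where
  "constant_sheaf X V =
     \<lparr>Sec = (\<lambda>U. \<lparr>carrier = {f \<in> U \<rightarrow>\<^sub>E carrier V.
                     \<forall>x\<in>U. \<exists>N. openin X N \<and> x \<in> N \<and> N \<subseteq> U \<and> (\<forall>y\<in>N. f y = f x)},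
                  mult = undefined, one = undefined,
                  zero = (\<lambda>x\<in>U. \<zero>\<^bsub>V\<^esub>),
                  add = (\<lambda>f g. \<lambda>x\<in>U. f x \<oplus>\<^bsub>V\<^esub> g x),
                  smult = (\<lambda>c f. \<lambda>x\<in>U. c \<odot>\<^bsub>V\<^esub> f x)\<rparr>),
      Res = (\<lambda>U V f. restrict f V)\<rparr>"

text \<open>A presheaf on \<open>X\<close> is restricted to the open subset \<open>U\<close> by viewing it as a presheaf on the
  subspace \<open>U\<close>.\<close>

definition local_system :: "'k ring \<Rightarrow> 'x topology \<Rightarrow> ('x, 'k, 's) presheaf \<Rightarrow> bool" where
  "local_system k X F \<longleftrightarrow> sheaf_of_spaces k X F \<and>
     (\<forall>x\<in>topspace X. \<exists>U. openin X U \<and> x \<in> U \<and>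
        (\<exists>(V :: ('k, 's) module) h. fd_space k V \<and>
           sheaf_isomorphism k (subtopology X U) F (constant_sheaf (subtopology X U) V) h))"

definition sheaf_bilinear ::
  "'k ring \<Rightarrow> 'x topology \<Rightarrow> ('x, 'k, 's) presheaf \<Rightarrow> ('x, 'k, 's) presheaf \<Rightarrow> ('x, 'k, 's) presheaf \<Rightarrow>
   ('x set \<Rightarrow> 's \<Rightarrow> 's \<Rightarrow> 's) \<Rightarrow> bool"
where
  "sheaf_bilinear k X E F T \<beta> \<longleftrightarrow>
     (\<forall>U. openin X U \<longrightarrow> \<beta> U \<in> bilinear_maps k (Sec E U) (Sec F U) (Sec T U)) \<and>
     (\<forall>U V. openin X U \<and> openin X V \<and> V \<subseteq> U \<longrightarrow>
        (\<forall>s\<in>carrier (Sec E U). \<forall>t\<in>carrier (Sec F U).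
           \<beta> V (Res E U V s) (Res F U V t) = Res T U V (\<beta> U s t)))"

text \<open>\<open>\<beta>\<close> exhibits \<open>T\<close> as the tensor product of the sheaves \<open>E\<close> and \<open>F\<close>, that is as the
  sheafification of \<open>U \<mapsto> E(U) \<otimes> F(U)\<close>: it is universal among the bilinear maps from \<open>E \<times> F\<close> to
  sheaves.\<close>

definition is_sheaf_tensor_product ::
  "'k ring \<Rightarrow> 'x topology \<Rightarrow> ('x, 'k, 's) presheaf \<Rightarrow> ('x, 'k, 's) presheaf \<Rightarrow> ('x, 'k, 's) presheaf \<Rightarrow>
   ('x set \<Rightarrow> 's \<Rightarrow> 's \<Rightarrow> 's) \<Rightarrow> bool"
where
  "is_sheaf_tensor_product k X E F T \<beta> \<longleftrightarrow> sheaf_bilinear k X E F T \<beta> \<and>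
     (\<forall>(Z :: ('x, 'k, 's) presheaf) \<gamma>. sheaf_of_spaces k X Z \<and> sheaf_bilinear k X E F Z \<gamma> \<longrightarrow>
        (\<exists>h. sheaf_morphism k X T Z h \<and>
           (\<forall>U. openin X U \<longrightarrow> (\<forall>s\<in>carrier (Sec E U). \<forall>t\<in>carrier (Sec F U).
              h U (\<beta> U s t) = \<gamma> U s t)) \<and>
           (\<forall>h'. sheaf_morphism k X T Z h' \<and>
              (\<forall>U. openin X U \<longrightarrow> (\<forall>s\<in>carrier (Sec E U). \<forall>t\<in>carrier (Sec F U).
                 h' U (\<beta> U s t) = \<gamma> U s t)) \<longrightarrow>
              (\<forall>U. openin X U \<longrightarrow> (\<forall>t\<in>carrier (Sec T U). h' U t = h U t)))))"

text \<open>The germ at \<open>x\<close> of \<open>s \<in> F(U)\<close>, as an equivalence class of pairs (neighbourhood, section).\<close>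

definition germ ::
  "'x topology \<Rightarrow> 'x \<Rightarrow> ('x, 'k, 's) presheaf \<Rightarrow> 'x set \<Rightarrow> 's \<Rightarrow> ('x set \<times> 's) set"
where
  "germ X x F U s =
     {(V, t). openin X V \<and> x \<in> V \<and> t \<in> carrier (Sec F V) \<and>
        (\<exists>W. openin X W \<and> x \<in> W \<and> W \<subseteq> U \<inter> V \<and> Res F U W s = Res F V W t)}"

text \<open>The operations on germs are computed on representatives; all members of each of the unions
  below are equal.\<close>

definition stalk ::
  "'x topology \<Rightarrow> 'x \<Rightarrow> ('x, 'k, 's) presheaf \<Rightarrow> ('k, ('x set \<times> 's) set) module"
where
  "stalk X x F =
     \<lparr>carrier = {germ X x F U s | U s. openin X U \<and> x \<in> U \<and> s \<in> carrier (Sec F U)},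
      mult = undefined, one = undefined,
      zero = germ X x F (topspace X) \<zero>\<^bsub>Sec F (topspace X)\<^esub>,
      add = (\<lambda>C D. \<Union>(U, s)\<in>C. \<Union>(V, t)\<in>D.
               germ X x F (U \<inter> V) (Res F U (U \<inter> V) s \<oplus>\<^bsub>Sec F (U \<inter> V)\<^esub> Res F V (U \<inter> V) t)),
      smult = (\<lambda>c C. \<Union>(U, s)\<in>C. germ X x F U (c \<odot>\<^bsub>Sec F U\<^esub> s))\<rparr>"

definition stalk_map ::
  "'x topology \<Rightarrow> 'x \<Rightarrow> ('x, 'k, 's) presheaf \<Rightarrow> ('x set \<Rightarrow> 's \<Rightarrow> 's) \<Rightarrow>
   ('x set \<times> 's) set \<Rightarrow> ('x set \<times> 's) set"
where
  "stalk_map X x F h = (\<lambda>C. \<Union>(U, s)\<in>C. germ X x F U (h U s))"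

definition stalk_bilinear ::
  "'x topology \<Rightarrow> 'x \<Rightarrow> ('x, 'k, 's) presheaf \<Rightarrow> ('x, 'k, 's) presheaf \<Rightarrow> ('x, 'k, 's) presheaf \<Rightarrow>
   ('x set \<Rightarrow> 's \<Rightarrow> 's \<Rightarrow> 's) \<Rightarrow> ('x set \<times> 's) set \<Rightarrow> ('x set \<times> 's) set \<Rightarrow> ('x set \<times> 's) set"
where
  "stalk_bilinear X x E F T \<beta> = (\<lambda>C D. \<Union>(U, s)\<in>C. \<Union>(V, t)\<in>D.
     germ X x T (U \<inter> V) (\<beta> (U \<inter> V) (Res E U (U \<inter> V) s) (Res F V (U \<inter> V) t)))"

definition regular_module :: "'k ring \<Rightarrow> ('k, 'k) module" where
  "regular_module k =
     \<lparr>carrier = carrier k, mult = mult k, one = one k, zero = zero k, add = add k, smult = mult k\<rparr>"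

text \<open>The category \<open>Loc\<^sub>k(X)\<close> of local systems whose sections belong to the type \<open>'s\<close>, with the
  fibre functor given by the stalk at \<open>x\<^sub>0\<close>. The unit object is the constant sheaf \<open>k\<close>.\<close>

definition Loc ::
  "'s itself \<Rightarrow> 'k ring \<Rightarrow> 'x topology \<Rightarrow> 'x \<Rightarrow>
   (('x, 'k, 's) presheaf, 'k, ('x set \<times> 's) set) fibre_functor"
where
  "Loc _ k X x\<^sub>0 =
     \<lparr>Obj = {F. local_system k X F},
      Fib = stalk X x\<^sub>0,
      Mor = (\<lambda>E F. {stalk_map X x\<^sub>0 F h | h. sheaf_morphism k X E F h}),
      Tens = (\<lambda>E F T. {stalk_bilinear X x\<^sub>0 E F T \<beta> | \<beta>. is_sheaf_tensor_product k X E F T \<beta>}),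
      Unit = (\<lambda>F. {germ X x\<^sub>0 F (topspace X) (h (topspace X) (\<lambda>x\<in>topspace X. \<one>\<^bsub>k\<^esub>)) | h.
                sheaf_isomorphism k X (constant_sheaf X (regular_module k)) F h})\<rparr>"

definition is_proalgebraic_fundamental_group ::
  "'s itself \<Rightarrow> 'k ring \<Rightarrow> 'x topology \<Rightarrow> 'x \<Rightarrow>
   ('k, 'a) module \<Rightarrow> (('k, 'a) module \<Rightarrow> ('a \<Rightarrow> 'a) monoid) \<Rightarrow> bool"
where
  "is_proalgebraic_fundamental_group T k X x\<^sub>0 A G \<longleftrightarrow> tannakian_dual k (Loc T k X x\<^sub>0) A G"

text \<open>
  Both categories depend on a type that has to be large enough for every object to have an isomorphic
  copy on it. For finite-dimensional spaces over \<open>k\<close> it suffices that \<open>nat \<Rightarrow> 'k\<close> embeds into the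
  type, since \<open>k\<^sup>n\<close> does so then; for local systems, that \<open>'x \<Rightarrow> nat \<Rightarrow> 'k\<close> embeds into it, since after
  a choice of bases of the stalks a section becomes a function from points to coordinate vectors.
\<close>

definition large_for_spaces :: "'v itself \<Rightarrow> 'k ring \<Rightarrow> bool" where
  "large_for_spaces _ (k :: 'k ring) \<longleftrightarrow> (\<exists>e :: (nat \<Rightarrow> 'k) \<Rightarrow> 'v. inj e)"

definition large_for_local_systems :: "'s itself \<Rightarrow> 'k ring \<Rightarrow> 'x topology \<Rightarrow> bool" where
  "large_for_local_systems _ (k :: 'k ring) (X :: 'x topology) \<longleftrightarrow>
     (\<exists>e :: ('x \<Rightarrow> nat \<Rightarrow> 'k) \<Rightarrow> 's. inj e)"

end

theory Submission
  imports Defs "HOL-Computational_Algebra.Primes"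
begin

text \<open>
  Let \<open>\<tau> V\<close> be the object \<open>V\<close> on which a scalar \<open>c\<close> acts as \<open>c\<^sup>p\<close> did before. Both for representations
  and for local systems \<open>\<tau>\<close> is an endofunctor that changes neither the underlying maps nor the
  tensor products. As \<open>k\<close> is perfect, \<open>\<tau>\<close> is invertible, and \<open>V\<close> is the usual Frobenius twist of \<open>\<tau> V\<close>.

  Let \<open>Spec A\<close> represent \<open>Aut\<^sup>\<otimes>(\<omega>)\<close>, with universal point \<open>\<eta>\<close>, and let \<open>A\<^bsup>1/p\<^esup>\<close> be the ring \<open>A\<close> on which
  \<open>k\<close> acts through \<open>p\<close>-th roots. Then \<open>\<omega>(V) \<otimes> A\<^bsup>1/p\<^esup> = \<omega>(\<tau> V) \<otimes> A\<close>, so that the components of \<open>\<eta>\<close> at \<open>\<tau> V\<close>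
  form a tensor automorphism over \<open>A\<^bsup>1/p\<^esup>\<close>; it comes from a homomorphism \<open>h : A \<rightarrow> A\<^bsup>1/p\<^esup>\<close>. The \<open>p\<close>-power
  map \<open>A\<^bsup>1/p\<^esup> \<rightarrow> A\<close> is a homomorphism of \<open>k\<close>-algebras, and its composite with \<open>h\<close> is the identity: by
  the universal property this says that the matrix entries of \<open>\<eta>\<close> at \<open>V\<close> are the \<open>p\<close>-th powers of
  those at \<open>\<tau> V\<close>. Hence \<open>h(a)\<^sup>p = a\<close> for all \<open>a\<close>, and also \<open>h(a\<^sup>p) = h(a)\<^sup>p = a\<close>, so the \<open>p\<close>-power map
  of \<open>A\<close> is bijective (\<open>tannakian_dual_perfect\<close>).

  The matrix entries are compared by describing the Frobenius twist in terms of tensor products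
  (\<open>tensor_automorphism_frob\<close>). For \<open>U = \<tau> V\<close> let \<open>P\<close> be the subobject of \<open>U \<otimes> \<dots> \<otimes> U\<close> (\<open>p\<close> factors) spanned
  by the powers \<open>v \<otimes> \<dots> \<otimes> v\<close>. The assignment \<open>v \<otimes> \<dots> \<otimes> v \<mapsto> v\<close> extends to a morphism \<open>P \<rightarrow> V\<close>: if \<open>x\<^sub>i\<close>
  are the coordinates of \<open>v\<close> in \<open>U\<close>, then the diagonal entry \<open>x\<^sub>i\<^sup>p\<close> of \<open>v \<otimes> \<dots> \<otimes> v\<close> is the \<open>i\<close>-th
  coordinate of \<open>v\<close> in \<open>V\<close>. As \<open>\<eta>\<close> commutes with morphisms and tensor products, \<open>\<eta>(v)\<close> at \<open>V\<close> is the image of the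
  \<open>p\<close>-fold power of \<open>\<eta>(v)\<close> at \<open>U\<close>.

  The locale \<open>twisted_fibre_functor\<close> collects what this argument needs. For local systems one has to
  produce the tensor products and the objects \<open>P\<close> as local systems on the given type of sections. They
  are assembled from their stalks and from charts (\<open>associated_local_system\<close>), and whether a bilinear
  map of sheaves is a tensor product can be read off from the stalks (\<open>tensor_product_from_stalks\<close>).
\<close>

section \<open>The Frobenius map of a perfect field\<close>

lemma (in cring) binomial_theorem:
  fixes n :: nat
  assumes x: "x \<in> carrier R" and y: "y \<in> carrier R"
  shows "(x \<oplus> y) [^] n = (\<Oplus>i\<in>{..n}. [(n choose i)] \<cdot> (x [^] i \<otimes> y [^] (n - i)))"
proof (induction n)
  case 0
  then show ?case using x y by simp
next
  case (Suc n)
  let ?f = "\<lambda>i. [(n choose i)] \<cdot> (x [^] i \<otimes> y [^] (n - i))"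
  let ?g = "\<lambda>i. [(n choose i)] \<cdot> (x [^] i \<otimes> y [^] (Suc n - i))"
  let ?h = "\<lambda>i. case i of 0 \<Rightarrow> \<zero> | Suc j \<Rightarrow> [(n choose j)] \<cdot> (x [^] Suc j \<otimes> y [^] (n - j))"
  have c: "?f \<in> {..n} \<rightarrow> carrier R" "?g \<in> {..Suc n} \<rightarrow> carrier R" "?h \<in> {..Suc n} \<rightarrow> carrier R"
    using x y by (auto split: nat.split)
  have "(x \<oplus> y) [^] Suc n = (\<Oplus>i\<in>{..n}. ?f i) \<otimes> y \<oplus> (\<Oplus>i\<in>{..n}. ?f i) \<otimes> x"
    using Suc x y c(1) by (simp add: r_distr a_comm)
  also have "(\<Oplus>i\<in>{..n}. ?f i) \<otimes> y = (\<Oplus>i\<in>{..n}. ?f i \<otimes> y)"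
    by (rule finsum_ldistr) (use x y c in auto)
  also have "\<dots> = (\<Oplus>i\<in>{..n}. ?g i)"
    by (rule finsum_cong') (use x y in \<open>auto simp: add_pow_ldistr m_assoc Suc_diff_le\<close>)
  also have "\<dots> = (\<Oplus>i\<in>{..Suc n}. ?g i)"
    by (subst finsum_Suc) (use c x y in \<open>auto simp: binomial_eq_0\<close>)
  also have "(\<Oplus>i\<in>{..n}. ?f i) \<otimes> x = (\<Oplus>i\<in>{..n}. ?f i \<otimes> x)"
    by (rule finsum_ldistr) (use x y c in auto)
  also have "\<dots> = (\<Oplus>i\<in>{..n}. ?h (Suc i))"
  proof (rule finsum_cong')
    fix i
    have "x [^] i \<otimes> y [^] (n - i) \<otimes> x = x [^] Suc i \<otimes> y [^] (n - i)"
      using x y m_lcomm m_comm by (simp add: m_ac)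
    then show "?f i \<otimes> x = ?h (Suc i)"
      using x y by (simp add: add_pow_ldistr)
  qed (use x y in auto)
  also have "\<dots> = (\<Oplus>i\<in>{..Suc n}. ?h i)"
    by (subst finsum_Suc2) (use c x y in auto)
  also have "(\<Oplus>i\<in>{..Suc n}. ?g i) \<oplus> (\<Oplus>i\<in>{..Suc n}. ?h i) = (\<Oplus>i\<in>{..Suc n}. ?g i \<oplus> ?h i)"
    by (rule finsum_addf[symmetric]) (use c in auto)
  also have "\<dots> = (\<Oplus>i\<in>{..Suc n}. [(Suc n choose i)] \<cdot> (x [^] i \<otimes> y [^] (Suc n - i)))"
  proof (rule finsum_cong')
    fix i assume "i \<in> {..Suc n}"
    show "?g i \<oplus> ?h i = [(Suc n choose i)] \<cdot> (x [^] i \<otimes> y [^] (Suc n - i))"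
    proof (cases i)
      case (Suc j)
      have "([(n choose Suc j)] \<cdot> (x [^] Suc j \<otimes> y [^] (n - j)))
          \<oplus> ([(n choose j)] \<cdot> (x [^] Suc j \<otimes> y [^] (n - j)))
        = [((n choose Suc j) + (n choose j))] \<cdot> (x [^] Suc j \<otimes> y [^] (n - j))"
        by (rule add.nat_pow_mult) (use x y in simp)
      then show ?thesis using Suc by (simp add: add.commute)
    qed (use x y in auto)
  qed (use x y in auto)
  finally show ?case .
qed

lemma (in cring) add_pow_eq_0:
  assumes "[p] \<cdot> \<one> = \<zero>" "p dvd m" "z \<in> carrier R"
  shows "[(m::nat)] \<cdot> z = \<zero>"
proof -
  obtain q where m: "m = p * q" using assms(2) by auto
  have "[p] \<cdot> w = \<zero>" if "w \<in> carrier R" for w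
  proof -
    have "[p] \<cdot> w = ([p] \<cdot> \<one>) \<otimes> w" using that by (simp add: add_pow_ldistr)
    then show ?thesis using assms that by simp
  qed
  then have "[p] \<cdot> ([q] \<cdot> z) = \<zero>" using assms(3) by simp
  then show ?thesis using add.nat_pow_pow[OF assms(3), of p q] m by (simp add: mult.commute)
qed

lemma (in cring) freshmans_dream:
  assumes "prime p" "[p] \<cdot> \<one> = \<zero>" "x \<in> carrier R" "y \<in> carrier R"
  shows "(x \<oplus> y) [^] (p::nat) = x [^] p \<oplus> y [^] p"
proof -
  let ?f = "\<lambda>i. [(p choose i)] \<cdot> (x [^] i \<otimes> y [^] (p - i))"
  have p1: "1 < p" using assms(1) prime_gt_1_nat by blast
  then obtain q where q: "p = Suc q" by (cases p) auto
  have z: "?f (Suc i) = \<zero>" if "i < q" for i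
  proof (rule add_pow_eq_0[OF assms(2)])
    show "p dvd (p choose Suc i)"
      by (rule dvd_choose_prime) (use that q assms in auto)
  qed (use assms in auto)
  have "(x \<oplus> y) [^] p = (\<Oplus>i\<in>{..Suc q}. ?f i)"
    using binomial_theorem[OF assms(3,4), of p] q by simp
  also have "\<dots> = (\<Oplus>i\<in>{..q}. ?f (Suc i)) \<oplus> ?f 0"
    by (rule finsum_Suc2) (use assms in auto)
  also have "(\<Oplus>i\<in>{..q}. ?f (Suc i)) = ?f (Suc q) \<oplus> (\<Oplus>i\<in>{..<q}. ?f (Suc i))"
    using assms by (subst lessThan_Suc_atMost[symmetric], subst lessThan_Suc) simp
  also have "(\<Oplus>i\<in>{..<q}. ?f (Suc i)) = \<zero>"
    by (rule add.finprod_one_eqI) (use z in auto)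
  also have "?f (Suc q) \<oplus> \<zero> \<oplus> ?f 0 = x [^] p \<oplus> y [^] p"
    using q assms by (simp add: add.nat_pow_one)
  finally show ?thesis .
qed

locale perfect_char = field k for k :: "'k ring" (structure) +
  fixes p :: nat
  assumes prime_p: "prime p" and char_p: "[p] \<cdot> \<one> = \<zero>"
    and ex_root: "c \<in> carrier k \<Longrightarrow> \<exists>d\<in>carrier k. d [^] p = c"

text \<open>Since \<open>m \<cdot> \<one> = \<zero>\<close> exactly for the multiples \<open>m\<close> of \<open>p\<close>, the absence of zero divisors makes \<open>p\<close> prime.\<close>

lemma perfect_field_imp_perfect_char:
  assumes "perfect_field k" "p > 0" "has_characteristic k p"
  shows "perfect_char k p"
proof -
  interpret field k using assms by (simp add: perfect_field_def)
  have ch: "[m] \<cdot>\<^bsub>k\<^esub> \<one>\<^bsub>k\<^esub> = \<zero>\<^bsub>k\<^esub> \<longleftrightarrow> p dvd m" for m :: nat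
    using assms(3) by (simp add: has_characteristic_def)
  have "prime p"
  proof (rule prime_natI)
    fix a b :: nat assume "p dvd a * b"
    have "([a] \<cdot>\<^bsub>k\<^esub> \<one>\<^bsub>k\<^esub>) \<otimes>\<^bsub>k\<^esub> ([b] \<cdot>\<^bsub>k\<^esub> \<one>\<^bsub>k\<^esub>) = [a] \<cdot>\<^bsub>k\<^esub> ([b] \<cdot>\<^bsub>k\<^esub> \<one>\<^bsub>k\<^esub>)"
      by (simp add: add_pow_ldistr)
    also have "\<dots> = [(b * a)] \<cdot>\<^bsub>k\<^esub> \<one>\<^bsub>k\<^esub>"
      by (rule add.nat_pow_pow) simp
    also have "\<dots> = \<zero>\<^bsub>k\<^esub>" using \<open>p dvd a * b\<close> ch by (simp add: mult.commute)
    finally have "[a] \<cdot>\<^bsub>k\<^esub> \<one>\<^bsub>k\<^esub> = \<zero>\<^bsub>k\<^esub> \<or> [b] \<cdot>\<^bsub>k\<^esub> \<one>\<^bsub>k\<^esub> = \<zero>\<^bsub>k\<^esub>"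
      by (rule integral) auto
    then show "p dvd a \<or> p dvd b" using ch by blast
  next
    have "\<not> p dvd 1" using ch[of "Suc 0"] by (simp add: add.nat_pow_Suc)
    then show "2 \<le> p" using assms(2) by (cases "p = 1") auto
  qed
  then show ?thesis
    using assms ch[of p] by unfold_locales (auto simp: perfect_field_def)
qed

context perfect_char
begin

definition frob :: "'k \<Rightarrow> 'k" where "frob c = c [^] p"
definition root :: "'k \<Rightarrow> 'k" where "root c = (THE d. d \<in> carrier k \<and> d [^] p = c)"

lemma p_pos: "p > 0" using prime_p prime_gt_0_nat by blast

lemma frob_closed[simp]: "c \<in> carrier k \<Longrightarrow> frob c \<in> carrier k"
  by (simp add: frob_def)

lemma frob_add: "a \<in> carrier k \<Longrightarrow> b \<in> carrier k \<Longrightarrow> frob (a \<oplus> b) = frob a \<oplus> frob b"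
  unfolding frob_def by (rule freshmans_dream[OF prime_p char_p])

lemma frob_mult: "a \<in> carrier k \<Longrightarrow> b \<in> carrier k \<Longrightarrow> frob (a \<otimes> b) = frob a \<otimes> frob b"
  unfolding frob_def by (rule nat_pow_distrib)

lemma frob_one[simp]: "frob \<one> = \<one>" by (simp add: frob_def)

lemma frob_zero[simp]: "frob \<zero> = \<zero>" using p_pos by (simp add: frob_def nat_pow_zero)

lemma frob_eq_0: "c \<in> carrier k \<Longrightarrow> frob c = \<zero> \<Longrightarrow> c = \<zero>"
proof -
  have "c [^] n = \<zero> \<Longrightarrow> c = \<zero>" if "c \<in> carrier k" for n :: nat
    using that by (induction n) (auto dest: integral)
  then show "c \<in> carrier k \<Longrightarrow> frob c = \<zero> \<Longrightarrow> c = \<zero>" by (auto simp: frob_def)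
qed

lemma frob_inj: "inj_on frob (carrier k)"
proof (rule inj_onI)
  fix a b assume ab: "a \<in> carrier k" "b \<in> carrier k" "frob a = frob b"
  have "frob (a \<ominus> b) \<oplus> frob b = frob a"
    using ab frob_add[of "a \<ominus> b" b] by (simp add: minus_eq a_assoc l_neg)
  then have "frob (a \<ominus> b) = \<zero>"
    using ab by (metis add.l_cancel_one' frob_closed a_comm minus_closed)
  then have "a \<ominus> b = \<zero>" using ab frob_eq_0 by simp
  moreover have "a = (a \<ominus> b) \<oplus> b" using ab by (simp add: minus_eq a_assoc l_neg)
  ultimately show "a = b" using ab by simp
qed

lemma root_ex: "c \<in> carrier k \<Longrightarrow> root c \<in> carrier k \<and> frob (root c) = c"
proof -
  assume c: "c \<in> carrier k"
  obtain d where d: "d \<in> carrier k" "d [^] p = c" using ex_root[OF c] by auto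
  have "root c = d" unfolding root_def
    by (rule the_equality) (use d frob_inj in \<open>auto simp: frob_def inj_on_def\<close>)
  then show ?thesis using d by (simp add: frob_def)
qed

lemma root_closed[simp]: "c \<in> carrier k \<Longrightarrow> root c \<in> carrier k"
  and frob_root[simp]: "c \<in> carrier k \<Longrightarrow> frob (root c) = c"
  using root_ex by auto

lemma root_frob[simp]: "c \<in> carrier k \<Longrightarrow> root (frob c) = c"
  using frob_inj by (auto simp: inj_on_def)

lemma root_add: "a \<in> carrier k \<Longrightarrow> b \<in> carrier k \<Longrightarrow> root (a \<oplus> b) = root a \<oplus> root b"
  using frob_inj by (auto simp: inj_on_def frob_add)

lemma root_mult: "a \<in> carrier k \<Longrightarrow> b \<in> carrier k \<Longrightarrow> root (a \<otimes> b) = root a \<otimes> root b"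
  using frob_inj by (auto simp: inj_on_def frob_mult)

lemma root_one[simp]: "root \<one> = \<one>" using root_frob[of \<one>] by simp

end

section \<open>Linear maps, functionals and bases\<close>

abbreviation lin where "lin \<equiv> LinearCombinations.module_hom"

lemma linI:
  assumes "\<And>x. x \<in> carrier M \<Longrightarrow> f x \<in> carrier N"
    and "\<And>x y. x \<in> carrier M \<Longrightarrow> y \<in> carrier M \<Longrightarrow> f (x \<oplus>\<^bsub>M\<^esub> y) = f x \<oplus>\<^bsub>N\<^esub> f y"
    and "\<And>r x. r \<in> carrier R \<Longrightarrow> x \<in> carrier M \<Longrightarrow> f (r \<odot>\<^bsub>M\<^esub> x) = r \<odot>\<^bsub>N\<^esub> f x"
  shows "f \<in> lin R M N"
  using assms by (auto simp: LinearCombinations.module_hom_def)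

lemma lin_closed: "f \<in> lin R M N \<Longrightarrow> x \<in> carrier M \<Longrightarrow> f x \<in> carrier N"
  and lin_add: "f \<in> lin R M N \<Longrightarrow> x \<in> carrier M \<Longrightarrow> y \<in> carrier M \<Longrightarrow> f (x \<oplus>\<^bsub>M\<^esub> y) = f x \<oplus>\<^bsub>N\<^esub> f y"
  and lin_smult: "f \<in> lin R M N \<Longrightarrow> r \<in> carrier R \<Longrightarrow> x \<in> carrier M \<Longrightarrow> f (r \<odot>\<^bsub>M\<^esub> x) = r \<odot>\<^bsub>N\<^esub> f x"
  by (auto simp: LinearCombinations.module_hom_def)

lemma lin_compose: "f \<in> lin R M N \<Longrightarrow> g \<in> lin R N P \<Longrightarrow> (\<lambda>x. g (f x)) \<in> lin R M P"
  by (rule linI) (simp_all add: lin_closed lin_add lin_smult)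

lemma lin_cong:
  assumes "Module.module R M" "f \<in> lin R M N" "\<And>x. x \<in> carrier M \<Longrightarrow> g x = f x"
  shows "g \<in> lin R M N"
proof -
  interpret Module.module R M by fact
  show ?thesis by (rule linI) (use assms in \<open>auto simp: lin_closed lin_add lin_smult\<close>)
qed

lemma lin_zero:
  assumes "Module.module R M" "Module.module R N" "f \<in> lin R M N"
  shows "f \<zero>\<^bsub>M\<^esub> = \<zero>\<^bsub>N\<^esub>"
  using assms by (intro mod_hom.f0_is_0) (simp add: mod_hom_def mod_hom_axioms_def)

lemma lin_finsum:
  assumes "Module.module R M" "Module.module R N" "f \<in> lin R M N" "g \<in> I \<rightarrow> carrier M"
  shows "f (finsum M g I) = finsum N (\<lambda>i. f (g i)) I"
proof -
  interpret M: Module.module R M by fact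
  interpret N: Module.module R N by fact
  show ?thesis using assms(4)
  proof (induction I rule: infinite_finite_induct)
    case (insert i I)
    then show ?case using assms(3) by (auto simp: lin_add lin_closed Pi_def M.M.finsum_closed)
  qed (use assms lin_zero in auto)
qed

lemma bilinear_mapsI:
  assumes "\<And>x. x \<in> carrier M \<Longrightarrow> \<beta> x \<in> lin R N P" "\<And>y. y \<in> carrier N \<Longrightarrow> (\<lambda>x. \<beta> x y) \<in> lin R M P"
  shows "\<beta> \<in> bilinear_maps R M N P"
  using assms by (auto simp: bilinear_maps_def)

lemma bilinear_lin1: "\<beta> \<in> bilinear_maps R M N P \<Longrightarrow> y \<in> carrier N \<Longrightarrow> (\<lambda>x. \<beta> x y) \<in> lin R M P"
  and bilinear_lin2: "\<beta> \<in> bilinear_maps R M N P \<Longrightarrow> x \<in> carrier M \<Longrightarrow> \<beta> x \<in> lin R N P"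
  and bilinear_closed: "\<beta> \<in> bilinear_maps R M N P \<Longrightarrow> x \<in> carrier M \<Longrightarrow> y \<in> carrier N \<Longrightarrow> \<beta> x y \<in> carrier P"
  by (auto simp: bilinear_maps_def LinearCombinations.module_hom_def)

lemma (in Module.module) span_induct [consumes 2, case_names zero base add smult]:
  assumes "x \<in> span S" "S \<subseteq> carrier M"
    and "P \<zero>\<^bsub>M\<^esub>" "\<And>s. s \<in> S \<Longrightarrow> P s"
    and "\<And>x y. x \<in> carrier M \<Longrightarrow> y \<in> carrier M \<Longrightarrow> P x \<Longrightarrow> P y \<Longrightarrow> P (x \<oplus>\<^bsub>M\<^esub> y)"
    and "\<And>r x. r \<in> carrier R \<Longrightarrow> x \<in> carrier M \<Longrightarrow> P x \<Longrightarrow> P (r \<odot>\<^bsub>M\<^esub> x)"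
  shows "P x"
proof -
  have "LinearCombinations.submodule R {x \<in> carrier M. P x} M"
    by (rule LinearCombinations.submodule.intro) (use assms in \<open>auto intro: module_axioms\<close>)
  then have "span S \<subseteq> {x \<in> carrier M. P x}"
    by (rule span_is_subset[rotated]) (use assms in auto)
  then show ?thesis using assms(1) by auto
qed

lemma lin_eq_on_span:
  assumes "Module.module R M" "Module.module R N" "f \<in> lin R M N" "g \<in> lin R M N" "S \<subseteq> carrier M"
    and "\<And>s. s \<in> S \<Longrightarrow> f s = g s" "x \<in> LinearCombinations.module.span R M S"
  shows "f x = g x"
proof -
  interpret M: Module.module R M by fact
  show ?thesis using assms(7,5)
    by (induction rule: M.span_induct) (use assms in \<open>auto simp: lin_zero lin_add lin_smult\<close>)
qed

subsection \<open>Functionals and finite bases\<close>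

lemma regular_module_simps[simp]:
  "carrier (regular_module k) = carrier k" "a \<oplus>\<^bsub>regular_module k\<^esub> b = a \<oplus>\<^bsub>k\<^esub> b"
  "\<zero>\<^bsub>regular_module k\<^esub> = \<zero>\<^bsub>k\<^esub>" "smult (regular_module k) c a = c \<otimes>\<^bsub>k\<^esub> a"
  by (auto simp: regular_module_def)

lemma regular_module:
  fixes k :: "'k ring"
  assumes "cring k"
  shows "Module.module k (regular_module k)"
proof -
  interpret cring k by fact
  show ?thesis
    by (rule module_criteria)
      (auto simp: is_cring a_ac l_distr r_distr m_assoc r_neg intro: exI[of _ "\<ominus>\<^bsub>k\<^esub> _"] bexI[of _ "\<ominus>\<^bsub>k\<^esub> _"])
qed

abbreviation functionals where "functionals k V \<equiv> lin k V (regular_module k)"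

lemma finsum_regular[simp]: "finsum (regular_module k) = finsum k"
  by (simp add: fun_eq_iff finsum_def finprod_def regular_module_def)

text \<open>A finite basis is given together with its dual basis. The coordinate functionals are what the
  constructions below use; they also express linear independence.\<close>

definition dual_basis ::
  "'k ring \<Rightarrow> ('k, 'v) module \<Rightarrow> 'i set \<Rightarrow> ('i \<Rightarrow> 'v) \<Rightarrow> ('i \<Rightarrow> 'v \<Rightarrow> 'k) \<Rightarrow> bool"
where
  "dual_basis k V I b d \<longleftrightarrow> finite I \<and> (\<forall>i\<in>I. b i \<in> carrier V \<and> d i \<in> functionals k V) \<and>
     (\<forall>i\<in>I. \<forall>j\<in>I. d i (b j) = (if i = j then \<one>\<^bsub>k\<^esub> else \<zero>\<^bsub>k\<^esub>)) \<and>
     (\<forall>v\<in>carrier V. v = (\<Oplus>\<^bsub>V\<^esub>i\<in>I. d i v \<odot>\<^bsub>V\<^esub> b i))"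

lemma dual_basisD:
  assumes "dual_basis k V I b d"
  shows "finite I" "i \<in> I \<Longrightarrow> b i \<in> carrier V" "i \<in> I \<Longrightarrow> d i \<in> functionals k V"
    "i \<in> I \<Longrightarrow> v \<in> carrier V \<Longrightarrow> d i v \<in> carrier k"
    "i \<in> I \<Longrightarrow> j \<in> I \<Longrightarrow> d i (b j) = (if i = j then \<one>\<^bsub>k\<^esub> else \<zero>\<^bsub>k\<^esub>)"
    "v \<in> carrier V \<Longrightarrow> (\<Oplus>\<^bsub>V\<^esub>i\<in>I. d i v \<odot>\<^bsub>V\<^esub> b i) = v"
    "i \<in> I \<Longrightarrow> v \<in> carrier V \<Longrightarrow> w \<in> carrier V \<Longrightarrow> d i (v \<oplus>\<^bsub>V\<^esub> w) = d i v \<oplus>\<^bsub>k\<^esub> d i w"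
    "i \<in> I \<Longrightarrow> c \<in> carrier k \<Longrightarrow> v \<in> carrier V \<Longrightarrow> d i (c \<odot>\<^bsub>V\<^esub> v) = c \<otimes>\<^bsub>k\<^esub> d i v"
  using assms lin_closed[of "d i" k V "regular_module k" v] lin_add[of "d i" k V "regular_module k" v w]
    lin_smult[of "d i" k V "regular_module k" c v] by (auto simp: dual_basis_def)

lemma (in Module.module) finsum_smult_delta:
  assumes "finite I" "j \<in> I" "c \<in> I \<rightarrow> carrier M"
  shows "(\<Oplus>\<^bsub>M\<^esub>i\<in>I. (if i = j then \<one> else \<zero>) \<odot>\<^bsub>M\<^esub> c i) = c j"
proof -
  have "(\<Oplus>\<^bsub>M\<^esub>i\<in>I. (if i = j then \<one> else \<zero>) \<odot>\<^bsub>M\<^esub> c i) = (\<Oplus>\<^bsub>M\<^esub>i\<in>I. if j = i then c i else \<zero>\<^bsub>M\<^esub>)"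
    by (rule M.finsum_cong') (use assms in \<open>auto simp: Pi_def\<close>)
  also have "\<dots> = c j"
    by (rule M.add.finprod_singleton) (use assms in auto)
  finally show ?thesis .
qed

lemma (in Module.module) lin_finsum_coeffs:
  assumes N: "Module.module R N" and "\<And>i. i \<in> I \<Longrightarrow> f i \<in> carrier N \<rightarrow> carrier R"
    and "\<And>i x y. i \<in> I \<Longrightarrow> x \<in> carrier N \<Longrightarrow> y \<in> carrier N \<Longrightarrow> f i (x \<oplus>\<^bsub>N\<^esub> y) = f i x \<oplus> f i y"
    and "\<And>i r x. i \<in> I \<Longrightarrow> r \<in> carrier R \<Longrightarrow> x \<in> carrier N \<Longrightarrow> f i (r \<odot>\<^bsub>N\<^esub> x) = r \<otimes> f i x"
    and "c \<in> I \<rightarrow> carrier M" "finite I"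
  shows "(\<lambda>x. \<Oplus>\<^bsub>M\<^esub>i\<in>I. f i x \<odot>\<^bsub>M\<^esub> c i) \<in> lin R N M"
proof (rule linI)
  have cl: "(\<lambda>i. f i x \<odot>\<^bsub>M\<^esub> c i) \<in> I \<rightarrow> carrier M" if "x \<in> carrier N" for x
    using assms(2,5) that by (auto simp: Pi_def)
  fix x y assume xy: "x \<in> carrier N" "y \<in> carrier N"
  show "(\<Oplus>\<^bsub>M\<^esub>i\<in>I. f i x \<odot>\<^bsub>M\<^esub> c i) \<in> carrier M" using cl xy by (simp add: M.finsum_closed)
  have "(\<Oplus>\<^bsub>M\<^esub>i\<in>I. f i (x \<oplus>\<^bsub>N\<^esub> y) \<odot>\<^bsub>M\<^esub> c i) = (\<Oplus>\<^bsub>M\<^esub>i\<in>I. f i x \<odot>\<^bsub>M\<^esub> c i \<oplus>\<^bsub>M\<^esub> f i y \<odot>\<^bsub>M\<^esub> c i)"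
    by (rule M.finsum_cong') (use assms(2,3,5) xy in \<open>auto simp: Pi_def smult_l_distr\<close>)
  then show "(\<Oplus>\<^bsub>M\<^esub>i\<in>I. f i (x \<oplus>\<^bsub>N\<^esub> y) \<odot>\<^bsub>M\<^esub> c i)
      = (\<Oplus>\<^bsub>M\<^esub>i\<in>I. f i x \<odot>\<^bsub>M\<^esub> c i) \<oplus>\<^bsub>M\<^esub> (\<Oplus>\<^bsub>M\<^esub>i\<in>I. f i y \<odot>\<^bsub>M\<^esub> c i)"
    using cl xy by (simp add: M.finsum_addf)
next
  fix r x assume rx: "r \<in> carrier R" "x \<in> carrier N"
  have cl: "(\<lambda>i. f i x \<odot>\<^bsub>M\<^esub> c i) \<in> I \<rightarrow> carrier M"
    using assms(2,5) rx by (auto simp: Pi_def)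
  have "(\<Oplus>\<^bsub>M\<^esub>i\<in>I. f i (r \<odot>\<^bsub>N\<^esub> x) \<odot>\<^bsub>M\<^esub> c i) = (\<Oplus>\<^bsub>M\<^esub>i\<in>I. r \<odot>\<^bsub>M\<^esub> (f i x \<odot>\<^bsub>M\<^esub> c i))"
    by (rule M.finsum_cong') (use assms(2,4,5) rx in \<open>auto simp: Pi_def smult_assoc1\<close>)
  then show "(\<Oplus>\<^bsub>M\<^esub>i\<in>I. f i (r \<odot>\<^bsub>N\<^esub> x) \<odot>\<^bsub>M\<^esub> c i) = r \<odot>\<^bsub>M\<^esub> (\<Oplus>\<^bsub>M\<^esub>i\<in>I. f i x \<odot>\<^bsub>M\<^esub> c i)"
    using cl rx assms(6) by (simp add: finsum_smult_ldistr)
qed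

lemma dual_basis_extend:
  fixes k :: "'k ring"
  assumes V: "Module.module k V" and Z: "Module.module k Z" and db: "dual_basis k V I b d"
    and c: "\<And>i. i \<in> I \<Longrightarrow> c i \<in> carrier Z"
  shows "\<exists>f\<in>lin k V Z. \<forall>i\<in>I. f (b i) = c i"
proof -
  interpret Z: Module.module k Z by fact
  let ?f = "\<lambda>v. \<Oplus>\<^bsub>Z\<^esub>i\<in>I. d i v \<odot>\<^bsub>Z\<^esub> c i"
  have "?f \<in> lin k V Z"
    by (rule Z.lin_finsum_coeffs[OF V]) (use dual_basisD(1,4,7,8)[OF db] c in auto)
  moreover have "?f (b j) = c j" if "j \<in> I" for j
  proof -
    have "?f (b j) = (\<Oplus>\<^bsub>Z\<^esub>i\<in>I. (if i = j then \<one>\<^bsub>k\<^esub> else \<zero>\<^bsub>k\<^esub>) \<odot>\<^bsub>Z\<^esub> c i)"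
      by (rule Z.M.finsum_cong') (use dual_basisD[OF db] c that in auto)
    then show ?thesis using Z.finsum_smult_delta[of I j c] dual_basisD(1)[OF db] that c by auto
  qed
  ultimately show ?thesis by (intro bexI[of _ ?f] ballI)
qed

lemma lin_eq_on_basis:
  assumes V: "Module.module k V" and Z: "Module.module k Z" and db: "dual_basis k V I b d"
    and f: "f \<in> lin k V Z" and g: "g \<in> lin k V Z" and eq: "\<And>i. i \<in> I \<Longrightarrow> f (b i) = g (b i)"
    and v: "v \<in> carrier V"
  shows "f v = g v"
proof -
  interpret V: Module.module k V by fact
  interpret Z: Module.module k Z by fact
  have *: "h v = (\<Oplus>\<^bsub>Z\<^esub>i\<in>I. d i v \<odot>\<^bsub>Z\<^esub> h (b i))" if h: "h \<in> lin k V Z" for h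
  proof -
    have "h v = h (\<Oplus>\<^bsub>V\<^esub>i\<in>I. d i v \<odot>\<^bsub>V\<^esub> b i)" using dual_basisD(6)[OF db v] by simp
    also have "\<dots> = (\<Oplus>\<^bsub>Z\<^esub>i\<in>I. h (d i v \<odot>\<^bsub>V\<^esub> b i))"
      by (rule lin_finsum[OF V Z h]) (use dual_basisD[OF db] v in auto)
    also have "\<dots> = (\<Oplus>\<^bsub>Z\<^esub>i\<in>I. d i v \<odot>\<^bsub>Z\<^esub> h (b i))"
      by (rule Z.M.finsum_cong')
        (use dual_basisD[OF db] v h in \<open>auto simp: lin_smult lin_closed\<close>)
    finally show ?thesis .
  qed
  have "(\<Oplus>\<^bsub>Z\<^esub>i\<in>I. d i v \<odot>\<^bsub>Z\<^esub> f (b i)) = (\<Oplus>\<^bsub>Z\<^esub>i\<in>I. d i v \<odot>\<^bsub>Z\<^esub> g (b i))"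
    by (rule Z.M.finsum_cong') (use dual_basisD[OF db] v eq g in \<open>auto simp: lin_closed\<close>)
  then show ?thesis using *[OF f] *[OF g] by simp
qed

lemma bilinear_eq_on_bases:
  assumes "Module.module k V" "Module.module k W" "Module.module k Z"
    and db: "dual_basis k V I b d" "dual_basis k W J c e"
    and f: "f \<in> bilinear_maps k V W Z" and g: "g \<in> bilinear_maps k V W Z"
    and eq: "\<And>i j. i \<in> I \<Longrightarrow> j \<in> J \<Longrightarrow> f (b i) (c j) = g (b i) (c j)"
    and vw: "v \<in> carrier V" "w \<in> carrier W"
  shows "f v w = g v w"
proof -
  have "f v (c j) = g v (c j)" if "j \<in> J" for j
    by (rule lin_eq_on_basis[OF assms(1,3) db(1) _ _ _ vw(1), of "\<lambda>v. f v (c j)" "\<lambda>v. g v (c j)"])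
      (use bilinear_lin1[OF f] bilinear_lin1[OF g] dual_basisD[OF db(2)] that eq in auto)
  then show ?thesis
    by (intro lin_eq_on_basis[OF assms(2,3) db(2) _ _ _ vw(2), of "f v" "g v"])
      (use bilinear_lin2[OF f] bilinear_lin2[OF g] vw in auto)
qed

lemma dual_basisI:
  fixes k :: "'k ring"
  assumes V: "Module.module k V" and fin: "finite I" and b: "\<And>i. i \<in> I \<Longrightarrow> b i \<in> carrier V"
    and gen: "\<And>v. v \<in> carrier V \<Longrightarrow> \<exists>a\<in>I \<rightarrow> carrier k. v = (\<Oplus>\<^bsub>V\<^esub>i\<in>I. a i \<odot>\<^bsub>V\<^esub> b i)"
    and indep: "\<And>a i. a \<in> I \<rightarrow> carrier k \<Longrightarrow> (\<Oplus>\<^bsub>V\<^esub>i\<in>I. a i \<odot>\<^bsub>V\<^esub> b i) = \<zero>\<^bsub>V\<^esub> \<Longrightarrow> i \<in> I \<Longrightarrow> a i = \<zero>\<^bsub>k\<^esub>"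
  shows "\<exists>d. dual_basis k V I b d"
proof -
  interpret V: Module.module k V by fact
  let ?c = "\<lambda>a. \<Oplus>\<^bsub>V\<^esub>i\<in>I. a i \<odot>\<^bsub>V\<^esub> b i"
  have cl: "(\<lambda>i. a i \<odot>\<^bsub>V\<^esub> b i) \<in> I \<rightarrow> carrier V" if "a \<in> I \<rightarrow> carrier k" for a
    using that b by auto
  have add: "?c (\<lambda>i. a i \<oplus>\<^bsub>k\<^esub> a' i) = ?c a \<oplus>\<^bsub>V\<^esub> ?c a'"
    if "a \<in> I \<rightarrow> carrier k" "a' \<in> I \<rightarrow> carrier k" for a a'
  proof -
    have "?c (\<lambda>i. a i \<oplus>\<^bsub>k\<^esub> a' i) = (\<Oplus>\<^bsub>V\<^esub>i\<in>I. a i \<odot>\<^bsub>V\<^esub> b i \<oplus>\<^bsub>V\<^esub> a' i \<odot>\<^bsub>V\<^esub> b i)"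
      by (rule V.M.finsum_cong') (use that b in \<open>auto simp: V.smult_l_distr Pi_def\<close>)
    then show ?thesis using cl that by (simp add: V.M.finsum_addf)
  qed
  have smult: "?c (\<lambda>i. r \<otimes>\<^bsub>k\<^esub> a i) = r \<odot>\<^bsub>V\<^esub> ?c a" if "r \<in> carrier k" "a \<in> I \<rightarrow> carrier k" for r a
  proof -
    have "?c (\<lambda>i. r \<otimes>\<^bsub>k\<^esub> a i) = (\<Oplus>\<^bsub>V\<^esub>i\<in>I. r \<odot>\<^bsub>V\<^esub> (a i \<odot>\<^bsub>V\<^esub> b i))"
      by (rule V.M.finsum_cong') (use that b in \<open>auto simp: V.smult_assoc1 Pi_def\<close>)
    then show ?thesis using cl that fin by (simp add: V.finsum_smult_ldistr)
  qed
  define A where "A v = (SOME a. a \<in> I \<rightarrow> carrier k \<and> v = ?c a)" for v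
  have A: "A v \<in> I \<rightarrow> carrier k" "?c (A v) = v" if "v \<in> carrier V" for v
  proof -
    have "\<exists>a. a \<in> I \<rightarrow> carrier k \<and> v = ?c a" using gen[OF that] by blast
    from someI_ex[OF this] have "A v \<in> I \<rightarrow> carrier k \<and> v = ?c (A v)" unfolding A_def .
    then show "A v \<in> I \<rightarrow> carrier k" "?c (A v) = v" by simp_all
  qed
  have uniq: "A v i = a i" if "a \<in> I \<rightarrow> carrier k" "v = ?c a" "i \<in> I" for v a i
  proof -
    have v: "v \<in> carrier V" using cl that by (simp add: V.M.finsum_closed)
    have m: "(\<lambda>i. \<ominus>\<^bsub>k\<^esub> \<one>\<^bsub>k\<^esub> \<otimes>\<^bsub>k\<^esub> a i) \<in> I \<rightarrow> carrier k" using that by auto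
    have "?c (\<lambda>i. A v i \<oplus>\<^bsub>k\<^esub> (\<ominus>\<^bsub>k\<^esub> \<one>\<^bsub>k\<^esub> \<otimes>\<^bsub>k\<^esub> a i)) = v \<oplus>\<^bsub>V\<^esub> (\<ominus>\<^bsub>k\<^esub> \<one>\<^bsub>k\<^esub>) \<odot>\<^bsub>V\<^esub> v"
      using add[OF A(1)[OF v] m] smult[of "\<ominus>\<^bsub>k\<^esub> \<one>\<^bsub>k\<^esub>" a] A[OF v] that by simp
    also have "\<dots> = \<zero>\<^bsub>V\<^esub>" using v by (simp add: V.smult_l_minus V.M.r_neg)
    finally have "A v i \<oplus>\<^bsub>k\<^esub> (\<ominus>\<^bsub>k\<^esub> \<one>\<^bsub>k\<^esub> \<otimes>\<^bsub>k\<^esub> a i) = \<zero>\<^bsub>k\<^esub>"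
      using indep[of "\<lambda>i. A v i \<oplus>\<^bsub>k\<^esub> (\<ominus>\<^bsub>k\<^esub> \<one>\<^bsub>k\<^esub> \<otimes>\<^bsub>k\<^esub> a i)" i] A(1)[OF v] m that(3) by auto
    moreover have c: "A v i \<in> carrier k" "a i \<in> carrier k" using A(1)[OF v] that by auto
    moreover have "A v i = (A v i \<oplus>\<^bsub>k\<^esub> (\<ominus>\<^bsub>k\<^esub> \<one>\<^bsub>k\<^esub> \<otimes>\<^bsub>k\<^esub> a i)) \<oplus>\<^bsub>k\<^esub> a i"
      using c by (simp add: V.R.a_assoc V.R.l_minus V.R.l_neg)
    ultimately show ?thesis using c by simp
  qed
  have "dual_basis k V I b (\<lambda>i v. A v i)" unfolding dual_basis_def
  proof (intro conjI ballI)
    fix i assume i: "i \<in> I"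
    show "(\<lambda>v. A v i) \<in> functionals k V"
    proof (rule linI)
      fix x y assume xy: "x \<in> carrier V" "y \<in> carrier V"
      show "A (x \<oplus>\<^bsub>V\<^esub> y) i = A x i \<oplus>\<^bsub>regular_module k\<^esub> A y i"
        using uniq[of "\<lambda>i. A x i \<oplus>\<^bsub>k\<^esub> A y i" "x \<oplus>\<^bsub>V\<^esub> y" i] add[of "A x" "A y"] A xy i by (auto simp: Pi_def)
    next
      fix r x assume rx: "r \<in> carrier k" "x \<in> carrier V"
      show "A (r \<odot>\<^bsub>V\<^esub> x) i = r \<odot>\<^bsub>regular_module k\<^esub> A x i"
        using uniq[of "\<lambda>i. r \<otimes>\<^bsub>k\<^esub> A x i" "r \<odot>\<^bsub>V\<^esub> x" i] smult[of r "A x"] A rx i by (auto simp: Pi_def)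
    qed (use A i in \<open>auto simp: Pi_def\<close>)
    fix j assume j: "j \<in> I"
    have "b j = ?c (\<lambda>i. if i = j then \<one>\<^bsub>k\<^esub> else \<zero>\<^bsub>k\<^esub>)"
      using V.finsum_smult_delta[of I j b] fin j b by auto
    from uniq[OF _ this i] show "A (b j) i = (if i = j then \<one>\<^bsub>k\<^esub> else \<zero>\<^bsub>k\<^esub>)" by auto
  qed (use fin b A in auto)
  then show ?thesis by blast
qed

lemma dual_basis_of_lin_indpt:
  assumes "vectorspace k V" "B \<subseteq> carrier V" "finite B" "\<not> LinearCombinations.module.lin_dep k V B"
    "LinearCombinations.module.span k V B = carrier V"
  shows "\<exists>d. dual_basis k V B (\<lambda>v. v) d"
proof -
  interpret V: vectorspace k V by fact
  show ?thesis
  proof (rule dual_basisI)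
    fix v assume "v \<in> carrier V"
    then show "\<exists>a\<in>B \<rightarrow> carrier k. v = (\<Oplus>\<^bsub>V\<^esub>i\<in>B. a i \<odot>\<^bsub>V\<^esub> i)"
      using V.finite_in_span[of B v] assms by (auto simp: V.lincomb_def)
  next
    fix a i assume "a \<in> B \<rightarrow> carrier k" "(\<Oplus>\<^bsub>V\<^esub>i\<in>B. a i \<odot>\<^bsub>V\<^esub> i) = \<zero>\<^bsub>V\<^esub>" "i \<in> B"
    then show "a i = \<zero>\<^bsub>k\<^esub>"
      using V.lin_dep_crit[of B B a i] assms by (auto simp: V.lincomb_def)
  qed (use assms V.module_axioms in auto)
qed

lemma dual_basis_reindex:
  assumes "Module.module k V" "dual_basis k V I b d" "bij_betw f J I"
  shows "dual_basis k V J (\<lambda>j. b (f j)) (\<lambda>j. d (f j))"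
proof -
  interpret V: Module.module k V by fact
  have I: "I = f ` J" "inj_on f J" using assms(3) by (auto simp: bij_betw_def)
  have "(\<Oplus>\<^bsub>V\<^esub>j\<in>J. d (f j) v \<odot>\<^bsub>V\<^esub> b (f j)) = v" if "v \<in> carrier V" for v
  proof -
    have "(\<Oplus>\<^bsub>V\<^esub>i\<in>f ` J. d i v \<odot>\<^bsub>V\<^esub> b i) = (\<Oplus>\<^bsub>V\<^esub>j\<in>J. d (f j) v \<odot>\<^bsub>V\<^esub> b (f j))"
      by (rule V.M.add.finprod_reindex) (use I dual_basisD[OF assms(2)] that in auto)
    then show ?thesis using dual_basisD(6)[OF assms(2) that] I by simp
  qed
  moreover have "f j \<in> I" if "j \<in> J" for j using that I by simp
  moreover have "finite J" using bij_betw_finite[OF assms(3)] dual_basisD(1)[OF assms(2)] by simp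
  moreover have "f i = f j \<longleftrightarrow> i = j" if "i \<in> J" "j \<in> J" for i j
    using that I(2) by (auto simp: inj_on_def)
  ultimately show ?thesis
    unfolding dual_basis_def using dual_basisD(2,3,5)[OF assms(2)] by simp
qed

lemma fd_space_imp_dual_basis:
  assumes "fd_space k V"
  obtains n :: nat and b d where "dual_basis k V {..<n} b d"
proof -
  interpret V: vectorspace k V using assms by (simp add: fd_space_def)
  obtain B where B: "finite B" "V.basis B"
    using V.finite_basis_exists assms by (auto simp: fd_space_def)
  then obtain d where "dual_basis k V B (\<lambda>v. v) d"
    using dual_basis_of_lin_indpt[OF V.vectorspace_axioms, of B] by (auto simp: V.basis_def)
  moreover obtain f where "bij_betw f {..<card B} B"
    using ex_bij_betw_nat_finite[OF B(1)] by (auto simp: atLeast0LessThan)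
  ultimately show ?thesis
    using dual_basis_reindex[OF V.module_axioms] that by blast
qed

lemma dual_basis_imp_fd_space:
  assumes "vectorspace k V" "dual_basis k V I b d"
  shows "fd_space k V"
proof -
  interpret V: vectorspace k V by fact
  have "carrier V \<subseteq> V.span (b ` I)"
  proof
    fix v assume v: "v \<in> carrier V"
    have sub: "LinearCombinations.submodule k (V.span (b ` I)) V"
      by (rule V.span_is_submodule) (use dual_basisD[OF assms(2)] in auto)
    interpret S: LinearCombinations.submodule k "V.span (b ` I)" V by (fact sub)
    have own: "b ` I \<subseteq> V.span (b ` I)"
      by (rule V.in_own_span) (use dual_basisD[OF assms(2)] in auto)
    have "(\<Oplus>\<^bsub>V\<^esub>i\<in>J. d i v \<odot>\<^bsub>V\<^esub> b i) \<in> V.span (b ` I)" if "finite J" "J \<subseteq> I" for J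
      using that
    proof (induction J)
      case (insert j J)
      then show ?case
        using dual_basisD[OF assms(2)] v own
        by (subst V.M.finsum_insert) (auto simp: Pi_def subset_eq intro!: S.m_closed S.smult_closed)
    qed auto
    then show "v \<in> V.span (b ` I)"
      using dual_basisD(1,6)[OF assms(2)] v by (metis order_refl)
  qed
  moreover have "V.span (b ` I) \<subseteq> carrier V"
    by (rule V.span_is_subset2) (use dual_basisD[OF assms(2)] in auto)
  ultimately show ?thesis
    using assms(1) dual_basisD(1,2)[OF assms(2)]
    unfolding fd_space_def V.fin_dim_def by (intro conjI exI[of _ "b ` I"]) auto
qed

subsection \<open>Isomorphisms\<close>

definition lin_iso where "lin_iso R M N f \<longleftrightarrow> f \<in> lin R M N \<and> bij_betw f (carrier M) (carrier N)"

lemma lin_iso_inverse: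
  assumes "Module.module R M" "lin_iso R M N f"
  shows "inv_into (carrier M) f \<in> lin R N M"
proof -
  interpret Module.module R M by fact
  let ?g = "inv_into (carrier M) f"
  have f: "f \<in> lin R M N" and inj: "inj_on f (carrier M)" and im: "f ` carrier M = carrier N"
    using assms by (auto simp: lin_iso_def bij_betw_def)
  have g: "?g y \<in> carrier M" "f (?g y) = y" if "y \<in> carrier N" for y
    using that im by (auto simp: inv_into_into f_inv_into_f)
  have gf: "?g (f x) = x" if "x \<in> carrier M" for x using inj that by (rule inv_into_f_f)
  show ?thesis
  proof (rule linI)
    fix x y assume "x \<in> carrier N" "y \<in> carrier N"
    then show "?g (x \<oplus>\<^bsub>N\<^esub> y) = ?g x \<oplus>\<^bsub>M\<^esub> ?g y"
      using gf[of "?g x \<oplus>\<^bsub>M\<^esub> ?g y"] g lin_add[OF f, of "?g x" "?g y"] by simp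
  next
    fix r x assume "r \<in> carrier R" "x \<in> carrier N"
    then show "?g (r \<odot>\<^bsub>N\<^esub> x) = r \<odot>\<^bsub>M\<^esub> ?g x"
      using gf[of "r \<odot>\<^bsub>M\<^esub> ?g x"] g lin_smult[OF f, of r "?g x"] by simp
  qed (use g in auto)
qed

lemma module_image:
  fixes R (structure)
  assumes "Module.module R M" "carrier N = f ` carrier M" "\<zero>\<^bsub>N\<^esub> = f \<zero>\<^bsub>M\<^esub>"
    and add: "\<And>x y. x \<in> carrier M \<Longrightarrow> y \<in> carrier M \<Longrightarrow> f x \<oplus>\<^bsub>N\<^esub> f y = f (x \<oplus>\<^bsub>M\<^esub> y)"
    and sm: "\<And>r x. r \<in> carrier R \<Longrightarrow> x \<in> carrier M \<Longrightarrow> r \<odot>\<^bsub>N\<^esub> f x = f (r \<odot>\<^bsub>M\<^esub> x)"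
  shows "Module.module R N" "f \<in> lin R M N"
proof -
  interpret Module.module R M by fact
  show "Module.module R N"
  proof (rule module_criteria[OF R.is_cring])
    show "\<forall>v\<in>carrier N. \<exists>neg_v\<in>carrier N. v \<oplus>\<^bsub>N\<^esub> neg_v = \<zero>\<^bsub>N\<^esub>"
    proof
      fix v assume "v \<in> carrier N"
      then obtain x where x: "x \<in> carrier M" "v = f x" using assms(2) by auto
      then have "v \<oplus>\<^bsub>N\<^esub> f (\<ominus>\<^bsub>M\<^esub> x) = \<zero>\<^bsub>N\<^esub>" using add[of x "\<ominus>\<^bsub>M\<^esub> x"] assms(3) by (simp add: M.r_neg)
      then show "\<exists>neg_v\<in>carrier N. v \<oplus>\<^bsub>N\<^esub> neg_v = \<zero>\<^bsub>N\<^esub>"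
        using x assms(2) by (intro bexI[of _ "f (\<ominus>\<^bsub>M\<^esub> x)"]) auto
    qed
  qed (use assms(2,3) add sm in \<open>auto simp: M.a_ac smult_l_distr smult_r_distr smult_assoc1\<close>)
  show "f \<in> lin R M N" by (rule linI) (use assms in auto)
qed

text \<open>Spaces are constructed on the type \<open>nat \<Rightarrow> 'k\<close> and then moved to a type that is only known to be
  large enough.\<close>

definition transport :: "('v \<Rightarrow> 'w) \<Rightarrow> ('k, 'v) module \<Rightarrow> ('k, 'w) module" where
  "transport e M = \<lparr>carrier = e ` carrier M, monoid.mult = undefined, one = undefined, zero = e \<zero>\<^bsub>M\<^esub>,
     add = (\<lambda>x y. e (inv_into (carrier M) e x \<oplus>\<^bsub>M\<^esub> inv_into (carrier M) e y)),
     smult = (\<lambda>c x. e (c \<odot>\<^bsub>M\<^esub> inv_into (carrier M) e x))\<rparr>"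

lemma transport:
  assumes "Module.module R M" "inj_on e (carrier M)"
  shows "Module.module R (transport e M)" "lin_iso R M (transport e M) e"
  using module_image[OF assms(1), of "transport e M" e] assms(2)
  by (auto simp: transport_def lin_iso_def bij_betw_def)

lemma dual_basis_iso:
  assumes V: "Module.module k V" and W: "Module.module k W" and db: "dual_basis k V I b d" and f: "lin_iso k V W f"
  shows "dual_basis k W I (\<lambda>i. f (b i)) (\<lambda>i w. d i (inv_into (carrier V) f w))"
proof -
  interpret W: Module.module k W by fact
  let ?g = "inv_into (carrier V) f"
  have fl: "f \<in> lin k V W" and inj: "inj_on f (carrier V)" and im: "f ` carrier V = carrier W"
    using f by (auto simp: lin_iso_def bij_betw_def)
  have g: "?g y \<in> carrier V" "f (?g y) = y" if "y \<in> carrier W" for y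
    using that im by (auto simp: inv_into_into f_inv_into_f)
  have gf: "?g (f x) = x" if "x \<in> carrier V" for x using inj that by (rule inv_into_f_f)
  have "w = (\<Oplus>\<^bsub>W\<^esub>i\<in>I. d i (?g w) \<odot>\<^bsub>W\<^esub> f (b i))" if w: "w \<in> carrier W" for w
  proof -
    have "w = f (\<Oplus>\<^bsub>V\<^esub>i\<in>I. d i (?g w) \<odot>\<^bsub>V\<^esub> b i)" using dual_basisD(6)[OF db, of "?g w"] g w by simp
    also have "\<dots> = (\<Oplus>\<^bsub>W\<^esub>i\<in>I. f (d i (?g w) \<odot>\<^bsub>V\<^esub> b i))"
      by (rule lin_finsum[OF V W fl])
        (use dual_basisD[OF db] g w in \<open>auto intro!: Module.module.smult_closed[OF V]\<close>)
    also have "\<dots> = (\<Oplus>\<^bsub>W\<^esub>i\<in>I. d i (?g w) \<odot>\<^bsub>W\<^esub> f (b i))"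
      by (rule W.M.finsum_cong') (use dual_basisD[OF db] g w fl in \<open>auto simp: lin_smult lin_closed\<close>)
    finally show ?thesis .
  qed
  then show ?thesis
    using dual_basisD(1,2,5)[OF db] gf lin_closed[OF fl]
      lin_compose[OF lin_iso_inverse[OF V f] dual_basisD(3)[OF db]]
    unfolding dual_basis_def by auto
qed

lemma module_by:
  assumes "cring R" "\<zero>\<^bsub>M\<^esub> \<in> carrier M"
    and "\<And>v w. v \<in> carrier M \<Longrightarrow> w \<in> carrier M \<Longrightarrow> v \<oplus>\<^bsub>M\<^esub> w \<in> carrier M"
    and "\<And>v. v \<in> carrier M \<Longrightarrow> \<exists>neg_v\<in>carrier M. v \<oplus>\<^bsub>M\<^esub> neg_v = \<zero>\<^bsub>M\<^esub>"
    and "\<And>c v. c \<in> carrier R \<Longrightarrow> v \<in> carrier M \<Longrightarrow> c \<odot>\<^bsub>M\<^esub> v \<in> carrier M"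
    and "\<And>v w. v \<in> carrier M \<Longrightarrow> w \<in> carrier M \<Longrightarrow> v \<oplus>\<^bsub>M\<^esub> w = w \<oplus>\<^bsub>M\<^esub> v"
    and "\<And>v w x. v \<in> carrier M \<Longrightarrow> w \<in> carrier M \<Longrightarrow> x \<in> carrier M \<Longrightarrow> v \<oplus>\<^bsub>M\<^esub> w \<oplus>\<^bsub>M\<^esub> x = v \<oplus>\<^bsub>M\<^esub> (w \<oplus>\<^bsub>M\<^esub> x)"
    and "\<And>v. v \<in> carrier M \<Longrightarrow> v \<oplus>\<^bsub>M\<^esub> \<zero>\<^bsub>M\<^esub> = v"
    and "\<And>a b v. a \<in> carrier R \<Longrightarrow> b \<in> carrier R \<Longrightarrow> v \<in> carrier M \<Longrightarrow> (a \<otimes>\<^bsub>R\<^esub> b) \<odot>\<^bsub>M\<^esub> v = a \<odot>\<^bsub>M\<^esub> (b \<odot>\<^bsub>M\<^esub> v)"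
    and "\<And>v. v \<in> carrier M \<Longrightarrow> \<one>\<^bsub>R\<^esub> \<odot>\<^bsub>M\<^esub> v = v"
    and "\<And>a b v. a \<in> carrier R \<Longrightarrow> b \<in> carrier R \<Longrightarrow> v \<in> carrier M \<Longrightarrow> (a \<oplus>\<^bsub>R\<^esub> b) \<odot>\<^bsub>M\<^esub> v = a \<odot>\<^bsub>M\<^esub> v \<oplus>\<^bsub>M\<^esub> b \<odot>\<^bsub>M\<^esub> v"
    and "\<And>a v w. a \<in> carrier R \<Longrightarrow> v \<in> carrier M \<Longrightarrow> w \<in> carrier M \<Longrightarrow> a \<odot>\<^bsub>M\<^esub> (v \<oplus>\<^bsub>M\<^esub> w) = a \<odot>\<^bsub>M\<^esub> v \<oplus>\<^bsub>M\<^esub> a \<odot>\<^bsub>M\<^esub> w"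
  shows "Module.module R M"
  by (rule module_criteria, rule assms(1), rule assms(2))
    ((intro allI ballI impI)[1], (elim conjE)?, (rule assms(3-); assumption))+

section \<open>Free modules\<close>

text \<open>Unlike \<open>regular_module\<close>, this also accepts extended records, and so applies to an algebra as a module
  over itself.\<close>

definition self_module :: "('a, 'z) ring_scheme \<Rightarrow> ('a, 'a) module" where
  "self_module R = \<lparr>carrier = carrier R, monoid.mult = undefined, one = undefined, zero = \<zero>\<^bsub>R\<^esub>,
     add = add R, smult = monoid.mult R\<rparr>"

lemma self_module_simps[simp]:
  "carrier (self_module R) = carrier R" "a \<oplus>\<^bsub>self_module R\<^esub> b = a \<oplus>\<^bsub>R\<^esub> b"
  "\<zero>\<^bsub>self_module R\<^esub> = \<zero>\<^bsub>R\<^esub>" "smult (self_module R) c a = c \<otimes>\<^bsub>R\<^esub> a"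
  "finsum (self_module R) = finsum R"
  by (auto simp: self_module_def fun_eq_iff finsum_def finprod_def)

lemma (in cring) self_module: "Module.module R (self_module R)"
  by (rule module_criteria)
    (auto simp: is_cring a_ac l_distr r_distr m_assoc r_neg intro: exI[of _ "\<ominus> _"] bexI[of _ "\<ominus> _"])

context cring
begin

abbreviation "F \<equiv> free_module R"

lemma free_module_simps[simp]:
  "f \<in> carrier (F S) \<longleftrightarrow> f \<in> S \<rightarrow> carrier R \<and> (\<forall>s. s \<notin> S \<longrightarrow> f s = \<zero>) \<and> finite {s. f s \<noteq> \<zero>}"
  "f \<oplus>\<^bsub>F S\<^esub> g = (\<lambda>s. f s \<oplus> g s)" "\<zero>\<^bsub>F S\<^esub> = (\<lambda>_. \<zero>)" "r \<odot>\<^bsub>F S\<^esub> f = (\<lambda>s. r \<otimes> f s)"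
  by (auto simp: free_module_def)

lemma free_module_carrier: "f \<in> carrier (F S) \<Longrightarrow> f s \<in> carrier R"
  by (cases "s \<in> S") auto

lemma free_module_add_closed:
  assumes "f \<in> carrier (F S)" "g \<in> carrier (F S)"
  shows "(\<lambda>s. f s \<oplus> g s) \<in> carrier (F S)"
proof -
  have "{s. f s \<oplus> g s \<noteq> \<zero>} \<subseteq> {s. f s \<noteq> \<zero>} \<union> {s. g s \<noteq> \<zero>}" by auto
  then have "finite {s. f s \<oplus> g s \<noteq> \<zero>}" by (rule finite_subset) (use assms in auto)
  then show ?thesis using assms by auto
qed

lemma free_module_smult_closed:
  assumes "r \<in> carrier R" "f \<in> carrier (F S)"
  shows "(\<lambda>s. r \<otimes> f s) \<in> carrier (F S)"
proof -
  have "{s. r \<otimes> f s \<noteq> \<zero>} \<subseteq> {s. f s \<noteq> \<zero>}" using assms by auto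
  then have "finite {s. r \<otimes> f s \<noteq> \<zero>}" by (rule finite_subset) (use assms in auto)
  then show ?thesis using assms by auto
qed

lemma free_module: "Module.module R (F S)"
proof (rule module_by)
  show "cring R" by (rule is_cring)
  show "\<zero>\<^bsub>F S\<^esub> \<in> carrier (F S)" by auto
  fix v assume v: "v \<in> carrier (F S)"
  note vc = free_module_carrier[OF v]
  have "(\<lambda>s. \<ominus> \<one> \<otimes> v s) \<in> carrier (F S)" by (rule free_module_smult_closed[OF _ v]) auto
  moreover have "v \<oplus>\<^bsub>F S\<^esub> (\<lambda>s. \<ominus> \<one> \<otimes> v s) = \<zero>\<^bsub>F S\<^esub>"
    using vc by (simp add: fun_eq_iff l_minus r_neg)
  ultimately show "\<exists>neg_v\<in>carrier (F S). v \<oplus>\<^bsub>F S\<^esub> neg_v = \<zero>\<^bsub>F S\<^esub>" by blast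
  show "v \<oplus>\<^bsub>F S\<^esub> \<zero>\<^bsub>F S\<^esub> = v" "\<one> \<odot>\<^bsub>F S\<^esub> v = v" using vc by (simp_all add: fun_eq_iff)
  fix w assume w: "w \<in> carrier (F S)"
  note wc = free_module_carrier[OF w]
  show "v \<oplus>\<^bsub>F S\<^esub> w \<in> carrier (F S)" using free_module_add_closed[OF v w] by (simp only: free_module_simps(2))
  show "v \<oplus>\<^bsub>F S\<^esub> w = w \<oplus>\<^bsub>F S\<^esub> v" using vc wc by (simp add: fun_eq_iff a_comm)
  show "v \<oplus>\<^bsub>F S\<^esub> w \<oplus>\<^bsub>F S\<^esub> x = v \<oplus>\<^bsub>F S\<^esub> (w \<oplus>\<^bsub>F S\<^esub> x)" if "x \<in> carrier (F S)" for x
    using vc wc free_module_carrier[OF that] by (simp add: fun_eq_iff a_assoc)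
  fix a assume a: "a \<in> carrier R"
  show "a \<odot>\<^bsub>F S\<^esub> v \<in> carrier (F S)" using free_module_smult_closed[OF a v] by (simp only: free_module_simps(4))
  show "a \<odot>\<^bsub>F S\<^esub> (v \<oplus>\<^bsub>F S\<^esub> w) = a \<odot>\<^bsub>F S\<^esub> v \<oplus>\<^bsub>F S\<^esub> a \<odot>\<^bsub>F S\<^esub> w"
    using a vc wc by (simp add: fun_eq_iff r_distr)
  fix b assume b: "b \<in> carrier R"
  show "(a \<otimes> b) \<odot>\<^bsub>F S\<^esub> v = a \<odot>\<^bsub>F S\<^esub> (b \<odot>\<^bsub>F S\<^esub> v)" "(a \<oplus> b) \<odot>\<^bsub>F S\<^esub> v = a \<odot>\<^bsub>F S\<^esub> v \<oplus>\<^bsub>F S\<^esub> b \<odot>\<^bsub>F S\<^esub> v"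
    using a b vc by (simp_all add: fun_eq_iff m_assoc l_distr)
qed

lemma free_gen_closed: "s \<in> S \<Longrightarrow> free_gen R s \<in> carrier (F S)"
  by (auto simp: free_gen_def)

lemma free_module_summand_closed:
  assumes "f \<in> carrier (F S)" "s \<in> S"
  shows "f s \<odot>\<^bsub>F S\<^esub> free_gen R s \<in> carrier (F S)"
  by (rule Module.module.smult_closed[OF free_module free_module_carrier[OF assms(1)] free_gen_closed[OF assms(2)]])

lemma free_module_eval_lin: "(\<lambda>f. f s) \<in> lin R (F S) (self_module R)"
  by (rule linI) (auto simp del: free_module_simps(1) simp: free_module_carrier)

lemma free_module_finsum_eval:
  assumes "g \<in> I \<rightarrow> carrier (F S)"
  shows "finsum (F S) g I s = finsum R (\<lambda>i. g i s) I"
  using lin_finsum[OF free_module self_module free_module_eval_lin assms] by simp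

lemma free_module_expand:
  assumes f: "f \<in> carrier (F S)" and T: "finite T" "T \<subseteq> S" "\<And>s. s \<notin> T \<Longrightarrow> f s = \<zero>"
  shows "f = (\<Oplus>\<^bsub>F S\<^esub>s\<in>T. f s \<odot>\<^bsub>F S\<^esub> free_gen R s)"
proof
  fix x
  interpret FS: Module.module R "F S" by (rule free_module)
  have "(\<Oplus>\<^bsub>F S\<^esub>s\<in>T. f s \<odot>\<^bsub>F S\<^esub> free_gen R s) x = (\<Oplus>s\<in>T. f s \<otimes> free_gen R s x)"
    using free_module_finsum_eval[of "\<lambda>s. f s \<odot>\<^bsub>F S\<^esub> free_gen R s" T S x]
      free_module_summand_closed[OF f] T(2) by (auto simp: Pi_def simp del: free_module_simps(1))
  also have "\<dots> = (\<Oplus>s\<in>T. if x = s then f s else \<zero>)"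
    by (rule finsum_cong') (use free_module_carrier[OF f] in \<open>auto simp: free_gen_def\<close>)
  also have "\<dots> = f x"
  proof (cases "x \<in> T")
    case True
    then show ?thesis by (intro add.finprod_singleton) (use T free_module_carrier[OF f] in auto)
  next
    case False
    then have "(\<Oplus>s\<in>T. if x = s then f s else \<zero>) = \<zero>"
      by (intro add.finprod_one_eqI) auto
    then show ?thesis using T False by simp
  qed
  finally show "f x = (\<Oplus>\<^bsub>F S\<^esub>s\<in>T. f s \<odot>\<^bsub>F S\<^esub> free_gen R s) x" by simp
qed

lemma free_module_generated: "carrier (F S) \<subseteq> LinearCombinations.module.span R (F S) (free_gen R ` S)"
proof
  fix f assume f: "f \<in> carrier (F S)"
  interpret FS: Module.module R "F S" by (rule free_module)
  let ?N = "FS.span (free_gen R ` S)"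
  have gen: "free_gen R ` S \<subseteq> carrier (F S)" by (rule image_subsetI) (rule free_gen_closed)
  interpret N: LinearCombinations.submodule R ?N "F S" by (rule FS.span_is_submodule[OF gen])
  have own: "free_gen R ` S \<subseteq> ?N" by (rule FS.in_own_span[OF gen])
  have "(\<Oplus>\<^bsub>F S\<^esub>s\<in>T. f s \<odot>\<^bsub>F S\<^esub> free_gen R s) \<in> ?N" if "finite T" "T \<subseteq> S" for T
    using that
  proof (induction T)
    case empty
    show ?case using N.zero_closed by simp
  next
    case (insert s T)
    have c: "(\<lambda>s. f s \<odot>\<^bsub>F S\<^esub> free_gen R s) \<in> insert s T \<rightarrow> carrier (F S)"
      using insert free_module_summand_closed[OF f] by (auto simp: Pi_def simp del: free_module_simps)
    have "f s \<odot>\<^bsub>F S\<^esub> free_gen R s \<in> ?N"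
      by (rule N.smult_closed) (use insert own free_module_carrier[OF f] in auto)
    then have "f s \<odot>\<^bsub>F S\<^esub> free_gen R s \<oplus>\<^bsub>F S\<^esub> (\<Oplus>\<^bsub>F S\<^esub>s\<in>T. f s \<odot>\<^bsub>F S\<^esub> free_gen R s) \<in> ?N"
      using N.m_closed insert by blast
    moreover have "(\<Oplus>\<^bsub>F S\<^esub>s\<in>insert s T. f s \<odot>\<^bsub>F S\<^esub> free_gen R s)
        = f s \<odot>\<^bsub>F S\<^esub> free_gen R s \<oplus>\<^bsub>F S\<^esub> (\<Oplus>\<^bsub>F S\<^esub>s\<in>T. f s \<odot>\<^bsub>F S\<^esub> free_gen R s)"
      by (rule FS.M.finsum_insert) (use insert c in \<open>auto simp del: free_module_simps\<close>)
    ultimately show ?case by simp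
  qed
  moreover have "{s. f s \<noteq> \<zero>} \<subseteq> S" using f by auto
  moreover have "finite {s. f s \<noteq> \<zero>}" using f by simp
  ultimately have "(\<Oplus>\<^bsub>F S\<^esub>s\<in>{s. f s \<noteq> \<zero>}. f s \<odot>\<^bsub>F S\<^esub> free_gen R s) \<in> ?N" by blast
  moreover have "f = (\<Oplus>\<^bsub>F S\<^esub>s\<in>{s. f s \<noteq> \<zero>}. f s \<odot>\<^bsub>F S\<^esub> free_gen R s)"
    by (rule free_module_expand[OF f]) (use f in auto)
  ultimately show "f \<in> ?N" by simp
qed

lemma free_module_extend:
  assumes M: "Module.module R M" and h: "\<And>s. s \<in> S \<Longrightarrow> h s \<in> carrier M"
  shows "\<exists>H\<in>lin R (F S) M. \<forall>s\<in>S. H (free_gen R s) = h s"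
proof -
  interpret M: Module.module R M by fact
  let ?supp = "\<lambda>f. {s. f s \<noteq> \<zero>}"
  define H where "H f = (\<Oplus>\<^bsub>M\<^esub>s\<in>?supp f. f s \<odot>\<^bsub>M\<^esub> h s)" for f
  have H: "H f = (\<Oplus>\<^bsub>M\<^esub>s\<in>T. f s \<odot>\<^bsub>M\<^esub> h s)"
    if "finite T" "?supp f \<subseteq> T" "T \<subseteq> S" "f \<in> carrier (F S)" for f T
    unfolding H_def
  proof (rule M.M.add.finprod_mono_neutral_cong_left[OF that(1,2)])
    fix s assume "s \<in> T - ?supp f"
    then have "f s = \<zero>" "h s \<in> carrier M" using that(3) h by auto
    then show "f s \<odot>\<^bsub>M\<^esub> h s = \<zero>\<^bsub>M\<^esub>" by simp
  qed (use that(3) h free_module_carrier[OF that(4)] in auto)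
  have sub: "?supp f \<subseteq> S" if "f \<in> carrier (F S)" for f using that by auto
  have cl: "(\<lambda>s. f s \<odot>\<^bsub>M\<^esub> h s) \<in> T \<rightarrow> carrier M" if "f \<in> carrier (F S)" "T \<subseteq> S" for f T
    using that h free_module_carrier[OF that(1)] by auto
  have "H \<in> lin R (F S) M"
  proof (rule linI)
    fix f assume f: "f \<in> carrier (F S)"
    show "H f \<in> carrier M" unfolding H_def using cl[OF f sub[OF f]] by (simp add: M.M.finsum_closed)
    fix g assume g: "g \<in> carrier (F S)"
    let ?T = "?supp f \<union> ?supp g"
    have T: "finite ?T" "?T \<subseteq> S" using f g by auto
    have "H (\<lambda>s. f s \<oplus> g s) = (\<Oplus>\<^bsub>M\<^esub>s\<in>?T. (f s \<oplus> g s) \<odot>\<^bsub>M\<^esub> h s)"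
      by (rule H[OF T(1) _ T(2) free_module_add_closed[OF f g]]) auto
    also have "\<dots> = (\<Oplus>\<^bsub>M\<^esub>s\<in>?T. f s \<odot>\<^bsub>M\<^esub> h s \<oplus>\<^bsub>M\<^esub> g s \<odot>\<^bsub>M\<^esub> h s)"
      by (rule M.M.finsum_cong')
        (use T h free_module_carrier[OF f] free_module_carrier[OF g] in \<open>auto simp: M.smult_l_distr\<close>)
    also have "\<dots> = (\<Oplus>\<^bsub>M\<^esub>s\<in>?T. f s \<odot>\<^bsub>M\<^esub> h s) \<oplus>\<^bsub>M\<^esub> (\<Oplus>\<^bsub>M\<^esub>s\<in>?T. g s \<odot>\<^bsub>M\<^esub> h s)"
      by (rule M.M.finsum_addf) (use cl f g T in auto)
    also have "\<dots> = H f \<oplus>\<^bsub>M\<^esub> H g"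
      using H[OF T(1) _ T(2) f] H[OF T(1) _ T(2) g] by simp
    finally show "H (f \<oplus>\<^bsub>F S\<^esub> g) = H f \<oplus>\<^bsub>M\<^esub> H g" by simp
  next
    fix r f assume r: "r \<in> carrier R" and f: "f \<in> carrier (F S)"
    have fin: "finite (?supp f)" using f by auto
    have "H (\<lambda>s. r \<otimes> f s) = (\<Oplus>\<^bsub>M\<^esub>s\<in>?supp f. (r \<otimes> f s) \<odot>\<^bsub>M\<^esub> h s)"
      by (rule H[OF fin _ sub[OF f] free_module_smult_closed[OF r f]]) (use r in auto)
    also have "\<dots> = (\<Oplus>\<^bsub>M\<^esub>s\<in>?supp f. r \<odot>\<^bsub>M\<^esub> (f s \<odot>\<^bsub>M\<^esub> h s))"
      by (rule M.M.finsum_cong')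
        (use r h free_module_carrier[OF f] sub[OF f] in \<open>auto simp: M.smult_assoc1\<close>)
    also have "\<dots> = r \<odot>\<^bsub>M\<^esub> H f"
      unfolding H_def using M.finsum_smult_ldistr[OF fin r cl[OF f sub[OF f]]] by simp
    finally show "H (r \<odot>\<^bsub>F S\<^esub> f) = r \<odot>\<^bsub>M\<^esub> H f" by simp
  qed
  moreover have "H (free_gen R s) = h s" if "s \<in> S" for s
  proof -
    have "H (free_gen R s) = (\<Oplus>\<^bsub>M\<^esub>t\<in>{s}. free_gen R s t \<odot>\<^bsub>M\<^esub> h t)"
      by (rule H[OF _ _ _ free_gen_closed[OF that]]) (use that in \<open>auto simp: free_gen_def split: if_splits\<close>)
    then show ?thesis using that h by (simp add: free_gen_def)
  qed
  ultimately show ?thesis by blast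
qed

end

lemma free_module_dual_basis:
  fixes k :: "'k ring"
  assumes "field k" "finite S"
  shows "vectorspace k (free_module k S)" "dual_basis k (free_module k S) S (free_gen k) (\<lambda>s f. f s)"
proof -
  interpret field k by fact
  show "vectorspace k (free_module k S)"
    using free_module assms(1) by (simp add: vectorspace_def)
  have "(\<lambda>f. f s) \<in> functionals k (free_module k S)" for s
    by (rule linI) (auto simp del: free_module_simps(1) simp: free_module_carrier)
  moreover have "f = (\<Oplus>\<^bsub>F S\<^esub>s\<in>S. f s \<odot>\<^bsub>F S\<^esub> free_gen k s)" if "f \<in> carrier (F S)" for f
    by (rule free_module_expand) (use that assms in auto)
  ultimately show "dual_basis k (free_module k S) S (free_gen k) (\<lambda>s f. f s)"
    unfolding dual_basis_def using assms(2) free_gen_closed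
    by (auto simp: free_gen_def simp del: free_module_simps)
qed

section \<open>Tensor products of finite-dimensional spaces\<close>

text \<open>A bilinear map \<open>\<beta>\<close> whose image spans and on which any two functionals can be multiplied. For
  finite-dimensional spaces this means that \<open>\<beta>\<close> is a tensor product; unlike the universal property,
  it does not quantify over the modules of some type, so it can be used with targets of any type.\<close>

definition tensor_pairing ::
  "'k ring \<Rightarrow> ('k, 'v) module \<Rightarrow> ('k, 'w) module \<Rightarrow> ('k, 't) module \<Rightarrow> ('v \<Rightarrow> 'w \<Rightarrow> 't) \<Rightarrow> bool"
where
  "tensor_pairing k V W T \<beta> \<longleftrightarrow> \<beta> \<in> bilinear_maps k V W T \<and>
     LinearCombinations.module.span k T {\<beta> v w | v w. v \<in> carrier V \<and> w \<in> carrier W} = carrier T \<and>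
     (\<forall>l\<in>functionals k V. \<forall>m\<in>functionals k W. \<exists>n\<in>functionals k T.
        \<forall>v\<in>carrier V. \<forall>w\<in>carrier W. n (\<beta> v w) = l v \<otimes>\<^bsub>k\<^esub> m w)"

lemma tensor_pairing_eq:
  assumes "tensor_pairing k V W T \<beta>" "Module.module k T" "Module.module k Z"
    and "f \<in> lin k T Z" "g \<in> lin k T Z"
    and "\<And>v w. v \<in> carrier V \<Longrightarrow> w \<in> carrier W \<Longrightarrow> f (\<beta> v w) = g (\<beta> v w)" "t \<in> carrier T"
  shows "f t = g t"
  by (rule lin_eq_on_span[OF assms(2-5), of "{\<beta> v w | v w. v \<in> carrier V \<and> w \<in> carrier W}"])
    (use assms(1,6,7) in \<open>auto simp: tensor_pairing_def bilinear_closed\<close>)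

text \<open>The coordinates of \<open>b\<^sub>i \<otimes> c\<^sub>j\<close> are the products of the coordinate functionals. The expansion in them
  holds for the products \<open>v \<otimes> w\<close>, by expanding both factors, and these span.\<close>

lemma tensor_basis:
  assumes V: "vectorspace k V" and W: "vectorspace k W" and T: "vectorspace k T"
    and tp: "tensor_pairing k V W T \<beta>" and b: "dual_basis k V I b d" and c: "dual_basis k W J c e"
  shows "\<exists>g. dual_basis k T (I \<times> J) (\<lambda>(i, j). \<beta> (b i) (c j)) g"
proof -
  interpret V: vectorspace k V by fact
  interpret W: vectorspace k W by fact
  interpret T: vectorspace k T by fact
  have bil: "\<beta> \<in> bilinear_maps k V W T" using tp by (simp add: tensor_pairing_def)
  let ?P = "\<lambda>x n. n \<in> functionals k T \<and> (\<forall>v\<in>carrier V. \<forall>w\<in>carrier W. n (\<beta> v w) = d (fst x) v \<otimes>\<^bsub>k\<^esub> e (snd x) w)"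
  have "\<forall>x\<in>I \<times> J. \<exists>n. ?P x n"
  proof
    fix x assume "x \<in> I \<times> J"
    then have "d (fst x) \<in> functionals k V" "e (snd x) \<in> functionals k W"
      using dual_basisD(3)[OF b] dual_basisD(3)[OF c] by auto
    then show "\<exists>n. ?P x n" using tp unfolding tensor_pairing_def by fast
  qed
  then obtain g where "\<forall>x\<in>I \<times> J. ?P x (g x)" by (rule bchoice[THEN exE])
  then have g: "\<And>i j. i \<in> I \<Longrightarrow> j \<in> J \<Longrightarrow> g (i, j) \<in> functionals k T"
    and gb: "\<And>i j v w. i \<in> I \<Longrightarrow> j \<in> J \<Longrightarrow> v \<in> carrier V \<Longrightarrow> w \<in> carrier W \<Longrightarrow> g (i, j) (\<beta> v w) = d i v \<otimes>\<^bsub>k\<^esub> e j w"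
    by auto
  let ?B = "\<lambda>(i, j). \<beta> (b i) (c j)"
  have B: "?B x \<in> carrier T" if "x \<in> I \<times> J" for x
    using that dual_basisD(2)[OF b] dual_basisD(2)[OF c] bilinear_closed[OF bil] by auto
  have gB: "g x (?B y) = (if x = y then \<one>\<^bsub>k\<^esub> else \<zero>\<^bsub>k\<^esub>)" if "x \<in> I \<times> J" "y \<in> I \<times> J" for x y
    using that gb dual_basisD(2,5)[OF b] dual_basisD(2,5)[OF c] by (auto split: prod.splits if_splits)
  have fin: "finite (I \<times> J)" using dual_basisD(1)[OF b] dual_basisD(1)[OF c] by simp
  define E where "E t = (\<Oplus>\<^bsub>T\<^esub>x\<in>I \<times> J. g x t \<odot>\<^bsub>T\<^esub> ?B x)" for t
  have E: "E \<in> lin k T T" unfolding E_def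
    by (rule T.lin_finsum_coeffs[OF T.module_axioms _ _ _ _ fin])
      (use g B lin_closed[of _ k T "regular_module k"] lin_add[of _ k T "regular_module k"]
         lin_smult[of _ k T "regular_module k"] in auto)
  have idT: "(\<lambda>t. t) \<in> lin k T T" by (rule linI) auto
  have EB: "E (?B y) = ?B y" if "y \<in> I \<times> J" for y
  proof -
    have "E (?B y) = (\<Oplus>\<^bsub>T\<^esub>x\<in>I \<times> J. (if x = y then \<one>\<^bsub>k\<^esub> else \<zero>\<^bsub>k\<^esub>) \<odot>\<^bsub>T\<^esub> ?B x)"
      unfolding E_def by (rule T.M.finsum_cong') (use gB that B in auto)
    then show ?thesis using T.finsum_smult_delta[OF fin that, of ?B] B by auto
  qed
  have "E (\<beta> v w) = \<beta> v w" if "v \<in> carrier V" "w \<in> carrier W" for v w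
    by (rule bilinear_eq_on_bases[OF V.module_axioms W.module_axioms T.module_axioms b c _ bil _ that,
          of "\<lambda>v w. E (\<beta> v w)"])
      (use EB lin_compose[OF bilinear_lin1[OF bil] E] lin_compose[OF bilinear_lin2[OF bil] E]
        in \<open>auto intro: bilinear_mapsI\<close>)
  then have "E t = t" if "t \<in> carrier T" for t
    using tensor_pairing_eq[OF tp T.module_axioms T.module_axioms E idT _ that] by simp
  then have "dual_basis k T (I \<times> J) ?B g"
    using fin B g gB unfolding dual_basis_def E_def by auto
  then show ?thesis by blast
qed

lemma tensor_extend:
  assumes V: "fd_space k V" and W: "fd_space k W" and T: "vectorspace k T" and Z: "vectorspace k Z"
    and tp: "tensor_pairing k V W T \<beta>" and \<gamma>: "\<gamma> \<in> bilinear_maps k V W Z"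
  shows "\<exists>f\<in>lin k T Z. \<forall>v\<in>carrier V. \<forall>w\<in>carrier W. f (\<beta> v w) = \<gamma> v w"
proof -
  interpret V: vectorspace k V using V by (simp add: fd_space_def)
  interpret W: vectorspace k W using W by (simp add: fd_space_def)
  interpret T: vectorspace k T by fact
  interpret Z: vectorspace k Z by fact
  obtain n :: nat and b d where b: "dual_basis k V {..<n} b d" using fd_space_imp_dual_basis[OF V] .
  obtain m :: nat and c e where c: "dual_basis k W {..<m} c e" using fd_space_imp_dual_basis[OF W] .
  have bil: "\<beta> \<in> bilinear_maps k V W T" using tp by (simp add: tensor_pairing_def)
  obtain g where g: "dual_basis k T ({..<n} \<times> {..<m}) (\<lambda>(i, j). \<beta> (b i) (c j)) g"
    using tensor_basis[OF V.vectorspace_axioms W.vectorspace_axioms T tp b c] by blast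
  obtain f where f: "f \<in> lin k T Z"
    "\<And>i j. i < n \<Longrightarrow> j < m \<Longrightarrow> f (\<beta> (b i) (c j)) = \<gamma> (b i) (c j)"
    using dual_basis_extend[OF T.module_axioms Z.module_axioms g, of "\<lambda>(i, j). \<gamma> (b i) (c j)"]
      bilinear_closed[OF \<gamma>] dual_basisD(2)[OF b] dual_basisD(2)[OF c] by auto
  have "f (\<beta> v w) = \<gamma> v w" if "v \<in> carrier V" "w \<in> carrier W" for v w
    by (rule bilinear_eq_on_bases[OF V.module_axioms W.module_axioms Z.module_axioms b c _ \<gamma> _ that,
          of "\<lambda>v w. f (\<beta> v w)"])
      (use f lin_compose[OF bilinear_lin1[OF bil] f(1)] lin_compose[OF bilinear_lin2[OF bil] f(1)]
        in \<open>auto intro: bilinear_mapsI\<close>)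
  then show ?thesis using f(1) by blast
qed

lemma tensor_pairing_imp_is_tensor_product:
  assumes V: "fd_space k V" and W: "fd_space k W" and T: "vectorspace k T"
    and tp: "tensor_pairing k V W T \<beta>"
  shows "is_tensor_product k V W T \<beta>"
  unfolding is_tensor_product_def
proof (intro conjI allI impI)
  show "\<beta> \<in> bilinear_maps k V W T" using tp by (simp add: tensor_pairing_def)
  fix Z \<gamma> assume Z: "vectorspace k Z \<and> \<gamma> \<in> bilinear_maps k V W Z"
  then obtain f where f: "f \<in> lin k T Z" "\<forall>v\<in>carrier V. \<forall>w\<in>carrier W. f (\<beta> v w) = \<gamma> v w"
    using tensor_extend[OF V W T _ tp] by blast
  have m: "Module.module k T" "Module.module k Z" using T Z by (auto simp: vectorspace_def)
  have "f' t = f t" if "f' \<in> lin k T Z" "\<forall>x\<in>carrier V. \<forall>y\<in>carrier W. f' (\<beta> x y) = \<gamma> x y"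
    "t \<in> carrier T" for f' t
    by (rule tensor_pairing_eq[OF tp m that(1) f(1) _ that(3)]) (use f that in auto)
  then show "\<exists>f\<in>lin k T Z. (\<forall>x\<in>carrier V. \<forall>y\<in>carrier W. f (\<beta> x y) = \<gamma> x y) \<and>
      (\<forall>f'\<in>lin k T Z. (\<forall>x\<in>carrier V. \<forall>y\<in>carrier W. f' (\<beta> x y) = \<gamma> x y) \<longrightarrow>
         (\<forall>t\<in>carrier T. f' t = f t))"
    using f by blast
qed

lemma tensor_pairing_iso:
  assumes T: "Module.module k T" and tp: "tensor_pairing k V W T \<beta>" and f: "lin_iso k T T' f"
    and T': "Module.module k T'"
    and eq: "\<And>v w. v \<in> carrier V \<Longrightarrow> w \<in> carrier W \<Longrightarrow> \<beta>' v w = f (\<beta> v w)"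
    and V: "Module.module k V" and W: "Module.module k W"
  shows "tensor_pairing k V W T' \<beta>'"
  unfolding tensor_pairing_def
proof (intro conjI ballI)
  interpret T': Module.module k T' by fact
  interpret T: Module.module k T by fact
  let ?g = "inv_into (carrier T) f"
  have fl: "f \<in> lin k T T'" and inj: "inj_on f (carrier T)" and im: "f ` carrier T = carrier T'"
    using f by (auto simp: lin_iso_def bij_betw_def)
  have gf: "?g (f x) = x" if "x \<in> carrier T" for x using inj that by (rule inv_into_f_f)
  have bil: "\<beta> \<in> bilinear_maps k V W T" using tp by (simp add: tensor_pairing_def)
  show bil': "\<beta>' \<in> bilinear_maps k V W T'"
  proof (rule bilinear_mapsI)
    show "\<beta>' v \<in> lin k W T'" if "v \<in> carrier V" for v
      by (rule lin_cong[OF W lin_compose[OF bilinear_lin2[OF bil that] fl]]) (use eq that in auto)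
    show "(\<lambda>v. \<beta>' v w) \<in> lin k V T'" if "w \<in> carrier W" for w
      by (rule lin_cong[OF V lin_compose[OF bilinear_lin1[OF bil that] fl]]) (use eq that in auto)
  qed
  let ?S = "{\<beta> v w | v w. v \<in> carrier V \<and> w \<in> carrier W}"
  let ?S' = "{\<beta>' v w | v w. v \<in> carrier V \<and> w \<in> carrier W}"
  have S: "?S \<subseteq> carrier T" and S': "?S' \<subseteq> carrier T'"
    using bilinear_closed[OF bil] bilinear_closed[OF bil'] by auto
  interpret N: LinearCombinations.submodule k "T'.span ?S'" T' by (rule T'.span_is_submodule[OF S'])
  have "f t \<in> T'.span ?S'" if "t \<in> carrier T" for t
  proof -
    have "t \<in> T.span ?S" using that tp by (simp add: tensor_pairing_def)
    then show ?thesis using S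
    proof (induction rule: T.span_induct)
      case (base s)
      then obtain v w where "v \<in> carrier V" "w \<in> carrier W" "f s = \<beta>' v w" using eq by auto
      then have "f s \<in> ?S'" by blast
      then show ?case using T'.in_own_span[OF S'] by blast
    qed (auto simp: lin_zero[OF T T' fl] lin_add[OF fl] lin_smult[OF fl])
  qed
  then have "f ` carrier T \<subseteq> T'.span ?S'" by (rule image_subsetI)
  then show "T'.span ?S' = carrier T'"
    unfolding im by (rule equalityI[OF T'.span_is_subset2[OF S']])
  fix l m assume "l \<in> functionals k V" "m \<in> functionals k W"
  then obtain n where n: "n \<in> functionals k T"
    "\<forall>v\<in>carrier V. \<forall>w\<in>carrier W. n (\<beta> v w) = l v \<otimes>\<^bsub>k\<^esub> m w"
    using tp unfolding tensor_pairing_def by fast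
  have "(\<lambda>x. n (?g x)) \<in> functionals k T'"
    by (rule lin_compose[OF lin_iso_inverse[OF T f] n(1)])
  then show "\<exists>n\<in>functionals k T'. \<forall>v\<in>carrier V. \<forall>w\<in>carrier W. n (\<beta>' v w) = l v \<otimes>\<^bsub>k\<^esub> m w"
    by (rule bexI[rotated]) (use n(2) eq gf bilinear_closed[OF bil] in auto)
qed

text \<open>Coordinate vectors indexed by the pairs \<open>(i, j)\<close>, which are coded as natural numbers.\<close>

lemma tensor_pairing_exists:
  fixes k :: "'k ring"
  assumes V: "fd_space k V" and W: "fd_space k W"
  shows "\<exists>(T :: ('k, nat \<Rightarrow> 'k) module) \<beta>. fd_space k T \<and> tensor_pairing k V W T \<beta>"
proof -
  interpret V: vectorspace k V using V by (simp add: fd_space_def)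
  interpret W: vectorspace k W using W by (simp add: fd_space_def)
  have field: "field k" ..
  obtain n :: nat and b d where b: "dual_basis k V {..<n} b d" using fd_space_imp_dual_basis[OF V] .
  obtain m :: nat and c e where c: "dual_basis k W {..<m} c e" using fd_space_imp_dual_basis[OF W] .
  define S where "S = prod_encode ` ({..<n} \<times> {..<m})"
  have S: "finite S" by (simp add: S_def)
  let ?T = "free_module k S"
  note T = free_module_dual_basis[OF field S]
  interpret T: vectorspace k ?T by (rule T(1))
  define \<beta> where "\<beta> v w = (\<lambda>s. if s \<in> S then d (fst (prod_decode s)) v \<otimes>\<^bsub>k\<^esub> e (snd (prod_decode s)) w else \<zero>\<^bsub>k\<^esub>)" for v w
  have dec: "fst (prod_decode s) < n" "snd (prod_decode s) < m" if "s \<in> S" for s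
    using that by (auto simp: S_def)
  note dl = dual_basisD(4,7,8)[OF b] and el = dual_basisD(4,7,8)[OF c]
  have bcl: "\<beta> v w \<in> carrier ?T" if "v \<in> carrier V" "w \<in> carrier W" for v w
  proof -
    have "finite {s. \<beta> v w s \<noteq> \<zero>\<^bsub>k\<^esub>}" by (rule finite_subset[OF _ S]) (auto simp: \<beta>_def)
    then show ?thesis
      using dec dual_basisD(4)[OF b _ that(1)] dual_basisD(4)[OF c _ that(2)] by (auto simp: \<beta>_def)
  qed
  have bil: "\<beta> \<in> bilinear_maps k V W ?T"
  proof (rule bilinear_mapsI)
    fix v assume v: "v \<in> carrier V"
    show "\<beta> v \<in> lin k W ?T"
      by (rule linI)
        (use bcl v dec dl(1)[OF _ v] el in \<open>auto simp: \<beta>_def fun_eq_iff V.R.r_distr V.R.m_lcomm simp del: V.R.free_module_simps(1)\<close>)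
  next
    fix w assume w: "w \<in> carrier W"
    show "(\<lambda>v. \<beta> v w) \<in> lin k V ?T"
      by (rule linI)
        (use bcl w dec dl el(1)[OF _ w] in \<open>auto simp: \<beta>_def fun_eq_iff V.R.l_distr V.R.m_assoc simp del: V.R.free_module_simps(1)\<close>)
  qed
  have bb: "\<beta> (b i) (c j) = free_gen k (prod_encode (i, j))" if "i < n" "j < m" for i j
    using that dec dual_basisD(5)[OF b, of _ i] dual_basisD(5)[OF c, of _ j]
    by (auto simp: \<beta>_def free_gen_def fun_eq_iff S_def)
  have tp: "tensor_pairing k V W ?T \<beta>" unfolding tensor_pairing_def
  proof (intro conjI ballI)
    show "\<beta> \<in> bilinear_maps k V W ?T" by fact
    let ?B = "{\<beta> v w | v w. v \<in> carrier V \<and> w \<in> carrier W}"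
    have B: "?B \<subseteq> carrier ?T" using bcl by blast
    have "free_gen k ` S \<subseteq> ?B"
    proof
      fix x assume "x \<in> free_gen k ` S"
      then obtain i j where "i < n" "j < m" "x = free_gen k (prod_encode (i, j))" by (auto simp: S_def)
      then show "x \<in> ?B" using bb[of i j] dual_basisD(2)[OF b, of i] dual_basisD(2)[OF c, of j]
        by (auto intro!: exI[of _ "b i"] exI[of _ "c j"])
    qed
    then have "T.span (free_gen k ` S) \<subseteq> T.span ?B" by (rule T.span_is_monotone)
    then show "T.span ?B = carrier ?T"
      using V.R.free_module_generated[of S] T.span_is_subset2[OF B] by blast
  next
    fix l \<mu> assume l: "l \<in> functionals k V" and \<mu>: "\<mu> \<in> functionals k W"
    interpret K: Module.module k "regular_module k" by (rule regular_module) (rule V.R.is_cring)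
    have lm: "(\<lambda>v w. l v \<otimes>\<^bsub>k\<^esub> \<mu> w) \<in> bilinear_maps k V W (regular_module k)"
      by (intro bilinear_mapsI linI)
        (use lin_closed[OF l] lin_closed[OF \<mu>] lin_add[OF l] lin_add[OF \<mu>] lin_smult[OF l] lin_smult[OF \<mu>]
          in \<open>auto simp: V.R.l_distr V.R.r_distr V.R.m_assoc V.R.m_lcomm\<close>)
    obtain \<nu> where \<nu>: "\<nu> \<in> functionals k ?T"
      "\<And>s. s \<in> S \<Longrightarrow> \<nu> (free_gen k s) = l (b (fst (prod_decode s))) \<otimes>\<^bsub>k\<^esub> \<mu> (c (snd (prod_decode s)))"
      using dual_basis_extend[OF T.module_axioms K.module_axioms T(2),
          of "\<lambda>s. l (b (fst (prod_decode s))) \<otimes>\<^bsub>k\<^esub> \<mu> (c (snd (prod_decode s)))"]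
        lin_closed[OF l] lin_closed[OF \<mu>] dual_basisD(2)[OF b] dual_basisD(2)[OF c] dec by auto
    have "\<nu> (\<beta> v w) = l v \<otimes>\<^bsub>k\<^esub> \<mu> w" if "v \<in> carrier V" "w \<in> carrier W" for v w
    proof (rule bilinear_eq_on_bases[OF V.module_axioms W.module_axioms K.module_axioms b c _ lm _ that,
          of "\<lambda>v w. \<nu> (\<beta> v w)"])
      show "(\<lambda>v w. \<nu> (\<beta> v w)) \<in> bilinear_maps k V W (regular_module k)"
        using lin_compose[OF bilinear_lin1[OF bil] \<nu>(1)] lin_compose[OF bilinear_lin2[OF bil] \<nu>(1)]
        by (auto intro: bilinear_mapsI)
      show "\<nu> (\<beta> (b i) (c j)) = l (b i) \<otimes>\<^bsub>k\<^esub> \<mu> (c j)" if "i \<in> {..<n}" "j \<in> {..<m}" for i j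
        using that bb[of i j] \<nu>(2)[of "prod_encode (i, j)"] by (auto simp: S_def)
    qed
    then show "\<exists>n\<in>functionals k ?T. \<forall>v\<in>carrier V. \<forall>w\<in>carrier W. n (\<beta> v w) = l v \<otimes>\<^bsub>k\<^esub> \<mu> w"
      using \<nu>(1) by blast
  qed
  then show ?thesis using dual_basis_imp_fd_space[OF T] by blast
qed

section \<open>Base change\<close>

lemma submodule_minus_closed:
  assumes "LinearCombinations.submodule R N M" "x \<in> N"
  shows "\<ominus>\<^bsub>M\<^esub> x \<in> N"
proof -
  interpret N: LinearCombinations.submodule R N M by fact
  interpret Module.module R M by (rule N.module)
  have x: "x \<in> carrier M" using assms(2) N.subset by (rule subsetD[rotated])
  have "(\<ominus>\<^bsub>R\<^esub> \<one>\<^bsub>R\<^esub>) \<odot>\<^bsub>M\<^esub> x \<in> N" using assms(2) by (intro N.smult_closed) auto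
  then show ?thesis using x by (simp add: smult_l_minus)
qed

lemma submodule_imp_abelian_subgroup:
  assumes "LinearCombinations.submodule R N M"
  shows "abelian_subgroup N M"
proof -
  interpret N: LinearCombinations.submodule R N M by fact
  interpret Module.module R M by (rule N.module)
  have "subgroup N (add_monoid M)"
  proof (rule M.add.subgroupI)
    show "N \<noteq> {}" using N.zero_closed by blast
  qed (use N.subset N.m_closed submodule_minus_closed[OF assms] in auto)
  then show ?thesis
    by (intro abelian_subgroupI3 additive_subgroup.intro M.abelian_group_axioms)
qed

lemma a_coset_eq:
  assumes "LinearCombinations.submodule R N M" "x \<in> carrier M" "y \<in> carrier M" "x \<ominus>\<^bsub>M\<^esub> y \<in> N"
  shows "N +>\<^bsub>M\<^esub> x = N +>\<^bsub>M\<^esub> y"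
proof -
  interpret N: abelian_subgroup N M by (rule submodule_imp_abelian_subgroup[OF assms(1)])
  have "x = (x \<ominus>\<^bsub>M\<^esub> y) \<oplus>\<^bsub>M\<^esub> y"
    using assms(2,3) by (simp add: a_minus_def N.a_assoc N.l_neg)
  then have "x \<in> N +>\<^bsub>M\<^esub> y" using assms(4) by (auto simp: a_r_coset_def' intro!: bexI)
  then show ?thesis using N.a_repr_independence[OF _ assms(3) N.a_subgroup] by simp
qed

lemma a_coset_decomp:
  assumes "LinearCombinations.submodule R N M" "x \<in> carrier M" "N +>\<^bsub>M\<^esub> x = N +>\<^bsub>M\<^esub> y"
  shows "\<exists>n\<in>N. x = n \<oplus>\<^bsub>M\<^esub> y"
proof -
  interpret N: abelian_subgroup N M by (rule submodule_imp_abelian_subgroup[OF assms(1)])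
  have "x \<in> N +>\<^bsub>M\<^esub> x" by (rule N.a_rcos_self[OF assms(2)])
  then show ?thesis using assms(3) by (auto simp: a_r_coset_def')
qed

lemma quotient_module:
  assumes N: "LinearCombinations.submodule R N M"
  shows "Module.module R (quotient_module M N)" "(\<lambda>x. N +>\<^bsub>M\<^esub> x) \<in> lin R M (quotient_module M N)"
    "carrier (quotient_module M N) = (\<lambda>x. N +>\<^bsub>M\<^esub> x) ` carrier M"
proof -
  interpret S: LinearCombinations.submodule R N M by fact
  interpret Module.module R M by (rule S.module)
  interpret N: abelian_subgroup N M by (rule submodule_imp_abelian_subgroup[OF N])
  show c: "carrier (quotient_module M N) = (\<lambda>x. N +>\<^bsub>M\<^esub> x) ` carrier M"
    by (auto simp: quotient_module_def A_RCOSETS_def')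
  have z: "\<zero>\<^bsub>quotient_module M N\<^esub> = N +>\<^bsub>M\<^esub> \<zero>\<^bsub>M\<^esub>"
    using S.subset by (simp add: quotient_module_def M.a_coset_add_zero)
  have a: "(N +>\<^bsub>M\<^esub> x) \<oplus>\<^bsub>quotient_module M N\<^esub> (N +>\<^bsub>M\<^esub> y) = N +>\<^bsub>M\<^esub> (x \<oplus>\<^bsub>M\<^esub> y)"
    if "x \<in> carrier M" "y \<in> carrier M" for x y
    using that by (simp add: quotient_module_def N.a_rcos_sum)
  have s: "r \<odot>\<^bsub>quotient_module M N\<^esub> (N +>\<^bsub>M\<^esub> x) = N +>\<^bsub>M\<^esub> (r \<odot>\<^bsub>M\<^esub> x)"
    if r: "r \<in> carrier R" and x: "x \<in> carrier M" for r x
  proof -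
    have "N +>\<^bsub>M\<^esub> (r \<odot>\<^bsub>M\<^esub> y) = N +>\<^bsub>M\<^esub> (r \<odot>\<^bsub>M\<^esub> x)" if y: "y \<in> N +>\<^bsub>M\<^esub> x" for y
    proof -
      obtain n where n: "n \<in> N" "y = n \<oplus>\<^bsub>M\<^esub> x" using y by (auto simp: a_r_coset_def')
      have nM: "n \<in> carrier M" using n S.subset by auto
      have "r \<odot>\<^bsub>M\<^esub> y \<ominus>\<^bsub>M\<^esub> r \<odot>\<^bsub>M\<^esub> x = r \<odot>\<^bsub>M\<^esub> n"
        using n nM r x by (simp add: smult_r_distr a_minus_def M.a_assoc M.r_neg)
      then show ?thesis using n nM r x by (intro a_coset_eq[OF N]) auto
    qed
    then have "(\<Union>y\<in>N +>\<^bsub>M\<^esub> x. N +>\<^bsub>M\<^esub> (r \<odot>\<^bsub>M\<^esub> y)) = N +>\<^bsub>M\<^esub> (r \<odot>\<^bsub>M\<^esub> x)"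
      using N.a_rcos_self[OF x] by blast
    then show ?thesis by (simp add: quotient_module_def)
  qed
  show "Module.module R (quotient_module M N)" "(\<lambda>x. N +>\<^bsub>M\<^esub> x) \<in> lin R M (quotient_module M N)"
    using module_image[OF module_axioms c z a s] by auto
qed

lemma quotient_extend:
  assumes N: "LinearCombinations.submodule R N M" and P: "Module.module R P"
    and H: "H \<in> lin R M P" and kill: "\<And>n. n \<in> N \<Longrightarrow> H n = \<zero>\<^bsub>P\<^esub>"
  shows "\<exists>H'\<in>lin R (quotient_module M N) P. \<forall>x\<in>carrier M. H' (N +>\<^bsub>M\<^esub> x) = H x"
proof -
  interpret S: LinearCombinations.submodule R N M by fact
  interpret Module.module R M by (rule S.module)
  interpret P: Module.module R P by fact
  note q = quotient_module[OF N]
  let ?q = "\<lambda>x. N +>\<^bsub>M\<^esub> x"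
  define H' where "H' C = H (SOME x. x \<in> carrier M \<and> C = ?q x)" for C
  have H': "H' (?q x) = H x" if x: "x \<in> carrier M" for x
  proof -
    let ?y = "SOME y. y \<in> carrier M \<and> ?q x = ?q y"
    have y: "?y \<in> carrier M \<and> ?q x = ?q ?y" by (rule someI[of _ x]) (use x in simp)
    then obtain n where n: "n \<in> N" "x = n \<oplus>\<^bsub>M\<^esub> ?y" using a_coset_decomp[OF N x, of ?y] by blast
    have "H x = H n \<oplus>\<^bsub>P\<^esub> H ?y"
      by (subst n(2), rule lin_add[OF H]) (use n y S.subset in auto)
    then show ?thesis using kill n lin_closed[OF H] y by (simp add: H'_def)
  qed
  have "H' \<in> lin R (quotient_module M N) P"
  proof (rule linI)
    fix C assume "C \<in> carrier (quotient_module M N)"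
    then obtain x where x: "x \<in> carrier M" "C = ?q x" using q(3) by auto
    then show "H' C \<in> carrier P" using H' lin_closed[OF H] by simp
    show "H' (r \<odot>\<^bsub>quotient_module M N\<^esub> C) = r \<odot>\<^bsub>P\<^esub> H' C" if "r \<in> carrier R" for r
      using that x H' lin_smult[OF H] lin_smult[OF q(2), symmetric] by simp
    fix D assume "D \<in> carrier (quotient_module M N)"
    then obtain y where y: "y \<in> carrier M" "D = ?q y" using q(3) by auto
    show "H' (C \<oplus>\<^bsub>quotient_module M N\<^esub> D) = H' C \<oplus>\<^bsub>P\<^esub> H' D"
      using x y H' lin_add[OF H] lin_add[OF q(2), symmetric] by simp
  qed
  then show ?thesis using H' by blast
qed

definition restrict_scalars ::
  "('k, 'a) module \<Rightarrow> ('a, 'b) module \<Rightarrow> ('k, 'b) module"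
where
  "restrict_scalars A P = \<lparr>carrier = carrier P, monoid.mult = undefined, one = undefined, zero = \<zero>\<^bsub>P\<^esub>,
     add = add P, smult = (\<lambda>c x. (c \<odot>\<^bsub>A\<^esub> \<one>\<^bsub>A\<^esub>) \<odot>\<^bsub>P\<^esub> x)\<rparr>"

lemma restrict_scalars_simps[simp]:
  "carrier (restrict_scalars A P) = carrier P" "\<zero>\<^bsub>restrict_scalars A P\<^esub> = \<zero>\<^bsub>P\<^esub>"
  "x \<oplus>\<^bsub>restrict_scalars A P\<^esub> y = x \<oplus>\<^bsub>P\<^esub> y"
  "c \<odot>\<^bsub>restrict_scalars A P\<^esub> x = (c \<odot>\<^bsub>A\<^esub> \<one>\<^bsub>A\<^esub>) \<odot>\<^bsub>P\<^esub> x"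
  by (simp_all add: restrict_scalars_def)

locale k_algebra =
  fixes k :: "'k ring" and A :: "('k, 'a) module"
  assumes algebra: "algebra k A"
begin

sublocale R: cring k using algebra by (simp add: algebra_def Module.module_def)
sublocale A: cring A using algebra by (simp add: algebra_def)
sublocale Alg: Module.module k A using algebra by (simp add: algebra_def)

lemma smult_assoc2:
  "c \<in> carrier k \<Longrightarrow> x \<in> carrier A \<Longrightarrow> y \<in> carrier A \<Longrightarrow> (c \<odot>\<^bsub>A\<^esub> x) \<otimes>\<^bsub>A\<^esub> y = c \<odot>\<^bsub>A\<^esub> (x \<otimes>\<^bsub>A\<^esub> y)"
  using algebra by (simp add: algebra_def algebra_axioms_def)

definition unit_map :: "'k \<Rightarrow> 'a" where "unit_map c = c \<odot>\<^bsub>A\<^esub> \<one>\<^bsub>A\<^esub>"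

lemma unit_map_closed[simp]: "c \<in> carrier k \<Longrightarrow> unit_map c \<in> carrier A"
  and unit_map_add: "c \<in> carrier k \<Longrightarrow> d \<in> carrier k \<Longrightarrow> unit_map (c \<oplus>\<^bsub>k\<^esub> d) = unit_map c \<oplus>\<^bsub>A\<^esub> unit_map d"
  and unit_map_one[simp]: "unit_map \<one>\<^bsub>k\<^esub> = \<one>\<^bsub>A\<^esub>"
  and unit_map_zero[simp]: "unit_map \<zero>\<^bsub>k\<^esub> = \<zero>\<^bsub>A\<^esub>"
  by (auto simp: unit_map_def Alg.smult_l_distr)

lemma unit_map_mult:
  "c \<in> carrier k \<Longrightarrow> d \<in> carrier k \<Longrightarrow> unit_map (c \<otimes>\<^bsub>k\<^esub> d) = unit_map c \<otimes>\<^bsub>A\<^esub> unit_map d"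
  using smult_assoc2[of c "\<one>\<^bsub>A\<^esub>" "unit_map d"] by (simp add: unit_map_def Alg.smult_assoc1)

lemma unit_map_pow: "c \<in> carrier k \<Longrightarrow> unit_map (c [^]\<^bsub>k\<^esub> (n::nat)) = unit_map c [^]\<^bsub>A\<^esub> n"
  by (induction n) (simp_all add: unit_map_mult)

lemma restrict_scalars:
  assumes "Module.module A P"
  shows "Module.module k (restrict_scalars A P)"
proof -
  interpret P: Module.module A P by fact
  show ?thesis
  proof (rule module_by)
    show "\<exists>neg_v\<in>carrier (restrict_scalars A P). v \<oplus>\<^bsub>restrict_scalars A P\<^esub> neg_v = \<zero>\<^bsub>restrict_scalars A P\<^esub>"
      if "v \<in> carrier (restrict_scalars A P)" for v
      using that P.M.r_neg by (intro bexI[of _ "\<ominus>\<^bsub>P\<^esub> v"]) auto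
  qed (simp_all add: R.is_cring P.M.a_ac P.smult_r_distr P.smult_l_distr P.smult_assoc1
        unit_map_mult unit_map_add flip: unit_map_def)
qed

abbreviation FA where "FA V \<equiv> free_module A (carrier V)"

definition bc_rels :: "('k, 'v) module \<Rightarrow> ('v \<Rightarrow> 'a) set" where
  "bc_rels V = {free_gen A (v \<oplus>\<^bsub>V\<^esub> w) \<ominus>\<^bsub>FA V\<^esub> (free_gen A v \<oplus>\<^bsub>FA V\<^esub> free_gen A w)
          | v w. v \<in> carrier V \<and> w \<in> carrier V} \<union>
       {free_gen A (c \<odot>\<^bsub>V\<^esub> v) \<ominus>\<^bsub>FA V\<^esub> ((c \<odot>\<^bsub>A\<^esub> \<one>\<^bsub>A\<^esub>) \<odot>\<^bsub>FA V\<^esub> free_gen A v)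
          | c v. c \<in> carrier k \<and> v \<in> carrier V}"

abbreviation bc where "bc V \<equiv> base_change k A V"
abbreviation be where "be V v \<equiv> base_elt k A V v"

lemma bc_rel_add:
  "v \<in> carrier V \<Longrightarrow> w \<in> carrier V \<Longrightarrow>
    free_gen A (v \<oplus>\<^bsub>V\<^esub> w) \<ominus>\<^bsub>FA V\<^esub> (free_gen A v \<oplus>\<^bsub>FA V\<^esub> free_gen A w) \<in> bc_rels V"
  unfolding bc_rels_def by blast

lemma bc_rel_smult:
  "c \<in> carrier k \<Longrightarrow> v \<in> carrier V \<Longrightarrow>
    free_gen A (c \<odot>\<^bsub>V\<^esub> v) \<ominus>\<^bsub>FA V\<^esub> ((c \<odot>\<^bsub>A\<^esub> \<one>\<^bsub>A\<^esub>) \<odot>\<^bsub>FA V\<^esub> free_gen A v) \<in> bc_rels V"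
  unfolding bc_rels_def by blast

lemma base_change_relations_eq:
  "base_change_relations k A V = LinearCombinations.module.span A (FA V) (bc_rels V)"
  by (simp add: base_change_relations_def bc_rels_def Let_def)

context
  fixes V :: "('k, 'v) module"
  assumes V: "Module.module k V"
begin

interpretation V: Module.module k V by (rule V)
interpretation FV: Module.module A "FA V" by (rule A.free_module)

lemma gen_closed: "v \<in> carrier V \<Longrightarrow> free_gen A v \<in> carrier (FA V)"
  by (rule A.free_gen_closed)

lemma bc_rels_closed: "bc_rels V \<subseteq> carrier (FA V)"
  unfolding bc_rels_def
  by (auto simp del: A.free_module_simps
      intro!: FV.M.minus_closed FV.M.a_closed FV.smult_closed gen_closed)

lemma bc_submodule: "LinearCombinations.submodule A (base_change_relations k A V) (FA V)"
  unfolding base_change_relations_eq by (rule FV.span_is_submodule[OF bc_rels_closed])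

lemma bc_rels_in: "x \<in> bc_rels V \<Longrightarrow> x \<in> base_change_relations k A V"
  unfolding base_change_relations_eq using FV.in_own_span[OF bc_rels_closed] by blast

lemma bc_module: "Module.module A (bc V)"
  unfolding base_change_def by (rule quotient_module(1)[OF bc_submodule])

interpretation Q: Module.module A "bc V" by (rule bc_module)

lemma bc_proj_lin: "(\<lambda>x. base_change_relations k A V +>\<^bsub>FA V\<^esub> x) \<in> lin A (FA V) (bc V)"
  unfolding base_change_def by (rule quotient_module(2)[OF bc_submodule])

lemma be_closed: "v \<in> carrier V \<Longrightarrow> be V v \<in> carrier (bc V)"
  unfolding base_elt_def by (rule lin_closed[OF bc_proj_lin gen_closed])

lemma be_lin: "be V \<in> lin k V (restrict_scalars A (bc V))"
proof (rule linI)
  fix x assume x: "x \<in> carrier V"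
  show "be V x \<in> carrier (restrict_scalars A (bc V))" using be_closed[OF x] by simp
  fix y assume y: "y \<in> carrier V"
  have "be V (x \<oplus>\<^bsub>V\<^esub> y) = base_change_relations k A V +>\<^bsub>FA V\<^esub> (free_gen A x \<oplus>\<^bsub>FA V\<^esub> free_gen A y)"
    unfolding base_elt_def
    by (rule a_coset_eq[OF bc_submodule])
      (use x y in \<open>auto simp del: A.free_module_simps intro!: gen_closed FV.M.a_closed bc_rels_in bc_rel_add\<close>)
  then show "be V (x \<oplus>\<^bsub>V\<^esub> y) = be V x \<oplus>\<^bsub>restrict_scalars A (bc V)\<^esub> be V y"
    using lin_add[OF bc_proj_lin gen_closed gen_closed] x y by (simp add: base_elt_def)
next
  fix c x assume x: "x \<in> carrier V" and c: "c \<in> carrier k"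
  have c1: "c \<odot>\<^bsub>A\<^esub> \<one>\<^bsub>A\<^esub> \<in> carrier A" using c by simp
  have "be V (c \<odot>\<^bsub>V\<^esub> x) = base_change_relations k A V +>\<^bsub>FA V\<^esub> ((c \<odot>\<^bsub>A\<^esub> \<one>\<^bsub>A\<^esub>) \<odot>\<^bsub>FA V\<^esub> free_gen A x)"
    unfolding base_elt_def
    by (rule a_coset_eq[OF bc_submodule])
      (use x c c1 in \<open>auto simp del: A.free_module_simps intro!: gen_closed FV.smult_closed bc_rels_in bc_rel_smult\<close>)
  then show "be V (c \<odot>\<^bsub>V\<^esub> x) = c \<odot>\<^bsub>restrict_scalars A (bc V)\<^esub> be V x"
    using lin_smult[OF bc_proj_lin c1 gen_closed] x by (simp add: base_elt_def)
qed

text \<open>The universal property of \<open>V \<otimes> A\<close>; all maps on base changes are obtained from it.\<close>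

lemma bc_extend:
  assumes P: "Module.module A P" and h: "h \<in> lin k V (restrict_scalars A P)"
  shows "\<exists>H\<in>lin A (bc V) P. \<forall>v\<in>carrier V. H (be V v) = h v"
proof -
  interpret P: Module.module A P by fact
  have hc: "h v \<in> carrier P" if "v \<in> carrier V" for v using lin_closed[OF h that] by simp
  obtain H where H: "H \<in> lin A (FA V) P" "\<And>v. v \<in> carrier V \<Longrightarrow> H (free_gen A v) = h v"
    using A.free_module_extend[OF P, of "carrier V" h] hc by blast
  interpret H: mod_hom A "FA V" P H
    by (simp add: mod_hom_def mod_hom_axioms_def H(1) A.free_module P)
  have rel: "H n = \<zero>\<^bsub>P\<^esub>" if "n \<in> bc_rels V" for n
    using that unfolding bc_rels_def
  proof (elim UnE CollectE exE conjE)
    fix v w assume n: "n = free_gen A (v \<oplus>\<^bsub>V\<^esub> w) \<ominus>\<^bsub>FA V\<^esub> (free_gen A v \<oplus>\<^bsub>FA V\<^esub> free_gen A w)"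
      and vw: "v \<in> carrier V" "w \<in> carrier V"
    have "H n = H (free_gen A (v \<oplus>\<^bsub>V\<^esub> w)) \<ominus>\<^bsub>P\<^esub> (H (free_gen A v) \<oplus>\<^bsub>P\<^esub> H (free_gen A w))"
      unfolding n using vw gen_closed
      by (simp del: A.free_module_simps add: H.f_minus H.f_add)
    then show ?thesis using vw H(2) hc lin_add[OF h] by (simp add: a_minus_def P.M.r_neg)
  next
    fix c v assume n: "n = free_gen A (c \<odot>\<^bsub>V\<^esub> v) \<ominus>\<^bsub>FA V\<^esub> ((c \<odot>\<^bsub>A\<^esub> \<one>\<^bsub>A\<^esub>) \<odot>\<^bsub>FA V\<^esub> free_gen A v)"
      and cv: "c \<in> carrier k" "v \<in> carrier V"
    have "H n = H (free_gen A (c \<odot>\<^bsub>V\<^esub> v)) \<ominus>\<^bsub>P\<^esub> (c \<odot>\<^bsub>A\<^esub> \<one>\<^bsub>A\<^esub>) \<odot>\<^bsub>P\<^esub> H (free_gen A v)"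
      unfolding n using cv gen_closed
      by (simp del: A.free_module_simps add: H.f_minus H.f_smult)
    then show ?thesis using cv H(2) hc lin_smult[OF h] by (simp add: a_minus_def P.M.r_neg)
  qed
  have "H n = \<zero>\<^bsub>P\<^esub>" if "n \<in> base_change_relations k A V" for n
    using that bc_rels_closed unfolding base_change_relations_eq
    by (induction rule: FV.span_induct)
      (use rel in \<open>simp_all del: A.free_module_simps add: H.f_add H.f_smult\<close>)
  then obtain H' where "H' \<in> lin A (bc V) P"
    "\<forall>x\<in>carrier (FA V). H' (base_change_relations k A V +>\<^bsub>FA V\<^esub> x) = H x"
    using quotient_extend[OF bc_submodule P H(1)] unfolding base_change_def by blast
  then show ?thesis using H(2) gen_closed unfolding base_elt_def by (intro bexI[of _ H']) auto
qed

lemma bc_generated: "x \<in> carrier (bc V) \<Longrightarrow> x \<in> Q.span (be V ` carrier V)"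
proof -
  assume "x \<in> carrier (bc V)"
  then obtain f where f: "f \<in> carrier (FA V)"
    "x = base_change_relations k A V +>\<^bsub>FA V\<^esub> f"
    using quotient_module(3)[OF bc_submodule] unfolding base_change_def by blast
  have sub: "be V ` carrier V \<subseteq> carrier (bc V)" using be_closed by blast
  interpret N: LinearCombinations.submodule A "Q.span (be V ` carrier V)" "bc V"
    by (rule Q.span_is_submodule[OF sub])
  have own: "be V ` carrier V \<subseteq> Q.span (be V ` carrier V)" by (rule Q.in_own_span[OF sub])
  let ?q = "\<lambda>x. base_change_relations k A V +>\<^bsub>FA V\<^esub> x"
  have gsub: "free_gen A ` carrier V \<subseteq> carrier (FA V)" using gen_closed by blast
  have "f \<in> FV.span (free_gen A ` carrier V)" using A.free_module_generated f(1) by blast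
  then have "?q f \<in> Q.span (be V ` carrier V)" using gsub
  proof (induction rule: FV.span_induct)
    case zero
    show ?case using lin_zero[OF FV.module_axioms bc_module bc_proj_lin] N.zero_closed by simp
  next
    case (base s)
    then show ?case using own by (auto simp: base_elt_def)
  next
    case (add x y)
    then show ?case using lin_add[OF bc_proj_lin, of x y] N.m_closed by (simp del: A.free_module_simps)
  next
    case (smult r x)
    then show ?case using lin_smult[OF bc_proj_lin, of r x] N.smult_closed by (simp del: A.free_module_simps)
  qed
  then show ?thesis using f by simp
qed

lemma bc_induct [consumes 1, case_names zero base add smult]:
  assumes "x \<in> carrier (bc V)" "P \<zero>\<^bsub>bc V\<^esub>" "\<And>v. v \<in> carrier V \<Longrightarrow> P (be V v)"
    and "\<And>x y. x \<in> carrier (bc V) \<Longrightarrow> y \<in> carrier (bc V) \<Longrightarrow> P x \<Longrightarrow> P y \<Longrightarrow> P (x \<oplus>\<^bsub>bc V\<^esub> y)"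
    and "\<And>r x. r \<in> carrier A \<Longrightarrow> x \<in> carrier (bc V) \<Longrightarrow> P x \<Longrightarrow> P (r \<odot>\<^bsub>bc V\<^esub> x)"
  shows "P x"
proof -
  have "be V ` carrier V \<subseteq> carrier (bc V)" using be_closed by blast
  from bc_generated[OF assms(1)] this show ?thesis
    by (induction rule: Q.span_induct) (use assms in auto)
qed

lemma bc_lin_eq:
  assumes "Module.module A P" "f \<in> lin A (bc V) P" "g \<in> lin A (bc V) P"
    and "\<And>v. v \<in> carrier V \<Longrightarrow> f (be V v) = g (be V v)" "x \<in> carrier (bc V)"
  shows "f x = g x"
  using assms(5)
  by (induction rule: bc_induct)
    (use assms in \<open>auto simp: lin_zero[OF bc_module] lin_add lin_smult\<close>)

end

lemma lin_restrict: "f \<in> lin A M N \<Longrightarrow> f \<in> lin k (restrict_scalars A M) (restrict_scalars A N)"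
  by (rule linI) (auto simp: lin_closed lin_add lin_smult)

lemma bc_map:
  assumes V: "Module.module k V" and W: "Module.module k W" and f: "f \<in> lin k V W"
  shows "\<exists>g\<in>lin A (bc V) (bc W). \<forall>v\<in>carrier V. g (be V v) = be W (f v)"
  using bc_extend[OF V bc_module[OF W] lin_compose[OF f be_lin[OF W]]] .

lemma bc_functional:
  assumes V: "Module.module k V" and l: "l \<in> functionals k V"
  shows "\<exists>L\<in>lin A (bc V) (self_module A). \<forall>v\<in>carrier V. L (be V v) = unit_map (l v)"
proof -
  have "(\<lambda>v. unit_map (l v)) \<in> lin k V (restrict_scalars A (self_module A))"
    by (rule linI)
      (use lin_closed[OF l] lin_add[OF l] lin_smult[OF l] in \<open>auto simp: unit_map_add unit_map_mult simp flip: unit_map_def\<close>)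
  then show ?thesis by (rule bc_extend[OF V A.self_module])
qed

lemma lin_pointwise_add:
  assumes "Module.module A M" "Module.module A P" "f \<in> lin A M P" "g \<in> lin A M P"
  shows "(\<lambda>x. f x \<oplus>\<^bsub>P\<^esub> g x) \<in> lin A M P"
proof -
  interpret P: Module.module A P by fact
  show ?thesis
    by (rule linI)
      (use lin_closed[OF assms(3)] lin_closed[OF assms(4)] in
        \<open>auto simp: lin_add[OF assms(3)] lin_add[OF assms(4)] lin_smult[OF assms(3)] lin_smult[OF assms(4)] P.M.a_ac P.smult_r_distr\<close>)
qed

lemma lin_pointwise_smult:
  assumes "Module.module A M" "Module.module A P" "f \<in> lin A M P" "r \<in> carrier A"
  shows "(\<lambda>x. r \<odot>\<^bsub>P\<^esub> f x) \<in> lin A M P"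
proof -
  interpret P: Module.module A P by fact
  have "r \<odot>\<^bsub>P\<^esub> (s \<odot>\<^bsub>P\<^esub> x) = s \<odot>\<^bsub>P\<^esub> (r \<odot>\<^bsub>P\<^esub> x)" if "s \<in> carrier A" "x \<in> carrier P" for s x
    using that assms(4) P.smult_assoc1[of r s x] P.smult_assoc1[of s r x] by (simp add: A.m_comm)
  then show ?thesis
    by (intro linI)
      (use assms(4) lin_closed[OF assms(3)] in \<open>auto simp: lin_add[OF assms(3)] lin_smult[OF assms(3)] P.smult_r_distr\<close>)
qed

text \<open>For fixed \<open>v\<close> the map \<open>w \<otimes> 1 \<mapsto> \<beta> v w \<otimes> 1\<close> extends to \<open>W \<otimes> A\<close>. The extension is \<open>k\<close>-linear in \<open>v\<close>, because
  this holds on the generators \<open>w \<otimes> 1\<close>, and so it extends once more to \<open>V \<otimes> A\<close>.\<close>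

lemma bc_bilinear:
  assumes V: "Module.module k V" and W: "Module.module k W" and T: "Module.module k T"
    and \<beta>: "\<beta> \<in> bilinear_maps k V W T"
  shows "\<exists>B\<in>bilinear_maps A (bc V) (bc W) (bc T).
           \<forall>v\<in>carrier V. \<forall>w\<in>carrier W. B (be V v) (be W w) = be T (\<beta> v w)"
proof -
  interpret V: Module.module k V by fact
  interpret TA: Module.module A "bc T" by (rule bc_module[OF T])
  note mods = bc_module[OF W] bc_module[OF T]
  have "\<exists>b\<in>lin A (bc W) (bc T). \<forall>w\<in>carrier W. b (be W w) = be T (\<beta> v w)" if "v \<in> carrier V" for v
    by (rule bc_map[OF W T bilinear_lin2[OF \<beta> that]])
  then obtain b where b: "\<And>v. v \<in> carrier V \<Longrightarrow> b v \<in> lin A (bc W) (bc T)"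
    and bw: "\<And>v w. v \<in> carrier V \<Longrightarrow> w \<in> carrier W \<Longrightarrow> b v (be W w) = be T (\<beta> v w)"
    by metis
  have h: "(\<lambda>v. b v y) \<in> lin k V (restrict_scalars A (bc T))" if y: "y \<in> carrier (bc W)" for y
  proof (rule linI)
    fix v v' assume v: "v \<in> carrier V" "v' \<in> carrier V"
    show "b v y \<in> carrier (restrict_scalars A (bc T))" using lin_closed[OF b[OF v(1)] y] by simp
    have "b (v \<oplus>\<^bsub>V\<^esub> v') y = b v y \<oplus>\<^bsub>bc T\<^esub> b v' y"
      by (rule bc_lin_eq[OF W mods(2) _ lin_pointwise_add[OF mods b b] _ y])
        (use v b bw lin_add[OF be_lin[OF T]] lin_add[OF bilinear_lin1[OF \<beta>]] bilinear_closed[OF \<beta>] in auto)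
    then show "b (v \<oplus>\<^bsub>V\<^esub> v') y = b v y \<oplus>\<^bsub>restrict_scalars A (bc T)\<^esub> b v' y" by simp
  next
    fix c v assume v: "v \<in> carrier V" and c: "c \<in> carrier k"
    have "b (c \<odot>\<^bsub>V\<^esub> v) y = (c \<odot>\<^bsub>A\<^esub> \<one>\<^bsub>A\<^esub>) \<odot>\<^bsub>bc T\<^esub> b v y"
      by (rule bc_lin_eq[OF W mods(2) _ lin_pointwise_smult[OF mods b] _ y])
        (use v c b bw lin_smult[OF be_lin[OF T]] lin_smult[OF bilinear_lin1[OF \<beta>]] bilinear_closed[OF \<beta>] in auto)
    then show "b (c \<odot>\<^bsub>V\<^esub> v) y = c \<odot>\<^bsub>restrict_scalars A (bc T)\<^esub> b v y" by simp
  qed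
  have "\<exists>H\<in>lin A (bc V) (bc T). \<forall>v\<in>carrier V. H (be V v) = b v y" if "y \<in> carrier (bc W)" for y
    by (rule bc_extend[OF V mods(2) h[OF that]])
  then obtain H where H: "\<And>y. y \<in> carrier (bc W) \<Longrightarrow> H y \<in> lin A (bc V) (bc T)"
    and Hv: "\<And>y v. y \<in> carrier (bc W) \<Longrightarrow> v \<in> carrier V \<Longrightarrow> H y (be V v) = b v y"
    by metis
  interpret WA: Module.module A "bc W" by (rule bc_module[OF W])
  have "(\<lambda>x y. H y x) \<in> bilinear_maps A (bc V) (bc W) (bc T)"
  proof (rule bilinear_mapsI)
    fix x assume x: "x \<in> carrier (bc V)"
    show "(\<lambda>y. H y x) \<in> lin A (bc W) (bc T)"
    proof (rule linI)
      fix y y' assume y: "y \<in> carrier (bc W)" "y' \<in> carrier (bc W)"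
      show "H y x \<in> carrier (bc T)" by (rule lin_closed[OF H[OF y(1)] x])
      show "H (y \<oplus>\<^bsub>bc W\<^esub> y') x = H y x \<oplus>\<^bsub>bc T\<^esub> H y' x"
        by (rule bc_lin_eq[OF V mods(2) _ lin_pointwise_add[OF bc_module[OF V] mods(2) H H] _ x])
          (use y H Hv lin_add[OF b] in auto)
    next
      fix r y assume y: "y \<in> carrier (bc W)" and r: "r \<in> carrier A"
      show "H (r \<odot>\<^bsub>bc W\<^esub> y) x = r \<odot>\<^bsub>bc T\<^esub> H y x"
        by (rule bc_lin_eq[OF V mods(2) _ lin_pointwise_smult[OF bc_module[OF V] mods(2) H] _ x])
          (use y r H Hv lin_smult[OF b] in auto)
    qed
  qed (use H in auto)
  then show ?thesis
    by (rule bexI[rotated]) (use Hv bw be_closed[OF W] in auto)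
qed

text \<open>Functionals of a finite-dimensional space still separate points after base change, since the
  coordinate functionals extend to coordinates on \<open>V \<otimes> A\<close>.\<close>

lemma bc_separate:
  assumes fd: "fd_space k V" and x: "x \<in> carrier (bc V)" and y: "y \<in> carrier (bc V)"
    and eq: "\<And>l L. l \<in> functionals k V \<Longrightarrow> L \<in> lin A (bc V) (self_module A) \<Longrightarrow>
        (\<forall>v\<in>carrier V. L (be V v) = unit_map (l v)) \<Longrightarrow> L x = L y"
  shows "x = y"
proof -
  interpret V: vectorspace k V using fd by (simp add: fd_space_def)
  have V: "Module.module k V" ..
  interpret VA: Module.module A "bc V" by (rule bc_module[OF V])
  obtain n :: nat and b d where db: "dual_basis k V {..<n} b d" using fd_space_imp_dual_basis[OF fd] .
  have "\<forall>i\<in>{..<n}. \<exists>L. L \<in> lin A (bc V) (self_module A) \<and> (\<forall>v\<in>carrier V. L (be V v) = unit_map (d i v))"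
    using bc_functional[OF V dual_basisD(3)[OF db]] by blast
  then obtain D where D: "\<And>i. i < n \<Longrightarrow> D i \<in> lin A (bc V) (self_module A)"
    "\<And>i v. i < n \<Longrightarrow> v \<in> carrier V \<Longrightarrow> D i (be V v) = unit_map (d i v)"
    by (metis lessThan_iff)
  define E where "E x = (\<Oplus>\<^bsub>bc V\<^esub>i\<in>{..<n}. D i x \<odot>\<^bsub>bc V\<^esub> be V (b i))" for x
  have cl: "be V (b i) \<in> carrier (bc V)" if "i < n" for i
    using be_closed[OF V dual_basisD(2)[OF db]] that by simp
  have El: "E \<in> lin A (bc V) (bc V)" unfolding E_def
    by (rule VA.lin_finsum_coeffs[OF VA.module_axioms])
      (use D(1) cl lin_closed[of _ A "bc V" "self_module A"] lin_add[of _ A "bc V" "self_module A"]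
         lin_smult[of _ A "bc V" "self_module A"] in auto)
  have idl: "(\<lambda>x. x) \<in> lin A (bc V) (bc V)" by (rule linI) auto
  have Eb: "E (be V (b j)) = be V (b j)" if "j < n" for j
  proof -
    have "E (be V (b j)) = (\<Oplus>\<^bsub>bc V\<^esub>i\<in>{..<n}. (if i = j then \<one>\<^bsub>A\<^esub> else \<zero>\<^bsub>A\<^esub>) \<odot>\<^bsub>bc V\<^esub> be V (b i))"
      unfolding E_def
      by (rule VA.M.finsum_cong') (use that D(2) dual_basisD(2,5)[OF db] cl in auto)
    then show ?thesis using VA.finsum_smult_delta[of "{..<n}" j "\<lambda>i. be V (b i)"] cl that by auto
  qed
  have Ebe: "E (be V v) = be V v" if "v \<in> carrier V" for v
    by (rule lin_eq_on_basis[OF V restrict_scalars[OF bc_module[OF V]] db _ be_lin[OF V] _ that,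
          of "\<lambda>v. E (be V v)"])
      (use lin_compose[OF be_lin[OF V] lin_restrict[OF El]] Eb in auto)
  have E: "E z = z" if "z \<in> carrier (bc V)" for z
    by (rule bc_lin_eq[OF V bc_module[OF V] El idl Ebe that])
  have "E x = E y" unfolding E_def
    by (rule VA.M.finsum_cong')
      (use eq[OF dual_basisD(3)[OF db] D(1)] D(2) cl lin_closed[OF D(1) y] in auto)
  then show ?thesis using E x y by simp
qed

end

section \<open>Frobenius twists\<close>

text \<open>Only the action of the scalars changes. So a module and its twist have literally the same elements,
  and a linear map is also a linear map between the twists.\<close>

definition twist :: "('r \<Rightarrow> 'r) \<Rightarrow> ('r, 'm) module \<Rightarrow> ('r, 'm) module" where
  "twist \<sigma> M = M\<lparr>smult := (\<lambda>c x. \<sigma> c \<odot>\<^bsub>M\<^esub> x)\<rparr>"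

lemma twist_simps[simp]:
  "carrier (twist \<sigma> M) = carrier M" "\<zero>\<^bsub>twist \<sigma> M\<^esub> = \<zero>\<^bsub>M\<^esub>" "\<one>\<^bsub>twist \<sigma> M\<^esub> = \<one>\<^bsub>M\<^esub>"
  "x \<oplus>\<^bsub>twist \<sigma> M\<^esub> y = x \<oplus>\<^bsub>M\<^esub> y" "x \<otimes>\<^bsub>twist \<sigma> M\<^esub> y = x \<otimes>\<^bsub>M\<^esub> y"
  "c \<odot>\<^bsub>twist \<sigma> M\<^esub> x = \<sigma> c \<odot>\<^bsub>M\<^esub> x"
  "finsum (twist \<sigma> M) = finsum M"
  by (simp_all add: twist_def fun_eq_iff finsum_def finprod_def)

lemma twist_pow[simp]: "x [^]\<^bsub>twist \<sigma> M\<^esub> (n::nat) = x [^]\<^bsub>M\<^esub> n"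
  by (simp add: nat_pow_def)

lemma twist_module:
  assumes "Module.module R M" "\<sigma> \<in> ring_hom R R"
  shows "Module.module R (twist \<sigma> M)"
proof -
  interpret Module.module R M by fact
  have s: "\<sigma> c \<in> carrier R" if "c \<in> carrier R" for c using assms(2) that by (rule ring_hom_closed)
  show ?thesis
  proof (rule module_by)
    show "\<exists>neg_v\<in>carrier (twist \<sigma> M). v \<oplus>\<^bsub>twist \<sigma> M\<^esub> neg_v = \<zero>\<^bsub>twist \<sigma> M\<^esub>"
      if "v \<in> carrier (twist \<sigma> M)" for v
      using that M.r_neg by (intro bexI[of _ "\<ominus>\<^bsub>M\<^esub> v"]) auto
  qed (simp_all add: R.is_cring s M.a_ac smult_r_distr smult_l_distr smult_assoc1
      ring_hom_add[OF assms(2)] ring_hom_mult[OF assms(2)] ring_hom_one[OF assms(2)])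
qed

lemma lin_twist:
  assumes "f \<in> lin R M N" "\<And>c. c \<in> carrier R \<Longrightarrow> \<sigma> c \<in> carrier R"
  shows "f \<in> lin R (twist \<sigma> M) (twist \<sigma> N)"
  by (rule linI) (use assms in \<open>auto simp: lin_closed lin_add lin_smult\<close>)

lemma lin_twist_ring[simp]: "lin (twist \<sigma> A) = lin A"
  by (simp add: fun_eq_iff LinearCombinations.module_hom_def)

lemma bilinear_maps_twist_ring[simp]: "bilinear_maps (twist \<sigma> A) = bilinear_maps A"
  by (simp add: fun_eq_iff bilinear_maps_def)

lemma twist_cring:
  assumes "cring A" shows "cring (twist \<sigma> A)"
proof -
  interpret cring A by fact
  show ?thesis
    by (intro cringI abelian_groupI comm_monoidI)
      (auto simp: a_ac m_ac l_distr r_distr intro!: bexI[of _ "\<ominus>\<^bsub>A\<^esub> _"] l_neg)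
qed

lemma span_cong_ring:
  assumes "Module.module R M" "Module.module R' M" "carrier R = carrier R'"
  shows "LinearCombinations.module.span R M S = LinearCombinations.module.span R' M S"
  using assms(3)
  by (simp add: LinearCombinations.module.span_def[OF assms(1)] LinearCombinations.module.span_def[OF assms(2)]
      LinearCombinations.module.lincomb_def[OF assms(1)] LinearCombinations.module.lincomb_def[OF assms(2)])

lemma free_module_twist[simp]: "free_module (twist \<sigma> A) S = free_module A S"
  and free_gen_twist[simp]: "free_gen (twist \<sigma> A) = free_gen A"
  by (simp_all add: free_module_def free_gen_def fun_eq_iff)

context perfect_char
begin

lemma frob_ring_hom: "frob \<in> ring_hom k k"
  by (rule ring_hom_memI) (auto simp: frob_add frob_mult)

lemma root_ring_hom: "root \<in> ring_hom k k"
  by (rule ring_hom_memI) (auto simp: root_add root_mult)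

lemma twist_vectorspace: "vectorspace k V \<Longrightarrow> vectorspace k (twist frob V)"
  by (simp add: vectorspace_def twist_module[OF _ frob_ring_hom])

lemma untwist_vectorspace: "vectorspace k V \<Longrightarrow> vectorspace k (twist root V)"
  by (simp add: vectorspace_def twist_module[OF _ root_ring_hom])

text \<open>The twist along \<open>root\<close> is inverse to the twist along \<open>frob\<close>, and therefore adjoint to it.\<close>

lemma lin_twist_adjoint: "f \<in> lin k (twist frob M) N \<longleftrightarrow> f \<in> lin k M (twist root N)"
proof
  assume f: "f \<in> lin k (twist frob M) N"
  show "f \<in> lin k M (twist root N)"
  proof (rule linI)
    show "f (r \<odot>\<^bsub>M\<^esub> x) = r \<odot>\<^bsub>twist root N\<^esub> f x" if "r \<in> carrier k" "x \<in> carrier M" for r x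
      using lin_smult[OF f, of "root r" x] that by simp
  qed (use lin_closed[OF f] lin_add[OF f] in auto)
next
  assume f: "f \<in> lin k M (twist root N)"
  show "f \<in> lin k (twist frob M) N"
  proof (rule linI)
    show "f (r \<odot>\<^bsub>twist frob M\<^esub> x) = r \<odot>\<^bsub>N\<^esub> f x" if "r \<in> carrier k" "x \<in> carrier (twist frob M)" for r x
      using lin_smult[OF f, of "frob r" x] that by simp
  qed (use lin_closed[OF f] lin_add[OF f] in auto)
qed

lemma root_functional:
  assumes "l \<in> functionals k V"
  shows "(\<lambda>v. root (l v)) \<in> functionals k (twist frob V)"
  by (rule linI)
    (use assms lin_closed[OF assms] in \<open>auto simp: lin_add lin_smult root_add root_mult\<close>)

lemma twist_fd_space:
  assumes "fd_space k V" shows "fd_space k (twist frob V)"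
proof -
  have vs: "vectorspace k V" using assms by (simp add: fd_space_def)
  interpret V: vectorspace k V by (rule vs)
  obtain n :: nat and b d where db: "dual_basis k V {..<n} b d" using fd_space_imp_dual_basis[OF assms] .
  have "(\<Oplus>\<^bsub>V\<^esub>i\<in>{..<n}. frob (root (d i v)) \<odot>\<^bsub>V\<^esub> b i) = v" if "v \<in> carrier V" for v
  proof -
    have "(\<Oplus>\<^bsub>V\<^esub>i\<in>{..<n}. frob (root (d i v)) \<odot>\<^bsub>V\<^esub> b i) = (\<Oplus>\<^bsub>V\<^esub>i\<in>{..<n}. d i v \<odot>\<^bsub>V\<^esub> b i)"
      by (rule V.M.finsum_cong') (use dual_basisD(2,4)[OF db] that in auto)
    then show ?thesis using dual_basisD(6)[OF db that] by simp
  qed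
  moreover have "root \<zero> = \<zero>" using root_frob[of \<zero>] by simp
  ultimately have "dual_basis k (twist frob V) {..<n} b (\<lambda>i v. root (d i v))"
    unfolding dual_basis_def using dual_basisD(2,5)[OF db] root_functional[OF dual_basisD(3)[OF db]] by auto
  then show ?thesis by (rule dual_basis_imp_fd_space[OF twist_vectorspace[OF vs]])
qed

text \<open>\<open>twist root A\<close> is the algebra \<open>A\<^bsup>1/p\<^esup>\<close>.\<close>

lemma algebra_untwist:
  assumes "algebra k A"
  shows "algebra k (twist root A)"
proof -
  interpret k_algebra k A using assms by (simp add: k_algebra_def)
  show ?thesis
    unfolding algebra_def algebra_axioms_def
    using twist_module[OF Alg.module_axioms root_ring_hom] twist_cring[OF A.is_cring] smult_assoc2 by simp
qed

text \<open>Both sides are the quotient of the same free module by the same relations, since Frobenius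
  permutes the scalars.\<close>

lemma base_change_relations_untwist:
  assumes "algebra k A" "Module.module k V"
  shows "base_change_relations k (twist root A) V = base_change_relations k A (twist frob V)"
proof -
  interpret A: k_algebra k A using assms by (simp add: k_algebra_def)
  interpret A': k_algebra k "twist root A" using algebra_untwist assms by (simp add: k_algebra_def)
  have m': "Module.module (twist root A) (free_module A (carrier V))"
    using A'.A.free_module[of "carrier V"] by simp
  have *: "{free_gen A (c \<odot>\<^bsub>V\<^esub> v) \<ominus>\<^bsub>F\<^esub> (root c \<odot>\<^bsub>A\<^esub> \<one>\<^bsub>A\<^esub>) \<odot>\<^bsub>F\<^esub> free_gen A v |c v. c \<in> carrier k \<and> v \<in> carrier V}
      = {free_gen A (frob c \<odot>\<^bsub>V\<^esub> v) \<ominus>\<^bsub>F\<^esub> (c \<odot>\<^bsub>A\<^esub> \<one>\<^bsub>A\<^esub>) \<odot>\<^bsub>F\<^esub> free_gen A v |c v. c \<in> carrier k \<and> v \<in> carrier V}"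
    (is "?L = ?R") for F
  proof (intro equalityI subsetI)
    fix x assume "x \<in> ?L"
    then obtain c v where "c \<in> carrier k" "v \<in> carrier V"
      "x = free_gen A (c \<odot>\<^bsub>V\<^esub> v) \<ominus>\<^bsub>F\<^esub> (root c \<odot>\<^bsub>A\<^esub> \<one>\<^bsub>A\<^esub>) \<odot>\<^bsub>F\<^esub> free_gen A v" by blast
    then show "x \<in> ?R" by (intro CollectI exI[of _ "root c"] exI[of _ v]) simp
  next
    fix x assume "x \<in> ?R"
    then obtain c v where "c \<in> carrier k" "v \<in> carrier V"
      "x = free_gen A (frob c \<odot>\<^bsub>V\<^esub> v) \<ominus>\<^bsub>F\<^esub> (c \<odot>\<^bsub>A\<^esub> \<one>\<^bsub>A\<^esub>) \<odot>\<^bsub>F\<^esub> free_gen A v" by blast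
    then show "x \<in> ?L" by (intro CollectI exI[of _ "frob c"] exI[of _ v]) simp
  qed
  show ?thesis
    unfolding base_change_relations_def Let_def free_module_twist free_gen_twist twist_simps *
    by (rule span_cong_ring[OF m' A.A.free_module]) simp
qed

text \<open>\<open>V \<otimes> A\<^bsup>1/p\<^esup>\<close> and \<open>(\<tau> V) \<otimes> A\<close> are equal and not just isomorphic. So the components at the twisted objects
  of a tensor automorphism over \<open>A\<close> can be used as components over \<open>A\<^bsup>1/p\<^esup>\<close> without any identification.\<close>

lemma base_change_untwist:
  assumes "algebra k A" "Module.module k V"
  shows "base_change k (twist root A) V = base_change k A (twist frob V)"
    and "base_elt k (twist root A) V = base_elt k A (twist frob V)"
  unfolding base_change_def base_elt_def fun_eq_iff base_change_relations_untwist[OF assms]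
  by simp_all

end

section \<open>Tensor powers\<close>

text \<open>\<open>v \<otimes> \<dots> \<otimes> v\<close> with \<open>n + 1\<close> factors, where \<open>\<beta> n\<close> pairs \<open>U\<close> with the \<open>n\<close>-th space of the tower
  \<open>T 0 = U\<close>, \<open>T (n + 1) = U \<otimes> T n\<close>.\<close>

fun tpow :: "(nat \<Rightarrow> 'u \<Rightarrow> 'u \<Rightarrow> 'u) \<Rightarrow> nat \<Rightarrow> 'u \<Rightarrow> 'u" where
  "tpow \<beta> 0 v = v"
| "tpow \<beta> (Suc n) v = \<beta> n v (tpow \<beta> n v)"

definition tensor_tower :: "'k ring \<Rightarrow> ('k, 'v) module \<Rightarrow> (nat \<Rightarrow> ('k, 'v) module) \<Rightarrow> (nat \<Rightarrow> 'v \<Rightarrow> 'v \<Rightarrow> 'v) \<Rightarrow> bool"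
where
  "tensor_tower k U T \<beta> \<longleftrightarrow> T 0 = U \<and> (\<forall>n. fd_space k (T n) \<and> tensor_pairing k U (T n) (T (Suc n)) (\<beta> n))"

lemma tensor_tower_bilinear: "tensor_tower k U T \<beta> \<Longrightarrow> \<beta> n \<in> bilinear_maps k U (T n) (T (Suc n))"
  by (simp add: tensor_tower_def tensor_pairing_def)

lemma tpow_closed: "tensor_tower k U T \<beta> \<Longrightarrow> u \<in> carrier U \<Longrightarrow> tpow \<beta> n u \<in> carrier (T n)"
proof (induction n)
  case 0
  then show ?case by (simp add: tensor_tower_def)
next
  case (Suc n)
  then show ?case using bilinear_closed[OF tensor_tower_bilinear[OF Suc(2), of n]] by simp
qed

lemma tensor_pairing_functional:
  assumes "tensor_pairing k V W T \<beta>" "l \<in> functionals k V" "m \<in> functionals k W"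
  shows "\<exists>n. n \<in> functionals k T \<and> (\<forall>v\<in>carrier V. \<forall>w\<in>carrier W. n (\<beta> v w) = l v \<otimes>\<^bsub>k\<^esub> m w)"
proof -
  have "\<forall>l\<in>functionals k V. \<forall>m\<in>functionals k W. \<exists>n\<in>functionals k T.
      \<forall>v\<in>carrier V. \<forall>w\<in>carrier W. n (\<beta> v w) = l v \<otimes>\<^bsub>k\<^esub> m w"
    using assms(1) by (simp add: tensor_pairing_def)
  from bspec[OF bspec[OF this assms(2)] assms(3)] show ?thesis by (simp only: Bex_def)
qed

text \<open>\<open>\<epsilon> n\<close> is the functional \<open>l \<otimes> \<dots> \<otimes> l\<close>.\<close>

lemma tensor_tower_functional:
  assumes tw: "tensor_tower k U T \<beta>" and l: "l \<in> functionals k U"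
  obtains \<epsilon> where "\<epsilon> 0 = l" "\<And>n. \<epsilon> n \<in> functionals k (T n)"
    "\<And>n u t. u \<in> carrier U \<Longrightarrow> t \<in> carrier (T n) \<Longrightarrow> \<epsilon> (Suc n) (\<beta> n u t) = l u \<otimes>\<^bsub>k\<^esub> \<epsilon> n t"
proof -
  let ?P = "\<lambda>n e. e \<in> functionals k (T n) \<and> (n = 0 \<longrightarrow> e = l)"
  let ?Q = "\<lambda>n e e'. \<forall>u\<in>carrier U. \<forall>t\<in>carrier (T n). e' (\<beta> n u t) = l u \<otimes>\<^bsub>k\<^esub> e t"
  have "\<exists>f. \<forall>n. ?P n (f n) \<and> ?Q n (f n) (f (Suc n))"
  proof (rule dependent_nat_choice)
    show "\<exists>e. ?P 0 e" using tw l by (auto simp: tensor_tower_def)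
    show "\<exists>e'. ?P (Suc n) e' \<and> ?Q n e e'" if "?P n e" for n e
    proof -
      have "tensor_pairing k U (T n) (T (Suc n)) (\<beta> n)" using tw by (simp add: tensor_tower_def)
      from tensor_pairing_functional[OF this l, of e] that show ?thesis by simp
    qed
  qed
  then obtain f where f: "\<And>n. ?P n (f n)" "\<And>n. ?Q n (f n) (f (Suc n))" by blast
  show thesis by (rule that[of f]) (use f in auto)
qed

lemma tensor_tower_functional_tpow:
  assumes "field k" and tw: "tensor_tower k U T \<beta>" and l: "l \<in> functionals k U"
    and \<epsilon>: "\<epsilon> 0 = l" "\<And>n u t. u \<in> carrier U \<Longrightarrow> t \<in> carrier (T n) \<Longrightarrow> \<epsilon> (Suc n) (\<beta> n u t) = l u \<otimes>\<^bsub>k\<^esub> \<epsilon> n t"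
    and u: "u \<in> carrier U"
  shows "\<epsilon> n (tpow \<beta> n u) = l u [^]\<^bsub>k\<^esub> Suc n"
proof -
  interpret field k by fact
  have lu: "l u \<in> carrier k" using lin_closed[OF l u] by simp
  show ?thesis
  proof (induction n)
    case (Suc n)
    then show ?case
      using \<epsilon>(2)[OF u tpow_closed[OF tw u], of n] lu
      by (simp add: m_comm)
  qed (use \<epsilon> lu in simp)
qed

context perfect_char
begin

text \<open>\<open>v \<otimes> \<dots> \<otimes> v \<mapsto> v\<close>, with \<open>p\<close> factors, extends to a linear map: the \<open>i\<close>-th coordinate of \<open>v\<close> is
  the \<open>p\<close>-th power of its \<open>p\<close>-th root, and the latter is a functional on the twist of \<open>V\<close>.\<close>

lemma tensor_power_retraction:
  assumes V: "fd_space k V" and tw: "tensor_tower k (twist frob V) T \<beta>"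
  shows "\<exists>\<pi>\<in>lin k (T (p - 1)) V. \<forall>v\<in>carrier V. \<pi> (tpow \<beta> (p - 1) v) = v"
proof -
  let ?U = "twist frob V" and ?q = "p - 1"
  have pq: "Suc ?q = p" using p_pos by simp
  interpret V: vectorspace k V using V by (simp add: fd_space_def)
  obtain n :: nat and b d where db: "dual_basis k V {..<n} b d" using fd_space_imp_dual_basis[OF V] .
  have "\<exists>e. e \<in> functionals k (T ?q) \<and> (\<forall>v\<in>carrier V. e (tpow \<beta> ?q v) = d i v)" if i: "i < n" for i
  proof -
    define l where "l = (\<lambda>v. root (d i v))"
    have l: "l \<in> functionals k ?U"
      unfolding l_def by (rule root_functional[OF dual_basisD(3)[OF db]]) (use i in simp)
    obtain \<epsilon> where \<epsilon>: "\<epsilon> 0 = l" "\<And>n. \<epsilon> n \<in> functionals k (T n)"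
      "\<And>n u t. u \<in> carrier ?U \<Longrightarrow> t \<in> carrier (T n) \<Longrightarrow> \<epsilon> (Suc n) (\<beta> n u t) = l u \<otimes> \<epsilon> n t"
      by (rule tensor_tower_functional[OF tw l]) blast
    have "\<epsilon> ?q (tpow \<beta> ?q v) = d i v" if v: "v \<in> carrier V" for v
      using tensor_tower_functional_tpow[OF field_axioms tw l \<epsilon>(1,3), of v ?q] v
        dual_basisD(4)[OF db _ v, of i] i frob_root[of "d i v"]
      unfolding pq by (simp add: frob_def l_def)
    then show ?thesis using \<epsilon>(2) by blast
  qed
  then obtain e where e: "\<And>i. i < n \<Longrightarrow> e i \<in> functionals k (T ?q)"
    "\<And>i v. i < n \<Longrightarrow> v \<in> carrier V \<Longrightarrow> e i (tpow \<beta> ?q v) = d i v" by metis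
  let ?\<pi> = "\<lambda>t. \<Oplus>\<^bsub>V\<^esub>i\<in>{..<n}. e i t \<odot>\<^bsub>V\<^esub> b i"
  have T: "Module.module k (T ?q)" using tw by (auto simp: tensor_tower_def fd_space_def vectorspace_def)
  have "?\<pi> \<in> lin k (T ?q) V"
  proof (rule V.lin_finsum_coeffs[OF T])
    fix i assume "i \<in> {..<n}"
    then have ei: "e i \<in> functionals k (T ?q)" using e by simp
    show "e i \<in> carrier (T ?q) \<rightarrow> carrier k" using lin_closed[OF ei] by simp
    show "e i (x \<oplus>\<^bsub>T ?q\<^esub> y) = e i x \<oplus> e i y" if "x \<in> carrier (T ?q)" "y \<in> carrier (T ?q)" for x y
      using lin_add[OF ei that] by simp
    show "e i (r \<odot>\<^bsub>T ?q\<^esub> x) = r \<otimes> e i x" if "r \<in> carrier k" "x \<in> carrier (T ?q)" for r x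
      using lin_smult[OF ei that] by simp
  qed (use dual_basisD(2)[OF db] in auto)
  moreover have "?\<pi> (tpow \<beta> ?q v) = v" if v: "v \<in> carrier V" for v
  proof -
    have "?\<pi> (tpow \<beta> ?q v) = (\<Oplus>\<^bsub>V\<^esub>i\<in>{..<n}. d i v \<odot>\<^bsub>V\<^esub> b i)"
      by (rule V.M.finsum_cong') (use e(2)[OF _ v] dual_basisD(2,4)[OF db] v in auto)
    then show ?thesis using dual_basisD(6)[OF db v] by simp
  qed
  ultimately show ?thesis by (intro bexI[of _ ?\<pi>] ballI)
qed

end

section \<open>Frobenius on the coordinate ring of a Tannakian dual\<close>

lemma alg_homD:
  assumes "f \<in> alg_hom k R S"
  shows "f \<in> ring_hom R S" "f \<in> lin k R S" "f \<in> extensional (carrier R)"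
  using assms by (auto simp: alg_hom_def)

context k_algebra
begin

lemma smult_eq_unit_map: "c \<in> carrier k \<Longrightarrow> x \<in> carrier A \<Longrightarrow> c \<odot>\<^bsub>A\<^esub> x = unit_map c \<otimes>\<^bsub>A\<^esub> x"
  using smult_assoc2[of c "\<one>\<^bsub>A\<^esub>" x] by (simp add: unit_map_def)

lemma smult_pow:
  "c \<in> carrier k \<Longrightarrow> x \<in> carrier A \<Longrightarrow> (c \<odot>\<^bsub>A\<^esub> x) [^]\<^bsub>A\<^esub> (n::nat) = (c [^]\<^bsub>k\<^esub> n) \<odot>\<^bsub>A\<^esub> (x [^]\<^bsub>A\<^esub> n)"
  by (simp add: smult_eq_unit_map A.nat_pow_distrib unit_map_pow)

end

locale perfect_algebra = perfect_char k p + k_algebra k A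
  for k :: "'k ring" and p and A :: "('k, 'a) module"
begin

lemma A_char_p: "[p] \<cdot>\<^bsub>A\<^esub> \<one>\<^bsub>A\<^esub> = \<zero>\<^bsub>A\<^esub>"
proof -
  have "unit_map ([n] \<cdot>\<^bsub>k\<^esub> \<one>\<^bsub>k\<^esub>) = [n] \<cdot>\<^bsub>A\<^esub> \<one>\<^bsub>A\<^esub>" for n :: nat
    by (induction n) (simp_all add: unit_map_add)
  from this[of p] show ?thesis using char_p by simp
qed

lemma A_frob_add:
  "x \<in> carrier A \<Longrightarrow> y \<in> carrier A \<Longrightarrow> (x \<oplus>\<^bsub>A\<^esub> y) [^]\<^bsub>A\<^esub> p = x [^]\<^bsub>A\<^esub> p \<oplus>\<^bsub>A\<^esub> y [^]\<^bsub>A\<^esub> p"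
  by (rule A.freshmans_dream[OF prime_p A_char_p])

abbreviation Afrob where "Afrob \<equiv> \<lambda>a. a [^]\<^bsub>A\<^esub> p"

lemma Afrob_ring_hom: "Afrob \<in> ring_hom A A"
  by (rule ring_hom_memI) (auto simp: A_frob_add A.nat_pow_distrib)

text \<open>The \<open>p\<close>-power map multiplies by \<open>c\<close> where \<open>A\<^bsup>1/p\<^esup>\<close> multiplies by the \<open>p\<close>-th root of \<open>c\<close>.\<close>

lemma Afrob_alg_hom: "(\<lambda>a\<in>carrier A. Afrob a) \<in> alg_hom k (twist root A) A"
  unfolding alg_hom_def
proof (intro IntI)
  show "(\<lambda>a\<in>carrier A. Afrob a) \<in> ring_hom (twist root A) A"
    by (rule ring_hom_memI) (auto simp: A_frob_add A.nat_pow_distrib)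
  have "(c \<odot>\<^bsub>twist root A\<^esub> x) [^]\<^bsub>A\<^esub> p = c \<odot>\<^bsub>A\<^esub> (x [^]\<^bsub>A\<^esub> p)" if "c \<in> carrier k" "x \<in> carrier A" for c x
    using that smult_pow[of "root c" x p] frob_root[of c] by (simp add: frob_def)
  then show "(\<lambda>a\<in>carrier A. Afrob a) \<in> lin k (twist root A) A"
    by (intro linI) (auto simp: A_frob_add)
qed simp

text \<open>The canonical map \<open>v \<otimes> a \<mapsto> v \<otimes> a\<^sup>p\<close>, semilinear over the Frobenius map of \<open>A\<close>.\<close>

lemma bc_frob:
  assumes V: "Module.module k V"
  shows "\<exists>m\<in>lin A (bc (twist frob V)) (twist Afrob (bc V)). \<forall>v\<in>carrier V. m (be (twist frob V) v) = be V v"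
proof -
  have "be V \<in> lin k (twist frob V) (restrict_scalars A (twist Afrob (bc V)))"
  proof (rule linI)
    show "be V (r \<odot>\<^bsub>twist frob V\<^esub> x) = r \<odot>\<^bsub>restrict_scalars A (twist Afrob (bc V))\<^esub> be V x"
      if "r \<in> carrier k" "x \<in> carrier (twist frob V)" for r x
      using lin_smult[OF be_lin[OF V], of "frob r" x] that unit_map_pow[of r p]
      by (simp add: frob_def unit_map_def)
  qed (use lin_closed[OF be_lin[OF V]] lin_add[OF be_lin[OF V]] in auto)
  then show ?thesis
    using bc_extend[OF twist_module[OF V frob_ring_hom] twist_module[OF bc_module[OF V] Afrob_ring_hom]]
    by simp
qed

end

lemma tensor_automorphismsD:
  assumes "\<eta> \<in> tensor_automorphisms k \<omega> R"
  shows "V \<in> Obj \<omega> \<Longrightarrow> \<eta> V \<in> lin R (base_change k R (Fib \<omega> V)) (base_change k R (Fib \<omega> V))"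
    and "V \<in> Obj \<omega> \<Longrightarrow> W \<in> Obj \<omega> \<Longrightarrow> f \<in> Mor \<omega> V W \<Longrightarrow>
      g \<in> lin R (base_change k R (Fib \<omega> V)) (base_change k R (Fib \<omega> W)) \<Longrightarrow>
      (\<And>v. v \<in> carrier (Fib \<omega> V) \<Longrightarrow> g (base_elt k R (Fib \<omega> V) v) = base_elt k R (Fib \<omega> W) (f v)) \<Longrightarrow>
      x \<in> carrier (base_change k R (Fib \<omega> V)) \<Longrightarrow> \<eta> W (g x) = g (\<eta> V x)"
    and "V \<in> Obj \<omega> \<Longrightarrow> W \<in> Obj \<omega> \<Longrightarrow> T \<in> Obj \<omega> \<Longrightarrow> \<beta> \<in> Tens \<omega> V W T \<Longrightarrow>
      B \<in> bilinear_maps R (base_change k R (Fib \<omega> V)) (base_change k R (Fib \<omega> W)) (base_change k R (Fib \<omega> T)) \<Longrightarrow>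
      (\<And>v w. v \<in> carrier (Fib \<omega> V) \<Longrightarrow> w \<in> carrier (Fib \<omega> W) \<Longrightarrow>
        B (base_elt k R (Fib \<omega> V) v) (base_elt k R (Fib \<omega> W) w) = base_elt k R (Fib \<omega> T) (\<beta> v w)) \<Longrightarrow>
      x \<in> carrier (base_change k R (Fib \<omega> V)) \<Longrightarrow> y \<in> carrier (base_change k R (Fib \<omega> W)) \<Longrightarrow>
      \<eta> T (B x y) = B (\<eta> V x) (\<eta> W y)"
    and "\<eta> \<in> extensional (Obj \<omega>)"
    and "V \<in> Obj \<omega> \<Longrightarrow> \<eta> V \<in> extensional (carrier (base_change k R (Fib \<omega> V)))"
    and "V \<in> Obj \<omega> \<Longrightarrow> bij_betw (\<eta> V) (carrier (base_change k R (Fib \<omega> V))) (carrier (base_change k R (Fib \<omega> V)))"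
    and "U \<in> Obj \<omega> \<Longrightarrow> u \<in> Unit \<omega> U \<Longrightarrow> \<eta> U (base_elt k R (Fib \<omega> U) u) = base_elt k R (Fib \<omega> U) u"
proof -
  have *: "\<eta> \<in> extensional (Obj \<omega>)"
    "\<forall>V\<in>Obj \<omega>. \<eta> V \<in> extensional (carrier (base_change k R (Fib \<omega> V))) \<and>
       \<eta> V \<in> lin R (base_change k R (Fib \<omega> V)) (base_change k R (Fib \<omega> V)) \<and>
       bij_betw (\<eta> V) (carrier (base_change k R (Fib \<omega> V))) (carrier (base_change k R (Fib \<omega> V)))"
    "\<forall>V\<in>Obj \<omega>. \<forall>W\<in>Obj \<omega>. \<forall>f\<in>Mor \<omega> V W.
       \<forall>g\<in>lin R (base_change k R (Fib \<omega> V)) (base_change k R (Fib \<omega> W)).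
         (\<forall>v\<in>carrier (Fib \<omega> V). g (base_elt k R (Fib \<omega> V) v) = base_elt k R (Fib \<omega> W) (f v)) \<longrightarrow>
         (\<forall>x\<in>carrier (base_change k R (Fib \<omega> V)). \<eta> W (g x) = g (\<eta> V x))"
    "\<forall>V\<in>Obj \<omega>. \<forall>W\<in>Obj \<omega>. \<forall>T\<in>Obj \<omega>. \<forall>\<beta>\<in>Tens \<omega> V W T.
       \<forall>B\<in>bilinear_maps R (base_change k R (Fib \<omega> V)) (base_change k R (Fib \<omega> W)) (base_change k R (Fib \<omega> T)).
         (\<forall>v\<in>carrier (Fib \<omega> V). \<forall>w\<in>carrier (Fib \<omega> W).
            B (base_elt k R (Fib \<omega> V) v) (base_elt k R (Fib \<omega> W) w) = base_elt k R (Fib \<omega> T) (\<beta> v w)) \<longrightarrow>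
         (\<forall>x\<in>carrier (base_change k R (Fib \<omega> V)). \<forall>y\<in>carrier (base_change k R (Fib \<omega> W)).
            \<eta> T (B x y) = B (\<eta> V x) (\<eta> W y))"
    "\<forall>U\<in>Obj \<omega>. \<forall>u\<in>Unit \<omega> U. \<eta> U (base_elt k R (Fib \<omega> U) u) = base_elt k R (Fib \<omega> U) u"
    using assms unfolding tensor_automorphisms_def Let_def by simp_all
  show "\<eta> \<in> extensional (Obj \<omega>)" by (rule *(1))
  show "\<eta> V \<in> lin R (base_change k R (Fib \<omega> V)) (base_change k R (Fib \<omega> V))" if "V \<in> Obj \<omega>"
    using *(2) that by simp
  show "\<eta> V \<in> extensional (carrier (base_change k R (Fib \<omega> V)))" if "V \<in> Obj \<omega>"
    using *(2) that by simp
  show "bij_betw (\<eta> V) (carrier (base_change k R (Fib \<omega> V))) (carrier (base_change k R (Fib \<omega> V)))" if "V \<in> Obj \<omega>"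
    using *(2) that by simp
  show "\<eta> U (base_elt k R (Fib \<omega> U) u) = base_elt k R (Fib \<omega> U) u" if "U \<in> Obj \<omega>" "u \<in> Unit \<omega> U"
    using *(5) that by simp
  show "\<eta> W (g x) = g (\<eta> V x)"
    if "V \<in> Obj \<omega>" "W \<in> Obj \<omega>" "f \<in> Mor \<omega> V W"
      "g \<in> lin R (base_change k R (Fib \<omega> V)) (base_change k R (Fib \<omega> W))"
      "\<And>v. v \<in> carrier (Fib \<omega> V) \<Longrightarrow> g (base_elt k R (Fib \<omega> V) v) = base_elt k R (Fib \<omega> W) (f v)"
      "x \<in> carrier (base_change k R (Fib \<omega> V))"
    using bspec[OF bspec[OF bspec[OF bspec[OF *(3) that(1)] that(2)] that(3)] that(4)] that(5,6) by simp
  show "\<eta> T (B x y) = B (\<eta> V x) (\<eta> W y)"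
    if "V \<in> Obj \<omega>" "W \<in> Obj \<omega>" "T \<in> Obj \<omega>" "\<beta> \<in> Tens \<omega> V W T"
      "B \<in> bilinear_maps R (base_change k R (Fib \<omega> V)) (base_change k R (Fib \<omega> W)) (base_change k R (Fib \<omega> T))"
      "\<And>v w. v \<in> carrier (Fib \<omega> V) \<Longrightarrow> w \<in> carrier (Fib \<omega> W) \<Longrightarrow>
        B (base_elt k R (Fib \<omega> V) v) (base_elt k R (Fib \<omega> W) w) = base_elt k R (Fib \<omega> T) (\<beta> v w)"
      "x \<in> carrier (base_change k R (Fib \<omega> V))" "y \<in> carrier (base_change k R (Fib \<omega> W))"
    using bspec[OF bspec[OF bspec[OF bspec[OF bspec[OF *(4) that(1)] that(2)] that(3)] that(4)] that(5)] that(6-) by simp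
qed

text \<open>A fibre functor with a twist \<open>\<tau>\<close>: an endofunctor which does not change the underlying maps and
  changes the scalars by Frobenius. The last assumption says that \<open>V\<close> is the Frobenius twist of
  \<open>U = \<tau> V\<close> also in the sense of tensor categories: the object \<open>P\<close> is the subspace of \<open>U \<otimes> \<dots> \<otimes> U\<close>
  (\<open>p\<close> factors) spanned by the \<open>v \<otimes> \<dots> \<otimes> v\<close>, and \<open>v \<otimes> \<dots> \<otimes> v \<mapsto> v\<close> is a morphism \<open>P \<rightarrow> V\<close>. It is written
  as the restriction of a linear map \<open>r\<close> on the whole tensor power; such \<open>r\<close> exist by
  \<open>tensor_power_retraction\<close>, and they agree on the powers and hence on \<open>P\<close>.\<close>

locale twisted_fibre_functor = perfect_char k p for k :: "'k ring" and p +
  fixes \<omega> :: "('o, 'k, 'v) fibre_functor" and \<tau> :: "'o \<Rightarrow> 'o"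
  assumes fib_fd: "V \<in> Obj \<omega> \<Longrightarrow> fd_space k (Fib \<omega> V)"
    and mor_lin: "V \<in> Obj \<omega> \<Longrightarrow> W \<in> Obj \<omega> \<Longrightarrow> f \<in> Mor \<omega> V W \<Longrightarrow> f \<in> lin k (Fib \<omega> V) (Fib \<omega> W)"
    and tau_obj: "V \<in> Obj \<omega> \<Longrightarrow> \<tau> V \<in> Obj \<omega>"
    and tau_fib: "V \<in> Obj \<omega> \<Longrightarrow> Fib \<omega> (\<tau> V) = twist frob (Fib \<omega> V)"
    and tau_mor: "V \<in> Obj \<omega> \<Longrightarrow> W \<in> Obj \<omega> \<Longrightarrow> f \<in> Mor \<omega> V W \<Longrightarrow> f \<in> Mor \<omega> (\<tau> V) (\<tau> W)"
    and tau_tens: "V \<in> Obj \<omega> \<Longrightarrow> W \<in> Obj \<omega> \<Longrightarrow> T \<in> Obj \<omega> \<Longrightarrow> \<beta> \<in> Tens \<omega> V W T \<Longrightarrow> \<beta> \<in> Tens \<omega> (\<tau> V) (\<tau> W) (\<tau> T)"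
    and tau_unit: "U \<in> Obj \<omega> \<Longrightarrow> u \<in> Unit \<omega> U \<Longrightarrow> u \<in> Unit \<omega> (\<tau> U)"
    and ex_tensor: "V \<in> Obj \<omega> \<Longrightarrow> W \<in> Obj \<omega> \<Longrightarrow>
      \<exists>T\<in>Obj \<omega>. \<exists>\<beta>\<in>Tens \<omega> V W T. tensor_pairing k (Fib \<omega> V) (Fib \<omega> W) (Fib \<omega> T) \<beta>"
    and ex_powers: "V \<in> Obj \<omega> \<Longrightarrow> Ts 0 = \<tau> V \<Longrightarrow> (\<And>n. Ts n \<in> Obj \<omega>) \<Longrightarrow>
      (\<And>n. bs n \<in> Tens \<omega> (\<tau> V) (Ts n) (Ts (Suc n))) \<Longrightarrow>
      tensor_tower k (Fib \<omega> (\<tau> V)) (\<lambda>n. Fib \<omega> (Ts n)) bs \<Longrightarrow>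
      \<exists>P\<in>Obj \<omega>. \<exists>\<iota>\<in>Mor \<omega> P (Ts (p - 1)). \<exists>\<pi>\<in>Mor \<omega> P V.
        \<iota> ` carrier (Fib \<omega> P) = LinearCombinations.module.span k (Fib \<omega> (Ts (p - 1))) (tpow bs (p - 1) ` carrier (Fib \<omega> V)) \<and>
        (\<forall>r\<in>lin k (Fib \<omega> (Ts (p - 1))) (Fib \<omega> V). (\<forall>v\<in>carrier (Fib \<omega> V). r (tpow bs (p - 1) v) = v) \<longrightarrow>
           (\<forall>t\<in>carrier (Fib \<omega> P). \<pi> t = r (\<iota> t)))"
begin

lemma fib_module: "V \<in> Obj \<omega> \<Longrightarrow> Module.module k (Fib \<omega> V)"
  using fib_fd by (auto simp: fd_space_def vectorspace_def)

lemma ex_tower: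
  assumes "U \<in> Obj \<omega>"
  obtains T \<beta> where "T 0 = U" "\<And>n. T n \<in> Obj \<omega>" "\<And>n. \<beta> n \<in> Tens \<omega> U (T n) (T (Suc n))"
    "tensor_tower k (Fib \<omega> U) (\<lambda>n. Fib \<omega> (T n)) \<beta>"
proof -
  let ?Q = "\<lambda>(n::nat) t t'. \<exists>\<beta>\<in>Tens \<omega> U t t'. tensor_pairing k (Fib \<omega> U) (Fib \<omega> t) (Fib \<omega> t') \<beta>"
  have "\<exists>T. \<forall>n. (T n \<in> Obj \<omega> \<and> (n = 0 \<longrightarrow> T n = U)) \<and> ?Q n (T n) (T (Suc n))"
  proof (rule dependent_nat_choice)
    show "\<exists>x. x \<in> Obj \<omega> \<and> (0 = (0::nat) \<longrightarrow> x = U)" using assms by blast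
    show "\<exists>y. (y \<in> Obj \<omega> \<and> (Suc n = 0 \<longrightarrow> y = U)) \<and> ?Q n x y" if "x \<in> Obj \<omega> \<and> (n = 0 \<longrightarrow> x = U)" for x n
      using ex_tensor[OF assms, of x] that by blast
  qed
  then obtain T where T: "\<And>n. T n \<in> Obj \<omega>" "T 0 = U" "\<And>n. ?Q n (T n) (T (Suc n))" by metis
  then obtain \<beta> where \<beta>: "\<And>n. \<beta> n \<in> Tens \<omega> U (T n) (T (Suc n))"
    "\<And>n. tensor_pairing k (Fib \<omega> U) (Fib \<omega> (T n)) (Fib \<omega> (T (Suc n))) (\<beta> n)" by metis
  show thesis
    by (rule that[OF T(2,1) \<beta>(1)]) (use T \<beta> fib_fd in \<open>auto simp: tensor_tower_def\<close>)
qed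

end

locale twisted_fibre_functor_algebra = twisted_fibre_functor k p \<omega> \<tau> + perfect_algebra k p A
  for k :: "'k ring" and p and \<omega> :: "('o, 'k, 'v) fibre_functor" and \<tau> and A :: "('k, 'a) module"
begin

text \<open>The components of a tensor automorphism at \<open>V\<close> and at \<open>\<tau> V\<close> correspond under Frobenius. In
  matrix terms: the entries at \<open>V\<close> are the \<open>p\<close>-th powers of those at \<open>\<tau> V\<close>. Indeed \<open>v\<close> is the image of
  \<open>v \<otimes> \<dots> \<otimes> v\<close> under \<open>\<pi>\<close>, and \<open>\<eta>\<close> is compatible with \<open>\<pi>\<close>, with the inclusion \<open>\<iota>\<close> of \<open>P\<close> into the tensor
  power and with the tensor products. So \<open>\<eta>\<close> maps \<open>v \<otimes> \<dots> \<otimes> v\<close> to \<open>x \<otimes> \<dots> \<otimes> x\<close>, where \<open>x = \<eta>(v)\<close> at \<open>\<tau> V\<close>.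
  A functional \<open>\<mu>\<close> of \<open>V\<close> becomes \<open>l \<otimes> \<dots> \<otimes> l\<close> on \<open>P\<close>, with \<open>l\<close> the \<open>p\<close>-th root of \<open>\<mu>\<close>; its value at
  \<open>x \<otimes> \<dots> \<otimes> x\<close> is \<open>l(x)\<^sup>p\<close>.\<close>

lemma tensor_automorphism_frob_gen:
  assumes \<eta>: "\<eta> \<in> tensor_automorphisms k \<omega> A" and V: "V \<in> Obj \<omega>"
    and m: "m \<in> lin A (bc (Fib \<omega> (\<tau> V))) (twist Afrob (bc (Fib \<omega> V)))"
    and m_be: "\<And>v. v \<in> carrier (Fib \<omega> V) \<Longrightarrow> m (be (Fib \<omega> (\<tau> V)) v) = be (Fib \<omega> V) v"
    and v: "v \<in> carrier (Fib \<omega> V)"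
  shows "\<eta> V (be (Fib \<omega> V) v) = m (\<eta> (\<tau> V) (be (Fib \<omega> (\<tau> V)) v))"
proof -
  let ?U = "\<tau> V" and ?q = "p - 1"
  let ?VA = "bc (Fib \<omega> V)" and ?UA = "bc (Fib \<omega> ?U)"
  have pq: "Suc ?q = p" using p_pos by simp
  note U = tau_obj[OF V] and nat = tensor_automorphismsD[OF \<eta>]
  note Vm = fib_module[OF V] and Um = fib_module[OF U]
  have cU: "carrier (Fib \<omega> ?U) = carrier (Fib \<omega> V)" using tau_fib[OF V] by simp
  obtain T \<beta> where T0: "T 0 = ?U" and T: "\<And>n. T n \<in> Obj \<omega>"
    and \<beta>: "\<And>n. \<beta> n \<in> Tens \<omega> ?U (T n) (T (Suc n))"
    and tw: "tensor_tower k (Fib \<omega> ?U) (\<lambda>n. Fib \<omega> (T n)) \<beta>"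
    by (rule ex_tower[OF U]) blast
  note Tm = fib_module[OF T]
  obtain P \<iota> \<pi> where P: "P \<in> Obj \<omega>" and \<iota>: "\<iota> \<in> Mor \<omega> P (T ?q)" and \<pi>: "\<pi> \<in> Mor \<omega> P V"
    and im: "\<iota> ` carrier (Fib \<omega> P) = LinearCombinations.module.span k (Fib \<omega> (T ?q)) (tpow \<beta> ?q ` carrier (Fib \<omega> V))"
    and \<pi>r': "\<forall>r\<in>lin k (Fib \<omega> (T ?q)) (Fib \<omega> V). (\<forall>v\<in>carrier (Fib \<omega> V). r (tpow \<beta> ?q v) = v) \<longrightarrow>
           (\<forall>t\<in>carrier (Fib \<omega> P). \<pi> t = r (\<iota> t))"
    using ex_powers[of V T \<beta>, OF V T0 T \<beta> tw] by (elim bexE conjE)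
  have \<pi>r: "\<pi> t = r (\<iota> t)" if "r \<in> lin k (Fib \<omega> (T ?q)) (Fib \<omega> V)"
    "\<forall>v\<in>carrier (Fib \<omega> V). r (tpow \<beta> ?q v) = v" "t \<in> carrier (Fib \<omega> P)" for r t
    using bspec[OF \<pi>r' that(1)] that(2,3) by simp
  note Pm = fib_module[OF P]
  obtain r where r: "r \<in> lin k (Fib \<omega> (T ?q)) (Fib \<omega> V)" "\<forall>v\<in>carrier (Fib \<omega> V). r (tpow \<beta> ?q v) = v"
    using tensor_power_retraction[OF fib_fd[OF V], of "\<lambda>n. Fib \<omega> (T n)" \<beta>] tw tau_fib[OF V] by auto
  have tc: "tpow \<beta> ?q ` carrier (Fib \<omega> V) \<subseteq> carrier (Fib \<omega> (T ?q))"
    using tpow_closed[OF tw] cU by auto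
  have "tpow \<beta> ?q v \<in> \<iota> ` carrier (Fib \<omega> P)"
    unfolding im using LinearCombinations.module.in_own_span[OF Tm tc] v by blast
  then obtain t where t: "t \<in> carrier (Fib \<omega> P)" "\<iota> t = tpow \<beta> ?q v" by auto
  have \<pi>t: "\<pi> t = v" using \<pi>r[OF r t(1)] t(2) r(2) v by simp
  obtain \<iota>A where \<iota>A: "\<iota>A \<in> lin A (bc (Fib \<omega> P)) (bc (Fib \<omega> (T ?q)))"
    "\<And>t. t \<in> carrier (Fib \<omega> P) \<Longrightarrow> \<iota>A (be (Fib \<omega> P) t) = be (Fib \<omega> (T ?q)) (\<iota> t)"
    using bc_map[OF Pm Tm mor_lin[OF P T \<iota>]] by blast
  obtain \<pi>A where \<pi>A: "\<pi>A \<in> lin A (bc (Fib \<omega> P)) ?VA"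
    "\<And>t. t \<in> carrier (Fib \<omega> P) \<Longrightarrow> \<pi>A (be (Fib \<omega> P) t) = be (Fib \<omega> V) (\<pi> t)"
    using bc_map[OF Pm Vm mor_lin[OF P V \<pi>]] by blast
  have "\<forall>n. \<exists>b. b \<in> bilinear_maps A ?UA (bc (Fib \<omega> (T n))) (bc (Fib \<omega> (T (Suc n)))) \<and>
      (\<forall>u\<in>carrier (Fib \<omega> ?U). \<forall>s\<in>carrier (Fib \<omega> (T n)).
         b (be (Fib \<omega> ?U) u) (be (Fib \<omega> (T n)) s) = be (Fib \<omega> (T (Suc n))) (\<beta> n u s))"
    using bc_bilinear[OF Um Tm Tm tensor_tower_bilinear[OF tw]] by blast
  then obtain B where B0: "\<forall>n. B n \<in> bilinear_maps A ?UA (bc (Fib \<omega> (T n))) (bc (Fib \<omega> (T (Suc n)))) \<and>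
      (\<forall>u\<in>carrier (Fib \<omega> ?U). \<forall>s\<in>carrier (Fib \<omega> (T n)).
         B n (be (Fib \<omega> ?U) u) (be (Fib \<omega> (T n)) s) = be (Fib \<omega> (T (Suc n))) (\<beta> n u s))"
    by (rule choice[THEN exE])
  have B: "B n \<in> bilinear_maps A ?UA (bc (Fib \<omega> (T n))) (bc (Fib \<omega> (T (Suc n))))" for n
    using B0 by blast
  have Bbe: "B n (be (Fib \<omega> ?U) u) (be (Fib \<omega> (T n)) s) = be (Fib \<omega> (T (Suc n))) (\<beta> n u s)"
    if "u \<in> carrier (Fib \<omega> ?U)" "s \<in> carrier (Fib \<omega> (T n))" for n u s
    using B0 that by blast
  define x where "x = \<eta> ?U (be (Fib \<omega> ?U) v)"
  have beU: "be (Fib \<omega> ?U) v \<in> carrier ?UA" using be_closed[OF Um] v cU by simp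
  have x: "x \<in> carrier ?UA" unfolding x_def by (rule lin_closed[OF nat(1)[OF U] beU])
  have tB: "tpow B n x \<in> carrier (bc (Fib \<omega> (T n)))" for n
    by (induction n) (use x T0 bilinear_closed[OF B] in auto)
  have eta_pow: "\<eta> (T n) (be (Fib \<omega> (T n)) (tpow \<beta> n v)) = tpow B n x" for n
  proof (induction n)
    case 0
    then show ?case by (simp add: T0 x_def)
  next
    case (Suc n)
    have tn: "tpow \<beta> n v \<in> carrier (Fib \<omega> (T n))" using tpow_closed[OF tw] v cU by simp
    have "\<eta> (T (Suc n)) (be (Fib \<omega> (T (Suc n))) (tpow \<beta> (Suc n) v))
        = \<eta> (T (Suc n)) (B n (be (Fib \<omega> ?U) v) (be (Fib \<omega> (T n)) (tpow \<beta> n v)))"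
      using Bbe[OF _ tn] v cU by simp
    also have "\<dots> = B n x (\<eta> (T n) (be (Fib \<omega> (T n)) (tpow \<beta> n v)))"
      unfolding x_def by (rule nat(3)[OF U T T \<beta> B Bbe beU be_closed[OF Tm tn]])
    finally show ?case using Suc by simp
  qed
  show ?thesis
  proof (rule bc_separate[OF fib_fd[OF V]])
    show "\<eta> V (be (Fib \<omega> V) v) \<in> carrier ?VA" by (rule lin_closed[OF nat(1)[OF V] be_closed[OF Vm v]])
    show "m (\<eta> ?U (be (Fib \<omega> ?U) v)) \<in> carrier ?VA" using lin_closed[OF m x] by (simp add: x_def)
  next
    fix \<mu> M assume \<mu>: "\<mu> \<in> functionals k (Fib \<omega> V)" and M: "M \<in> lin A ?VA (self_module A)"
      and Mbe: "\<forall>v\<in>carrier (Fib \<omega> V). M (be (Fib \<omega> V) v) = unit_map (\<mu> v)"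
    define l where "l = (\<lambda>v. root (\<mu> v))"
    have l: "l \<in> functionals k (Fib \<omega> ?U)"
      unfolding tau_fib[OF V] l_def by (rule root_functional[OF \<mu>])
    obtain L where L: "L \<in> lin A ?UA (self_module A)"
      "\<And>u. u \<in> carrier (Fib \<omega> V) \<Longrightarrow> L (be (Fib \<omega> ?U) u) = unit_map (l u)"
      using bc_functional[OF Um l] cU by auto
    obtain \<epsilon> where e0: "\<epsilon> 0 = l" and e: "\<And>n. \<epsilon> n \<in> functionals k (Fib \<omega> (T n))"
      and es: "\<And>n u t. u \<in> carrier (Fib \<omega> ?U) \<Longrightarrow> t \<in> carrier (Fib \<omega> (T n)) \<Longrightarrow> \<epsilon> (Suc n) (\<beta> n u t) = l u \<otimes>\<^bsub>k\<^esub> \<epsilon> n t"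
      by (rule tensor_tower_functional[OF tw l]) blast
    have "\<forall>n. \<exists>E. E \<in> lin A (bc (Fib \<omega> (T n))) (self_module A) \<and>
        (\<forall>s\<in>carrier (Fib \<omega> (T n)). E (be (Fib \<omega> (T n)) s) = unit_map (\<epsilon> n s))"
      using bc_functional[OF Tm e] by blast
    then obtain E where E0: "\<forall>n. E n \<in> lin A (bc (Fib \<omega> (T n))) (self_module A) \<and>
        (\<forall>s\<in>carrier (Fib \<omega> (T n)). E n (be (Fib \<omega> (T n)) s) = unit_map (\<epsilon> n s))"
      by (rule choice[THEN exE])
    have E: "E n \<in> lin A (bc (Fib \<omega> (T n))) (self_module A)"
      "s \<in> carrier (Fib \<omega> (T n)) \<Longrightarrow> E n (be (Fib \<omega> (T n)) s) = unit_map (\<epsilon> n s)" for n s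
      using E0 by blast+
    have Lc: "L z \<in> carrier A" if "z \<in> carrier ?UA" for z using lin_closed[OF L(1) that] by simp
    have Ec: "E n z \<in> carrier A" if "z \<in> carrier (bc (Fib \<omega> (T n)))" for n z using lin_closed[OF E(1) that] by simp
    \<comment> \<open>the functionals are multiplicative on the base change of the tower, too\<close>
    have E_mult: "E (Suc n) (B n z y) = L z \<otimes>\<^bsub>A\<^esub> E n y"
      if z: "z \<in> carrier ?UA" and y: "y \<in> carrier (bc (Fib \<omega> (T n)))" for n z y
    proof (rule bc_lin_eq[OF Um A.self_module _ _ _ z, of "\<lambda>z. E (Suc n) (B n z y)" "\<lambda>z. L z \<otimes>\<^bsub>A\<^esub> E n y"])
      show "(\<lambda>z. E (Suc n) (B n z y)) \<in> lin A ?UA (self_module A)"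
        by (rule lin_compose[OF bilinear_lin1[OF B y] E(1)])
      show "(\<lambda>z. L z \<otimes>\<^bsub>A\<^esub> E n y) \<in> lin A ?UA (self_module A)"
        by (rule linI)
          (use Lc Ec[OF y] lin_add[OF L(1)] lin_smult[OF L(1)] in \<open>auto simp: A.l_distr A.m_assoc\<close>)
      fix u assume u: "u \<in> carrier (Fib \<omega> ?U)"
      have ub: "be (Fib \<omega> ?U) u \<in> carrier ?UA" by (rule be_closed[OF Um u])
      show "E (Suc n) (B n (be (Fib \<omega> ?U) u) y) = L (be (Fib \<omega> ?U) u) \<otimes>\<^bsub>A\<^esub> E n y"
      proof (rule bc_lin_eq[OF Tm A.self_module _ _ _ y, of "\<lambda>y. E (Suc n) (B n (be (Fib \<omega> ?U) u) y)"
            "\<lambda>y. L (be (Fib \<omega> ?U) u) \<otimes>\<^bsub>A\<^esub> E n y"])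
        show "(\<lambda>y. E (Suc n) (B n (be (Fib \<omega> ?U) u) y)) \<in> lin A (bc (Fib \<omega> (T n))) (self_module A)"
          by (rule lin_compose[OF bilinear_lin2[OF B ub] E(1)])
        show "(\<lambda>y. L (be (Fib \<omega> ?U) u) \<otimes>\<^bsub>A\<^esub> E n y) \<in> lin A (bc (Fib \<omega> (T n))) (self_module A)"
          by (rule linI)
            (use Lc[OF ub] Ec lin_add[OF E(1)] lin_smult[OF E(1)] in \<open>auto simp: A.r_distr A.m_lcomm\<close>)
        fix s assume s: "s \<in> carrier (Fib \<omega> (T n))"
        have "\<epsilon> n s \<in> carrier k" "l u \<in> carrier k" "\<beta> n u s \<in> carrier (Fib \<omega> (T (Suc n)))"
          using lin_closed[OF e s] lin_closed[OF l u] bilinear_closed[OF tensor_tower_bilinear[OF tw] u s] by auto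
        then show "E (Suc n) (B n (be (Fib \<omega> ?U) u) (be (Fib \<omega> (T n)) s)) = L (be (Fib \<omega> ?U) u) \<otimes>\<^bsub>A\<^esub> E n (be (Fib \<omega> (T n)) s)"
          using Bbe[OF u s] E(2) L(2) es[OF u s] u s cU by (simp add: unit_map_mult)
      qed
    qed
    have E_pow: "E n (tpow B n x) = L x [^]\<^bsub>A\<^esub> Suc n" for n
    proof (induction n)
      case 0
      have "E 0 \<in> lin A ?UA (self_module A)" using E(1)[of 0] by (simp only: T0)
      moreover have "E 0 (be (Fib \<omega> ?U) u) = L (be (Fib \<omega> ?U) u)" if "u \<in> carrier (Fib \<omega> ?U)" for u
        using E(2)[of u 0] L(2)[of u] that cU by (simp add: T0 e0)
      ultimately have "E 0 x = L x"
        by (rule bc_lin_eq[OF Um A.self_module _ L(1) _ x])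
      then show ?case using Lc[OF x] by simp
    next
      case (Suc n)
      then show ?case using E_mult[OF x tB, of n] Lc[OF x] by (simp add: A.m_comm)
    qed
    \<comment> \<open>on the powers, \<open>l \<otimes> \<dots> \<otimes> l\<close> takes the value \<open>root (\<mu> v)\<^sup>p = \<mu> v\<close>\<close>
    have eq_on_P: "E ?q (\<iota>A z) = M (\<pi>A z)" if z: "z \<in> carrier (bc (Fib \<omega> P))" for z
    proof (rule bc_lin_eq[OF Pm A.self_module lin_compose[OF \<iota>A(1) E(1)] lin_compose[OF \<pi>A(1) M] _ z])
      fix s assume s: "s \<in> carrier (Fib \<omega> P)"
      have isc: "\<iota> s \<in> carrier (Fib \<omega> (T ?q))" using lin_closed[OF mor_lin[OF P T \<iota>] s] .
      have "\<epsilon> ?q (\<iota> s) = \<mu> (r (\<iota> s))"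
      proof (rule lin_eq_on_span[OF Tm _ e lin_compose[OF r(1) \<mu>] tc])
        show "Module.module k (regular_module k)" by (rule regular_module[OF is_cring])
        show "\<iota> s \<in> LinearCombinations.module.span k (Fib \<omega> (T ?q)) (tpow \<beta> ?q ` carrier (Fib \<omega> V))"
          using im s by blast
        fix y assume "y \<in> tpow \<beta> ?q ` carrier (Fib \<omega> V)"
        then obtain w where w: "w \<in> carrier (Fib \<omega> V)" "y = tpow \<beta> ?q w" by auto
        have "\<mu> w \<in> carrier k" using lin_closed[OF \<mu> w(1)] by simp
        then show "\<epsilon> ?q y = \<mu> (r y)"
          using tensor_tower_functional_tpow[OF field_axioms tw l e0 es, of w ?q] w cU r(2) frob_root[of "\<mu> w"]
          unfolding pq by (simp add: frob_def l_def)
      qed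
      then show "E ?q (\<iota>A (be (Fib \<omega> P) s)) = M (\<pi>A (be (Fib \<omega> P) s))"
        using \<iota>A(2)[OF s] \<pi>A(2)[OF s] E(2)[OF isc] Mbe \<pi>r[OF r s] lin_closed[OF r(1) isc] by simp
    qed
    have M_m: "M (m z) = L z [^]\<^bsub>A\<^esub> p" if "z \<in> carrier ?UA" for z
      using that
    proof (induction rule: bc_induct[OF Um, consumes 1, case_names zero base add smult])
      case zero
      have "\<zero>\<^bsub>A\<^esub> [^]\<^bsub>A\<^esub> p = \<zero>\<^bsub>A\<^esub>" using p_pos by (simp add: A.nat_pow_zero)
      then show ?case
        using lin_zero[OF bc_module[OF Um] twist_module[OF bc_module[OF Vm] Afrob_ring_hom] m]
          lin_zero[OF bc_module[OF Vm] A.self_module M] lin_zero[OF bc_module[OF Um] A.self_module L(1)] by simp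
    next
      case (base u)
      have "\<mu> u \<in> carrier k" using lin_closed[OF \<mu>] base cU by simp
      then show ?case
        using m_be[of u] Mbe L(2)[of u] base cU unit_map_pow[of "root (\<mu> u)" p] frob_root[of "\<mu> u"]
        by (simp add: frob_def l_def)
    next
      case (add y z)
      have "m y \<in> carrier ?VA" "m z \<in> carrier ?VA" using lin_closed[OF m add(1)] lin_closed[OF m add(2)] by auto
      then show ?case
        using add lin_add[OF m add(1,2)] lin_add[OF M] lin_add[OF L(1) add(1,2)] Lc A_frob_add by simp
    next
      case (smult a z)
      have "m z \<in> carrier ?VA" using lin_closed[OF m smult(2)] by auto
      then show ?case
        using smult lin_smult[OF m smult(1,2)] lin_smult[OF M] lin_smult[OF L(1) smult(1,2)] Lc A.nat_pow_distrib by simp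
    qed
    have tP: "be (Fib \<omega> P) t \<in> carrier (bc (Fib \<omega> P))" by (rule be_closed[OF Pm t(1)])
    have eP: "\<eta> P (be (Fib \<omega> P) t) \<in> carrier (bc (Fib \<omega> P))" by (rule lin_closed[OF nat(1)[OF P] tP])
    have "M (\<eta> V (be (Fib \<omega> V) v)) = M (\<eta> V (\<pi>A (be (Fib \<omega> P) t)))"
      using \<pi>A(2)[OF t(1)] \<pi>t by simp
    also have "\<dots> = M (\<pi>A (\<eta> P (be (Fib \<omega> P) t)))"
      using nat(2)[OF P V \<pi> \<pi>A tP] by simp
    also have "\<dots> = E ?q (\<iota>A (\<eta> P (be (Fib \<omega> P) t)))" using eq_on_P[OF eP] by simp
    also have "\<dots> = E ?q (\<eta> (T ?q) (\<iota>A (be (Fib \<omega> P) t)))"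
      using nat(2)[OF P T \<iota> \<iota>A tP] by simp
    also have "\<dots> = E ?q (tpow B ?q x)" using \<iota>A(2)[OF t(1)] t(2) eta_pow by simp
    also have "\<dots> = L x [^]\<^bsub>A\<^esub> p" using E_pow[of ?q] unfolding pq .
    also have "\<dots> = M (m x)" using M_m[OF x] by simp
    finally show "M (\<eta> V (be (Fib \<omega> V) v)) = M (m (\<eta> ?U (be (Fib \<omega> ?U) v)))" by (simp add: x_def)
  qed
qed

text \<open>Both sides are semilinear in \<open>x\<close>, so the elements \<open>v \<otimes> 1\<close> suffice.\<close>

lemma tensor_automorphism_frob:
  assumes \<eta>: "\<eta> \<in> tensor_automorphisms k \<omega> A" and V: "V \<in> Obj \<omega>"
    and m: "m \<in> lin A (bc (Fib \<omega> (\<tau> V))) (twist Afrob (bc (Fib \<omega> V)))"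
    and m_be: "\<And>v. v \<in> carrier (Fib \<omega> V) \<Longrightarrow> m (be (Fib \<omega> (\<tau> V)) v) = be (Fib \<omega> V) v"
    and x: "x \<in> carrier (bc (Fib \<omega> (\<tau> V)))"
  shows "\<eta> V (m x) = m (\<eta> (\<tau> V) x)"
proof -
  let ?Q = "twist Afrob (bc (Fib \<omega> V))"
  note U = tau_obj[OF V] and nat = tensor_automorphismsD[OF \<eta>]
  have cU: "carrier (Fib \<omega> (\<tau> V)) = carrier (Fib \<omega> V)" using tau_fib[OF V] by simp
  have Q: "Module.module A ?Q" by (rule twist_module[OF bc_module[OF fib_module[OF V]] Afrob_ring_hom])
  have "\<eta> V \<in> lin A ?Q ?Q" by (rule lin_twist[OF nat(1)[OF V]]) simp
  then show ?thesis
    by (intro bc_lin_eq[OF fib_module[OF U] Q lin_compose[OF m] lin_compose[OF nat(1)[OF U] m] _ x])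
      (use tensor_automorphism_frob_gen[OF \<eta> V m m_be] m_be cU in auto)
qed

end

context twisted_fibre_functor
begin

lemma tensor_automorphisms_untwist:
  assumes A: "algebra k A" and \<eta>: "\<eta> \<in> tensor_automorphisms k \<omega> A"
  shows "(\<lambda>V\<in>Obj \<omega>. \<eta> (\<tau> V)) \<in> tensor_automorphisms k \<omega> (twist root A)"
proof -
  note nat = tensor_automorphismsD[OF \<eta>]
  have bc: "base_change k (twist root A) (Fib \<omega> V) = base_change k A (Fib \<omega> (\<tau> V))"
    "base_elt k (twist root A) (Fib \<omega> V) = base_elt k A (Fib \<omega> (\<tau> V))"
    "carrier (Fib \<omega> V) = carrier (Fib \<omega> (\<tau> V))" if "V \<in> Obj \<omega>" for V
    using base_change_untwist[OF A fib_module[OF that]] tau_fib[OF that] by simp_all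
  show ?thesis
    unfolding tensor_automorphisms_def Let_def lin_twist_ring bilinear_maps_twist_ring
  proof (intro CollectI conjI ballI impI)
    fix V assume V: "V \<in> Obj \<omega>"
    note tV = tau_obj[OF V]
    show "(\<lambda>V\<in>Obj \<omega>. \<eta> (\<tau> V)) V \<in> extensional (carrier (base_change k (twist root A) (Fib \<omega> V)))"
      "(\<lambda>V\<in>Obj \<omega>. \<eta> (\<tau> V)) V \<in> lin A (base_change k (twist root A) (Fib \<omega> V)) (base_change k (twist root A) (Fib \<omega> V))"
      "bij_betw ((\<lambda>V\<in>Obj \<omega>. \<eta> (\<tau> V)) V) (carrier (base_change k (twist root A) (Fib \<omega> V))) (carrier (base_change k (twist root A) (Fib \<omega> V)))"
      using V nat(1,5,6)[OF tV] by (simp_all add: bc)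
    show "(\<lambda>V\<in>Obj \<omega>. \<eta> (\<tau> V)) V (base_elt k (twist root A) (Fib \<omega> V) u) = base_elt k (twist root A) (Fib \<omega> V) u"
      if "u \<in> Unit \<omega> V" for u
      using nat(7)[OF tV tau_unit[OF V that]] V by (simp add: bc)
    fix W assume W: "W \<in> Obj \<omega>"
    note tW = tau_obj[OF W]
    show "(\<lambda>V\<in>Obj \<omega>. \<eta> (\<tau> V)) W (g x) = g ((\<lambda>V\<in>Obj \<omega>. \<eta> (\<tau> V)) V x)"
      if "f \<in> Mor \<omega> V W" "g \<in> lin A (base_change k (twist root A) (Fib \<omega> V)) (base_change k (twist root A) (Fib \<omega> W))"
        "\<forall>v\<in>carrier (Fib \<omega> V). g (base_elt k (twist root A) (Fib \<omega> V) v) = base_elt k (twist root A) (Fib \<omega> W) (f v)"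
        "x \<in> carrier (base_change k (twist root A) (Fib \<omega> V))" for f g x
      using nat(2)[OF tV tW tau_mor[OF V W that(1)], of g x] that V W by (simp add: bc)
    fix T assume T: "T \<in> Obj \<omega>"
    note tT = tau_obj[OF T]
    show "(\<lambda>V\<in>Obj \<omega>. \<eta> (\<tau> V)) T (B x y) = B ((\<lambda>V\<in>Obj \<omega>. \<eta> (\<tau> V)) V x) ((\<lambda>V\<in>Obj \<omega>. \<eta> (\<tau> V)) W y)"
      if "\<beta> \<in> Tens \<omega> V W T"
        "B \<in> bilinear_maps A (base_change k (twist root A) (Fib \<omega> V)) (base_change k (twist root A) (Fib \<omega> W)) (base_change k (twist root A) (Fib \<omega> T))"
        "\<forall>v\<in>carrier (Fib \<omega> V). \<forall>w\<in>carrier (Fib \<omega> W). B (base_elt k (twist root A) (Fib \<omega> V) v) (base_elt k (twist root A) (Fib \<omega> W) w) = base_elt k (twist root A) (Fib \<omega> T) (\<beta> v w)"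
        "x \<in> carrier (base_change k (twist root A) (Fib \<omega> V))" "y \<in> carrier (base_change k (twist root A) (Fib \<omega> W))" for \<beta> B x y
      using nat(3)[OF tV tW tT tau_tens[OF V W T that(1)], of B x y] that V W T by (simp add: bc)
  qed auto
qed

text \<open>The family \<open>\<theta>\<close> of the components of \<open>\<eta>\<close> at the twisted objects is a point over \<open>A\<^bsup>1/p\<^esup>\<close>, and \<open>h\<close> is the
  homomorphism that classifies it. The image of \<open>\<theta>\<close> under the \<open>p\<close>-power map is the universal point \<open>\<eta>\<close>
  again; so the \<open>p\<close>-power map after \<open>h\<close> is the identity.\<close>

theorem tannakian_dual_perfect:
  assumes dual: "tannakian_dual k \<omega> A G"
  shows "perfect_group_scheme p k A G"
proof -
  have ags: "affine_group_scheme k A G" using dual by (simp add: tannakian_dual_def)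
  then have alg: "algebra k A" and carrier_G: "\<And>R. algebra k R \<Longrightarrow> carrier (G R) = alg_hom k A R"
    by (auto simp: affine_group_scheme_def)
  obtain \<Phi> where *: "\<forall>R. algebra k R \<longrightarrow> \<Phi> R \<in> iso (G R) (tensor_aut_group k \<omega> R)"
    "\<forall>R S \<phi>. algebra k R \<and> algebra k S \<and> \<phi> \<in> alg_hom k R S \<longrightarrow>
       (\<forall>h\<in>carrier (G R). tensor_aut_induced k \<omega> R S \<phi> (\<Phi> R h) (\<Phi> S (compose (carrier A) \<phi> h)))"
    using dual unfolding tannakian_dual_def by blast
  have \<Phi>: "\<And>R. algebra k R \<Longrightarrow> \<Phi> R \<in> iso (G R) (tensor_aut_group k \<omega> R)"
    and \<Phi>_nat: "\<And>R S \<phi> h. algebra k R \<Longrightarrow> algebra k S \<Longrightarrow> \<phi> \<in> alg_hom k R S \<Longrightarrow> h \<in> carrier (G R) \<Longrightarrow>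
      tensor_aut_induced k \<omega> R S \<phi> (\<Phi> R h) (\<Phi> S (compose (carrier A) \<phi> h))"
    using * by simp_all
  have \<Phi>_bij: "bij_betw (\<Phi> R) (alg_hom k A R) (tensor_automorphisms k \<omega> R)" if "algebra k R" for R
    using \<Phi>[OF that] carrier_G[OF that] by (simp add: iso_def tensor_aut_group_def)
  interpret twisted_fibre_functor_algebra k p \<omega> \<tau> A
    by (intro_locales) (simp add: k_algebra_def alg)
  let ?R = "twist root A"
  note algR = algebra_untwist[OF alg]
  let ?id = "\<lambda>a\<in>carrier A. a"
  let ?Fr = "\<lambda>a\<in>carrier A. Afrob a"
  have id: "?id \<in> alg_hom k A A"
    unfolding alg_hom_def
    by (intro IntI ring_hom_memI linI) auto
  define \<eta> where "\<eta> = \<Phi> A ?id"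
  have \<eta>: "\<eta> \<in> tensor_automorphisms k \<omega> A"
    unfolding \<eta>_def by (rule bij_betwE[OF \<Phi>_bij[OF alg], rule_format, OF id])
  define \<theta> where "\<theta> = (\<lambda>V\<in>Obj \<omega>. \<eta> (\<tau> V))"
  have \<theta>: "\<theta> \<in> tensor_automorphisms k \<omega> ?R"
    unfolding \<theta>_def by (rule tensor_automorphisms_untwist[OF alg \<eta>])
  then have "\<theta> \<in> \<Phi> ?R ` alg_hom k A ?R"
    using bij_betw_imp_surj_on[OF \<Phi>_bij[OF algR]] by simp
  then obtain h where h: "h \<in> alg_hom k A ?R" "\<Phi> ?R h = \<theta>" by blast
  define g where "g = compose (carrier A) ?Fr h"
  have hG: "h \<in> carrier (G ?R)" using h carrier_G[OF algR] by simp
  have "(\<lambda>h. compose (carrier A) ?Fr h) \<in> hom (G ?R) (G A)"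
    using ags algR alg Afrob_alg_hom by (auto simp: affine_group_scheme_def)
  then have g: "g \<in> alg_hom k A A"
    unfolding g_def using hG carrier_G[OF alg] by (auto simp: hom_def)
  define \<zeta> where "\<zeta> = \<Phi> A g"
  have \<zeta>: "\<zeta> \<in> tensor_automorphisms k \<omega> A"
    unfolding \<zeta>_def by (rule bij_betwE[OF \<Phi>_bij[OF alg], rule_format, OF g])
  have ind: "tensor_aut_induced k \<omega> ?R A ?Fr \<theta> \<zeta>"
    using \<Phi>_nat[OF algR alg Afrob_alg_hom hG] by (simp add: h(2) \<zeta>_def g_def)
  have "\<zeta> = \<eta>"
  proof (rule extensionalityI)
    show "\<zeta> \<in> extensional (Obj \<omega>)" "\<eta> \<in> extensional (Obj \<omega>)"
      using tensor_automorphismsD(4) \<zeta> \<eta> by blast+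
    fix V assume V: "V \<in> Obj \<omega>"
    note Vm = fib_module[OF V] and Um = fib_module[OF tau_obj[OF V]]
    have tV: "Fib \<omega> (\<tau> V) = twist frob (Fib \<omega> V)" by (rule tau_fib[OF V])
    obtain m where m: "m \<in> lin A (bc (Fib \<omega> (\<tau> V))) (twist Afrob (bc (Fib \<omega> V)))"
      and m_be: "\<And>v. v \<in> carrier (Fib \<omega> V) \<Longrightarrow> m (be (Fib \<omega> (\<tau> V)) v) = be (Fib \<omega> V) v"
      using bc_frob[OF Vm] unfolding tV by auto
    have bcR: "base_change k ?R (Fib \<omega> V) = bc (Fib \<omega> (\<tau> V))" "base_elt k ?R (Fib \<omega> V) = be (Fib \<omega> (\<tau> V))"
      using base_change_untwist[OF alg Vm] unfolding tV by auto
    \<comment> \<open>the canonical map \<open>m\<close> is \<open>id \<otimes> Frob : \<omega>(V) \<otimes> A\<^bsup>1/p\<^esup> \<rightarrow> \<omega>(V) \<otimes> A\<close>, which relates \<open>\<theta>\<close> to \<open>\<zeta>\<close>\<close>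
    have zm: "\<zeta> V (m x) = m (\<eta> (\<tau> V) x)" if x: "x \<in> carrier (bc (Fib \<omega> (\<tau> V)))" for x
    proof -
      have *: "\<forall>m\<in>carrier (bc (Fib \<omega> (\<tau> V))) \<rightarrow> carrier (bc (Fib \<omega> V)).
          (\<forall>x\<in>carrier (bc (Fib \<omega> (\<tau> V))). \<forall>y\<in>carrier (bc (Fib \<omega> (\<tau> V))). m (x \<oplus>\<^bsub>bc (Fib \<omega> (\<tau> V))\<^esub> y) = m x \<oplus>\<^bsub>bc (Fib \<omega> V)\<^esub> m y) \<and>
          (\<forall>r\<in>carrier A. \<forall>x\<in>carrier (bc (Fib \<omega> (\<tau> V))). m (r \<odot>\<^bsub>bc (Fib \<omega> (\<tau> V))\<^esub> x) = ?Fr r \<odot>\<^bsub>bc (Fib \<omega> V)\<^esub> m x) \<and>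
          (\<forall>v\<in>carrier (Fib \<omega> V). m (be (Fib \<omega> (\<tau> V)) v) = be (Fib \<omega> V) v) \<longrightarrow>
          (\<forall>x\<in>carrier (bc (Fib \<omega> (\<tau> V))). \<zeta> V (m x) = m (\<theta> V x))"
        using ind V unfolding tensor_aut_induced_def Let_def bcR[symmetric] twist_simps by blast
      have "m \<in> carrier (bc (Fib \<omega> (\<tau> V))) \<rightarrow> carrier (bc (Fib \<omega> V))" using lin_closed[OF m] by simp
      from bspec[OF * this] have "\<zeta> V (m x) = m (\<theta> V x)"
        using lin_add[OF m] lin_smult[OF m] m_be x by simp
      then show ?thesis using V by (simp add: \<theta>_def)
    qed
    have be_eq: "\<zeta> V (be (Fib \<omega> V) v) = \<eta> V (be (Fib \<omega> V) v)" if v: "v \<in> carrier (Fib \<omega> V)" for v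
    proof -
      have "be (Fib \<omega> (\<tau> V)) v \<in> carrier (bc (Fib \<omega> (\<tau> V)))"
        by (rule be_closed[OF Um]) (use v tV in simp)
      then show ?thesis
        using zm tensor_automorphism_frob[OF \<eta> V m m_be] m_be[OF v] by metis
    qed
    show "\<zeta> V = \<eta> V"
    proof (rule extensionalityI)
      show "\<zeta> V \<in> extensional (carrier (bc (Fib \<omega> V)))" "\<eta> V \<in> extensional (carrier (bc (Fib \<omega> V)))"
        using tensor_automorphismsD(5)[OF \<zeta> V] tensor_automorphismsD(5)[OF \<eta> V] .
      show "\<zeta> V x = \<eta> V x" if "x \<in> carrier (bc (Fib \<omega> V))" for x
        by (rule bc_lin_eq[OF Vm bc_module[OF Vm] tensor_automorphismsD(1)[OF \<zeta> V]
              tensor_automorphismsD(1)[OF \<eta> V] be_eq that])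
    qed
  qed
  then have "g = ?id"
    using bij_betw_imp_inj_on[OF \<Phi>_bij[OF alg]] g id unfolding \<zeta>_def \<eta>_def by (auto dest: inj_onD)
  have hc: "h a \<in> carrier A" if "a \<in> carrier A" for a
    using lin_closed[OF alg_homD(2)[OF h(1)] that] by simp
  have Fh: "Afrob (h a) = a" if a: "a \<in> carrier A" for a
    using fun_cong[OF \<open>g = ?id\<close>, of a] a hc[OF a] by (simp add: g_def compose_def)
  have hF: "h (Afrob a) = a" if a: "a \<in> carrier A" for a
  proof -
    have "h (a [^]\<^bsub>A\<^esub> n) = h a [^]\<^bsub>A\<^esub> n" for n :: nat
      using ring_hom_mult[OF alg_homD(1)[OF h(1)]] ring_hom_one[OF alg_homD(1)[OF h(1)]] a
      by (induction n) auto
    then show ?thesis using Fh[OF a] by simp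
  qed
  have "bij_betw Afrob (carrier A) (carrier A)"
    by (rule bij_betw_byWitness[of _ h]) (use Fh hF hc in auto)
  then show ?thesis using ags by (simp add: perfect_group_scheme_def)
qed

end

section \<open>Spans in finite-dimensional spaces\<close>

lemma subspace_inclusion: "(\<lambda>v. v) \<in> lin R (V\<lparr>carrier := C\<rparr>) V" if "C \<subseteq> carrier V"
  by (rule linI) (use that in auto)

text \<open>A maximal linearly independent subset of \<open>S\<close> is a finite basis of the span.\<close>

lemma span_fd_space:
  assumes V: "fd_space k V" and S: "S \<subseteq> carrier V"
  shows "fd_space k (V\<lparr>carrier := LinearCombinations.module.span k V S\<rparr>)"
proof -
  interpret V: vectorspace k V using V by (simp add: fd_space_def)
  obtain C where C: "finite C" "C \<subseteq> carrier V" "V.gen_set C" using V by (auto simp: fd_space_def V.fin_dim_def)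
  let ?P = "\<lambda>B. B \<subseteq> S \<and> V.lin_indpt B"
  have fin: "finite B" if "?P B" for B
    by (rule V.fin_dim_li_fin) (use that V S in \<open>auto simp: fd_space_def\<close>)
  have bound: "card B < Suc (card C)" if "?P B" for B
  proof -
    have "B \<subseteq> carrier V" using that S by blast
    then show ?thesis
      using V.li_smaller_than_gen[OF fin[OF that] C(1) _ C(2)] that C(3) by (simp add: less_Suc_eq_le)
  qed
  have "?P {}" by (simp add: V.lin_dep_def)
  then obtain B where B: "?P B" and max: "\<And>B'. ?P B' \<Longrightarrow> card B' \<le> card B"
    using ex_has_greatest_nat[of ?P "{}" card "Suc (card C)"] bound by blast
  note Bfin = fin[OF B]
  have Bc: "B \<subseteq> carrier V" using B S by blast
  have subB: "LinearCombinations.submodule k (V.span B) V" by (rule V.span_is_submodule[OF Bc])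
  have "s \<in> V.span B" if s: "s \<in> S" for s
  proof (rule ccontr)
    assume n: "s \<notin> V.span B"
    then have "s \<notin> B" using V.in_own_span[OF Bc] by blast
    then have "V.lin_indpt (B \<union> {s})"
      using V.lin_dep_iff_in_span[OF Bc, of s] B n s S by blast
    then have "card (B \<union> {s}) \<le> card B" using max[of "B \<union> {s}"] B s by blast
    then show False using \<open>s \<notin> B\<close> Bfin by simp
  qed
  then have "V.span S \<subseteq> V.span B" by (intro V.span_is_subset[OF _ subB] subsetI) 
  moreover have "V.span B \<subseteq> V.span S" using B by (intro V.span_is_monotone) blast
  ultimately have eq: "V.span S = V.span B" by blast
  let ?W = "V\<lparr>carrier := V.span B\<rparr>"
  have vsW: "vectorspace k ?W"
    by (rule V.subspace_is_vs[OF V.span_is_subspace[OF Bc]])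
  interpret W: vectorspace k ?W by (rule vsW)
  have cW: "V.span B \<subseteq> carrier V" by (rule V.span_is_subset2[OF Bc])
  have own: "B \<subseteq> V.span B" by (rule V.in_own_span[OF Bc])
  have sum: "(\<Oplus>\<^bsub>?W\<^esub>i\<in>B. a i \<odot>\<^bsub>?W\<^esub> i) = V.lincomb a B" if "a \<in> B \<rightarrow> carrier k" for a
  proof -
    have "(\<lambda>i. a i \<odot>\<^bsub>?W\<^esub> i) \<in> B \<rightarrow> carrier ?W"
      using that own by (auto intro!: W.smult_closed[simplified])
    from lin_finsum[OF W.module_axioms V.module_axioms subspace_inclusion[OF cW] this]
    show ?thesis by (simp add: V.lincomb_def)
  qed
  have "\<exists>d. dual_basis k ?W B (\<lambda>v. v) d"
  proof (rule dual_basisI[OF W.module_axioms Bfin])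
    fix v assume "v \<in> carrier ?W"
    then obtain a where "a \<in> B \<rightarrow> carrier k" "V.lincomb a B = v"
      using V.finite_in_span[OF Bfin Bc, of v] by auto
    then show "\<exists>a\<in>B \<rightarrow> carrier k. v = (\<Oplus>\<^bsub>?W\<^esub>i\<in>B. a i \<odot>\<^bsub>?W\<^esub> i)"
      using sum by (intro bexI[of _ a]) auto
  next
    fix a i assume "a \<in> B \<rightarrow> carrier k" "(\<Oplus>\<^bsub>?W\<^esub>i\<in>B. a i \<odot>\<^bsub>?W\<^esub> i) = \<zero>\<^bsub>?W\<^esub>" "i \<in> B"
    then show "a i = \<zero>\<^bsub>k\<^esub>"
      using V.lin_dep_crit[OF Bfin order_refl, of a i] B sum by auto
  qed (use own in auto)
  then show ?thesis unfolding eq using dual_basis_imp_fd_space[OF vsW] by blast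
qed

lemma (in perfect_char) lin_twist_adjoint_set: "lin k (twist frob M) N = lin k M (twist root N)"
  using lin_twist_adjoint by blast

text \<open>Linear and bilinear maps from twisted spaces to \<open>Z\<close> are the same as maps from the original spaces to
  \<open>twist root Z\<close>.\<close>

lemma (in perfect_char) twist_is_tensor_product:
  fixes V W T :: "('k, 'v) module"
  assumes "is_tensor_product k V W T \<beta>"
  shows "is_tensor_product k (twist frob V) (twist frob W) (twist frob T) \<beta>"
  unfolding is_tensor_product_def
proof (intro conjI allI impI)
  have \<beta>: "\<beta> \<in> bilinear_maps k V W T" using assms by (simp add: is_tensor_product_def)
  show "\<beta> \<in> bilinear_maps k (twist frob V) (twist frob W) (twist frob T)"
    by (rule bilinear_mapsI) (auto intro!: lin_twist bilinear_lin1[OF \<beta>] bilinear_lin2[OF \<beta>])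
  fix Z :: "('k, 'v) module" and \<gamma>
  assume Z: "vectorspace k Z \<and> \<gamma> \<in> bilinear_maps k (twist frob V) (twist frob W) Z"
  have \<gamma>: "\<gamma> \<in> bilinear_maps k V W (twist root Z)"
    using bilinear_lin1[of \<gamma> k "twist frob V" "twist frob W" Z] bilinear_lin2[of \<gamma> k "twist frob V" "twist frob W" Z] Z
    by (intro bilinear_mapsI) (auto simp: lin_twist_adjoint)
  have U: "\<forall>(Z :: ('k, 'v) module) \<gamma>. vectorspace k Z \<and> \<gamma> \<in> bilinear_maps k V W Z \<longrightarrow>
      (\<exists>f\<in>lin k T Z. (\<forall>x\<in>carrier V. \<forall>y\<in>carrier W. f (\<beta> x y) = \<gamma> x y) \<and>
        (\<forall>f'\<in>lin k T Z. (\<forall>x\<in>carrier V. \<forall>y\<in>carrier W. f' (\<beta> x y) = \<gamma> x y) \<longrightarrow>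
          (\<forall>t\<in>carrier T. f' t = f t)))"
    using assms unfolding is_tensor_product_def by (rule conjunct2)
  have "vectorspace k (twist root Z)" using Z untwist_vectorspace by blast
  with spec[OF spec[OF U, of "twist root Z"], of \<gamma>] \<gamma> show "\<exists>f\<in>lin k (twist frob T) Z. (\<forall>x\<in>carrier (twist frob V). \<forall>y\<in>carrier (twist frob W). f (\<beta> x y) = \<gamma> x y) \<and>
      (\<forall>f'\<in>lin k (twist frob T) Z. (\<forall>x\<in>carrier (twist frob V). \<forall>y\<in>carrier (twist frob W). f' (\<beta> x y) = \<gamma> x y) \<longrightarrow>
        (\<forall>t\<in>carrier (twist frob T). f' t = f t))"
    unfolding lin_twist_adjoint_set twist_simps by simp
qed

lemma (in perfect_char) bij_betw_frob: "bij_betw frob (carrier k) (carrier k)"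
  by (rule bij_betw_byWitness[of _ root]) auto

section \<open>Representations of a discrete group\<close>

lemma fd_representationD:
  assumes "fd_representation k \<Gamma> (V, \<rho>)"
  shows "fd_space k V" "g \<in> carrier \<Gamma> \<Longrightarrow> \<rho> g \<in> lin k V V" "v \<in> carrier V \<Longrightarrow> \<rho> \<one>\<^bsub>\<Gamma>\<^esub> v = v"
    "g \<in> carrier \<Gamma> \<Longrightarrow> h \<in> carrier \<Gamma> \<Longrightarrow> v \<in> carrier V \<Longrightarrow> \<rho> (g \<otimes>\<^bsub>\<Gamma>\<^esub> h) v = \<rho> g (\<rho> h v)"
  using assms by (auto simp: fd_representation_def)

lemma Rep_simps:
  "X \<in> Obj (Rep t k \<Gamma>) \<longleftrightarrow> fd_representation k \<Gamma> X" "Fib (Rep t k \<Gamma>) = fst"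
  "f \<in> Mor (Rep t k \<Gamma>) (V, \<rho>) (W, \<sigma>) \<longleftrightarrow> f \<in> lin k V W \<and> (\<forall>g\<in>carrier \<Gamma>. \<forall>v\<in>carrier V. f (\<rho> g v) = \<sigma> g (f v))"
  "\<beta> \<in> Tens (Rep t k \<Gamma>) (V, \<rho>) (W, \<sigma>) (T, \<tau>) \<longleftrightarrow> is_tensor_product k V W T \<beta> \<and>
     (\<forall>g\<in>carrier \<Gamma>. \<forall>v\<in>carrier V. \<forall>w\<in>carrier W. \<tau> g (\<beta> v w) = \<beta> (\<rho> g v) (\<sigma> g w))"
  "u \<in> Unit (Rep t k \<Gamma>) (V, \<rho>) \<longleftrightarrow> u \<in> carrier V \<and> bij_betw (\<lambda>c. c \<odot>\<^bsub>V\<^esub> u) (carrier k) (carrier V) \<and>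
     (\<forall>g\<in>carrier \<Gamma>. \<rho> g u = u)"
  by (auto simp: Rep_def)

lemma Rep_tensor_exists:
  fixes k :: "'k ring" and \<Gamma> :: "('g, 'z) monoid_scheme" and e :: "(nat \<Rightarrow> 'k) \<Rightarrow> 'v"
  assumes e: "inj e" and \<Gamma>: "group \<Gamma>"
    and V: "fd_representation k \<Gamma> (V :: ('k, 'v) module, \<rho>)" and W: "fd_representation k \<Gamma> (W, \<sigma>)"
  shows "\<exists>(T :: ('k, 'v) module) \<tau> \<beta>. fd_representation k \<Gamma> (T, \<tau>) \<and> tensor_pairing k V W T \<beta> \<and>
     (\<forall>g\<in>carrier \<Gamma>. \<forall>v\<in>carrier V. \<forall>w\<in>carrier W. \<tau> g (\<beta> v w) = \<beta> (\<rho> g v) (\<sigma> g w))"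
proof -
  interpret \<Gamma>: group \<Gamma> by fact
  note VD = fd_representationD[OF V] and WD = fd_representationD[OF W]
  obtain T0 :: "('k, nat \<Rightarrow> 'k) module" and \<beta>0 where T0: "fd_space k T0" "tensor_pairing k V W T0 \<beta>0"
    using tensor_pairing_exists[OF VD(1) WD(1)] by blast
  have T0m: "Module.module k T0" and Vm: "Module.module k V" and Wm: "Module.module k W" and field: "field k"
    using T0 VD(1) WD(1) by (auto simp: fd_space_def vectorspace_def)
  define T where "T = transport e T0"
  have ej: "inj_on e (carrier T0)" using e by (rule inj_on_subset) simp
  note Tm = transport(1)[OF T0m ej, folded T_def] and iso = transport(2)[OF T0m ej, folded T_def]
  have Tvs: "vectorspace k T" using Tm field by (simp add: vectorspace_def)
  have Tfd: "fd_space k T"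
    by (rule fd_space_imp_dual_basis[OF T0(1)], rule dual_basis_imp_fd_space[OF Tvs dual_basis_iso[OF T0m Tm _ iso]])
  define \<beta> where "\<beta> v w = e (\<beta>0 v w)" for v w
  have tp: "tensor_pairing k V W T \<beta>"
    by (rule tensor_pairing_iso[OF T0m T0(2) iso Tm _ Vm Wm]) (simp add: \<beta>_def)
  have bil: "\<beta> \<in> bilinear_maps k V W T" using tp by (simp add: tensor_pairing_def)
  have "\<exists>f\<in>lin k T T. \<forall>v\<in>carrier V. \<forall>w\<in>carrier W. f (\<beta> v w) = \<beta> (\<rho> g v) (\<sigma> g w)" if g: "g \<in> carrier \<Gamma>" for g
  proof (rule tensor_extend[OF VD(1) WD(1) Tvs Tvs tp])
    show "(\<lambda>v w. \<beta> (\<rho> g v) (\<sigma> g w)) \<in> bilinear_maps k V W T"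
      by (rule bilinear_mapsI)
        (use lin_compose[OF WD(2)[OF g] bilinear_lin2[OF bil lin_closed[OF VD(2)[OF g]]]]
           lin_compose[OF VD(2)[OF g] bilinear_lin1[OF bil lin_closed[OF WD(2)[OF g]]]] in auto)
  qed
  then obtain \<tau> where \<tau>: "\<And>g. g \<in> carrier \<Gamma> \<Longrightarrow> \<tau> g \<in> lin k T T"
    and \<tau>\<beta>: "\<And>g v w. g \<in> carrier \<Gamma> \<Longrightarrow> v \<in> carrier V \<Longrightarrow> w \<in> carrier W \<Longrightarrow> \<tau> g (\<beta> v w) = \<beta> (\<rho> g v) (\<sigma> g w)"
    by metis
  have idT: "(\<lambda>t. t) \<in> lin k T T" by (rule linI) auto
  have "fd_representation k \<Gamma> (T, \<tau>)"
    unfolding fd_representation_def prod.case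
  proof (intro conjI ballI)
    show "fd_space k T" by (rule Tfd)
    show "\<tau> g \<in> lin k T T" if "g \<in> carrier \<Gamma>" for g by (rule \<tau>[OF that])
    show "\<tau> \<one>\<^bsub>\<Gamma>\<^esub> t = t" if "t \<in> carrier T" for t
      by (rule tensor_pairing_eq[OF tp Tm Tm \<tau>[OF \<Gamma>.one_closed] idT _ that])
        (use \<tau>\<beta> VD(3) WD(3) in auto)
    show "\<tau> (g \<otimes>\<^bsub>\<Gamma>\<^esub> h) t = \<tau> g (\<tau> h t)" if "g \<in> carrier \<Gamma>" "h \<in> carrier \<Gamma>" "t \<in> carrier T" for g h t
      by (rule tensor_pairing_eq[OF tp Tm Tm \<tau>[OF \<Gamma>.m_closed[OF that(1,2)]] lin_compose[OF \<tau>[OF that(2)] \<tau>[OF that(1)]] _ that(3)])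
        (use \<tau>\<beta> VD(2,4) WD(2,4) that lin_closed[OF VD(2)] lin_closed[OF WD(2)] in auto)
  qed
  with tp \<tau>\<beta> have "fd_representation k \<Gamma> (T, \<tau>) \<and> tensor_pairing k V W T \<beta> \<and>
     (\<forall>g\<in>carrier \<Gamma>. \<forall>v\<in>carrier V. \<forall>w\<in>carrier W. \<tau> g (\<beta> v w) = \<beta> (\<rho> g v) (\<sigma> g w))" by simp
  then show ?thesis by (intro exI)
qed

context perfect_char
begin

text \<open>The span of the powers is stable under the group, and a retraction is equivariant on it because it
  is on the powers.\<close>

lemma Rep_twisted_fibre_functor:
  fixes \<Gamma> :: "('g, 'z) monoid_scheme"
  assumes large: "large_for_spaces TYPE('v) k" and \<Gamma>: "group \<Gamma>"
  shows "twisted_fibre_functor k p (Rep TYPE('v) k \<Gamma>) (\<lambda>(V, \<rho>). (twist frob V, \<rho>))"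
proof
  let ?\<omega> = "Rep TYPE('v) k \<Gamma>"
  let ?\<tau> = "\<lambda>(V :: ('k, 'v) module, \<rho> :: 'g \<Rightarrow> 'v \<Rightarrow> 'v). (twist frob V, \<rho>)"
  obtain e :: "(nat \<Rightarrow> 'k) \<Rightarrow> 'v" where e: "inj e" using large by (auto simp: large_for_spaces_def)
  interpret \<Gamma>: group \<Gamma> by fact
  fix X assume X: "X \<in> Obj ?\<omega>"
  obtain V \<rho> where X_eq: "X = (V, \<rho>)" by (cases X)
  have V: "fd_representation k \<Gamma> (V, \<rho>)" using X by (simp add: X_eq Rep_simps)
  note VD = fd_representationD[OF V]
  show "fd_space k (Fib ?\<omega> X)" using VD by (simp add: Rep_simps X_eq)
  show "?\<tau> X \<in> Obj ?\<omega>"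
    unfolding X_eq prod.case Rep_simps fd_representation_def
    by (intro conjI ballI twist_fd_space VD lin_twist) (use VD in simp_all)
  show "Fib ?\<omega> (?\<tau> X) = twist frob (Fib ?\<omega> X)" by (simp add: X_eq Rep_simps)
  show "u \<in> Unit ?\<omega> (?\<tau> X)" if "u \<in> Unit ?\<omega> X" for u
  proof -
    have "bij_betw (\<lambda>c. c \<odot>\<^bsub>V\<^esub> u) (carrier k) (carrier V)" using that by (simp add: X_eq Rep_simps)
    from bij_betw_trans[OF bij_betw_frob this] show ?thesis
      using that by (simp add: X_eq Rep_simps o_def)
  qed
  show "\<exists>P\<in>Obj ?\<omega>. \<exists>\<iota>\<in>Mor ?\<omega> P (T (p - 1)). \<exists>\<pi>\<in>Mor ?\<omega> P X.
      \<iota> ` carrier (Fib ?\<omega> P) = LinearCombinations.module.span k (Fib ?\<omega> (T (p - 1))) (tpow \<beta> (p - 1) ` carrier (Fib ?\<omega> X)) \<and>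
      (\<forall>r\<in>lin k (Fib ?\<omega> (T (p - 1))) (Fib ?\<omega> X). (\<forall>v\<in>carrier (Fib ?\<omega> X). r (tpow \<beta> (p - 1) v) = v) \<longrightarrow>
         (\<forall>t\<in>carrier (Fib ?\<omega> P). \<pi> t = r (\<iota> t)))"
    if T0: "T 0 = ?\<tau> X" and T: "\<And>n. T n \<in> Obj ?\<omega>" and \<beta>: "\<And>n. \<beta> n \<in> Tens ?\<omega> (?\<tau> X) (T n) (T (Suc n))"
      and tw: "tensor_tower k (Fib ?\<omega> (?\<tau> X)) (\<lambda>n. Fib ?\<omega> (T n)) \<beta>" for T \<beta>
  proof -
    let ?q = "p - 1"
    let ?T = "\<lambda>n. fst (T n)" and ?t = "\<lambda>n. snd (T n)"
    have tw': "tensor_tower k (twist frob V) ?T \<beta>" using tw by (simp add: Rep_simps X_eq)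
    have TD: "fd_representation k \<Gamma> (?T n, ?t n)" for n using T by (simp add: Rep_simps)
    note TD = fd_representationD[OF TD]
    have equi: "?t (Suc n) g (\<beta> n v w) = \<beta> n (\<rho> g v) (?t n g w)"
      if "g \<in> carrier \<Gamma>" "v \<in> carrier V" "w \<in> carrier (?T n)" for n g v w
      using \<beta>[of n] that Rep_simps(4)[of "\<beta> n" "TYPE('v)" k \<Gamma> "twist frob V" \<rho> "?T n" "?t n" "?T (Suc n)" "?t (Suc n)"]
      by (simp add: X_eq)
    have pow_closed: "tpow \<beta> n v \<in> carrier (?T n)" if "v \<in> carrier V" for n v
      using tpow_closed[OF tw'] that by simp
    have pow_equi: "?t n g (tpow \<beta> n v) = tpow \<beta> n (\<rho> g v)" if "g \<in> carrier \<Gamma>" "v \<in> carrier V" for n g v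
      by (induction n) (use that T0 equi pow_closed in \<open>auto simp: X_eq\<close>)
    have Vm: "Module.module k V" and Tm: "Module.module k (?T n)" for n
      using VD(1) TD(1) by (auto simp: fd_space_def vectorspace_def)
    interpret Tq: Module.module k "?T ?q" by (rule Tm)
    let ?S = "tpow \<beta> ?q ` carrier V"
    have S: "?S \<subseteq> carrier (?T ?q)" using pow_closed by blast
    have spc: "Tq.span ?S \<subseteq> carrier (?T ?q)" by (rule Tq.span_is_subset2[OF S])
    interpret sp: LinearCombinations.submodule k "Tq.span ?S" "?T ?q" by (rule Tq.span_is_submodule[OF S])
    let ?P = "(?T ?q\<lparr>carrier := Tq.span ?S\<rparr>, ?t ?q)"
    have inv: "?t ?q g s \<in> Tq.span ?S" if g: "g \<in> carrier \<Gamma>" and s: "s \<in> Tq.span ?S" for g s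
      using s S
    proof (induction rule: Tq.span_induct)
      case (base s)
      then obtain v where v: "v \<in> carrier V" "s = tpow \<beta> ?q v" by auto
      have "?t ?q g s \<in> ?S" using pow_equi[OF g v(1)] v lin_closed[OF VD(2)[OF g] v(1)] by auto
      then show ?case using Tq.in_own_span[OF S] by blast
    next
      case (add x y)
      then show ?case using lin_add[OF TD(2)[OF g] add(1,2)] sp.m_closed by simp
    next
      case (smult c x)
      then show ?case using lin_smult[OF TD(2)[OF g] smult(1,2)] sp.smult_closed by simp
    next
      case zero
      show ?case using lin_zero[OF Tm Tm TD(2)[OF g]] sp.zero_closed by simp
    qed
    have P: "?P \<in> Obj ?\<omega>"
      unfolding Rep_simps fd_representation_def prod.case
    proof (intro conjI ballI)
      show "fd_space k (?T ?q\<lparr>carrier := Tq.span ?S\<rparr>)" by (rule span_fd_space[OF TD(1) S])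
      show "?t ?q g \<in> lin k (?T ?q\<lparr>carrier := Tq.span ?S\<rparr>) (?T ?q\<lparr>carrier := Tq.span ?S\<rparr>)" if "g \<in> carrier \<Gamma>" for g
        by (rule linI)
          (use inv[OF that] lin_add[OF TD(2)[OF that] subsetD[OF spc] subsetD[OF spc]]
             lin_smult[OF TD(2)[OF that] _ subsetD[OF spc]] in auto)
    qed (use TD(3,4) spc in auto)
    obtain r where r: "r \<in> lin k (?T ?q) V" "\<forall>v\<in>carrier V. r (tpow \<beta> ?q v) = v"
      using tensor_power_retraction[OF VD(1) tw'] by blast
    have r_equi: "r (?t ?q g s) = \<rho> g (r s)" if g: "g \<in> carrier \<Gamma>" and s: "s \<in> Tq.span ?S" for g s
      by (rule lin_eq_on_span[OF Tm Vm lin_compose[OF TD(2)[OF g] r(1)] lin_compose[OF r(1) VD(2)[OF g]] S _ s])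
        (use r(2) pow_equi[OF g] lin_closed[OF VD(2)[OF g]] in auto)
    have \<iota>: "(\<lambda>t. t) \<in> Mor ?\<omega> ?P (T ?q)"
      using Rep_simps(3)[of "\<lambda>t. t" "TYPE('v)" k \<Gamma> "?T ?q\<lparr>carrier := Tq.span ?S\<rparr>" "?t ?q" "?T ?q" "?t ?q"]
        subspace_inclusion[OF spc] by simp
    have \<pi>: "r \<in> Mor ?\<omega> ?P X"
      unfolding X_eq Rep_simps
      using lin_compose[OF subspace_inclusion[OF spc] r(1)] r_equi by auto
    have uniq: "r t = r' t" if "r' \<in> lin k (?T ?q) V" "\<forall>v\<in>carrier V. r' (tpow \<beta> ?q v) = v" "t \<in> Tq.span ?S" for r' t
      by (rule lin_eq_on_span[OF Tm Vm r(1) that(1) S _ that(3)]) (use r(2) that(2) in auto)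
    show ?thesis
      by (intro bexI[OF _ P] bexI[OF _ \<iota>] bexI[OF _ \<pi>] conjI) (use uniq in \<open>auto simp: Rep_simps X_eq\<close>)
  qed
  fix Y assume Y: "Y \<in> Obj ?\<omega>"
  obtain W \<sigma> where Y_eq: "Y = (W, \<sigma>)" by (cases Y)
  have W: "fd_representation k \<Gamma> (W, \<sigma>)" using Y by (simp add: Y_eq Rep_simps)
  show "f \<in> lin k (Fib ?\<omega> X) (Fib ?\<omega> Y)" "f \<in> Mor ?\<omega> (?\<tau> X) (?\<tau> Y)" if "f \<in> Mor ?\<omega> X Y" for f
    using that lin_twist[of f k V W frob] by (auto simp: X_eq Y_eq Rep_simps)
  show "\<exists>T\<in>Obj ?\<omega>. \<exists>\<beta>\<in>Tens ?\<omega> X Y T. tensor_pairing k (Fib ?\<omega> X) (Fib ?\<omega> Y) (Fib ?\<omega> T) \<beta>"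
  proof -
    obtain T :: "('k, 'v) module" and \<tau> \<beta> where T: "fd_representation k \<Gamma> (T, \<tau>)" "tensor_pairing k V W T \<beta>"
      "\<forall>g\<in>carrier \<Gamma>. \<forall>v\<in>carrier V. \<forall>w\<in>carrier W. \<tau> g (\<beta> v w) = \<beta> (\<rho> g v) (\<sigma> g w)"
      using Rep_tensor_exists[OF e \<Gamma> V W] by blast
    have "is_tensor_product k V W T \<beta>"
      by (rule tensor_pairing_imp_is_tensor_product[OF _ _ _ T(2)])
        (use VD(1) fd_representationD(1)[OF W] fd_representationD(1)[OF T(1)] in \<open>auto simp: fd_space_def\<close>)
    then show ?thesis using T
      by (intro bexI[of _ "(T, \<tau>)"] bexI[of _ \<beta>]) (auto simp: X_eq Y_eq Rep_simps)
  qed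
  fix Z assume "Z \<in> Obj ?\<omega>"
  obtain T \<tau> where Z_eq: "Z = (T, \<tau>)" by (cases Z)
  show "\<beta> \<in> Tens ?\<omega> (?\<tau> X) (?\<tau> Y) (?\<tau> Z)" if "\<beta> \<in> Tens ?\<omega> X Y Z" for \<beta>
    using that twist_is_tensor_product by (auto simp: X_eq Y_eq Z_eq Rep_simps)
qed

end

section \<open>Germs and stalks\<close>

text \<open>The operations on stalks are unions over the members of germs. They are evaluated by showing that all
  members give the same set.\<close>

lemma UN_const_single:
  assumes "C \<noteq> {}" "\<And>U s. (U, s) \<in> C \<Longrightarrow> f U s = c"
  shows "(\<Union>(U, s)\<in>C. f U s) = c"
  by (rule SUP_eq_const[OF assms(1)]) (use assms(2) in \<open>auto split: prod.split\<close>)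

lemma UN_const_pair:
  assumes "C \<noteq> {}" "D \<noteq> {}" "\<And>U s V t. (U, s) \<in> C \<Longrightarrow> (V, t) \<in> D \<Longrightarrow> f U s V t = c"
  shows "(\<Union>(U, s)\<in>C. \<Union>(V, t)\<in>D. f U s V t) = c"
  by (rule UN_const_single[OF assms(1)], rule UN_const_single[OF assms(2)], rule assms(3))

locale sheaf_base =
  fixes k :: "'k ring" (structure) and X :: "'x topology"
  assumes is_field: "field k"
begin

sublocale K: field k by (rule is_field)

abbreviation nbhd where "nbhd U x \<equiv> openin X U \<and> x \<in> U"

lemma presheafD:
  assumes "presheaf_of_spaces k X F"
  shows "openin X U \<Longrightarrow> vectorspace k (Sec F U)"
    and "openin X U \<Longrightarrow> openin X V \<Longrightarrow> V \<subseteq> U \<Longrightarrow> Res F U V \<in> lin k (Sec F U) (Sec F V)"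
    and "openin X U \<Longrightarrow> s \<in> carrier (Sec F U) \<Longrightarrow> Res F U U s = s"
    and "openin X U \<Longrightarrow> openin X V \<Longrightarrow> openin X W \<Longrightarrow> W \<subseteq> V \<Longrightarrow> V \<subseteq> U \<Longrightarrow> s \<in> carrier (Sec F U) \<Longrightarrow>
      Res F V W (Res F U V s) = Res F U W s"
  using assms by (auto simp: presheaf_of_spaces_def)

lemma sheaf_imp_presheaf: "sheaf_of_spaces k X F \<Longrightarrow> presheaf_of_spaces k X F"
  by (simp add: sheaf_of_spaces_def)

context
  fixes F :: "('x, 'k, 's) presheaf"
  assumes F: "presheaf_of_spaces k X F"
begin

lemma sec_vectorspace: "openin X U \<Longrightarrow> vectorspace k (Sec F U)"
  by (rule presheafD(1)[OF F])

lemma sec_module: "openin X U \<Longrightarrow> Module.module k (Sec F U)"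
  using sec_vectorspace by (simp add: vectorspace_def)

lemma res_lin: "openin X U \<Longrightarrow> openin X V \<Longrightarrow> V \<subseteq> U \<Longrightarrow> Res F U V \<in> lin k (Sec F U) (Sec F V)"
  by (rule presheafD(2)[OF F])

lemma res_closed:
  "openin X U \<Longrightarrow> openin X V \<Longrightarrow> V \<subseteq> U \<Longrightarrow> s \<in> carrier (Sec F U) \<Longrightarrow> Res F U V s \<in> carrier (Sec F V)"
  by (rule lin_closed[OF res_lin])

lemma res_id: "openin X U \<Longrightarrow> s \<in> carrier (Sec F U) \<Longrightarrow> Res F U U s = s"
  by (rule presheafD(3)[OF F])

lemma res_res: "openin X U \<Longrightarrow> openin X V \<Longrightarrow> openin X W \<Longrightarrow> W \<subseteq> V \<Longrightarrow> V \<subseteq> U \<Longrightarrow> s \<in> carrier (Sec F U) \<Longrightarrow>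
      Res F V W (Res F U V s) = Res F U W s"
  by (rule presheafD(4)[OF F])

lemma germ_mem: "(V, t) \<in> germ X x F U s \<longleftrightarrow> nbhd V x \<and> t \<in> carrier (Sec F V) \<and>
    (\<exists>W. nbhd W x \<and> W \<subseteq> U \<inter> V \<and> Res F U W s = Res F V W t)"
  by (auto simp: germ_def)

lemma germ_subset:
  assumes "nbhd U x" "nbhd V x" "s \<in> carrier (Sec F U)" "t \<in> carrier (Sec F V)"
    and "nbhd W x" "W \<subseteq> U \<inter> V" "Res F U W s = Res F V W t"
  shows "germ X x F U s \<subseteq> germ X x F V t"
proof clarify
  fix P r assume "(P, r) \<in> germ X x F U s"
  then obtain W1 where P: "nbhd P x" "r \<in> carrier (Sec F P)"
    and W1: "nbhd W1 x" "W1 \<subseteq> U \<inter> P" "Res F U W1 s = Res F P W1 r"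
    unfolding germ_mem by blast
  let ?W = "W \<inter> W1"
  have o: "openin X ?W" using assms W1 by auto
  have "Res F V ?W t = Res F W ?W (Res F V W t)"
    by (rule res_res[symmetric]) (use assms o in auto)
  also have "\<dots> = Res F W ?W (Res F U W s)" using assms by simp
  also have "\<dots> = Res F U ?W s" by (rule res_res) (use assms o in auto)
  also have "\<dots> = Res F W1 ?W (Res F U W1 s)" by (rule res_res[symmetric]) (use assms W1 o in auto)
  also have "\<dots> = Res F W1 ?W (Res F P W1 r)" using W1 by simp
  also have "\<dots> = Res F P ?W r" by (rule res_res) (use P W1 o in auto)
  finally show "(P, r) \<in> germ X x F V t"
    unfolding germ_mem using P o assms W1 by (intro conjI exI[of _ ?W]) auto
qed

lemma germ_eqI:
  assumes "nbhd U x" "nbhd V x" "s \<in> carrier (Sec F U)" "t \<in> carrier (Sec F V)"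
    and "nbhd W x" "W \<subseteq> U \<inter> V" "Res F U W s = Res F V W t"
  shows "germ X x F U s = germ X x F V t"
  by (rule equalityI; rule germ_subset[where W = W]) (use assms in auto)

lemma germ_self: "nbhd U x \<Longrightarrow> s \<in> carrier (Sec F U) \<Longrightarrow> (U, s) \<in> germ X x F U s"
  unfolding germ_mem by blast

lemma germ_eqD:
  assumes "nbhd V x" "t \<in> carrier (Sec F V)" "germ X x F U s = germ X x F V t"
  obtains W where "nbhd W x" "W \<subseteq> U \<inter> V" "Res F U W s = Res F V W t"
proof -
  have "(V, t) \<in> germ X x F U s" unfolding assms(3) by (rule germ_self[OF assms(1,2)])
  then show thesis using that unfolding germ_mem by blast
qed

lemma germ_res:
  assumes "nbhd V x" "openin X U" "V \<subseteq> U" "s \<in> carrier (Sec F U)"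
  shows "germ X x F V (Res F U V s) = germ X x F U s"
  by (rule germ_eqI[of V x U _ _ V]) (use assms res_closed res_id in auto)

lemma germ_closed: "nbhd U x \<Longrightarrow> s \<in> carrier (Sec F U) \<Longrightarrow> germ X x F U s \<in> carrier (stalk X x F)"
  by (auto simp: stalk_def)

lemma stalkE:
  assumes "C \<in> carrier (stalk X x F)"
  obtains U s where "nbhd U x" "s \<in> carrier (Sec F U)" "C = germ X x F U s"
  using assms by (auto simp: stalk_def)

lemma stalkE_in:
  assumes "C \<in> carrier (stalk X x F)" "nbhd N x"
  obtains U s where "nbhd U x" "U \<subseteq> N" "s \<in> carrier (Sec F U)" "C = germ X x F U s"
proof -
  obtain U s where U: "nbhd U x" "s \<in> carrier (Sec F U)" "C = germ X x F U s" using stalkE[OF assms(1)] .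
  have "C = germ X x F (U \<inter> N) (Res F U (U \<inter> N) s)"
    using germ_res[of "U \<inter> N" x U s] U assms(2) by auto
  then show thesis using that[of "U \<inter> N" "Res F U (U \<inter> N) s"] U assms(2) res_closed by auto
qed

lemma stalkE2:
  assumes "C \<in> carrier (stalk X x F)" "D \<in> carrier (stalk X x F)"
  obtains U s t where "nbhd U x" "s \<in> carrier (Sec F U)" "t \<in> carrier (Sec F U)"
    "C = germ X x F U s" "D = germ X x F U t"
proof -
  obtain V t where V: "nbhd V x" "t \<in> carrier (Sec F V)" "D = germ X x F V t" using stalkE[OF assms(2)] .
  obtain U s where U: "nbhd U x" "U \<subseteq> V" "s \<in> carrier (Sec F U)" "C = germ X x F U s"
    using stalkE_in[OF assms(1) V(1)] .
  have "D = germ X x F U (Res F V U t)" using germ_res[of U x V t] U V by auto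
  then show thesis using that[of U s "Res F V U t"] U V res_closed by auto
qed

lemma germ_add:
  assumes "nbhd U x" "s \<in> carrier (Sec F U)" "t \<in> carrier (Sec F U)"
  shows "germ X x F U s \<oplus>\<^bsub>stalk X x F\<^esub> germ X x F U t = germ X x F U (s \<oplus>\<^bsub>Sec F U\<^esub> t)"
proof -
  interpret SU: Module.module k "Sec F U" by (rule sec_module) (use assms in simp)
  have "(\<Union>(U', s')\<in>germ X x F U s. \<Union>(V', t')\<in>germ X x F U t.
      germ X x F (U' \<inter> V') (Res F U' (U' \<inter> V') s' \<oplus>\<^bsub>Sec F (U' \<inter> V')\<^esub> Res F V' (U' \<inter> V') t'))
    = germ X x F U (s \<oplus>\<^bsub>Sec F U\<^esub> t)"
  proof (rule UN_const_pair)
    show "germ X x F U s \<noteq> {}" "germ X x F U t \<noteq> {}" using germ_self assms by blast+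
    fix U' s' V' t' assume "(U', s') \<in> germ X x F U s" "(V', t') \<in> germ X x F U t"
    then obtain W1 W2 where U': "nbhd U' x" "s' \<in> carrier (Sec F U')" and V': "nbhd V' x" "t' \<in> carrier (Sec F V')"
      and W1: "nbhd W1 x" "W1 \<subseteq> U \<inter> U'" "Res F U W1 s = Res F U' W1 s'"
      and W2: "nbhd W2 x" "W2 \<subseteq> U \<inter> V'" "Res F U W2 t = Res F V' W2 t'"
      unfolding germ_mem by blast
    let ?W = "W1 \<inter> W2" and ?I = "U' \<inter> V'"
    have o: "openin X ?W" "openin X ?I" using W1 W2 U' V' by auto
    interpret SI: Module.module k "Sec F ?I" by (rule sec_module[OF o(2)])
    have c: "Res F U' ?I s' \<in> carrier (Sec F ?I)" "Res F V' ?I t' \<in> carrier (Sec F ?I)"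
      using res_closed U' V' o by auto
    have r1: "Res F U' ?W s' = Res F U ?W s"
    proof -
      have "Res F U' ?W s' = Res F W1 ?W (Res F U' W1 s')" by (rule res_res[symmetric]) (use o U' W1 in auto)
      also have "\<dots> = Res F W1 ?W (Res F U W1 s)" using W1 by simp
      also have "\<dots> = Res F U ?W s" by (rule res_res) (use o assms W1 in auto)
      finally show ?thesis .
    qed
    have r2: "Res F V' ?W t' = Res F U ?W t"
    proof -
      have "Res F V' ?W t' = Res F W2 ?W (Res F V' W2 t')" by (rule res_res[symmetric]) (use o V' W2 in auto)
      also have "\<dots> = Res F W2 ?W (Res F U W2 t)" using W2 by simp
      also have "\<dots> = Res F U ?W t" by (rule res_res) (use o assms W2 in auto)
      finally show ?thesis .
    qed
    have l1: "Res F ?I ?W \<in> lin k (Sec F ?I) (Sec F ?W)" by (rule res_lin) (use o W1 W2 in auto)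
    have l2: "Res F U ?W \<in> lin k (Sec F U) (Sec F ?W)" by (rule res_lin) (use o W1 W2 assms in auto)
    have e1: "Res F ?I ?W (Res F U' ?I s') = Res F U' ?W s'"
      by (rule res_res) (use o U' W1 W2 in auto)
    have e2: "Res F ?I ?W (Res F V' ?I t') = Res F V' ?W t'"
      by (rule res_res) (use o V' W1 W2 in auto)
    have "Res F ?I ?W (Res F U' ?I s' \<oplus>\<^bsub>Sec F ?I\<^esub> Res F V' ?I t')
        = Res F U' ?W s' \<oplus>\<^bsub>Sec F ?W\<^esub> Res F V' ?W t'"
      using lin_add[OF l1 c] e1 e2 by simp
    also have "\<dots> = Res F U ?W (s \<oplus>\<^bsub>Sec F U\<^esub> t)" using r1 r2 lin_add[OF l2 assms(2,3)] by simp
    finally show "germ X x F ?I (Res F U' ?I s' \<oplus>\<^bsub>Sec F ?I\<^esub> Res F V' ?I t') = germ X x F U (s \<oplus>\<^bsub>Sec F U\<^esub> t)"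
      by (intro germ_eqI[of ?I x U _ _ ?W]) (use o U' V' W1 W2 assms c in auto)
  qed
  then show ?thesis by (simp add: stalk_def)
qed

lemma germ_smult:
  assumes "nbhd U x" "s \<in> carrier (Sec F U)" "c \<in> carrier k"
  shows "c \<odot>\<^bsub>stalk X x F\<^esub> germ X x F U s = germ X x F U (c \<odot>\<^bsub>Sec F U\<^esub> s)"
proof -
  interpret SU: Module.module k "Sec F U" by (rule sec_module) (use assms in simp)
  have "(\<Union>(U', s')\<in>germ X x F U s. germ X x F U' (c \<odot>\<^bsub>Sec F U'\<^esub> s')) = germ X x F U (c \<odot>\<^bsub>Sec F U\<^esub> s)"
  proof (rule UN_const_single)
    show "germ X x F U s \<noteq> {}" using germ_self assms by blast
    fix U' s' assume "(U', s') \<in> germ X x F U s"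
    then obtain W where U': "nbhd U' x" "s' \<in> carrier (Sec F U')"
      and W: "nbhd W x" "W \<subseteq> U \<inter> U'" "Res F U W s = Res F U' W s'"
      unfolding germ_mem by blast
    interpret SU': Module.module k "Sec F U'" by (rule sec_module) (use U' in simp)
    have l1: "Res F U' W \<in> lin k (Sec F U') (Sec F W)" by (rule res_lin) (use U' W in auto)
    have l2: "Res F U W \<in> lin k (Sec F U) (Sec F W)" by (rule res_lin) (use W assms in auto)
    show "germ X x F U' (c \<odot>\<^bsub>Sec F U'\<^esub> s') = germ X x F U (c \<odot>\<^bsub>Sec F U\<^esub> s)"
      by (rule germ_eqI[of U' x U _ _ W])
        (use U' W assms lin_smult[OF l1 assms(3) U'(2)] lin_smult[OF l2 assms(3,2)] in auto)
  qed
  then show ?thesis by (simp add: stalk_def)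
qed

lemma germ_zero:
  assumes "nbhd U x"
  shows "\<zero>\<^bsub>stalk X x F\<^esub> = germ X x F U \<zero>\<^bsub>Sec F U\<^esub>"
proof -
  have U: "U \<subseteq> topspace X" using assms openin_subset by blast
  interpret S: Module.module k "Sec F (topspace X)" by (rule sec_module) simp
  have m: "Module.module k (Sec F U)" by (rule sec_module) (use assms in simp)
  have "Res F (topspace X) U \<zero>\<^bsub>Sec F (topspace X)\<^esub> = \<zero>\<^bsub>Sec F U\<^esub>"
    by (rule lin_zero[OF S.module_axioms m res_lin]) (use assms U in auto)
  then show ?thesis
    using germ_res[of U x "topspace X" "\<zero>\<^bsub>Sec F (topspace X)\<^esub>"] assms U by (simp add: stalk_def)
qed

lemma stalk_module:
  assumes x: "x \<in> topspace X"
  shows "Module.module k (stalk X x F)"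
proof (rule module_by[OF K.is_cring])
  have T: "nbhd (topspace X) x" using x by simp
  interpret ST: Module.module k "Sec F (topspace X)" by (rule sec_module) simp
  show "\<zero>\<^bsub>stalk X x F\<^esub> \<in> carrier (stalk X x F)"
    unfolding germ_zero[OF T] by (rule germ_closed[OF T]) simp
  fix C assume C: "C \<in> carrier (stalk X x F)"
  then obtain U s where U: "nbhd U x" "s \<in> carrier (Sec F U)" "C = germ X x F U s" by (rule stalkE)
  interpret SU: Module.module k "Sec F U" by (rule sec_module) (use U in simp)
  show "\<exists>neg_v\<in>carrier (stalk X x F). C \<oplus>\<^bsub>stalk X x F\<^esub> neg_v = \<zero>\<^bsub>stalk X x F\<^esub>"
    using germ_add[OF U(1,2), of "\<ominus>\<^bsub>Sec F U\<^esub> s"] germ_zero[OF U(1)] germ_closed[OF U(1), of "\<ominus>\<^bsub>Sec F U\<^esub> s"] U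
    by (intro bexI[of _ "germ X x F U (\<ominus>\<^bsub>Sec F U\<^esub> s)"]) (auto simp: SU.M.r_neg)
  show "C \<oplus>\<^bsub>stalk X x F\<^esub> \<zero>\<^bsub>stalk X x F\<^esub> = C"
    using germ_add[OF U(1,2), of "\<zero>\<^bsub>Sec F U\<^esub>"] germ_zero[OF U(1)] U by simp
  show "\<one> \<odot>\<^bsub>stalk X x F\<^esub> C = C" using germ_smult[OF U(1,2), of \<one>] U by simp
  show sc: "a \<odot>\<^bsub>stalk X x F\<^esub> C \<in> carrier (stalk X x F)" if "a \<in> carrier k" for a
    using germ_smult[OF U(1,2) that] germ_closed[OF U(1)] U that by simp
  show "(a \<otimes> b) \<odot>\<^bsub>stalk X x F\<^esub> C = a \<odot>\<^bsub>stalk X x F\<^esub> (b \<odot>\<^bsub>stalk X x F\<^esub> C)"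
    "(a \<oplus> b) \<odot>\<^bsub>stalk X x F\<^esub> C = a \<odot>\<^bsub>stalk X x F\<^esub> C \<oplus>\<^bsub>stalk X x F\<^esub> b \<odot>\<^bsub>stalk X x F\<^esub> C"
    if "a \<in> carrier k" "b \<in> carrier k" for a b
    using U that by (simp_all add: germ_smult germ_add SU.smult_assoc1 SU.smult_l_distr)
  fix D assume D: "D \<in> carrier (stalk X x F)"
  obtain V s t where V: "nbhd V x" "s \<in> carrier (Sec F V)" "t \<in> carrier (Sec F V)"
    "C = germ X x F V s" "D = germ X x F V t" using stalkE2[OF C D] .
  interpret SV: Module.module k "Sec F V" by (rule sec_module) (use V in simp)
  show "C \<oplus>\<^bsub>stalk X x F\<^esub> D \<in> carrier (stalk X x F)" "C \<oplus>\<^bsub>stalk X x F\<^esub> D = D \<oplus>\<^bsub>stalk X x F\<^esub> C"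
    using V germ_closed by (simp_all add: germ_add SV.M.a_comm)
  show "a \<odot>\<^bsub>stalk X x F\<^esub> (C \<oplus>\<^bsub>stalk X x F\<^esub> D) = a \<odot>\<^bsub>stalk X x F\<^esub> C \<oplus>\<^bsub>stalk X x F\<^esub> a \<odot>\<^bsub>stalk X x F\<^esub> D"
    if "a \<in> carrier k" for a
    using V that by (simp add: germ_smult germ_add SV.smult_r_distr)
  fix E assume E: "E \<in> carrier (stalk X x F)"
  obtain W r where W: "nbhd W x" "W \<subseteq> V" "r \<in> carrier (Sec F W)" "E = germ X x F W r"
    using stalkE_in[OF E V(1)] .
  interpret SW: Module.module k "Sec F W" by (rule sec_module) (use W in simp)
  have "C = germ X x F W (Res F V W s)" "D = germ X x F W (Res F V W t)"
    using V W germ_res by auto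
  moreover have "Res F V W s \<in> carrier (Sec F W)" "Res F V W t \<in> carrier (Sec F W)"
    using V W res_closed by auto
  ultimately show "C \<oplus>\<^bsub>stalk X x F\<^esub> D \<oplus>\<^bsub>stalk X x F\<^esub> E = C \<oplus>\<^bsub>stalk X x F\<^esub> (D \<oplus>\<^bsub>stalk X x F\<^esub> E)"
    using W by (simp add: germ_add SW.M.a_assoc)
qed

lemma stalk_vectorspace: "x \<in> topspace X \<Longrightarrow> vectorspace k (stalk X x F)"
  using stalk_module is_field by (simp add: vectorspace_def)

lemma germ_lin: "nbhd U x \<Longrightarrow> germ X x F U \<in> lin k (Sec F U) (stalk X x F)"
  by (rule linI) (auto simp: germ_closed germ_add germ_smult)

end

lemma sheaf_ex1:
  assumes "sheaf_of_spaces k X F"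
    and "(\<forall>U\<in>\<U>. openin X U) \<and> (\<forall>U\<in>\<U>. f U \<in> carrier (Sec F U)) \<and>
      (\<forall>U\<in>\<U>. \<forall>V\<in>\<U>. Res F U (U \<inter> V) (f U) = Res F V (U \<inter> V) (f V))"
  shows "\<exists>!t. t \<in> carrier (Sec F (\<Union>\<U>)) \<and> (\<forall>U\<in>\<U>. Res F (\<Union>\<U>) U t = f U)"
proof -
  have "\<forall>\<U> s. (\<forall>U\<in>\<U>. openin X U) \<and> (\<forall>U\<in>\<U>. s U \<in> carrier (Sec F U)) \<and>
        (\<forall>U\<in>\<U>. \<forall>V\<in>\<U>. Res F U (U \<inter> V) (s U) = Res F V (U \<inter> V) (s V)) \<longrightarrow>
        (\<exists>!t. t \<in> carrier (Sec F (\<Union>\<U>)) \<and> (\<forall>U\<in>\<U>. Res F (\<Union>\<U>) U t = s U))"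
    using assms(1) unfolding sheaf_of_spaces_def by (rule conjunct2)
  from spec[OF spec[OF this, of \<U>], of f] assms(2) show ?thesis by (rule mp)
qed

lemma sheaf_sections_eq:
  assumes F: "sheaf_of_spaces k X F" and U: "openin X U"
    and s: "s \<in> carrier (Sec F U)" and t: "t \<in> carrier (Sec F U)"
    and eq: "\<And>x. x \<in> U \<Longrightarrow> germ X x F U s = germ X x F U t"
  shows "s = t"
proof -
  note ps = sheaf_imp_presheaf[OF F]
  let ?\<U> = "{W. openin X W \<and> W \<subseteq> U \<and> Res F U W s = Res F U W t}"
  have cover: "\<Union>?\<U> = U"
  proof (intro equalityI subsetI)
    fix x assume x: "x \<in> U"
    obtain W where "nbhd W x" "W \<subseteq> U \<inter> U" "Res F U W s = Res F U W t"
      using germ_eqD[OF ps _ t eq[OF x]] U x by blast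
    then show "x \<in> \<Union>?\<U>" by blast
  qed blast
  have compat: "(\<forall>W\<in>?\<U>. openin X W) \<and> (\<forall>W\<in>?\<U>. Res F U W s \<in> carrier (Sec F W)) \<and>
      (\<forall>W\<in>?\<U>. \<forall>W'\<in>?\<U>. Res F W (W \<inter> W') (Res F U W s) = Res F W' (W \<inter> W') (Res F U W' s))"
  proof (intro conjI ballI)
    fix W W' assume W: "W \<in> ?\<U>" and W': "W' \<in> ?\<U>"
    have o: "openin X (W \<inter> W')" using W W' by auto
    have "Res F W (W \<inter> W') (Res F U W s) = Res F U (W \<inter> W') s"
      by (rule res_res[OF ps U]) (use W o s in auto)
    moreover have "Res F W' (W \<inter> W') (Res F U W' s) = Res F U (W \<inter> W') s"
      by (rule res_res[OF ps U]) (use W' o s in auto)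
    ultimately show "Res F W (W \<inter> W') (Res F U W s) = Res F W' (W \<inter> W') (Res F U W' s)" by simp
  qed (use res_closed[OF ps U _ _ s] res_closed[OF ps U _ _ t] in auto)
  have "\<exists>!r. r \<in> carrier (Sec F (\<Union>?\<U>)) \<and> (\<forall>W\<in>?\<U>. Res F (\<Union>?\<U>) W r = Res F U W s)"
    by (rule sheaf_ex1[OF F compat])
  then have "\<exists>!r. r \<in> carrier (Sec F U) \<and> (\<forall>W\<in>?\<U>. Res F U W r = Res F U W s)"
    unfolding cover .
  moreover have "s \<in> carrier (Sec F U) \<and> (\<forall>W\<in>?\<U>. Res F U W s = Res F U W s)" using s by simp
  moreover have "t \<in> carrier (Sec F U) \<and> (\<forall>W\<in>?\<U>. Res F U W t = Res F U W s)" using t by simp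
  ultimately show ?thesis by blast
qed

text \<open>A family of germs is a section as soon as it is locally given by sections: the local sections agree on
  overlaps because sections are determined by their germs.\<close>

lemma sheaf_glue:
  assumes F: "sheaf_of_spaces k X F" and U: "openin X U"
    and loc: "\<And>x. x \<in> U \<Longrightarrow> \<exists>W s. nbhd W x \<and> W \<subseteq> U \<and> s \<in> carrier (Sec F W) \<and> (\<forall>y\<in>W. germ X y F W s = \<sigma> y)"
  shows "\<exists>s\<in>carrier (Sec F U). \<forall>x\<in>U. germ X x F U s = \<sigma> x"
proof -
  note ps = sheaf_imp_presheaf[OF F]
  let ?P = "\<lambda>W s. s \<in> carrier (Sec F W) \<and> (\<forall>y\<in>W. germ X y F W s = \<sigma> y)"
  let ?\<U> = "{W. openin X W \<and> W \<subseteq> U \<and> (\<exists>s. ?P W s)}"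
  define f where "f W = (SOME s. ?P W s)" for W
  have f: "?P W (f W)" if "W \<in> ?\<U>" for W
  proof -
    have "\<exists>s. ?P W s" using that by simp
    from someI_ex[OF this] show ?thesis unfolding f_def .
  qed
  have cover: "\<Union>?\<U> = U"
  proof (intro equalityI subsetI)
    fix x assume "x \<in> U"
    from loc[OF this] obtain W s where "nbhd W x" "W \<subseteq> U" "?P W s" by (elim exE conjE) simp
    then show "x \<in> \<Union>?\<U>" by (intro UnionI[of W]) auto
  qed auto
  have compat: "(\<forall>W\<in>?\<U>. openin X W) \<and> (\<forall>W\<in>?\<U>. f W \<in> carrier (Sec F W)) \<and>
      (\<forall>W\<in>?\<U>. \<forall>W'\<in>?\<U>. Res F W (W \<inter> W') (f W) = Res F W' (W \<inter> W') (f W'))"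
  proof (intro conjI ballI)
    fix W W' assume W: "W \<in> ?\<U>" and W': "W' \<in> ?\<U>"
    have o: "openin X (W \<inter> W')" using W W' by auto
    show "Res F W (W \<inter> W') (f W) = Res F W' (W \<inter> W') (f W')"
    proof (rule sheaf_sections_eq[OF F o])
      fix x assume x: "x \<in> W \<inter> W'"
      show "germ X x F (W \<inter> W') (Res F W (W \<inter> W') (f W)) = germ X x F (W \<inter> W') (Res F W' (W \<inter> W') (f W'))"
        using germ_res[OF ps, of "W \<inter> W'" x W "f W"] germ_res[OF ps, of "W \<inter> W'" x W' "f W'"] o x f[OF W] f[OF W'] W W' by auto
    qed (use res_closed[OF ps] o f[OF W] f[OF W'] W W' in auto)
  qed (use f in auto)
  have "\<exists>!r. r \<in> carrier (Sec F (\<Union>?\<U>)) \<and> (\<forall>W\<in>?\<U>. Res F (\<Union>?\<U>) W r = f W)"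
    by (rule sheaf_ex1[OF F compat])
  then obtain r where r: "r \<in> carrier (Sec F U)" "\<forall>W\<in>?\<U>. Res F U W r = f W"
    unfolding cover by (elim ex1E conjE)
  have "germ X x F U r = \<sigma> x" if x: "x \<in> U" for x
  proof -
    have "x \<in> \<Union>?\<U>" unfolding cover by (rule x)
    then obtain W where W: "W \<in> ?\<U>" "x \<in> W" by (rule UnionE)
    have "germ X x F U r = germ X x F W (Res F U W r)"
      using germ_res[OF ps, of W x U r] W U r(1) by auto
    then show ?thesis using r(2) W f[OF W(1)] by auto
  qed
  then show ?thesis using r(1) by blast
qed

subsection \<open>Maps on stalks\<close>

lemma sheaf_morphismD:
  assumes "sheaf_morphism k X E F h"
  shows "openin X U \<Longrightarrow> h U \<in> lin k (Sec E U) (Sec F U)"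
    and "openin X U \<Longrightarrow> openin X V \<Longrightarrow> V \<subseteq> U \<Longrightarrow> s \<in> carrier (Sec E U) \<Longrightarrow> h V (Res E U V s) = Res F U V (h U s)"
  using assms by (auto simp: sheaf_morphism_def)

lemma stalk_map_germ:
  assumes E: "presheaf_of_spaces k X E" and F: "presheaf_of_spaces k X F" and h: "sheaf_morphism k X E F h"
    and U: "nbhd U x" "s \<in> carrier (Sec E U)"
  shows "(\<Union>(U', s')\<in>germ X x E U s. germ X x F U' (h U' s')) = germ X x F U (h U s)"
proof (rule UN_const_single)
  show "germ X x E U s \<noteq> {}" using germ_self[OF E U] by blast
  fix U' s' assume "(U', s') \<in> germ X x E U s"
  then obtain W where U': "nbhd U' x" "s' \<in> carrier (Sec E U')"
    and W: "nbhd W x" "W \<subseteq> U \<inter> U'" "Res E U W s = Res E U' W s'"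
    unfolding germ_mem[OF E] by blast
  show "germ X x F U' (h U' s') = germ X x F U (h U s)"
    by (rule germ_eqI[OF F, of U' x U _ _ W])
      (use U U' W sheaf_morphismD(2)[OF h, of U W s] sheaf_morphismD(2)[OF h, of U' W s']
         lin_closed[OF sheaf_morphismD(1)[OF h]] in auto)
qed

lemma stalk_map_eq: "stalk_map X x F h (germ X x E U s) = (\<Union>(U', s')\<in>germ X x E U s. germ X x F U' (h U' s'))"
  by (simp add: stalk_map_def)

lemma stalk_map_lin:
  assumes E: "presheaf_of_spaces k X E" and F: "presheaf_of_spaces k X F" and h: "sheaf_morphism k X E F h"
  shows "stalk_map X x F h \<in> lin k (stalk X x E) (stalk X x F)"
proof (rule linI)
  note g = stalk_map_eq stalk_map_germ[OF E F h]
  fix C assume C: "C \<in> carrier (stalk X x E)"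
  obtain U s where U: "nbhd U x" "s \<in> carrier (Sec E U)" "C = germ X x E U s" using stalkE[OF E C] .
  have hl: "h U \<in> lin k (Sec E U) (Sec F U)" by (rule sheaf_morphismD(1)[OF h]) (use U in simp)
  interpret SU: Module.module k "Sec E U" by (rule sec_module[OF E]) (use U in simp)
  show "stalk_map X x F h C \<in> carrier (stalk X x F)"
    using U germ_closed[OF F U(1) lin_closed[OF hl U(2)]] by (simp add: g)
  show "stalk_map X x F h (c \<odot>\<^bsub>stalk X x E\<^esub> C) = c \<odot>\<^bsub>stalk X x F\<^esub> stalk_map X x F h C" if "c \<in> carrier k" for c
    using U that lin_closed[OF hl U(2)] lin_smult[OF hl that U(2)] by (simp add: g germ_smult[OF E] germ_smult[OF F])
  fix D assume D: "D \<in> carrier (stalk X x E)"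
  obtain V s t where V: "nbhd V x" "s \<in> carrier (Sec E V)" "t \<in> carrier (Sec E V)"
    "C = germ X x E V s" "D = germ X x E V t" using stalkE2[OF E C D] .
  have hl: "h V \<in> lin k (Sec E V) (Sec F V)" by (rule sheaf_morphismD(1)[OF h]) (use V in simp)
  interpret SV: Module.module k "Sec E V" by (rule sec_module[OF E]) (use V in simp)
  show "stalk_map X x F h (C \<oplus>\<^bsub>stalk X x E\<^esub> D) = stalk_map X x F h C \<oplus>\<^bsub>stalk X x F\<^esub> stalk_map X x F h D"
    using V lin_closed[OF hl] lin_add[OF hl V(2,3)] by (simp add: g germ_add[OF E] germ_add[OF F])
qed

text \<open>Equations between sections can be checked on germs.\<close>

lemma lin_from_germs:
  assumes E: "presheaf_of_spaces k X E" and F: "sheaf_of_spaces k X F" and U: "openin X U"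
    and h: "\<And>s. s \<in> carrier (Sec E U) \<Longrightarrow> h s \<in> carrier (Sec F U)"
    and \<theta>: "\<And>x. x \<in> U \<Longrightarrow> \<theta> x \<in> lin k (stalk X x E) (stalk X x F)"
    and hg: "\<And>x s. x \<in> U \<Longrightarrow> s \<in> carrier (Sec E U) \<Longrightarrow> germ X x F U (h s) = \<theta> x (germ X x E U s)"
  shows "h \<in> lin k (Sec E U) (Sec F U)"
proof (rule linI)
  note Fp = sheaf_imp_presheaf[OF F]
  interpret EU: Module.module k "Sec E U" by (rule sec_module[OF E U])
  interpret FU: Module.module k "Sec F U" by (rule sec_module[OF Fp U])
  fix s assume s: "s \<in> carrier (Sec E U)"
  show "h s \<in> carrier (Sec F U)" by (rule h[OF s])
  show "h (c \<odot>\<^bsub>Sec E U\<^esub> s) = c \<odot>\<^bsub>Sec F U\<^esub> h s" if c: "c \<in> carrier k" for c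
  proof (rule sheaf_sections_eq[OF F U])
    have cs: "c \<odot>\<^bsub>Sec E U\<^esub> s \<in> carrier (Sec E U)" using s c by simp
    show "h (c \<odot>\<^bsub>Sec E U\<^esub> s) \<in> carrier (Sec F U)" by (rule h[OF cs])
    show "c \<odot>\<^bsub>Sec F U\<^esub> h s \<in> carrier (Sec F U)" using h[OF s] c by simp
    fix x assume x: "x \<in> U"
    have n: "nbhd U x" using U x by simp
    show "germ X x F U (h (c \<odot>\<^bsub>Sec E U\<^esub> s)) = germ X x F U (c \<odot>\<^bsub>Sec F U\<^esub> h s)"
      unfolding hg[OF x cs] germ_smult[OF Fp n h[OF s] c, symmetric] hg[OF x s] germ_smult[OF E n s c, symmetric]
      by (rule lin_smult[OF \<theta>[OF x] c germ_closed[OF E n s]])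
  qed
  fix t assume t: "t \<in> carrier (Sec E U)"
  show "h (s \<oplus>\<^bsub>Sec E U\<^esub> t) = h s \<oplus>\<^bsub>Sec F U\<^esub> h t"
  proof (rule sheaf_sections_eq[OF F U])
    have st: "s \<oplus>\<^bsub>Sec E U\<^esub> t \<in> carrier (Sec E U)" using s t by simp
    show "h (s \<oplus>\<^bsub>Sec E U\<^esub> t) \<in> carrier (Sec F U)" by (rule h[OF st])
    show "h s \<oplus>\<^bsub>Sec F U\<^esub> h t \<in> carrier (Sec F U)" using h[OF s] h[OF t] by simp
    fix x assume x: "x \<in> U"
    have n: "nbhd U x" using U x by simp
    show "germ X x F U (h (s \<oplus>\<^bsub>Sec E U\<^esub> t)) = germ X x F U (h s \<oplus>\<^bsub>Sec F U\<^esub> h t)"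
      unfolding hg[OF x st] germ_add[OF Fp n h[OF s] h[OF t], symmetric] hg[OF x s] hg[OF x t]
        germ_add[OF E n s t, symmetric]
      by (rule lin_add[OF \<theta>[OF x] germ_closed[OF E n s] germ_closed[OF E n t]])
  qed
qed

lemma morphism_from_stalks:
  assumes E: "presheaf_of_spaces k X E" and F: "sheaf_of_spaces k X F"
    and \<theta>: "\<And>x. x \<in> topspace X \<Longrightarrow> \<theta> x \<in> lin k (stalk X x E) (stalk X x F)"
    and loc: "\<And>U s x. nbhd U x \<Longrightarrow> s \<in> carrier (Sec E U) \<Longrightarrow>
        \<exists>W t. nbhd W x \<and> W \<subseteq> U \<and> t \<in> carrier (Sec F W) \<and> (\<forall>y\<in>W. germ X y F W t = \<theta> y (germ X y E U s))"
  shows "\<exists>h. sheaf_morphism k X E F h \<and>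
    (\<forall>U s x. nbhd U x \<longrightarrow> s \<in> carrier (Sec E U) \<longrightarrow> germ X x F U (h U s) = \<theta> x (germ X x E U s))"
proof -
  note Fp = sheaf_imp_presheaf[OF F]
  let ?P = "\<lambda>U s t. t \<in> carrier (Sec F U) \<and> (\<forall>x\<in>U. germ X x F U t = \<theta> x (germ X x E U s))"
  define h where "h U s = (SOME t. ?P U s t)" for U s
  have h: "?P U s (h U s)" if "openin X U" "s \<in> carrier (Sec E U)" for U s
  proof -
    have "\<exists>t\<in>carrier (Sec F U). \<forall>x\<in>U. germ X x F U t = \<theta> x (germ X x E U s)"
      by (rule sheaf_glue[OF F that(1)]) (rule loc, use that in auto)
    then have "\<exists>t. ?P U s t" by (simp only: Bex_def)
    from someI_ex[OF this] show ?thesis unfolding h_def .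
  qed
  have top: "x \<in> topspace X" if "openin X U" "x \<in> U" for U x using that openin_subset by blast
  have hg: "germ X x F U (h U s) = \<theta> x (germ X x E U s)" if "nbhd U x" "s \<in> carrier (Sec E U)" for U s x
    using h that by blast
  have "sheaf_morphism k X E F h"
    unfolding sheaf_morphism_def
  proof (intro conjI allI impI ballI)
    fix U assume U: "openin X U"
    show "h U \<in> lin k (Sec E U) (Sec F U)"
    proof (rule lin_from_germs[OF E F U, where \<theta> = \<theta>])
      show "h U s \<in> carrier (Sec F U)" if "s \<in> carrier (Sec E U)" for s using h[OF U that] by blast
      show "\<theta> x \<in> lin k (stalk X x E) (stalk X x F)" if "x \<in> U" for x by (rule \<theta>[OF top[OF U that]])
      show "germ X x F U (h U s) = \<theta> x (germ X x E U s)" if "x \<in> U" "s \<in> carrier (Sec E U)" for x s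
        by (rule hg) (use U that in auto)
    qed
  next
    fix U V s assume "openin X U \<and> openin X V \<and> V \<subseteq> U" and s: "s \<in> carrier (Sec E U)"
    then have U: "openin X U" and V: "openin X V" "V \<subseteq> U" by auto
    have rs: "Res E U V s \<in> carrier (Sec E V)" by (rule res_closed[OF E U V s])
    have hs: "h U s \<in> carrier (Sec F U)" using h[OF U s] by blast
    show "h V (Res E U V s) = Res F U V (h U s)"
    proof (rule sheaf_sections_eq[OF F V(1)])
      fix x assume x: "x \<in> V"
      show "germ X x F V (h V (Res E U V s)) = germ X x F V (Res F U V (h U s))"
        using hg[of V x "Res E U V s"] hg[of U x s] germ_res[OF E, of V x U s] germ_res[OF Fp, of V x U "h U s"]
          x V U s rs hs by auto
    qed (use h[OF V(1) rs] res_closed[OF Fp U V hs] in auto)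
  qed
  then show ?thesis using hg by blast
qed

lemma sheaf_bilinearD:
  assumes "sheaf_bilinear k X E F T \<beta>"
  shows "openin X U \<Longrightarrow> \<beta> U \<in> bilinear_maps k (Sec E U) (Sec F U) (Sec T U)"
    and "openin X U \<Longrightarrow> openin X V \<Longrightarrow> V \<subseteq> U \<Longrightarrow> s \<in> carrier (Sec E U) \<Longrightarrow> t \<in> carrier (Sec F U) \<Longrightarrow>
      \<beta> V (Res E U V s) (Res F U V t) = Res T U V (\<beta> U s t)"
  using assms by (auto simp: sheaf_bilinear_def)

lemma stalk_bilinear_germ:
  assumes E: "presheaf_of_spaces k X E" and F: "presheaf_of_spaces k X F" and T: "presheaf_of_spaces k X T"
    and \<beta>: "sheaf_bilinear k X E F T \<beta>"
    and U: "nbhd U x" and s: "s \<in> carrier (Sec E U)" and t: "t \<in> carrier (Sec F U)"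
  shows "stalk_bilinear X x E F T \<beta> (germ X x E U s) (germ X x F U t) = germ X x T U (\<beta> U s t)"
  unfolding stalk_bilinear_def
proof (rule UN_const_pair)
  show "germ X x E U s \<noteq> {}" "germ X x F U t \<noteq> {}" using germ_self[OF E U s] germ_self[OF F U t] by blast+
  fix U' s' V' t' assume "(U', s') \<in> germ X x E U s" "(V', t') \<in> germ X x F U t"
  then obtain W1 W2 where U': "nbhd U' x" "s' \<in> carrier (Sec E U')" and V': "nbhd V' x" "t' \<in> carrier (Sec F V')"
    and W1: "nbhd W1 x" "W1 \<subseteq> U \<inter> U'" "Res E U W1 s = Res E U' W1 s'"
    and W2: "nbhd W2 x" "W2 \<subseteq> U \<inter> V'" "Res F U W2 t = Res F V' W2 t'"
    unfolding germ_mem[OF E] germ_mem[OF F] by blast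
  let ?W = "W1 \<inter> W2" and ?I = "U' \<inter> V'"
  have o: "openin X ?W" "openin X ?I" using W1 W2 U' V' by auto
  have c: "Res E U' ?I s' \<in> carrier (Sec E ?I)" "Res F V' ?I t' \<in> carrier (Sec F ?I)"
    using res_closed[OF E] res_closed[OF F] U' V' o by auto
  have r1: "Res E ?I ?W (Res E U' ?I s') = Res E U ?W s"
  proof -
    have "Res E ?I ?W (Res E U' ?I s') = Res E U' ?W s'" by (rule res_res[OF E]) (use o U' W1 W2 in auto)
    also have "\<dots> = Res E W1 ?W (Res E U' W1 s')" by (rule res_res[OF E, symmetric]) (use o U' W1 W2 in auto)
    also have "\<dots> = Res E W1 ?W (Res E U W1 s)" using W1 by simp
    also have "\<dots> = Res E U ?W s" by (rule res_res[OF E]) (use o U s W1 W2 in auto)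
    finally show ?thesis .
  qed
  have r2: "Res F ?I ?W (Res F V' ?I t') = Res F U ?W t"
  proof -
    have "Res F ?I ?W (Res F V' ?I t') = Res F V' ?W t'" by (rule res_res[OF F]) (use o V' W1 W2 in auto)
    also have "\<dots> = Res F W2 ?W (Res F V' W2 t')" by (rule res_res[OF F, symmetric]) (use o V' W1 W2 in auto)
    also have "\<dots> = Res F W2 ?W (Res F U W2 t)" using W2 by simp
    also have "\<dots> = Res F U ?W t" by (rule res_res[OF F]) (use o U t W1 W2 in auto)
    finally show ?thesis .
  qed
  have sub: "?W \<subseteq> ?I" using W1 W2 by blast
  have "Res T ?I ?W (\<beta> ?I (Res E U' ?I s') (Res F V' ?I t')) = \<beta> ?W (Res E U ?W s) (Res F U ?W t)"
    using sheaf_bilinearD(2)[OF \<beta> o(2,1) sub c] r1 r2 by simp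
  also have "\<dots> = Res T U ?W (\<beta> U s t)"
    by (rule sheaf_bilinearD(2)[OF \<beta>]) (use o U W1 s t in auto)
  finally show "germ X x T ?I (\<beta> ?I (Res E U' ?I s') (Res F V' ?I t')) = germ X x T U (\<beta> U s t)"
    by (intro germ_eqI[OF T, of ?I x U _ _ ?W])
      (use o U' V' W1 W2 U bilinear_closed[OF sheaf_bilinearD(1)[OF \<beta>]] c s t in auto)
qed

lemma stalkE_pair:
  assumes E: "presheaf_of_spaces k X E" and F: "presheaf_of_spaces k X F"
    and "C \<in> carrier (stalk X x E)" "D \<in> carrier (stalk X x F)"
  obtains U s t where "nbhd U x" "s \<in> carrier (Sec E U)" "t \<in> carrier (Sec F U)"
    "C = germ X x E U s" "D = germ X x F U t"
proof -
  obtain V t where V: "nbhd V x" "t \<in> carrier (Sec F V)" "D = germ X x F V t" using stalkE[OF F assms(4)] .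
  obtain U s where U: "nbhd U x" "U \<subseteq> V" "s \<in> carrier (Sec E U)" "C = germ X x E U s"
    using stalkE_in[OF E assms(3) V(1)] .
  have "D = germ X x F U (Res F V U t)" using germ_res[OF F, of U x V t] U V by auto
  then show thesis using that[of U s "Res F V U t"] U V res_closed[OF F] by auto
qed

end

section \<open>Charts of local systems\<close>

lemma lin_isoI:
  assumes "f \<in> lin R M N" "g \<in> lin R N M" "\<And>x. x \<in> carrier M \<Longrightarrow> g (f x) = x" "\<And>y. y \<in> carrier N \<Longrightarrow> f (g y) = y"
  shows "lin_iso R M N f"
  unfolding lin_iso_def
  by (intro conjI assms(1) bij_betw_byWitness[of _ g]) (use assms lin_closed[OF assms(1)] lin_closed[OF assms(2)] in auto)

lemma lin_isoD:
  assumes "lin_iso R M N f"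
  shows "f \<in> lin R M N" "inj_on f (carrier M)" "f ` carrier M = carrier N"
    "x \<in> carrier M \<Longrightarrow> inv_into (carrier M) f (f x) = x"
    "y \<in> carrier N \<Longrightarrow> inv_into (carrier M) f y \<in> carrier M"
    "y \<in> carrier N \<Longrightarrow> f (inv_into (carrier M) f y) = y"
proof -
  show f: "f \<in> lin R M N" "inj_on f (carrier M)" "f ` carrier M = carrier N"
    using assms by (auto simp: lin_iso_def bij_betw_def)
  show "x \<in> carrier M \<Longrightarrow> inv_into (carrier M) f (f x) = x" using f(2) by (rule inv_into_f_f)
  show "y \<in> carrier N \<Longrightarrow> inv_into (carrier M) f y \<in> carrier M" using f(3) by (metis inv_into_into)
  show "y \<in> carrier N \<Longrightarrow> f (inv_into (carrier M) f y) = y" using f(3) by (metis f_inv_into_f)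
qed

lemma lin_iso_compose:
  assumes "lin_iso R M N f" "lin_iso R N P g"
  shows "lin_iso R M P (\<lambda>x. g (f x))"
  using assms bij_betw_trans[of f "carrier M" "carrier N" g "carrier P"] lin_compose[of f R M N g P]
  by (auto simp: lin_iso_def o_def)

lemma fd_coordinates:
  fixes k :: "'k ring"
  assumes "fd_space k V"
  shows "\<exists>(W :: ('k, nat \<Rightarrow> 'k) module) f. fd_space k W \<and> lin_iso k W V f"
proof -
  have vs: "vectorspace k V" using assms by (simp add: fd_space_def)
  interpret V: vectorspace k V by (rule vs)
  obtain n :: nat and b d where db: "dual_basis k V {..<n} b d" using fd_space_imp_dual_basis[OF assms] .
  let ?W = "free_module k {..<n}"
  have field: "field k" ..
  note W = free_module_dual_basis[OF field, of "{..<n}", simplified finite_lessThan, OF TrueI]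
  interpret W: vectorspace k ?W by (rule W(1))
  obtain f where f: "f \<in> lin k ?W V" "\<forall>i\<in>{..<n}. f (free_gen k i) = b i"
    using dual_basis_extend[OF W.module_axioms V.module_axioms W(2), of b] dual_basisD(2)[OF db] by blast
  have gc: "free_gen k i \<in> carrier ?W" if "i \<in> {..<n}" for i by (rule dual_basisD(2)[OF W(2) that])
  obtain g where g: "g \<in> lin k V ?W" "\<forall>i\<in>{..<n}. g (b i) = free_gen k i"
    using dual_basis_extend[OF V.module_axioms W.module_axioms db, of "free_gen k"] gc by blast
  have idW: "(\<lambda>x. x) \<in> lin k ?W ?W" and idV: "(\<lambda>x. x) \<in> lin k V V" by (rule linI; simp)+
  have "lin_iso k ?W V f"
  proof (rule lin_isoI[OF f(1) g(1)])
    show "g (f x) = x" if "x \<in> carrier ?W" for x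
      by (rule lin_eq_on_basis[OF W.module_axioms W.module_axioms W(2) lin_compose[OF f(1) g(1)] idW _ that])
        (use f(2) g(2) in simp)
    show "f (g y) = y" if "y \<in> carrier V" for y
      by (rule lin_eq_on_basis[OF V.module_axioms V.module_axioms db lin_compose[OF g(1) f(1)] idV _ that])
        (use f(2) g(2) in simp)
  qed
  moreover have "fd_space k ?W" by (rule dual_basis_imp_fd_space[OF W])
  ultimately show ?thesis by blast
qed

lemma fd_space_iso:
  assumes "fd_space k V" "Module.module k W" "lin_iso k V W f"
  shows "fd_space k W"
proof -
  interpret V: vectorspace k V using assms by (simp add: fd_space_def)
  obtain n :: nat and b d where db: "dual_basis k V {..<n} b d" using fd_space_imp_dual_basis[OF assms(1)] .
  have "vectorspace k W" using assms(2) V.field_axioms by (simp add: vectorspace_def)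
  from dual_basis_imp_fd_space[OF this dual_basis_iso[OF V.module_axioms assms(2) db assms(3)]] show ?thesis .
qed

context sheaf_base
begin

text \<open>A local system is described by charts: over \<open>N\<close>, the elements of a fixed space \<open>V\<close> give sections
  whose germs at each point of \<open>N\<close> identify \<open>V\<close> with the stalk.\<close>

definition sheaf_chart :: "('x, 'k, 's) presheaf \<Rightarrow> 'x set \<Rightarrow> ('k, 'v) module \<Rightarrow> ('v \<Rightarrow> 's) \<Rightarrow> bool" where
  "sheaf_chart F N V j \<longleftrightarrow> openin X N \<and> fd_space k V \<and> j \<in> lin k V (Sec F N) \<and>
     (\<forall>y\<in>N. lin_iso k V (stalk X y F) (\<lambda>v. germ X y F N (j v)))"

lemma sheaf_chartD:
  assumes "sheaf_chart F N V j"
  shows "openin X N" "fd_space k V" "j \<in> lin k V (Sec F N)"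
    "y \<in> N \<Longrightarrow> lin_iso k V (stalk X y F) (\<lambda>v. germ X y F N (j v))"
  using assms by (auto simp: sheaf_chart_def)

lemma local_systemD:
  assumes "local_system k X F"
  shows "sheaf_of_spaces k X F" "presheaf_of_spaces k X F"
  using assms sheaf_imp_presheaf by (auto simp: local_system_def)

text \<open>A trivialisation of \<open>F\<close> over \<open>U\<close> turns \<open>v\<close> into the section with constant value \<open>v\<close>. It is an isomorphism
  on stalks since locally constant functions are constant near each point.\<close>

lemma local_system_chart:
  fixes F :: "('x, 'k, 's) presheaf"
  assumes F: "local_system k X F" and x: "x \<in> topspace X"
  shows "\<exists>N (V :: ('k, nat \<Rightarrow> 'k) module) j. x \<in> N \<and> sheaf_chart F N V j"
proof -
  note ps = local_systemD(2)[OF F]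
  obtain U and V0 :: "('k, 's) module" and h where U: "openin X U" "x \<in> U" and V0: "fd_space k V0"
    and h: "sheaf_isomorphism k (subtopology X U) F (constant_sheaf (subtopology X U) V0) h"
    using F x unfolding local_system_def by meson
  let ?C = "constant_sheaf (subtopology X U) V0"
  have sub: "openin (subtopology X U) W \<longleftrightarrow> openin X W \<and> W \<subseteq> U" for W
    using openin_open_subtopology[OF U(1)] .
  have hm: "h W \<in> lin k (Sec F W) (Sec ?C W)" "bij_betw (h W) (carrier (Sec F W)) (carrier (Sec ?C W))"
    if "openin X W" "W \<subseteq> U" for W
    using h that sub by (auto simp: sheaf_isomorphism_def sheaf_morphism_def)
  have hr: "h W (Res F W' W s) = restrict (h W' s) W"
    if "openin X W" "openin X W'" "W \<subseteq> W'" "W' \<subseteq> U" "s \<in> carrier (Sec F W')" for W W' s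
    using h that sub unfolding sheaf_isomorphism_def sheaf_morphism_def
    by (auto simp: constant_sheaf_def dest: order_trans)
  have hiso: "lin_iso k (Sec F W) (Sec ?C W) (h W)" if "openin X W" "W \<subseteq> U" for W
    using hm[OF that] by (simp add: lin_iso_def)
  have V0m: "Module.module k V0" using V0 by (auto simp: fd_space_def vectorspace_def)
  interpret V0: Module.module k V0 by (rule V0m)
  define \<kappa> where "\<kappa> W v = (\<lambda>y\<in>W. v)" for W :: "'x set" and v :: 's
  have \<kappa>: "\<kappa> W \<in> lin k V0 (Sec ?C W)" if "openin X W" "W \<subseteq> U" for W
    by (rule linI) (use that sub in \<open>auto simp: \<kappa>_def constant_sheaf_def fun_eq_iff\<close>)
  define j where "j v = inv_into (carrier (Sec F U)) (h U) (\<kappa> U v)" for v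
  note hU = lin_isoD[OF hiso[OF U(1) order_refl]]
  have \<kappa>c: "\<kappa> W v \<in> carrier (Sec ?C W)" if "openin X W" "W \<subseteq> U" "v \<in> carrier V0" for W v
    by (rule lin_closed[OF \<kappa>[OF that(1,2)] that(3)])
  have jl: "j \<in> lin k V0 (Sec F U)"
    unfolding j_def
    by (rule lin_compose[OF \<kappa>[OF U(1) order_refl] lin_iso_inverse[OF sec_module[OF ps U(1)] hiso[OF U(1) order_refl]]])
  have hj: "h W (Res F U W (j v)) = \<kappa> W v" if "openin X W" "W \<subseteq> U" "v \<in> carrier V0" for W v
  proof -
    have "h U (j v) = \<kappa> U v" unfolding j_def by (rule hU(6)[OF \<kappa>c[OF U(1) order_refl that(3)]])
    then show ?thesis
      using hr[OF that(1) U(1) that(2) order_refl lin_closed[OF jl that(3)]] that(2)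
      by (auto simp: \<kappa>_def fun_eq_iff restrict_def)
  qed
  have iso0: "lin_iso k V0 (stalk X y F) (\<lambda>v. germ X y F U (j v))" if y: "y \<in> U" for y
    unfolding lin_iso_def bij_betw_def
  proof (intro conjI)
    have n: "nbhd U y" using U y by simp
    show l: "(\<lambda>v. germ X y F U (j v)) \<in> lin k V0 (stalk X y F)"
      by (rule lin_compose[OF jl germ_lin[OF ps n]])
    show "inj_on (\<lambda>v. germ X y F U (j v)) (carrier V0)"
    proof (rule inj_onI)
      fix v w assume v: "v \<in> carrier V0" and w: "w \<in> carrier V0" and eq: "germ X y F U (j v) = germ X y F U (j w)"
      obtain W where W: "nbhd W y" "W \<subseteq> U \<inter> U" "Res F U W (j v) = Res F U W (j w)"
        using germ_eqD[OF ps n lin_closed[OF jl w] eq] .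
      have "\<kappa> W v = \<kappa> W w" using hj[of W v] hj[of W w] W v w by simp
      then show "v = w" using W(1) by (auto simp: \<kappa>_def fun_eq_iff restrict_def split: if_splits)
    qed
    show "(\<lambda>v. germ X y F U (j v)) ` carrier V0 = carrier (stalk X y F)"
    proof (intro equalityI subsetI)
      fix C assume "C \<in> carrier (stalk X y F)"
      then obtain W s where W: "nbhd W y" "W \<subseteq> U" "s \<in> carrier (Sec F W)" "C = germ X y F W s"
        using stalkE_in[OF ps _ n] by metis
      have hs: "h W s \<in> carrier (Sec ?C W)" by (rule lin_closed[OF hm(1)]) (use W in auto)
      then have hs1: "h W s \<in> W \<rightarrow>\<^sub>E carrier V0"
        and hs2: "\<forall>x\<in>W. \<exists>N. openin (subtopology X U) N \<and> x \<in> N \<and> N \<subseteq> W \<and> (\<forall>y\<in>N. h W s y = h W s x)"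
        by (simp_all add: constant_sheaf_def)
      have v: "h W s y \<in> carrier V0" by (rule PiE_mem[OF hs1]) (use W(1) in simp)
      obtain N where N: "openin (subtopology X U) N" "y \<in> N" "N \<subseteq> W" "\<forall>z\<in>N. h W s z = h W s y"
        using bspec[OF hs2, OF conjunct2[OF W(1)]] by (elim exE conjE)
      have No: "openin X N" "N \<subseteq> U" using N(1) sub by auto
      have "h N (Res F W N s) = \<kappa> N (h W s y)"
        using hr[OF No(1) _ N(3) W(2,3)] W(1) N(4) by (auto simp: \<kappa>_def fun_eq_iff restrict_def)
      also have "\<dots> = h N (Res F U N (j (h W s y)))" using hj[OF No v] by simp
      finally have r: "Res F W N s = Res F U N (j (h W s y))"
        by (rule inj_onD[OF lin_isoD(2)[OF hiso[OF No]] _ res_closed[OF ps _ No(1) N(3) W(3)] res_closed[OF ps U(1) No lin_closed[OF jl v]]])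
          (use W(1) in simp)
      have "C = germ X y F U (j (h W s y))"
        unfolding W(4)
        by (rule germ_eqI[OF ps W(1) n W(3) lin_closed[OF jl v] _ _ r]) (use W(2) No N(2,3) in auto)
      then show "C \<in> (\<lambda>v. germ X y F U (j v)) ` carrier V0" using v by blast
    qed (use lin_closed[OF l] in auto)
  qed
  obtain V :: "('k, nat \<Rightarrow> 'k) module" and f where V: "fd_space k V" "lin_iso k V V0 f"
    using fd_coordinates[OF V0] by blast
  have "sheaf_chart F U V (\<lambda>v. j (f v))"
    unfolding sheaf_chart_def
    using U V(1) lin_compose[OF lin_isoD(1)[OF V(2)] jl] lin_iso_compose[OF V(2) iso0] by blast
  then show ?thesis using U(2) by blast
qed

lemma sheaf_chart_restrict:
  assumes F: "presheaf_of_spaces k X F" and c: "sheaf_chart F N V j" and N': "openin X N'" "N' \<subseteq> N"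
  shows "sheaf_chart F N' V (\<lambda>v. Res F N N' (j v))"
proof -
  note cD = sheaf_chartD[OF c]
  have Vm: "Module.module k V" using cD(2) by (auto simp: fd_space_def vectorspace_def)
  have "lin_iso k V (stalk X y F) (\<lambda>v. germ X y F N' (Res F N N' (j v)))" if y: "y \<in> N'" for y
  proof -
    have eq: "germ X y F N' (Res F N N' (j v)) = germ X y F N (j v)" if "v \<in> carrier V" for v
      by (rule germ_res[OF F]) (use N' y cD(1) lin_closed[OF cD(3) that] in auto)
    have i: "lin_iso k V (stalk X y F) (\<lambda>v. germ X y F N (j v))" by (rule cD(4)) (use y N' in auto)
    show ?thesis
      unfolding lin_iso_def
      using lin_cong[OF Vm lin_isoD(1)[OF i] eq] i bij_betw_cong[of "carrier V", OF eq]
      by (simp add: lin_iso_def)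
  qed
  then show ?thesis
    unfolding sheaf_chart_def using N' cD(2) lin_compose[OF cD(3) res_lin[OF F cD(1) N']] by blast
qed

text \<open>In a chart, sections are locally constant.\<close>

lemma sheaf_chart_local:
  assumes F: "presheaf_of_spaces k X F" and c: "sheaf_chart F N V j"
    and U: "nbhd U x" and s: "s \<in> carrier (Sec F U)" and x: "x \<in> N"
  shows "\<exists>v\<in>carrier V. \<exists>W. nbhd W x \<and> W \<subseteq> U \<inter> N \<and> (\<forall>y\<in>W. germ X y F U s = germ X y F N (j v))"
proof -
  note cD = sheaf_chartD[OF c]
  have n: "nbhd N x" using cD(1) x by simp
  have "germ X x F U s \<in> (\<lambda>v. germ X x F N (j v)) ` carrier V"
    unfolding lin_isoD(3)[OF cD(4)[OF x]] by (rule germ_closed[OF F U s])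
  then obtain v where v: "v \<in> carrier V" "germ X x F U s = germ X x F N (j v)" by blast
  have jv: "j v \<in> carrier (Sec F N)" by (rule lin_closed[OF cD(3) v(1)])
  obtain W where W: "nbhd W x" "W \<subseteq> U \<inter> N" "Res F U W s = Res F N W (j v)"
    using germ_eqD[OF F n jv v(2)] .
  have "germ X y F U s = germ X y F N (j v)" if y: "y \<in> W" for y
    by (rule germ_eqI[OF F, of U y N _ _ W]) (use W U cD(1) y s jv in auto)
  then show ?thesis using v(1) W by blast
qed

lemma local_system_stalk_fd:
  assumes F: "local_system k X F" and x: "x \<in> topspace X"
  shows "fd_space k (stalk X x F)"
proof -
  obtain N and V :: "('k, nat \<Rightarrow> 'k) module" and j where c: "x \<in> N" "sheaf_chart F N V j"
    using local_system_chart[OF F x] by blast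
  show ?thesis
    by (rule fd_space_iso[OF sheaf_chartD(2)[OF c(2)] stalk_module[OF local_systemD(2)[OF F] x] sheaf_chartD(4)[OF c(2,1)]])
qed

end

section \<open>Local systems from compatible charts\<close>

text \<open>A family of spaces \<open>M y\<close>, with charts that identify \<open>V\<close> with \<open>M y\<close> for the points \<open>y\<close> of \<open>N\<close> and
  that differ by locally constant maps. The sections of the associated sheaf are the families that
  are constant in the charts; the encoding \<open>e\<close> moves them to the type of sections.\<close>

locale chart_family = sheaf_base k X for k :: "'k ring" (structure) and X :: "'x topology" +
  fixes M :: "'x \<Rightarrow> ('k, 'm) module"
    and \<C> :: "('x set \<times> ('k, nat \<Rightarrow> 'k) module \<times> ('x \<Rightarrow> (nat \<Rightarrow> 'k) \<Rightarrow> 'm)) set"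
    and e :: "('x \<Rightarrow> nat \<Rightarrow> 'k) \<Rightarrow> 's"
  assumes e_inj: "inj e"
    and M_module: "y \<in> topspace X \<Longrightarrow> Module.module k (M y)"
    and chart_open: "(N, V, j) \<in> \<C> \<Longrightarrow> openin X N"
    and chart_fd: "(N, V, j) \<in> \<C> \<Longrightarrow> fd_space k V"
    and chart_iso: "(N, V, j) \<in> \<C> \<Longrightarrow> y \<in> N \<Longrightarrow> lin_iso k V (M y) (j y)"
    and cover: "x \<in> topspace X \<Longrightarrow> \<exists>N V j. (N, V, j) \<in> \<C> \<and> x \<in> N"
    and compat: "(N, V, j) \<in> \<C> \<Longrightarrow> (N', V', j') \<in> \<C> \<Longrightarrow> x \<in> N \<inter> N' \<Longrightarrow> v \<in> carrier V \<Longrightarrow>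
      \<exists>v'\<in>carrier V'. \<exists>W. nbhd W x \<and> W \<subseteq> N \<inter> N' \<and> (\<forall>y\<in>W. j y v = j' y v')"
begin

definition in_chart where
  "in_chart N V j U \<sigma> x \<longleftrightarrow> (\<exists>v\<in>carrier V. \<exists>W. nbhd W x \<and> W \<subseteq> N \<inter> U \<and> (\<forall>y\<in>W. \<sigma> y = j y v))"

definition S where
  "S U = {\<sigma> \<in> extensional U. \<forall>x\<in>U. \<forall>N V j. (N, V, j) \<in> \<C> \<longrightarrow> x \<in> N \<longrightarrow> in_chart N V j U \<sigma> x}"

lemma top: "openin X U \<Longrightarrow> x \<in> U \<Longrightarrow> x \<in> topspace X"
  using openin_subset by blast

lemma chart_module: "(N, V, j) \<in> \<C> \<Longrightarrow> Module.module k V"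
  using chart_fd by (auto simp: fd_space_def vectorspace_def)

text \<open>Since charts differ by locally constant maps, it does not matter in which chart a family is constant.\<close>

lemma in_chart_change:
  assumes "(N, V, j) \<in> \<C>" "(N', V', j') \<in> \<C>" "x \<in> N" "x \<in> N'" "in_chart N V j U \<sigma> x"
  shows "in_chart N' V' j' U \<sigma> x"
proof -
  obtain v W where v: "v \<in> carrier V" "nbhd W x" "W \<subseteq> N \<inter> U" "\<forall>y\<in>W. \<sigma> y = j y v"
    using assms(5) unfolding in_chart_def by blast
  have "x \<in> N \<inter> N'" using assms by simp
  from compat[OF assms(1,2) this v(1)] obtain v' W' where v': "v' \<in> carrier V'" "nbhd W' x" "W' \<subseteq> N \<inter> N'"
    "\<forall>y\<in>W'. j y v = j' y v'" by blast
  have "nbhd (W \<inter> W') x" using v v' by auto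
  then show ?thesis
    unfolding in_chart_def using v v' by (intro bexI[OF _ v'(1)] exI[of _ "W \<inter> W'"]) auto
qed

lemma S_I:
  assumes "\<sigma> \<in> extensional U" "openin X U"
    and "\<And>x. x \<in> U \<Longrightarrow> \<exists>N V j. (N, V, j) \<in> \<C> \<and> x \<in> N \<and> in_chart N V j U \<sigma> x"
  shows "\<sigma> \<in> S U"
  unfolding S_def
proof (intro CollectI conjI ballI allI impI)
  fix x N V j assume x: "x \<in> U" and c: "(N, V, j) \<in> \<C>" "x \<in> N"
  obtain N' V' j' where c': "(N', V', j') \<in> \<C>" "x \<in> N'" "in_chart N' V' j' U \<sigma> x"
    using assms(3)[OF x] by blast
  show "in_chart N V j U \<sigma> x" by (rule in_chart_change[OF c'(1) c(1) c'(2) c(2) c'(3)])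
qed (rule assms(1))

lemma S_ext: "\<sigma> \<in> S U \<Longrightarrow> \<sigma> \<in> extensional U" by (simp add: S_def)

lemma S_chart:
  assumes "\<sigma> \<in> S U" "x \<in> U" "(N, V, j) \<in> \<C>" "x \<in> N"
  obtains v W where "v \<in> carrier V" "nbhd W x" "W \<subseteq> N \<inter> U" "\<And>y. y \<in> W \<Longrightarrow> \<sigma> y = j y v"
proof -
  have "in_chart N V j U \<sigma> x" using assms by (simp add: S_def)
  then show thesis using that unfolding in_chart_def by blast
qed

lemma S_val:
  assumes "\<sigma> \<in> S U" "openin X U" "x \<in> U"
  shows "\<sigma> x \<in> carrier (M x)"
proof -
  obtain N V j where c: "(N, V, j) \<in> \<C>" "x \<in> N" using cover[OF top[OF assms(2,3)]] by blast
  obtain v W where "v \<in> carrier V" "nbhd W x" "\<And>y. y \<in> W \<Longrightarrow> \<sigma> y = j y v"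
    using S_chart[OF assms(1,3) c] by metis
  then show ?thesis using lin_closed[OF lin_isoD(1)[OF chart_iso[OF c]]] by auto
qed

lemma S_restrict:
  assumes "\<sigma> \<in> S U" "openin X U" "openin X V" "V \<subseteq> U"
  shows "restrict \<sigma> V \<in> S V"
proof (rule S_I)
  fix x assume x: "x \<in> V"
  obtain N W j where c: "(N, W, j) \<in> \<C>" "x \<in> N" using cover[OF top[OF assms(3) x]] by blast
  obtain v P where P: "v \<in> carrier W" "nbhd P x" "P \<subseteq> N \<inter> U" "\<And>y. y \<in> P \<Longrightarrow> \<sigma> y = j y v"
    using S_chart[OF assms(1) _ c] x assms(4) by blast
  have "in_chart N W j V (restrict \<sigma> V) x"
    unfolding in_chart_def
    by (intro bexI[OF _ P(1)] exI[of _ "P \<inter> V"]) (use P x assms in auto)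
  then show "\<exists>N W j. (N, W, j) \<in> \<C> \<and> x \<in> N \<and> in_chart N W j V (restrict \<sigma> V) x" using c by blast
qed (use assms in auto)

lemma S_chart_section:
  assumes "(N, V, j) \<in> \<C>" "v \<in> carrier V" "openin X U" "U \<subseteq> N"
  shows "(\<lambda>y\<in>U. j y v) \<in> S U"
proof (rule S_I)
  fix x assume x: "x \<in> U"
  have "in_chart N V j U (\<lambda>y\<in>U. j y v) x"
    unfolding in_chart_def by (intro bexI[OF _ assms(2)] exI[of _ U]) (use assms x in auto)
  then show "\<exists>N' V' j'. (N', V', j') \<in> \<C> \<and> x \<in> N' \<and> in_chart N' V' j' U (\<lambda>y\<in>U. j y v) x"
    using assms x by blast
qed (use assms in auto)

definition SM :: "'x set \<Rightarrow> ('k, 'x \<Rightarrow> 'm) module" where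
  "SM U = \<lparr>carrier = S U, monoid.mult = undefined, one = undefined, zero = (\<lambda>y\<in>U. \<zero>\<^bsub>M y\<^esub>),
     add = (\<lambda>\<sigma> \<tau>. \<lambda>y\<in>U. \<sigma> y \<oplus>\<^bsub>M y\<^esub> \<tau> y), smult = (\<lambda>c \<sigma>. \<lambda>y\<in>U. c \<odot>\<^bsub>M y\<^esub> \<sigma> y)\<rparr>"

lemma SM_simps[simp]:
  "carrier (SM U) = S U" "\<zero>\<^bsub>SM U\<^esub> = (\<lambda>y\<in>U. \<zero>\<^bsub>M y\<^esub>)" "\<sigma> \<oplus>\<^bsub>SM U\<^esub> \<tau> = (\<lambda>y\<in>U. \<sigma> y \<oplus>\<^bsub>M y\<^esub> \<tau> y)"
  "c \<odot>\<^bsub>SM U\<^esub> \<sigma> = (\<lambda>y\<in>U. c \<odot>\<^bsub>M y\<^esub> \<sigma> y)"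
  by (simp_all add: SM_def)

lemma SM_module:
  assumes U: "openin X U"
  shows "Module.module k (SM U)"
proof (rule module_by[OF K.is_cring])
  have m: "Module.module k (M y)" if "y \<in> U" for y using M_module top[OF U that] by blast
  note val = S_val[OF _ U]
  have zero: "(\<lambda>y\<in>U. \<zero>\<^bsub>M y\<^esub>) \<in> S U"
  proof (rule S_I)
    fix x assume x: "x \<in> U"
    obtain N V j where c: "(N, V, j) \<in> \<C>" "x \<in> N" using cover[OF top[OF U x]] by blast
    interpret V: Module.module k V by (rule chart_module[OF c(1)])
    have "j y \<zero>\<^bsub>V\<^esub> = \<zero>\<^bsub>M y\<^esub>" if "y \<in> N \<inter> U" for y
      using lin_zero[OF V.module_axioms m lin_isoD(1)[OF chart_iso[OF c(1)]]] that by auto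
    then have "in_chart N V j U (\<lambda>y\<in>U. \<zero>\<^bsub>M y\<^esub>) x"
      unfolding in_chart_def
      by (intro bexI[of _ "\<zero>\<^bsub>V\<^esub>"] exI[of _ "N \<inter> U"]) (use U x c chart_open[OF c(1)] in auto)
    then show "\<exists>N V j. (N, V, j) \<in> \<C> \<and> x \<in> N \<and> in_chart N V j U (\<lambda>y\<in>U. \<zero>\<^bsub>M y\<^esub>) x" using c by blast
  qed (use U in auto)
  then show "\<zero>\<^bsub>SM U\<^esub> \<in> carrier (SM U)" by simp
  have smult: "(\<lambda>y\<in>U. a \<odot>\<^bsub>M y\<^esub> \<sigma> y) \<in> S U" if a: "a \<in> carrier k" and \<sigma>: "\<sigma> \<in> S U" for a \<sigma>
  proof (rule S_I)
    fix x assume x: "x \<in> U"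
    obtain N V j where c: "(N, V, j) \<in> \<C>" "x \<in> N" using cover[OF top[OF U x]] by blast
    interpret V: Module.module k V by (rule chart_module[OF c(1)])
    obtain v W where v: "v \<in> carrier V" "nbhd W x" "W \<subseteq> N \<inter> U" "\<And>y. y \<in> W \<Longrightarrow> \<sigma> y = j y v"
      using S_chart[OF \<sigma> x c] by blast
    have "in_chart N V j U (\<lambda>y\<in>U. a \<odot>\<^bsub>M y\<^esub> \<sigma> y) x"
      unfolding in_chart_def
    proof (intro bexI[of _ "a \<odot>\<^bsub>V\<^esub> v"] exI[of _ W] conjI ballI)
      fix y assume y: "y \<in> W"
      then have "y \<in> N" "y \<in> U" using v(3) by auto
      then show "(\<lambda>y\<in>U. a \<odot>\<^bsub>M y\<^esub> \<sigma> y) y = j y (a \<odot>\<^bsub>V\<^esub> v)"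
        using lin_smult[OF lin_isoD(1)[OF chart_iso[OF c(1)]] a v(1)] v(4)[OF y] by simp
    qed (use v a in auto)
    then show "\<exists>N V j. (N, V, j) \<in> \<C> \<and> x \<in> N \<and> in_chart N V j U (\<lambda>y\<in>U. a \<odot>\<^bsub>M y\<^esub> \<sigma> y) x" using c by blast
  qed (use U in auto)
  have add: "(\<lambda>y\<in>U. \<sigma> y \<oplus>\<^bsub>M y\<^esub> \<tau> y) \<in> S U" if \<sigma>: "\<sigma> \<in> S U" and \<tau>: "\<tau> \<in> S U" for \<sigma> \<tau>
  proof (rule S_I)
    fix x assume x: "x \<in> U"
    obtain N V j where c: "(N, V, j) \<in> \<C>" "x \<in> N" using cover[OF top[OF U x]] by blast
    interpret V: Module.module k V by (rule chart_module[OF c(1)])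
    obtain v W where v: "v \<in> carrier V" "nbhd W x" "W \<subseteq> N \<inter> U" "\<And>y. y \<in> W \<Longrightarrow> \<sigma> y = j y v"
      using S_chart[OF \<sigma> x c] by blast
    obtain w P where w: "w \<in> carrier V" "nbhd P x" "P \<subseteq> N \<inter> U" "\<And>y. y \<in> P \<Longrightarrow> \<tau> y = j y w"
      using S_chart[OF \<tau> x c] by blast
    have "in_chart N V j U (\<lambda>y\<in>U. \<sigma> y \<oplus>\<^bsub>M y\<^esub> \<tau> y) x"
      unfolding in_chart_def
    proof (intro bexI[of _ "v \<oplus>\<^bsub>V\<^esub> w"] exI[of _ "W \<inter> P"] conjI ballI)
      fix y assume y: "y \<in> W \<inter> P"
      then have "y \<in> N" "y \<in> U" using v(3) by auto
      then show "(\<lambda>y\<in>U. \<sigma> y \<oplus>\<^bsub>M y\<^esub> \<tau> y) y = j y (v \<oplus>\<^bsub>V\<^esub> w)"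
        using lin_add[OF lin_isoD(1)[OF chart_iso[OF c(1)]] v(1) w(1)] v(4) w(4) y by simp
    qed (use v w in auto)
    then show "\<exists>N V j. (N, V, j) \<in> \<C> \<and> x \<in> N \<and> in_chart N V j U (\<lambda>y\<in>U. \<sigma> y \<oplus>\<^bsub>M y\<^esub> \<tau> y) x" using c by blast
  qed (use U in auto)
  fix \<sigma> assume "\<sigma> \<in> carrier (SM U)"
  then have \<sigma>: "\<sigma> \<in> S U" by simp
  note \<sigma>v = val[OF \<sigma>] and \<sigma>e = S_ext[OF \<sigma>]
  have eqI: "f = g" if "f \<in> extensional U" "g \<in> extensional U" "\<And>y. y \<in> U \<Longrightarrow> f y = g y" for f g :: "'x \<Rightarrow> 'm"
    by (rule extensionalityI[OF that])
  show "\<exists>\<tau>\<in>carrier (SM U). \<sigma> \<oplus>\<^bsub>SM U\<^esub> \<tau> = \<zero>\<^bsub>SM U\<^esub>"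
  proof (rule bexI[of _ "\<lambda>y\<in>U. (\<ominus> \<one>) \<odot>\<^bsub>M y\<^esub> \<sigma> y"])
    show "(\<lambda>y\<in>U. (\<ominus> \<one>) \<odot>\<^bsub>M y\<^esub> \<sigma> y) \<in> carrier (SM U)" using smult[OF _ \<sigma>, of "\<ominus> \<one>"] by simp
    have "\<sigma> y \<oplus>\<^bsub>M y\<^esub> (\<ominus> \<one>) \<odot>\<^bsub>M y\<^esub> \<sigma> y = \<zero>\<^bsub>M y\<^esub>" if y: "y \<in> U" for y
    proof -
      interpret My: Module.module k "M y" by (rule m[OF y])
      show ?thesis using \<sigma>v[OF y] by (simp add: My.smult_l_minus My.M.r_neg)
    qed
    then show "\<sigma> \<oplus>\<^bsub>SM U\<^esub> (\<lambda>y\<in>U. (\<ominus> \<one>) \<odot>\<^bsub>M y\<^esub> \<sigma> y) = \<zero>\<^bsub>SM U\<^esub>"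
      by (intro eqI) auto
  qed
  show "\<sigma> \<oplus>\<^bsub>SM U\<^esub> \<zero>\<^bsub>SM U\<^esub> = \<sigma>"
  proof (rule eqI)
    fix y assume y: "y \<in> U"
    interpret My: Module.module k "M y" by (rule m[OF y])
    show "(\<sigma> \<oplus>\<^bsub>SM U\<^esub> \<zero>\<^bsub>SM U\<^esub>) y = \<sigma> y" using y \<sigma>v[OF y] by simp
  qed (use \<sigma>e in auto)
  show "\<one> \<odot>\<^bsub>SM U\<^esub> \<sigma> = \<sigma>"
  proof (rule eqI)
    fix y assume y: "y \<in> U"
    interpret My: Module.module k "M y" by (rule m[OF y])
    show "(\<one> \<odot>\<^bsub>SM U\<^esub> \<sigma>) y = \<sigma> y" using y \<sigma>v[OF y] by simp
  qed (use \<sigma>e in auto)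
  show "a \<odot>\<^bsub>SM U\<^esub> \<sigma> \<in> carrier (SM U)" if "a \<in> carrier k" for a using smult[OF that \<sigma>] by simp
  show "(a \<otimes> b) \<odot>\<^bsub>SM U\<^esub> \<sigma> = a \<odot>\<^bsub>SM U\<^esub> (b \<odot>\<^bsub>SM U\<^esub> \<sigma>)"
    "(a \<oplus> b) \<odot>\<^bsub>SM U\<^esub> \<sigma> = a \<odot>\<^bsub>SM U\<^esub> \<sigma> \<oplus>\<^bsub>SM U\<^esub> b \<odot>\<^bsub>SM U\<^esub> \<sigma>"
    if ab: "a \<in> carrier k" "b \<in> carrier k" for a b
  proof -
    have "(a \<otimes> b) \<odot>\<^bsub>M y\<^esub> \<sigma> y = a \<odot>\<^bsub>M y\<^esub> (b \<odot>\<^bsub>M y\<^esub> \<sigma> y)"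
      "(a \<oplus> b) \<odot>\<^bsub>M y\<^esub> \<sigma> y = a \<odot>\<^bsub>M y\<^esub> \<sigma> y \<oplus>\<^bsub>M y\<^esub> b \<odot>\<^bsub>M y\<^esub> \<sigma> y" if "y \<in> U" for y
      using Module.module.smult_assoc1[OF m[OF that] ab \<sigma>v[OF that]]
        Module.module.smult_l_distr[OF m[OF that] ab \<sigma>v[OF that]] .
    then show "(a \<otimes> b) \<odot>\<^bsub>SM U\<^esub> \<sigma> = a \<odot>\<^bsub>SM U\<^esub> (b \<odot>\<^bsub>SM U\<^esub> \<sigma>)"
      "(a \<oplus> b) \<odot>\<^bsub>SM U\<^esub> \<sigma> = a \<odot>\<^bsub>SM U\<^esub> \<sigma> \<oplus>\<^bsub>SM U\<^esub> b \<odot>\<^bsub>SM U\<^esub> \<sigma>"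
      by (auto intro!: eqI)
  qed
  fix \<tau> assume "\<tau> \<in> carrier (SM U)"
  then have \<tau>: "\<tau> \<in> S U" by simp
  note \<tau>v = val[OF \<tau>]
  show "\<sigma> \<oplus>\<^bsub>SM U\<^esub> \<tau> \<in> carrier (SM U)" using add[OF \<sigma> \<tau>] by simp
  show "\<sigma> \<oplus>\<^bsub>SM U\<^esub> \<tau> = \<tau> \<oplus>\<^bsub>SM U\<^esub> \<sigma>"
  proof (rule eqI)
    fix y assume y: "y \<in> U"
    interpret My: Module.module k "M y" by (rule m[OF y])
    show "(\<sigma> \<oplus>\<^bsub>SM U\<^esub> \<tau>) y = (\<tau> \<oplus>\<^bsub>SM U\<^esub> \<sigma>) y" using y \<sigma>v[OF y] \<tau>v[OF y] by (simp add: My.M.a_comm)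
  qed auto
  show "a \<odot>\<^bsub>SM U\<^esub> (\<sigma> \<oplus>\<^bsub>SM U\<^esub> \<tau>) = a \<odot>\<^bsub>SM U\<^esub> \<sigma> \<oplus>\<^bsub>SM U\<^esub> a \<odot>\<^bsub>SM U\<^esub> \<tau>" if a: "a \<in> carrier k" for a
  proof (rule eqI)
    fix y assume y: "y \<in> U"
    interpret My: Module.module k "M y" by (rule m[OF y])
    show "(a \<odot>\<^bsub>SM U\<^esub> (\<sigma> \<oplus>\<^bsub>SM U\<^esub> \<tau>)) y = (a \<odot>\<^bsub>SM U\<^esub> \<sigma> \<oplus>\<^bsub>SM U\<^esub> a \<odot>\<^bsub>SM U\<^esub> \<tau>) y"
      using y a \<sigma>v[OF y] \<tau>v[OF y] by (simp add: My.smult_r_distr)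
  qed auto
  fix \<rho> assume "\<rho> \<in> carrier (SM U)"
  then have \<rho>: "\<rho> \<in> S U" by simp
  show "\<sigma> \<oplus>\<^bsub>SM U\<^esub> \<tau> \<oplus>\<^bsub>SM U\<^esub> \<rho> = \<sigma> \<oplus>\<^bsub>SM U\<^esub> (\<tau> \<oplus>\<^bsub>SM U\<^esub> \<rho>)"
  proof (rule eqI)
    fix y assume y: "y \<in> U"
    interpret My: Module.module k "M y" by (rule m[OF y])
    show "(\<sigma> \<oplus>\<^bsub>SM U\<^esub> \<tau> \<oplus>\<^bsub>SM U\<^esub> \<rho>) y = (\<sigma> \<oplus>\<^bsub>SM U\<^esub> (\<tau> \<oplus>\<^bsub>SM U\<^esub> \<rho>)) y"
      using y \<sigma>v[OF y] \<tau>v[OF y] val[OF \<rho> y] by (simp add: My.M.a_assoc)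
  qed auto
qed

subsection \<open>The associated sheaf\<close>

text \<open>A chart embeds \<open>M y\<close> into \<open>nat \<Rightarrow> 'k\<close>. With such embeddings a family of elements of the \<open>M y\<close> becomes a
  function \<open>'x \<Rightarrow> nat \<Rightarrow> 'k\<close>, which \<open>e\<close> can encode as a section.\<close>

definition \<kappa> :: "'x \<Rightarrow> 'm \<Rightarrow> nat \<Rightarrow> 'k" where "\<kappa> y = (SOME f. inj_on f (carrier (M y)))"

definition enc :: "'x set \<Rightarrow> ('x \<Rightarrow> 'm) \<Rightarrow> 's" where "enc U \<sigma> = e (\<lambda>y\<in>U. \<kappa> y (\<sigma> y))"

definition dec :: "'x set \<Rightarrow> 's \<Rightarrow> 'x \<Rightarrow> 'm" where "dec U = inv_into (S U) (enc U)"

definition A :: "('x, 'k, 's) presheaf" where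
  "A = \<lparr>Sec = (\<lambda>U. transport (enc U) (SM U)), Res = (\<lambda>U V s. enc V (restrict (dec U s) V))\<rparr>"

lemma \<kappa>_inj: "y \<in> topspace X \<Longrightarrow> inj_on (\<kappa> y) (carrier (M y))"
proof -
  assume "y \<in> topspace X"
  then obtain N V j where c: "(N, V, j) \<in> \<C>" "y \<in> N" using cover by blast
  have "inj_on (inv_into (carrier V) (j y)) (carrier (M y))"
    by (rule inj_on_inv_into) (simp add: lin_isoD(3)[OF chart_iso[OF c]])
  then show ?thesis unfolding \<kappa>_def by (rule someI[of "\<lambda>f. inj_on f (carrier (M y))"])
qed

lemma enc_inj: "openin X U \<Longrightarrow> inj_on (enc U) (S U)"
proof (rule inj_onI)
  fix \<sigma> \<tau> assume U: "openin X U" and \<sigma>: "\<sigma> \<in> S U" and \<tau>: "\<tau> \<in> S U" and eq: "enc U \<sigma> = enc U \<tau>"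
  have r: "(\<lambda>y\<in>U. \<kappa> y (\<sigma> y)) = (\<lambda>y\<in>U. \<kappa> y (\<tau> y))" using eq e_inj unfolding enc_def by (rule injD[rotated])
  show "\<sigma> = \<tau>"
  proof (rule extensionalityI[OF S_ext[OF \<sigma>] S_ext[OF \<tau>]])
    fix y assume y: "y \<in> U"
    have "\<kappa> y (\<sigma> y) = \<kappa> y (\<tau> y)" using fun_cong[OF r, of y] y by simp
    then show "\<sigma> y = \<tau> y"
      using inj_onD[OF \<kappa>_inj[OF top[OF U y]]] S_val[OF \<sigma> U y] S_val[OF \<tau> U y] by blast
  qed
qed

lemma A_module: "openin X U \<Longrightarrow> Module.module k (Sec A U)"
  and enc_iso: "openin X U \<Longrightarrow> lin_iso k (SM U) (Sec A U) (enc U)"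
  using transport[OF SM_module, of U "enc U"] enc_inj by (simp_all add: A_def)

lemma enc_closed: "openin X U \<Longrightarrow> \<sigma> \<in> S U \<Longrightarrow> enc U \<sigma> \<in> carrier (Sec A U)"
  using lin_closed[OF lin_isoD(1)[OF enc_iso], of U \<sigma>] by simp

lemma dec_enc: "openin X U \<Longrightarrow> \<sigma> \<in> S U \<Longrightarrow> dec U (enc U \<sigma>) = \<sigma>"
  using lin_isoD(4)[OF enc_iso, of U \<sigma>] by (simp add: dec_def)

lemma dec_closed: "openin X U \<Longrightarrow> s \<in> carrier (Sec A U) \<Longrightarrow> dec U s \<in> S U"
  using lin_isoD(5)[OF enc_iso, of U s] by (simp add: dec_def)

lemma enc_dec: "openin X U \<Longrightarrow> s \<in> carrier (Sec A U) \<Longrightarrow> enc U (dec U s) = s"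
  using lin_isoD(6)[OF enc_iso, of U s] by (simp add: dec_def)

lemma dec_lin: "openin X U \<Longrightarrow> dec U \<in> lin k (Sec A U) (SM U)"
  using lin_iso_inverse[OF SM_module enc_iso, of U] by (simp add: dec_def)

lemma A_Res: "Res A U V s = enc V (restrict (dec U s) V)" by (simp add: A_def)

lemma dec_Res:
  "openin X U \<Longrightarrow> openin X V \<Longrightarrow> V \<subseteq> U \<Longrightarrow> s \<in> carrier (Sec A U) \<Longrightarrow> dec V (Res A U V s) = restrict (dec U s) V"
  by (simp add: A_Res dec_enc S_restrict[OF dec_closed])

lemma sec_eqI:
  assumes "openin X U" "s \<in> carrier (Sec A U)" "t \<in> carrier (Sec A U)" "\<And>y. y \<in> U \<Longrightarrow> dec U s y = dec U t y"
  shows "s = t"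
proof -
  have "dec U s = dec U t"
    by (rule extensionalityI[OF S_ext[OF dec_closed[OF assms(1,2)]] S_ext[OF dec_closed[OF assms(1,3)]] assms(4)])
  then have "enc U (dec U s) = enc U (dec U t)" by simp
  then show ?thesis unfolding enc_dec[OF assms(1,2)] enc_dec[OF assms(1,3)] .
qed

lemma dec_add: "openin X U \<Longrightarrow> s \<in> carrier (Sec A U) \<Longrightarrow> t \<in> carrier (Sec A U) \<Longrightarrow> y \<in> U \<Longrightarrow>
    dec U (s \<oplus>\<^bsub>Sec A U\<^esub> t) y = dec U s y \<oplus>\<^bsub>M y\<^esub> dec U t y"
  and dec_smult: "openin X U \<Longrightarrow> s \<in> carrier (Sec A U) \<Longrightarrow> c \<in> carrier k \<Longrightarrow> y \<in> U \<Longrightarrow>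
    dec U (c \<odot>\<^bsub>Sec A U\<^esub> s) y = c \<odot>\<^bsub>M y\<^esub> dec U s y"
  using lin_add[OF dec_lin, of U s t] lin_smult[OF dec_lin, of U c s] by simp_all

lemma A_Res_closed:
  "openin X U \<Longrightarrow> openin X V \<Longrightarrow> V \<subseteq> U \<Longrightarrow> s \<in> carrier (Sec A U) \<Longrightarrow> Res A U V s \<in> carrier (Sec A V)"
  by (simp add: A_Res enc_closed S_restrict[OF dec_closed])

lemma A_presheaf: "presheaf_of_spaces k X A"
  unfolding presheaf_of_spaces_def
proof (intro conjI allI impI ballI)
  show "vectorspace k (Sec A U)" if "openin X U" for U
    using A_module[OF that] is_field by (simp add: vectorspace_def)
  show "Res A U V \<in> lin k (Sec A U) (Sec A V)" if UV: "openin X U \<and> openin X V \<and> V \<subseteq> U" for U V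
  proof (rule linI)
    interpret AU: Module.module k "Sec A U" by (rule A_module) (use UV in simp)
    interpret AV: Module.module k "Sec A V" by (rule A_module) (use UV in simp)
    fix s assume s: "s \<in> carrier (Sec A U)"
    show rs: "Res A U V s \<in> carrier (Sec A V)" by (rule A_Res_closed) (use UV s in auto)
    show "Res A U V (c \<odot>\<^bsub>Sec A U\<^esub> s) = c \<odot>\<^bsub>Sec A V\<^esub> Res A U V s" if c: "c \<in> carrier k" for c
    proof (rule sec_eqI)
      have "c \<odot>\<^bsub>Sec A U\<^esub> s \<in> carrier (Sec A U)" using s c by simp
      then show "dec V (Res A U V (c \<odot>\<^bsub>Sec A U\<^esub> s)) y = dec V (c \<odot>\<^bsub>Sec A V\<^esub> Res A U V s) y" if "y \<in> V" for y
        using that UV s c rs dec_Res[of U V] dec_smult[of U s c y] dec_smult[of V "Res A U V s" c y] by auto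
    qed (use UV s c rs A_Res_closed[of U V "c \<odot>\<^bsub>Sec A U\<^esub> s"] in auto)
    fix t assume t: "t \<in> carrier (Sec A U)"
    have rt: "Res A U V t \<in> carrier (Sec A V)" by (rule A_Res_closed) (use UV t in auto)
    show "Res A U V (s \<oplus>\<^bsub>Sec A U\<^esub> t) = Res A U V s \<oplus>\<^bsub>Sec A V\<^esub> Res A U V t"
    proof (rule sec_eqI)
      have "s \<oplus>\<^bsub>Sec A U\<^esub> t \<in> carrier (Sec A U)" using s t by simp
      then show "dec V (Res A U V (s \<oplus>\<^bsub>Sec A U\<^esub> t)) y = dec V (Res A U V s \<oplus>\<^bsub>Sec A V\<^esub> Res A U V t) y" if "y \<in> V" for y
        using that UV s t rs rt dec_Res[of U V] dec_add[of U s t y] dec_add[of V "Res A U V s" "Res A U V t" y] by auto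
    qed (use UV s t rs rt A_Res_closed[of U V "s \<oplus>\<^bsub>Sec A U\<^esub> t"] in auto)
  qed
  show "Res A U U s = s" if U: "openin X U" "s \<in> carrier (Sec A U)" for U s
    by (rule sec_eqI[OF U(1)]) (use U A_Res_closed[of U U s] dec_Res[of U U s] in auto)
  show "Res A V W (Res A U V s) = Res A U W s"
    if UVW: "openin X U \<and> openin X V \<and> openin X W \<and> W \<subseteq> V \<and> V \<subseteq> U" and s: "s \<in> carrier (Sec A U)" for U V W s
  proof (rule sec_eqI[of W])
    have rs: "Res A U V s \<in> carrier (Sec A V)" by (rule A_Res_closed) (use UVW s in auto)
    show "Res A V W (Res A U V s) \<in> carrier (Sec A W)" by (rule A_Res_closed) (use UVW rs in auto)
    show "Res A U W s \<in> carrier (Sec A W)" by (rule A_Res_closed) (use UVW s in auto)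
    show "dec W (Res A V W (Res A U V s)) y = dec W (Res A U W s) y" if "y \<in> W" for y
      using that UVW s rs dec_Res[of V W "Res A U V s"] dec_Res[of U V s] dec_Res[of U W s] by auto
  qed (use UVW in simp)
qed

lemma A_sheaf: "sheaf_of_spaces k X A"
  unfolding sheaf_of_spaces_def
proof (intro conjI allI impI A_presheaf)
  fix \<U> s assume *: "(\<forall>U\<in>\<U>. openin X U) \<and> (\<forall>U\<in>\<U>. s U \<in> carrier (Sec A U)) \<and>
    (\<forall>U\<in>\<U>. \<forall>V\<in>\<U>. Res A U (U \<inter> V) (s U) = Res A V (U \<inter> V) (s V))"
  have o: "openin X U" and sc: "s U \<in> carrier (Sec A U)" if "U \<in> \<U>" for U using * that by auto
  let ?T = "\<Union>\<U>"
  have To: "openin X ?T" using o by blast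
  have same: "dec U (s U) y = dec V (s V) y" if "U \<in> \<U>" "V \<in> \<U>" "y \<in> U" "y \<in> V" for U V y
  proof -
    have i: "openin X (U \<inter> V)" using o that by blast
    have "Res A U (U \<inter> V) (s U) = Res A V (U \<inter> V) (s V)" using * that by blast
    then have "restrict (dec U (s U)) (U \<inter> V) = restrict (dec V (s V)) (U \<inter> V)"
      using dec_Res[OF o[OF that(1)] i _ sc[OF that(1)]] dec_Res[OF o[OF that(2)] i _ sc[OF that(2)]] by simp
    from fun_cong[OF this, of y] that show ?thesis by simp
  qed
  define pick where "pick y = (SOME U. U \<in> \<U> \<and> y \<in> U)" for y
  have pick: "pick y \<in> \<U>" "y \<in> pick y" if "y \<in> ?T" for y
  proof -
    have "\<exists>U. U \<in> \<U> \<and> y \<in> U" using that by blast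
    from someI_ex[OF this] show "pick y \<in> \<U>" "y \<in> pick y" unfolding pick_def by auto
  qed
  define \<sigma> where "\<sigma> = (\<lambda>y\<in>?T. dec (pick y) (s (pick y)) y)"
  have \<sigma>U: "\<sigma> y = dec U (s U) y" if U: "U \<in> \<U>" and y: "y \<in> U" for U y
  proof -
    have yT: "y \<in> ?T" using U y by blast
    then have "\<sigma> y = dec (pick y) (s (pick y)) y" by (simp add: \<sigma>_def)
    then show ?thesis using same[OF pick(1)[OF yT] U pick(2)[OF yT] y] by simp
  qed
  have \<sigma>: "\<sigma> \<in> S ?T"
  proof (rule S_I)
    fix x assume "x \<in> ?T"
    then obtain U where U: "U \<in> \<U>" "x \<in> U" by blast
    obtain N V j where c: "(N, V, j) \<in> \<C>" "x \<in> N" using cover[OF top[OF o[OF U(1)] U(2)]] by blast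
    obtain v W where v: "v \<in> carrier V" "nbhd W x" "W \<subseteq> N \<inter> U" "\<And>y. y \<in> W \<Longrightarrow> dec U (s U) y = j y v"
      using S_chart[OF dec_closed[OF o[OF U(1)] sc[OF U(1)]] U(2) c] by blast
    have "in_chart N V j ?T \<sigma> x"
      unfolding in_chart_def
    proof (intro bexI[OF _ v(1)] exI[of _ W] conjI ballI)
      fix y assume "y \<in> W"
      then show "\<sigma> y = j y v" using \<sigma>U[OF U(1), of y] v(3,4) by auto
    qed (use v U in auto)
    then show "\<exists>N V j. (N, V, j) \<in> \<C> \<and> x \<in> N \<and> in_chart N V j ?T \<sigma> x" using c by blast
  qed (use To in \<open>auto simp: \<sigma>_def\<close>)
  show "\<exists>!t. t \<in> carrier (Sec A ?T) \<and> (\<forall>U\<in>\<U>. Res A ?T U t = s U)"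
  proof (rule ex1I[of _ "enc ?T \<sigma>"])
    have tc: "enc ?T \<sigma> \<in> carrier (Sec A ?T)" by (rule enc_closed[OF To \<sigma>])
    have "Res A ?T U (enc ?T \<sigma>) = s U" if U: "U \<in> \<U>" for U
    proof (rule sec_eqI[OF o[OF U] _ sc[OF U]])
      show "Res A ?T U (enc ?T \<sigma>) \<in> carrier (Sec A U)" by (rule A_Res_closed[OF To o[OF U] _ tc]) (use U in blast)
      have "dec U (Res A ?T U (enc ?T \<sigma>)) = restrict \<sigma> U"
        using dec_Res[OF To o[OF U] _ tc] dec_enc[OF To \<sigma>] U by auto
      then show "dec U (Res A ?T U (enc ?T \<sigma>)) y = dec U (s U) y" if "y \<in> U" for y
        using \<sigma>U[OF U that] that by simp
    qed
    then show "enc ?T \<sigma> \<in> carrier (Sec A ?T) \<and> (\<forall>U\<in>\<U>. Res A ?T U (enc ?T \<sigma>) = s U)" using tc by blast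
    fix t assume t: "t \<in> carrier (Sec A ?T) \<and> (\<forall>U\<in>\<U>. Res A ?T U t = s U)"
    show "t = enc ?T \<sigma>"
    proof (rule sec_eqI[OF To _ tc])
      fix y assume "y \<in> ?T"
      then obtain U where U: "U \<in> \<U>" "y \<in> U" by blast
      have "U \<subseteq> ?T" using U by blast
      then have "dec U (s U) = restrict (dec ?T t) U" using dec_Res[OF To o[OF U(1)], of t] t U(1) by auto
      from fun_cong[OF this, of y] show "dec ?T t y = dec ?T (enc ?T \<sigma>) y"
        using \<sigma>U[OF U] U(2) dec_enc[OF To \<sigma>] by simp
    qed (use t in simp)
  qed
qed

text \<open>The value of a section at \<open>y\<close> depends only on its germ.\<close>

definition \<iota> :: "'x \<Rightarrow> ('x set \<times> 's) set \<Rightarrow> 'm" where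
  "\<iota> y C = (SOME m. \<exists>U s. (U, s) \<in> C \<and> m = dec U s y)"

lemma \<iota>_germ:
  assumes U: "nbhd U y" and s: "s \<in> carrier (Sec A U)"
  shows "\<iota> y (germ X y A U s) = dec U s y"
proof -
  have *: "dec U' s' y = dec U s y" if U': "(U', s') \<in> germ X y A U s" for U' s'
  proof -
    obtain W where W: "nbhd U' y" "s' \<in> carrier (Sec A U')" "nbhd W y" "W \<subseteq> U \<inter> U'" "Res A U W s = Res A U' W s'"
      using U' unfolding germ_mem[OF A_presheaf] by blast
    have "restrict (dec U s) W = restrict (dec U' s') W"
      using dec_Res[of U W s] dec_Res[of U' W s'] W U s by auto
    from fun_cong[OF this, of y] show ?thesis using W by simp
  qed
  have "\<exists>m. \<exists>U' s'. (U', s') \<in> germ X y A U s \<and> m = dec U' s' y"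
    using germ_self[OF A_presheaf U s] by blast
  from someI_ex[OF this] obtain U' s' where "(U', s') \<in> germ X y A U s" "\<iota> y (germ X y A U s) = dec U' s' y"
    unfolding \<iota>_def[symmetric] by (elim exE conjE)
  then show ?thesis using *[of U' s'] by simp
qed

lemma \<iota>_iso:
  assumes y: "y \<in> topspace X"
  shows "lin_iso k (stalk X y A) (M y) (\<iota> y)"
  unfolding lin_iso_def bij_betw_def
proof (intro conjI)
  note ps = A_presheaf
  obtain N V j where c: "(N, V, j) \<in> \<C>" "y \<in> N" using cover[OF y] by blast
  note j = lin_isoD[OF chart_iso[OF c]]
  show l: "\<iota> y \<in> lin k (stalk X y A) (M y)"
  proof (rule linI)
    fix C assume C: "C \<in> carrier (stalk X y A)"
    obtain U s where U: "nbhd U y" "s \<in> carrier (Sec A U)" "C = germ X y A U s" using stalkE[OF ps C] .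
    interpret AU: Module.module k "Sec A U" by (rule A_module) (use U in simp)
    show "\<iota> y C \<in> carrier (M y)" using U S_val[OF dec_closed] \<iota>_germ by auto
    show "\<iota> y (a \<odot>\<^bsub>stalk X y A\<^esub> C) = a \<odot>\<^bsub>M y\<^esub> \<iota> y C" if "a \<in> carrier k" for a
      using U that \<iota>_germ[OF U(1)] dec_smult[of U s a y] by (simp add: germ_smult[OF ps])
    fix D assume D: "D \<in> carrier (stalk X y A)"
    obtain W s t where W: "nbhd W y" "s \<in> carrier (Sec A W)" "t \<in> carrier (Sec A W)"
      "C = germ X y A W s" "D = germ X y A W t" using stalkE2[OF ps C D] .
    interpret AW: Module.module k "Sec A W" by (rule A_module) (use W in simp)
    show "\<iota> y (C \<oplus>\<^bsub>stalk X y A\<^esub> D) = \<iota> y C \<oplus>\<^bsub>M y\<^esub> \<iota> y D"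
      using W \<iota>_germ[OF W(1)] dec_add[of W s t y] by (simp add: germ_add[OF ps])
  qed
  show "inj_on (\<iota> y) (carrier (stalk X y A))"
  proof (rule inj_onI)
    fix C D assume C: "C \<in> carrier (stalk X y A)" and D: "D \<in> carrier (stalk X y A)" and eq: "\<iota> y C = \<iota> y D"
    obtain U s t where U: "nbhd U y" "s \<in> carrier (Sec A U)" "t \<in> carrier (Sec A U)"
      "C = germ X y A U s" "D = germ X y A U t" using stalkE2[OF ps C D] .
    have Uo: "openin X U" "y \<in> U" using U by auto
    obtain v W where v: "v \<in> carrier V" "nbhd W y" "W \<subseteq> N \<inter> U" "\<And>z. z \<in> W \<Longrightarrow> dec U s z = j z v"
      using S_chart[OF dec_closed[OF Uo(1) U(2)] Uo(2) c] by blast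
    obtain w P where w: "w \<in> carrier V" "nbhd P y" "P \<subseteq> N \<inter> U" "\<And>z. z \<in> P \<Longrightarrow> dec U t z = j z w"
      using S_chart[OF dec_closed[OF Uo(1) U(3)] Uo(2) c] by blast
    have "j y v = j y w" using eq U \<iota>_germ[OF U(1)] v w by simp
    then have vw: "v = w" using inj_onD[OF j(2)] v w by blast
    let ?W = "W \<inter> P"
    have Wo: "nbhd ?W y" "?W \<subseteq> U" using v w by auto
    have "Res A U ?W s = Res A U ?W t"
      by (rule sec_eqI[of ?W])
        (use Wo Uo U v w vw A_Res_closed[of U ?W] dec_Res[of U ?W s] dec_Res[of U ?W t] in auto)
    then show "C = D"
      unfolding U(4,5) by (intro germ_eqI[OF ps U(1) U(1) U(2,3) Wo(1)]) (use Wo in auto)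
  qed
  show "\<iota> y ` carrier (stalk X y A) = carrier (M y)"
  proof (intro equalityI subsetI)
    fix m assume "m \<in> carrier (M y)"
    then obtain v where v: "v \<in> carrier V" "m = j y v" using j(3) by blast
    have No: "nbhd N y" using chart_open[OF c(1)] c(2) by simp
    have s: "(\<lambda>z\<in>N. j z v) \<in> S N" by (rule S_chart_section[OF c(1) v(1) chart_open[OF c(1)] order_refl])
    have ec: "enc N (\<lambda>z\<in>N. j z v) \<in> carrier (Sec A N)" by (rule enc_closed[OF chart_open[OF c(1)] s])
    have "\<iota> y (germ X y A N (enc N (\<lambda>z\<in>N. j z v))) = m"
      using \<iota>_germ[OF No ec] dec_enc[OF chart_open[OF c(1)] s] v c(2) by simp
    then show "m \<in> \<iota> y ` carrier (stalk X y A)" using germ_closed[OF ps No ec] by blast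
  qed (use lin_closed[OF l] in auto)
qed

lemma \<iota>_local:
  assumes U: "nbhd U x" and s: "s \<in> carrier (Sec A U)" and c: "(N, V, j) \<in> \<C>" "x \<in> N"
  shows "\<exists>v\<in>carrier V. \<exists>W. nbhd W x \<and> W \<subseteq> N \<inter> U \<and> (\<forall>y\<in>W. \<iota> y (germ X y A U s) = j y v)"
proof -
  have Uo: "openin X U" "x \<in> U" using U by auto
  obtain v W where v: "v \<in> carrier V" "nbhd W x" "W \<subseteq> N \<inter> U" "\<And>y. y \<in> W \<Longrightarrow> dec U s y = j y v"
    using S_chart[OF dec_closed[OF Uo(1) s] Uo(2) c] by blast
  have "\<iota> y (germ X y A U s) = j y v" if "y \<in> W" for y
    using \<iota>_germ[of U y s] v Uo s that by auto
  then show ?thesis using v by blast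
qed

lemma \<iota>_chart_section:
  assumes c: "(N, V, j) \<in> \<C>" and v: "v \<in> carrier V"
  shows "\<exists>s\<in>carrier (Sec A N). \<forall>y\<in>N. \<iota> y (germ X y A N s) = j y v"
proof -
  note No = chart_open[OF c]
  have s: "(\<lambda>z\<in>N. j z v) \<in> S N" by (rule S_chart_section[OF c v No order_refl])
  have ec: "enc N (\<lambda>z\<in>N. j z v) \<in> carrier (Sec A N)" by (rule enc_closed[OF No s])
  have "\<iota> y (germ X y A N (enc N (\<lambda>z\<in>N. j z v))) = j y v" if "y \<in> N" for y
    using \<iota>_germ[of N y, OF _ ec] dec_enc[OF No s] that No by simp
  then show ?thesis using ec by blast
qed

lemma A_local_system: "local_system k X A"
  unfolding local_system_def
proof (intro conjI ballI A_sheaf)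
  fix x assume "x \<in> topspace X"
  then obtain N V j where c: "(N, V, j) \<in> \<C>" "x \<in> N" using cover by blast
  note No = chart_open[OF c(1)] and Vm = chart_module[OF c(1)] and ji = lin_isoD[OF chart_iso[OF c(1)]]
  define e2 where "e2 g = e (\<lambda>_. g)" for g
  have e2: "inj e2"
  proof (rule injI)
    fix f g assume "e2 f = e2 g"
    then have "(\<lambda>_::'x. f) = (\<lambda>_. g)" unfolding e2_def by (rule injD[OF e_inj])
    then show "f = g" by (rule fun_cong)
  qed
  let ?V = "transport e2 V"
  have e2V: "inj_on e2 (carrier V)" using e2 by (rule inj_on_subset) simp
  note V'm = transport(1)[OF Vm e2V] and V'iso = lin_isoD[OF transport(2)[OF Vm e2V]]
  have V'fd: "fd_space k ?V" by (rule fd_space_iso[OF chart_fd[OF c(1)] V'm transport(2)[OF Vm e2V]])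
  let ?X = "subtopology X N" and ?C = "constant_sheaf (subtopology X N) ?V"
  have sub: "openin ?X W \<longleftrightarrow> openin X W \<and> W \<subseteq> N" for W using openin_open_subtopology[OF No] .
  let ?g = "\<lambda>y. inv_into (carrier V) (j y)"
  have gl: "?g y \<in> lin k (M y) V" if "y \<in> N" for y by (rule lin_iso_inverse[OF Vm chart_iso[OF c(1) that]])
  \<comment> \<open>reading a section in the chart \<open>(N, V, j)\<close> gives a locally constant function to \<open>V\<close>\<close>
  define h where "h W s = (\<lambda>y\<in>W. e2 (?g y (dec W s y)))" for W s
  have Cc: "f \<in> carrier (Sec ?C W) \<longleftrightarrow> f \<in> W \<rightarrow>\<^sub>E carrier ?V \<and>
      (\<forall>x\<in>W. \<exists>P. openin ?X P \<and> x \<in> P \<and> P \<subseteq> W \<and> (\<forall>y\<in>P. f y = f x))" for f W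
    by (simp add: constant_sheaf_def)
  have dv: "dec W s y \<in> carrier (M y)" if "openin X W" "s \<in> carrier (Sec A W)" "y \<in> W" for W s y
    by (rule S_val[OF dec_closed[OF that(1,2)] that(1,3)])
  have gv: "?g y (dec W s y) \<in> carrier V" if "openin X W" "W \<subseteq> N" "s \<in> carrier (Sec A W)" "y \<in> W" for W s y
    by (rule lin_closed[OF gl dv]) (use that in auto)
  have "sheaf_isomorphism k ?X A ?C h"
    unfolding sheaf_isomorphism_def sheaf_morphism_def
  proof (intro conjI allI impI ballI)
    fix W assume "openin ?X W"
    then have W: "openin X W" "W \<subseteq> N" using sub by auto
    show hl: "h W \<in> lin k (Sec A W) (Sec ?C W)"
    proof (rule linI)
      fix s assume s: "s \<in> carrier (Sec A W)"
      show "h W s \<in> carrier (Sec ?C W)"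
        unfolding Cc
      proof (intro conjI ballI)
        show "h W s \<in> W \<rightarrow>\<^sub>E carrier ?V"
          using gv[OF W s] lin_closed[OF V'iso(1)] by (auto simp: h_def)
        fix z assume z: "z \<in> W"
        have zN: "z \<in> N" using z W by blast
        obtain v P where v: "v \<in> carrier V" "nbhd P z" "P \<subseteq> N \<inter> W" "\<And>y. y \<in> P \<Longrightarrow> dec W s y = j y v"
          using S_chart[OF dec_closed[OF W(1) s] z c(1) zN] by blast
        have "h W s y = e2 v" if "y \<in> P" for y
          using that v ji(4)[of y v] by (auto simp: h_def)
        then show "\<exists>P. openin ?X P \<and> z \<in> P \<and> P \<subseteq> W \<and> (\<forall>y\<in>P. h W s y = h W s z)"
          using v by (intro exI[of _ P]) (auto simp: sub)
      qed
      show "h W (a \<odot>\<^bsub>Sec A W\<^esub> s) = a \<odot>\<^bsub>Sec ?C W\<^esub> h W s" if a: "a \<in> carrier k" for a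
      proof
        fix y
        show "h W (a \<odot>\<^bsub>Sec A W\<^esub> s) y = (a \<odot>\<^bsub>Sec ?C W\<^esub> h W s) y"
        proof (cases "y \<in> W")
          case True
          then have "?g y (dec W (a \<odot>\<^bsub>Sec A W\<^esub> s) y) = a \<odot>\<^bsub>V\<^esub> ?g y (dec W s y)"
            using dec_smult[OF W(1) s a True] lin_smult[OF gl a dv[OF W(1) s True]] W by auto
          then show ?thesis
            using lin_smult[OF V'iso(1) a gv[OF W s True]] True by (simp add: h_def constant_sheaf_def)
        qed (simp add: h_def constant_sheaf_def)
      qed
      fix t assume t: "t \<in> carrier (Sec A W)"
      show "h W (s \<oplus>\<^bsub>Sec A W\<^esub> t) = h W s \<oplus>\<^bsub>Sec ?C W\<^esub> h W t"
      proof
        fix y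
        show "h W (s \<oplus>\<^bsub>Sec A W\<^esub> t) y = (h W s \<oplus>\<^bsub>Sec ?C W\<^esub> h W t) y"
        proof (cases "y \<in> W")
          case True
          then have "?g y (dec W (s \<oplus>\<^bsub>Sec A W\<^esub> t) y) = ?g y (dec W s y) \<oplus>\<^bsub>V\<^esub> ?g y (dec W t y)"
            using dec_add[OF W(1) s t True] lin_add[OF gl dv[OF W(1) s True] dv[OF W(1) t True]] W by auto
          then show ?thesis
            using lin_add[OF V'iso(1) gv[OF W s True] gv[OF W t True]] True by (simp add: h_def constant_sheaf_def)
        qed (simp add: h_def constant_sheaf_def)
      qed
    qed
    show "bij_betw (h W) (carrier (Sec A W)) (carrier (Sec ?C W))"
      unfolding bij_betw_def
    proof (intro conjI inj_onI equalityI subsetI)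
      fix s t assume s: "s \<in> carrier (Sec A W)" and t: "t \<in> carrier (Sec A W)" and eq: "h W s = h W t"
      show "s = t"
      proof (rule sec_eqI[OF W(1) s t])
        fix y assume y: "y \<in> W"
        then have yN: "y \<in> N" using W by blast
        have "e2 (?g y (dec W s y)) = e2 (?g y (dec W t y))" using fun_cong[OF eq, of y] y by (simp add: h_def)
        then have "?g y (dec W s y) = ?g y (dec W t y)" by (rule injD[OF e2])
        then have "j y (?g y (dec W s y)) = j y (?g y (dec W t y))" by (rule arg_cong)
        then show "dec W s y = dec W t y"
          unfolding ji(6)[OF yN dv[OF W(1) s y]] ji(6)[OF yN dv[OF W(1) t y]] .
      qed
    next
      fix f assume f: "f \<in> carrier (Sec ?C W)"
      then have fv: "f y \<in> carrier ?V" if "y \<in> W" for y using that unfolding Cc by auto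
      let ?f = "\<lambda>y. inv_into (carrier V) e2 (f y)"
      let ?\<sigma> = "\<lambda>y\<in>W. j y (?f y)"
      have \<sigma>: "?\<sigma> \<in> S W"
      proof (rule S_I)
        fix z assume z: "z \<in> W"
        obtain P where P: "openin ?X P" "z \<in> P" "P \<subseteq> W" "\<forall>y\<in>P. f y = f z" using f z unfolding Cc by blast
        have "?\<sigma> y = j y (?f z)" if y: "y \<in> P" for y
        proof -
          have "f y = f z" by (rule bspec[OF P(4) y])
          then show ?thesis using y P(3) by auto
        qed
        then have "in_chart N V j W ?\<sigma> z"
          unfolding in_chart_def
          by (intro bexI[OF _ V'iso(5)[OF fv[OF z]]] exI[of _ P]) (use P(1-3) z sub W in auto)
        then show "\<exists>N V j. (N, V, j) \<in> \<C> \<and> z \<in> N \<and> in_chart N V j W ?\<sigma> z" using c(1) W z by blast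
      qed (use W in auto)
      have hf: "h W (enc W ?\<sigma>) = f"
      proof (rule extensionalityI[of _ W])
        fix y assume y: "y \<in> W"
        then have yN: "y \<in> N" using W by blast
        show "h W (enc W ?\<sigma>) y = f y"
          using y dec_enc[OF W(1) \<sigma>] ji(4)[OF yN V'iso(5)[OF fv[OF y]]] V'iso(6)[OF fv[OF y]] by (simp add: h_def)
      qed (use f in \<open>auto simp: h_def Cc PiE_def\<close>)
      show "f \<in> h W ` carrier (Sec A W)" using imageI[OF enc_closed[OF W(1) \<sigma>], where f = "h W"] unfolding hf .
    qed (use lin_closed[OF hl] in auto)
  next
    fix U W s assume "openin ?X U \<and> openin ?X W \<and> W \<subseteq> U" and s: "s \<in> carrier (Sec A U)"
    then have o: "openin X U" "openin X W" "W \<subseteq> U" using sub by auto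
    show "h W (Res A U W s) = Res ?C U W (h U s)"
      using dec_Res[OF o s] o(3) by (auto simp: h_def constant_sheaf_def fun_eq_iff restrict_def)
  qed
  then show "\<exists>U. openin X U \<and> x \<in> U \<and> (\<exists>(V :: ('k, 's) module) h. fd_space k V \<and>
      sheaf_isomorphism k (subtopology X U) A (constant_sheaf (subtopology X U) V) h)"
    using No c(2) V'fd by blast
qed

text \<open>The sheaf is used only through the following properties: its stalks are the \<open>M y\<close>, its sections are
  locally constant in the charts, and the constants of a chart are sections.\<close>

lemma associated_local_system:
  "\<exists>(F :: ('x, 'k, 's) presheaf) \<iota>. local_system k X F \<and>
    (\<forall>y\<in>topspace X. lin_iso k (stalk X y F) (M y) (\<iota> y)) \<and>
    (\<forall>U s x N V j. nbhd U x \<longrightarrow> s \<in> carrier (Sec F U) \<longrightarrow> (N, V, j) \<in> \<C> \<longrightarrow> x \<in> N \<longrightarrow>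
       (\<exists>v\<in>carrier V. \<exists>W. nbhd W x \<and> W \<subseteq> N \<inter> U \<and> (\<forall>y\<in>W. \<iota> y (germ X y F U s) = j y v))) \<and>
    (\<forall>N V j v. (N, V, j) \<in> \<C> \<longrightarrow> v \<in> carrier V \<longrightarrow> (\<exists>s\<in>carrier (Sec F N). \<forall>y\<in>N. \<iota> y (germ X y F N s) = j y v))"
  using A_local_system \<iota>_iso \<iota>_local \<iota>_chart_section
  by (intro exI[of _ A] exI[of _ \<iota>]) simp

end

section \<open>Functoriality of tensor products\<close>

lemma bilinear_compose:
  assumes "\<beta> \<in> bilinear_maps k V' W' T" "f \<in> lin k V V'" "g \<in> lin k W W'"
  shows "(\<lambda>v w. \<beta> (f v) (g w)) \<in> bilinear_maps k V W T"
proof (rule bilinear_mapsI)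
  show "(\<lambda>w. \<beta> (f v) (g w)) \<in> lin k W T" if "v \<in> carrier V" for v
    by (rule lin_compose[OF assms(3) bilinear_lin2[OF assms(1) lin_closed[OF assms(2) that]]])
  show "(\<lambda>v. \<beta> (f v) (g w)) \<in> lin k V T" if "w \<in> carrier W" for w
    by (rule lin_compose[OF assms(2) bilinear_lin1[OF assms(1) lin_closed[OF assms(3) that]]])
qed

lemma bilinear_post:
  assumes "\<beta> \<in> bilinear_maps k V W T" "h \<in> lin k T Z"
  shows "(\<lambda>v w. h (\<beta> v w)) \<in> bilinear_maps k V W Z"
  by (rule bilinear_mapsI)
    (rule lin_compose[OF bilinear_lin2[OF assms(1)] assms(2)], assumption,
     rule lin_compose[OF bilinear_lin1[OF assms(1)] assms(2)], assumption)

lemma lin_iso_inv: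
  assumes "Module.module k V" "lin_iso k V W f"
  shows "lin_iso k W V (inv_into (carrier V) f)"
  by (rule lin_isoI[OF lin_iso_inverse[OF assms] lin_isoD(1)[OF assms(2)]]) (use lin_isoD[OF assms(2)] in auto)

lemma fd_vectorspace: "fd_space k V \<Longrightarrow> vectorspace k V"
  and fd_module: "fd_space k V \<Longrightarrow> Module.module k V"
  by (auto simp: fd_space_def vectorspace_def)

lemma tensor_pairing_bilinear: "tensor_pairing k V W T \<beta> \<Longrightarrow> \<beta> \<in> bilinear_maps k V W T"
  and tensor_pairing_span: "tensor_pairing k V W T \<beta> \<Longrightarrow>
    LinearCombinations.module.span k T {\<beta> v w | v w. v \<in> carrier V \<and> w \<in> carrier W} = carrier T"
  by (simp_all add: tensor_pairing_def)

lemma lin_id: "(\<lambda>x. x) \<in> lin k V V"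
  by (rule linI) auto

lemma tensor_pairing_map_iso:
  assumes V: "fd_space k V" and W: "fd_space k W" and T: "fd_space k T"
    and V': "fd_space k V'" and W': "fd_space k W'" and T': "fd_space k T'"
    and tp: "tensor_pairing k V W T \<mu>" and tp': "tensor_pairing k V' W' T' \<mu>'"
    and f: "lin_iso k V V' f" and g: "lin_iso k W W' g"
  shows "\<exists>J. lin_iso k T T' J \<and> (\<forall>v\<in>carrier V. \<forall>w\<in>carrier W. J (\<mu> v w) = \<mu>' (f v) (g w))"
proof -
  note fD = lin_isoD[OF f] and gD = lin_isoD[OF g]
  let ?f = "inv_into (carrier V) f" and ?g = "inv_into (carrier W) g"
  obtain J where J: "J \<in> lin k T T'" "\<forall>v\<in>carrier V. \<forall>w\<in>carrier W. J (\<mu> v w) = \<mu>' (f v) (g w)"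
    using tensor_extend[OF V W fd_vectorspace[OF T] fd_vectorspace[OF T'] tp
        bilinear_compose[OF tensor_pairing_bilinear[OF tp'] fD(1) gD(1)]] by blast
  obtain L where L: "L \<in> lin k T' T" "\<forall>v\<in>carrier V'. \<forall>w\<in>carrier W'. L (\<mu>' v w) = \<mu> (?f v) (?g w)"
    using tensor_extend[OF V' W' fd_vectorspace[OF T'] fd_vectorspace[OF T] tp'
        bilinear_compose[OF tensor_pairing_bilinear[OF tp] lin_iso_inverse[OF fd_module[OF V] f]
          lin_iso_inverse[OF fd_module[OF W] g]]] by blast
  have "lin_iso k T T' J"
  proof (rule lin_isoI[OF J(1) L(1)])
    show "L (J t) = t" if "t \<in> carrier T" for t
      by (rule tensor_pairing_eq[OF tp fd_module[OF T] fd_module[OF T] lin_compose[OF J(1) L(1)] lin_id _ that])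
        (use J(2) L(2) fD(4) gD(4) lin_closed[OF fD(1)] lin_closed[OF gD(1)] in simp)
    show "J (L t) = t" if "t \<in> carrier T'" for t
      by (rule tensor_pairing_eq[OF tp' fd_module[OF T'] fd_module[OF T'] lin_compose[OF L(1) J(1)] lin_id _ that])
        (use J(2) L(2) fD(5,6) gD(5,6) in simp)
  qed
  then show ?thesis using J(2) by blast
qed

lemma tensor_tower_map_iso:
  assumes tw: "tensor_tower k U T \<beta>" and tw': "tensor_tower k U' T' \<beta>'" and f: "lin_iso k U U' f"
  shows "\<exists>\<Psi>. lin_iso k (T n) (T' n) \<Psi> \<and> (\<forall>u\<in>carrier U. \<Psi> (tpow \<beta> n u) = tpow \<beta>' n (f u))"
proof (induction n)
  case 0
  then show ?case using tw tw' f by (intro exI[of _ f]) (simp add: tensor_tower_def)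
next
  case (Suc n)
  then obtain \<Psi> where \<Psi>: "lin_iso k (T n) (T' n) \<Psi>" "\<forall>u\<in>carrier U. \<Psi> (tpow \<beta> n u) = tpow \<beta>' n (f u)"
    by blast
  have U: "fd_space k U" "fd_space k U'" using tw tw' by (metis tensor_tower_def)+
  have fd: "fd_space k (T n)" "fd_space k (T' n)" for n using tw tw' by (simp_all add: tensor_tower_def)
  have tp: "tensor_pairing k U (T n) (T (Suc n)) (\<beta> n)" "tensor_pairing k U' (T' n) (T' (Suc n)) (\<beta>' n)"
    using tw tw' by (simp_all add: tensor_tower_def)
  obtain J where J: "lin_iso k (T (Suc n)) (T' (Suc n)) J"
    "\<forall>v\<in>carrier U. \<forall>w\<in>carrier (T n). J (\<beta> n v w) = \<beta>' n (f v) (\<Psi> w)"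
    using tensor_pairing_map_iso[OF U(1) fd(1) fd(1) U(2) fd(2) fd(2) tp f \<Psi>(1)] by blast
  show ?case by (intro exI[of _ J]) (use J \<Psi>(2) tpow_closed[OF tw, of _ n] in simp)
qed

lemma tensor_tower_exists:
  fixes U :: "('k, nat \<Rightarrow> 'k) module"
  assumes U: "fd_space k U"
  shows "\<exists>T \<beta>. tensor_tower k U T \<beta>"
proof -
  let ?Q = "\<lambda>T T'. \<exists>\<beta>. tensor_pairing k U T T' \<beta>"
  have "\<exists>T. \<forall>n. (fd_space k (T n) \<and> (n = 0 \<longrightarrow> T n = U)) \<and> ?Q (T n) (T (Suc n))"
  proof (rule dependent_nat_choice)
    fix T :: "('k, nat \<Rightarrow> 'k) module" and n :: nat
    assume "fd_space k T \<and> (n = 0 \<longrightarrow> T = U)"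
    then have T: "fd_space k T" by simp
    obtain T' :: "('k, nat \<Rightarrow> 'k) module" and \<beta> where "fd_space k T'" "tensor_pairing k U T T' \<beta>"
      using tensor_pairing_exists[OF U T] by blast
    then show "\<exists>T'. (fd_space k T' \<and> (Suc n = 0 \<longrightarrow> T' = U)) \<and> ?Q T T'" by blast
  qed (use U in blast)
  then obtain T where T: "\<And>n. fd_space k (T n)" "T 0 = U" "\<And>n. ?Q (T n) (T (Suc n))" by blast
  obtain \<beta> where "\<And>n. tensor_pairing k U (T n) (T (Suc n)) (\<beta> n)"
    using choice[of "\<lambda>n \<beta>. tensor_pairing k U (T n) (T (Suc n)) \<beta>"] T(3) by blast
  then show ?thesis using T by (intro exI[of _ T] exI[of _ \<beta>]) (simp add: tensor_tower_def)
qed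

lemma lin_image_span:
  assumes M: "Module.module R M" and N: "Module.module R N" and f: "f \<in> lin R M N" and S: "S \<subseteq> carrier M"
  shows "f ` LinearCombinations.module.span R M S = LinearCombinations.module.span R N (f ` S)"
proof -
  interpret M: Module.module R M by fact
  interpret N: Module.module R N by fact
  have S': "f ` S \<subseteq> carrier N" using S lin_closed[OF f] by blast
  interpret A: LinearCombinations.submodule R "M.span S" M by (rule M.span_is_submodule[OF S])
  interpret B: LinearCombinations.submodule R "N.span (f ` S)" N by (rule N.span_is_submodule[OF S'])
  have sub: "M.span S \<subseteq> carrier M" by (rule M.span_is_subset2[OF S])
  have "f x \<in> N.span (f ` S)" if "x \<in> M.span S" for x
    using that S
  proof (induction rule: M.span_induct)
    case (base s)
    then show ?case by (intro subsetD[OF N.in_own_span[OF S']] imageI)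
  qed (auto simp: lin_zero[OF M N f] lin_add[OF f] lin_smult[OF f])
  moreover have "y \<in> f ` M.span S" if "y \<in> N.span (f ` S)" for y
    using that S'
  proof (induction rule: N.span_induct)
    case zero
    show ?case by (rule image_eqI[of _ _ "\<zero>\<^bsub>M\<^esub>"]) (simp_all add: lin_zero[OF M N f])
  next
    case (base s)
    then show ?case using subsetD[OF M.in_own_span[OF S]] by blast
  next
    case (add x y)
    then obtain a b where ab: "a \<in> M.span S" "b \<in> M.span S" "x = f a" "y = f b" by blast
    have "x \<oplus>\<^bsub>N\<^esub> y = f (a \<oplus>\<^bsub>M\<^esub> b)" using ab lin_add[OF f subsetD[OF sub ab(1)] subsetD[OF sub ab(2)]] by simp
    then show ?case by (rule image_eqI) (use ab in simp)
  next
    case (smult r x)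
    then obtain a where a: "a \<in> M.span S" "x = f a" by blast
    have "r \<odot>\<^bsub>N\<^esub> x = f (r \<odot>\<^bsub>M\<^esub> a)" using a lin_smult[OF f smult(1) subsetD[OF sub a(1)]] by simp
    then show ?case by (rule image_eqI) (use a smult in simp)
  qed
  ultimately show ?thesis by blast
qed

lemma lin_iso_span:
  assumes "Module.module R M" "Module.module R N" "lin_iso R M N f" "S \<subseteq> carrier M"
  shows "lin_iso R (M\<lparr>carrier := LinearCombinations.module.span R M S\<rparr>)
    (N\<lparr>carrier := LinearCombinations.module.span R N (f ` S)\<rparr>) f"
proof -
  note fD = lin_isoD[OF assms(3)]
  note im = lin_image_span[OF assms(1,2) fD(1) assms(4)]
  have sub: "LinearCombinations.module.span R M S \<subseteq> carrier M"
    by (rule LinearCombinations.module.span_is_subset2[OF assms(1,4)])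
  show ?thesis
    unfolding lin_iso_def bij_betw_def
  proof (intro conjI)
    show "f \<in> lin R (M\<lparr>carrier := LinearCombinations.module.span R M S\<rparr>)
        (N\<lparr>carrier := LinearCombinations.module.span R N (f ` S)\<rparr>)"
      by (rule linI) (use im lin_add[OF fD(1) subsetD[OF sub] subsetD[OF sub]] lin_smult[OF fD(1) _ subsetD[OF sub]] in auto)
  qed (use inj_on_subset[OF fD(2) sub] im in simp_all)
qed

section \<open>Tensor products of local systems\<close>

context sheaf_base
begin

lemma point: "openin X U \<Longrightarrow> y \<in> U \<Longrightarrow> y \<in> topspace X"
  using openin_subset by blast

text \<open>Whether two charts differ by a locally constant map needs to be checked on generators only.\<close>

lemma locally_equal_span:
  assumes Q: "Module.module k Q" and Q': "Module.module k Q'" and No: "openin X N" "openin X N'"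
    and x: "x \<in> N \<inter> N'" and Mm: "\<And>y. y \<in> N \<Longrightarrow> Module.module k (M y)"
    and l: "\<And>y. y \<in> N \<Longrightarrow> f y \<in> lin k Q (M y)" and l': "\<And>y. y \<in> N' \<Longrightarrow> f' y \<in> lin k Q' (M y)"
    and S: "S \<subseteq> carrier Q" and q: "q \<in> LinearCombinations.module.span k Q S"
    and gen: "\<And>s. s \<in> S \<Longrightarrow> \<exists>s'\<in>carrier Q'. \<exists>P. nbhd P x \<and> P \<subseteq> N \<inter> N' \<and> (\<forall>y\<in>P. f y s = f' y s')"
  shows "\<exists>q'\<in>carrier Q'. \<exists>P. nbhd P x \<and> P \<subseteq> N \<inter> N' \<and> (\<forall>y\<in>P. f y q = f' y q')"
proof -
  interpret Q: Module.module k Q by (rule Q)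
  interpret Q': Module.module k Q' by (rule Q')
  show ?thesis using q S
  proof (induction rule: Q.span_induct)
    case zero
    have "f y \<zero>\<^bsub>Q\<^esub> = f' y \<zero>\<^bsub>Q'\<^esub>" if "y \<in> N" "y \<in> N'" for y
      using lin_zero[OF Q Mm[OF that(1)] l[OF that(1)]] lin_zero[OF Q' Mm[OF that(1)] l'[OF that(2)]] by simp
    then show ?case by (intro bexI[of _ "\<zero>\<^bsub>Q'\<^esub>"] exI[of _ "N \<inter> N'"]) (use No x in auto)
  next
    case (base s)
    then show ?case by (rule gen)
  next
    case (add a b)
    then obtain a' P where a': "a' \<in> carrier Q'" "nbhd P x" "P \<subseteq> N \<inter> N'" "\<forall>y\<in>P. f y a = f' y a'"
      by (elim bexE exE conjE) blast
    from add obtain b' R where b': "b' \<in> carrier Q'" "nbhd R x" "R \<subseteq> N \<inter> N'" "\<forall>y\<in>R. f y b = f' y b'"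
      by (elim bexE exE conjE) blast
    have "f y (a \<oplus>\<^bsub>Q\<^esub> b) = f' y (a' \<oplus>\<^bsub>Q'\<^esub> b')" if y: "y \<in> P \<inter> R" for y
    proof -
      have yN: "y \<in> N" "y \<in> N'" using y a'(3) by auto
      have "f y a = f' y a'" "f y b = f' y b'" using y a'(4) b'(4) by blast+
      then show ?thesis
        using lin_add[OF l[OF yN(1)] add(1,2)] lin_add[OF l'[OF yN(2)] a'(1) b'(1)] by simp
    qed
    then show ?case
      by (intro bexI[OF _ Q'.M.a_closed[OF a'(1) b'(1)]] exI[of _ "P \<inter> R"]) (use a'(2,3) b'(2,3) in auto)
  next
    case (smult c a)
    then obtain a' P where a': "a' \<in> carrier Q'" "nbhd P x" "P \<subseteq> N \<inter> N'" "\<forall>y\<in>P. f y a = f' y a'"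
      by (elim bexE exE conjE) blast
    have "f y (c \<odot>\<^bsub>Q\<^esub> a) = f' y (c \<odot>\<^bsub>Q'\<^esub> a')" if y: "y \<in> P" for y
    proof -
      have yN: "y \<in> N" "y \<in> N'" using y a'(3) by auto
      have "f y a = f' y a'" using y a'(4) by blast
      then show ?thesis
        using lin_smult[OF l[OF yN(1)] smult(1,2)] lin_smult[OF l'[OF yN(2)] smult(1) a'(1)] by simp
    qed
    then show ?case
      by (intro bexI[OF _ Q'.smult_closed[OF smult(1) a'(1)]] exI[of _ P]) (use a'(2,3) in auto)
  qed
qed

lemma bilinear_from_stalks:
  assumes E: "presheaf_of_spaces k X E" and F: "presheaf_of_spaces k X F" and T: "sheaf_of_spaces k X T"
    and \<theta>: "\<And>x. x \<in> topspace X \<Longrightarrow> \<theta> x \<in> bilinear_maps k (stalk X x E) (stalk X x F) (stalk X x T)"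
    and loc: "\<And>U s t x. nbhd U x \<Longrightarrow> s \<in> carrier (Sec E U) \<Longrightarrow> t \<in> carrier (Sec F U) \<Longrightarrow>
        \<exists>W r. nbhd W x \<and> W \<subseteq> U \<and> r \<in> carrier (Sec T W) \<and>
          (\<forall>y\<in>W. germ X y T W r = \<theta> y (germ X y E U s) (germ X y F U t))"
  shows "\<exists>\<beta>. sheaf_bilinear k X E F T \<beta> \<and>
    (\<forall>U s t x. nbhd U x \<longrightarrow> s \<in> carrier (Sec E U) \<longrightarrow> t \<in> carrier (Sec F U) \<longrightarrow>
       germ X x T U (\<beta> U s t) = \<theta> x (germ X x E U s) (germ X x F U t))"
proof -
  note Tp = sheaf_imp_presheaf[OF T]
  let ?P = "\<lambda>U s t r. r \<in> carrier (Sec T U) \<and> (\<forall>x\<in>U. germ X x T U r = \<theta> x (germ X x E U s) (germ X x F U t))"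
  define \<beta> where "\<beta> U s t = (SOME r. ?P U s t r)" for U s t
  have b: "?P U s t (\<beta> U s t)" if "openin X U" "s \<in> carrier (Sec E U)" "t \<in> carrier (Sec F U)" for U s t
  proof -
    have "\<exists>r\<in>carrier (Sec T U). \<forall>x\<in>U. germ X x T U r = \<theta> x (germ X x E U s) (germ X x F U t)"
      by (rule sheaf_glue[OF T that(1)]) (rule loc, use that in auto)
    then have "\<exists>r. ?P U s t r" by (simp only: Bex_def)
    from someI_ex[OF this] show ?thesis unfolding \<beta>_def .
  qed
  have bc: "\<beta> U s t \<in> carrier (Sec T U)" if "openin X U" "s \<in> carrier (Sec E U)" "t \<in> carrier (Sec F U)" for U s t
    using b[OF that] by blast
  have bg: "germ X x T U (\<beta> U s t) = \<theta> x (germ X x E U s) (germ X x F U t)"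
    if "nbhd U x" "s \<in> carrier (Sec E U)" "t \<in> carrier (Sec F U)" for U s t x
    using b[OF conjunct1[OF that(1)] that(2,3)] that(1) by blast
  have "sheaf_bilinear k X E F T \<beta>"
    unfolding sheaf_bilinear_def
  proof (intro conjI allI impI ballI)
    fix U assume U: "openin X U"
    show "\<beta> U \<in> bilinear_maps k (Sec E U) (Sec F U) (Sec T U)"
    proof (rule bilinear_mapsI)
      have g: "germ X x T U (\<beta> U s t) = \<theta> x (germ X x E U s) (germ X x F U t)"
        if "x \<in> U" "s \<in> carrier (Sec E U)" "t \<in> carrier (Sec F U)" for x s t
        by (rule bg) (use U that in auto)
      have n: "nbhd U x" if "x \<in> U" for x using U that by simp
      show "\<beta> U s \<in> lin k (Sec F U) (Sec T U)" if s: "s \<in> carrier (Sec E U)" for s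
        by (rule lin_from_germs[OF F T U bc[OF U s] bilinear_lin2[OF \<theta>[OF point[OF U]] germ_closed[OF E n s]] g[OF _ s]])
      show "(\<lambda>s. \<beta> U s t) \<in> lin k (Sec E U) (Sec T U)" if t: "t \<in> carrier (Sec F U)" for t
        by (rule lin_from_germs[OF E T U bc[OF U _ t] bilinear_lin1[OF \<theta>[OF point[OF U]] germ_closed[OF F n t]] g[OF _ _ t]])
    qed
  next
    fix U V s t assume "openin X U \<and> openin X V \<and> V \<subseteq> U" and s: "s \<in> carrier (Sec E U)" and t: "t \<in> carrier (Sec F U)"
    then have U: "openin X U" and V: "openin X V" "V \<subseteq> U" by auto
    have rs: "Res E U V s \<in> carrier (Sec E V)" by (rule res_closed[OF E U V s])
    have rt: "Res F U V t \<in> carrier (Sec F V)" by (rule res_closed[OF F U V t])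
    show "\<beta> V (Res E U V s) (Res F U V t) = Res T U V (\<beta> U s t)"
    proof (rule sheaf_sections_eq[OF T V(1) bc[OF V(1) rs rt] res_closed[OF Tp U V bc[OF U s t]]])
      fix x assume x: "x \<in> V"
      have n: "nbhd V x" "nbhd U x" using V U x by auto
      show "germ X x T V (\<beta> V (Res E U V s) (Res F U V t)) = germ X x T V (Res T U V (\<beta> U s t))"
        unfolding bg[OF n(1) rs rt] germ_res[OF Tp n(1) U V(2) bc[OF U s t]] germ_res[OF E n(1) U V(2) s]
          germ_res[OF F n(1) U V(2) t] bg[OF n(2) s t] ..
    qed
  qed
  then show ?thesis using bg by blast
qed

lemma stalk_bilinear_bilinear:
  assumes E: "presheaf_of_spaces k X E" and F: "presheaf_of_spaces k X F" and T: "presheaf_of_spaces k X T"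
    and \<beta>: "sheaf_bilinear k X E F T \<beta>" and x: "x \<in> topspace X"
  shows "stalk_bilinear X x E F T \<beta> \<in> bilinear_maps k (stalk X x E) (stalk X x F) (stalk X x T)"
    (is "?b \<in> _")
proof -
  note g = stalk_bilinear_germ[OF E F T \<beta>]
  have cl: "?b C D \<in> carrier (stalk X x T)" if C: "C \<in> carrier (stalk X x E)" and D: "D \<in> carrier (stalk X x F)" for C D
  proof -
    obtain U s t where U: "nbhd U x" "s \<in> carrier (Sec E U)" "t \<in> carrier (Sec F U)"
      "C = germ X x E U s" "D = germ X x F U t" using stalkE_pair[OF E F C D] .
    show ?thesis unfolding U(4,5) g[OF U(1-3)]
      by (rule germ_closed[OF T U(1) bilinear_closed[OF sheaf_bilinearD(1)[OF \<beta>] U(2,3)]]) (use U in simp)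
  qed
  show ?thesis
  proof (rule bilinear_mapsI)
    fix C assume C: "C \<in> carrier (stalk X x E)"
    show "?b C \<in> lin k (stalk X x F) (stalk X x T)"
    proof (rule linI)
      fix D assume D: "D \<in> carrier (stalk X x F)"
      show "?b C D \<in> carrier (stalk X x T)" by (rule cl[OF C D])
      obtain U s t where U: "nbhd U x" "s \<in> carrier (Sec E U)" "t \<in> carrier (Sec F U)"
        "C = germ X x E U s" "D = germ X x F U t" using stalkE_pair[OF E F C D] .
      have b: "\<beta> U \<in> bilinear_maps k (Sec E U) (Sec F U) (Sec T U)" by (rule sheaf_bilinearD(1)[OF \<beta>]) (use U in simp)
      interpret FU: Module.module k "Sec F U" by (rule sec_module[OF F]) (use U in simp)
      show "?b C (c \<odot>\<^bsub>stalk X x F\<^esub> D) = c \<odot>\<^bsub>stalk X x T\<^esub> ?b C D" if c: "c \<in> carrier k" for c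
        using lin_smult[OF bilinear_lin2[OF b U(2)] c U(3)] U c bilinear_closed[OF b U(2,3)]
        by (simp add: germ_smult[OF F] germ_smult[OF T] g)
      fix D' assume D': "D' \<in> carrier (stalk X x F)"
      obtain V t t' where V: "nbhd V x" "t \<in> carrier (Sec F V)" "t' \<in> carrier (Sec F V)"
        "D = germ X x F V t" "D' = germ X x F V t'" using stalkE2[OF F D D'] .
      obtain W s where W: "nbhd W x" "W \<subseteq> V" "s \<in> carrier (Sec E W)" "C = germ X x E W s"
        using stalkE_in[OF E C V(1)] .
      let ?t = "Res F V W t" and ?t' = "Res F V W t'"
      have tc: "?t \<in> carrier (Sec F W)" "?t' \<in> carrier (Sec F W)" using res_closed[OF F] V W by auto
      have eq: "D = germ X x F W ?t" "D' = germ X x F W ?t'" using germ_res[OF F] V W by auto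
      have b: "\<beta> W \<in> bilinear_maps k (Sec E W) (Sec F W) (Sec T W)" by (rule sheaf_bilinearD(1)[OF \<beta>]) (use W in simp)
      interpret FW: Module.module k "Sec F W" by (rule sec_module[OF F]) (use W in simp)
      show "?b C (D \<oplus>\<^bsub>stalk X x F\<^esub> D') = ?b C D \<oplus>\<^bsub>stalk X x T\<^esub> ?b C D'"
        unfolding eq W(4)
        using lin_add[OF bilinear_lin2[OF b W(3)] tc] tc W(1,3) bilinear_closed[OF b W(3)]
        by (simp add: germ_add[OF F] germ_add[OF T] g)
    qed
  next
    fix D assume D: "D \<in> carrier (stalk X x F)"
    show "(\<lambda>C. ?b C D) \<in> lin k (stalk X x E) (stalk X x T)"
    proof (rule linI)
      fix C assume C: "C \<in> carrier (stalk X x E)"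
      show "?b C D \<in> carrier (stalk X x T)" by (rule cl[OF C D])
      obtain U s t where U: "nbhd U x" "s \<in> carrier (Sec E U)" "t \<in> carrier (Sec F U)"
        "C = germ X x E U s" "D = germ X x F U t" using stalkE_pair[OF E F C D] .
      have b: "\<beta> U \<in> bilinear_maps k (Sec E U) (Sec F U) (Sec T U)" by (rule sheaf_bilinearD(1)[OF \<beta>]) (use U in simp)
      interpret EU: Module.module k "Sec E U" by (rule sec_module[OF E]) (use U in simp)
      show "?b (c \<odot>\<^bsub>stalk X x E\<^esub> C) D = c \<odot>\<^bsub>stalk X x T\<^esub> ?b C D" if c: "c \<in> carrier k" for c
        using lin_smult[OF bilinear_lin1[OF b U(3)] c U(2)] U c bilinear_closed[OF b U(2,3)]
        by (simp add: germ_smult[OF E] germ_smult[OF T] g)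
      fix C' assume C': "C' \<in> carrier (stalk X x E)"
      obtain V s s' where V: "nbhd V x" "s \<in> carrier (Sec E V)" "s' \<in> carrier (Sec E V)"
        "C = germ X x E V s" "C' = germ X x E V s'" using stalkE2[OF E C C'] .
      obtain W t where W: "nbhd W x" "W \<subseteq> V" "t \<in> carrier (Sec F W)" "D = germ X x F W t"
        using stalkE_in[OF F D V(1)] .
      let ?s = "Res E V W s" and ?s' = "Res E V W s'"
      have sc: "?s \<in> carrier (Sec E W)" "?s' \<in> carrier (Sec E W)" using res_closed[OF E] V W by auto
      have eq: "C = germ X x E W ?s" "C' = germ X x E W ?s'" using germ_res[OF E] V W by auto
      have b: "\<beta> W \<in> bilinear_maps k (Sec E W) (Sec F W) (Sec T W)" by (rule sheaf_bilinearD(1)[OF \<beta>]) (use W in simp)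
      interpret EW: Module.module k "Sec E W" by (rule sec_module[OF E]) (use W in simp)
      show "?b (C \<oplus>\<^bsub>stalk X x E\<^esub> C') D = ?b C D \<oplus>\<^bsub>stalk X x T\<^esub> ?b C' D"
        unfolding eq W(4)
        using lin_add[OF bilinear_lin1[OF b W(3)] sc] sc W(1,3) bilinear_closed[OF b _ W(3)]
        by (simp add: germ_add[OF E] germ_add[OF T] g)
    qed
  qed
qed

lemma stalk_map_on_germ:
  assumes "presheaf_of_spaces k X E" "presheaf_of_spaces k X F" "sheaf_morphism k X E F h"
    and "nbhd U x" "s \<in> carrier (Sec E U)"
  shows "stalk_map X x F h (germ X x E U s) = germ X x F U (h U s)"
  by (rule trans[OF stalk_map_eq stalk_map_germ[OF assms]])

lemma sheaf_morphism_compose: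
  assumes h: "sheaf_morphism k X E F h" and g: "sheaf_morphism k X F G g"
  shows "sheaf_morphism k X E G (\<lambda>U s. g U (h U s))"
  unfolding sheaf_morphism_def
proof (intro conjI allI impI ballI)
  show "(\<lambda>s. g U (h U s)) \<in> lin k (Sec E U) (Sec G U)" if "openin X U" for U
    by (rule lin_compose[OF sheaf_morphismD(1)[OF h that] sheaf_morphismD(1)[OF g that]])
  show "g V (h V (Res E U V s)) = Res G U V (g U (h U s))"
    if o: "openin X U \<and> openin X V \<and> V \<subseteq> U" and s: "s \<in> carrier (Sec E U)" for U V s
    using sheaf_morphismD(2)[OF h, of U V s] sheaf_morphismD(2)[OF g, of U V "h U s"]
      lin_closed[OF sheaf_morphismD(1)[OF h, of U] s] o s by simp
qed

lemma sheaf_morphism_id: "sheaf_morphism k X E E (\<lambda>U s. s)"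
  unfolding sheaf_morphism_def by (simp add: lin_id)

lemma sheaf_tensor_productD:
  fixes E F T Z :: "('x, 'k, 's) presheaf"
  assumes "is_sheaf_tensor_product k X E F T \<beta>"
  shows "sheaf_bilinear k X E F T \<beta>"
    and "sheaf_of_spaces k X Z \<Longrightarrow> sheaf_bilinear k X E F Z \<gamma> \<Longrightarrow>
      \<exists>h. sheaf_morphism k X T Z h \<and>
        (\<forall>U. openin X U \<longrightarrow> (\<forall>s\<in>carrier (Sec E U). \<forall>t\<in>carrier (Sec F U). h U (\<beta> U s t) = \<gamma> U s t)) \<and>
        (\<forall>h'. sheaf_morphism k X T Z h' \<and>
          (\<forall>U. openin X U \<longrightarrow> (\<forall>s\<in>carrier (Sec E U). \<forall>t\<in>carrier (Sec F U). h' U (\<beta> U s t) = \<gamma> U s t)) \<longrightarrow>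
          (\<forall>U. openin X U \<longrightarrow> (\<forall>t\<in>carrier (Sec T U). h' U t = h U t)))"
proof -
  note a = assms[unfolded is_sheaf_tensor_product_def]
  show "sheaf_bilinear k X E F T \<beta>" by (rule conjunct1[OF a])
  assume "sheaf_of_spaces k X Z" "sheaf_bilinear k X E F Z \<gamma>"
  then show "\<exists>h. sheaf_morphism k X T Z h \<and>
        (\<forall>U. openin X U \<longrightarrow> (\<forall>s\<in>carrier (Sec E U). \<forall>t\<in>carrier (Sec F U). h U (\<beta> U s t) = \<gamma> U s t)) \<and>
        (\<forall>h'. sheaf_morphism k X T Z h' \<and>
          (\<forall>U. openin X U \<longrightarrow> (\<forall>s\<in>carrier (Sec E U). \<forall>t\<in>carrier (Sec F U). h' U (\<beta> U s t) = \<gamma> U s t)) \<longrightarrow>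
          (\<forall>U. openin X U \<longrightarrow> (\<forall>t\<in>carrier (Sec T U). h' U t = h U t)))"
    by (intro mp[OF spec[OF spec[OF conjunct2[OF a], of Z], of \<gamma>]] conjI)
qed

context
  fixes E F T :: "('x, 'k, 's) presheaf" and \<beta>
  assumes E: "presheaf_of_spaces k X E" and F: "presheaf_of_spaces k X F" and T: "presheaf_of_spaces k X T"
    and \<beta>: "sheaf_bilinear k X E F T \<beta>"
    and tp: "\<And>x. x \<in> topspace X \<Longrightarrow>
      tensor_pairing k (stalk X x E) (stalk X x F) (stalk X x T) (stalk_bilinear X x E F T \<beta>)"
begin

lemma tensor_hom_eq:
  fixes Z :: "('x, 'k, 's) presheaf"
  assumes Z: "sheaf_of_spaces k X Z" and h: "sheaf_morphism k X T Z h" and h': "sheaf_morphism k X T Z h'"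
    and eq: "\<And>U s t. openin X U \<Longrightarrow> s \<in> carrier (Sec E U) \<Longrightarrow> t \<in> carrier (Sec F U) \<Longrightarrow>
      h U (\<beta> U s t) = h' U (\<beta> U s t)"
    and U: "openin X U" and t: "t \<in> carrier (Sec T U)"
  shows "h U t = h' U t"
proof (rule sheaf_sections_eq[OF Z U lin_closed[OF sheaf_morphismD(1)[OF h U] t] lin_closed[OF sheaf_morphismD(1)[OF h' U] t]])
  note Zp = sheaf_imp_presheaf[OF Z]
  fix x assume x: "x \<in> U"
  have n: "nbhd U x" using U x by simp
  note xt = point[OF U x]
  have "stalk_map X x Z h (germ X x T U t) = stalk_map X x Z h' (germ X x T U t)"
  proof (rule tensor_pairing_eq[OF tp[OF xt] stalk_module[OF T xt] stalk_module[OF Zp xt]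
        stalk_map_lin[OF T Zp h] stalk_map_lin[OF T Zp h'] _ germ_closed[OF T n t]])
    fix C D assume C: "C \<in> carrier (stalk X x E)" and D: "D \<in> carrier (stalk X x F)"
    obtain V s r where V: "nbhd V x" "s \<in> carrier (Sec E V)" "r \<in> carrier (Sec F V)"
      "C = germ X x E V s" "D = germ X x F V r" using stalkE_pair[OF E F C D] .
    have b: "\<beta> V s r \<in> carrier (Sec T V)"
      by (rule bilinear_closed[OF sheaf_bilinearD(1)[OF \<beta>] V(2,3)]) (use V in simp)
    have "h V (\<beta> V s r) = h' V (\<beta> V s r)" by (rule eq) (use V in auto)
    then show "stalk_map X x Z h (stalk_bilinear X x E F T \<beta> C D) = stalk_map X x Z h' (stalk_bilinear X x E F T \<beta> C D)"
      unfolding V(4,5) stalk_bilinear_germ[OF E F T \<beta> V(1-3)] stalk_map_on_germ[OF T Zp h V(1) b]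
        stalk_map_on_germ[OF T Zp h' V(1) b] by simp
  qed
  then show "germ X x Z U (h U t) = germ X x Z U (h' U t)"
    unfolding stalk_map_on_germ[OF T Zp h n t] stalk_map_on_germ[OF T Zp h' n t] .
qed

text \<open>The map to a sheaf \<open>Z\<close> that a bilinear map induces exists on stalks. It maps sections to sections
  since locally every section of \<open>T\<close> is a sum of products of sections.\<close>

lemma tensor_product_from_stalks:
  assumes fd: "\<And>x. x \<in> topspace X \<Longrightarrow> fd_space k (stalk X x E)" "\<And>x. x \<in> topspace X \<Longrightarrow> fd_space k (stalk X x F)"
  shows "is_sheaf_tensor_product k X E F T \<beta>"
  unfolding is_sheaf_tensor_product_def
proof (intro conjI allI impI \<beta>)
  fix Z :: "('x, 'k, 's) presheaf" and \<gamma>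
  assume "sheaf_of_spaces k X Z \<and> sheaf_bilinear k X E F Z \<gamma>"
  then have Z: "sheaf_of_spaces k X Z" and \<gamma>: "sheaf_bilinear k X E F Z \<gamma>" by auto
  note Zp = sheaf_imp_presheaf[OF Z]
  have "\<forall>x\<in>topspace X. \<exists>f. f \<in> lin k (stalk X x T) (stalk X x Z) \<and> (\<forall>C\<in>carrier (stalk X x E). \<forall>D\<in>carrier (stalk X x F).
      f (stalk_bilinear X x E F T \<beta> C D) = stalk_bilinear X x E F Z \<gamma> C D)"
  proof
    fix x assume x: "x \<in> topspace X"
    from tensor_extend[OF fd[OF x] stalk_vectorspace[OF T x] stalk_vectorspace[OF Zp x] tp[OF x]
        stalk_bilinear_bilinear[OF E F Zp \<gamma> x]]
    show "\<exists>f. f \<in> lin k (stalk X x T) (stalk X x Z) \<and> (\<forall>C\<in>carrier (stalk X x E). \<forall>D\<in>carrier (stalk X x F).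
      f (stalk_bilinear X x E F T \<beta> C D) = stalk_bilinear X x E F Z \<gamma> C D)" by (simp only: Bex_def)
  qed
  from bchoice[OF this] obtain \<theta> where \<theta>: "\<And>x. x \<in> topspace X \<Longrightarrow> \<theta> x \<in> lin k (stalk X x T) (stalk X x Z)"
    and \<theta>b: "\<And>x C D. x \<in> topspace X \<Longrightarrow> C \<in> carrier (stalk X x E) \<Longrightarrow> D \<in> carrier (stalk X x F) \<Longrightarrow>
      \<theta> x (stalk_bilinear X x E F T \<beta> C D) = stalk_bilinear X x E F Z \<gamma> C D" by fast
  have \<theta>g: "\<theta> y (germ X y T U (\<beta> U s t)) = germ X y Z U (\<gamma> U s t)"
    if n: "nbhd U y" and s: "s \<in> carrier (Sec E U)" and t: "t \<in> carrier (Sec F U)" for y U s t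
    using \<theta>b[OF point germ_closed[OF E n s] germ_closed[OF F n t]] n
    unfolding stalk_bilinear_germ[OF E F T \<beta> n s t] stalk_bilinear_germ[OF E F Zp \<gamma> n s t] by blast
  let ?G = "\<lambda>W r z. r \<in> carrier (Sec T W) \<and> z \<in> carrier (Sec Z W) \<and> (\<forall>y\<in>W. germ X y Z W z = \<theta> y (germ X y T W r))"
  have res: "?G V (Res T W V r) (Res Z W V z)" if G: "?G W r z" and V: "openin X W" "openin X V" "V \<subseteq> W" for V W r z
  proof (intro conjI ballI)
    fix y assume y: "y \<in> V"
    have n: "nbhd V y" using V y by simp
    show "germ X y Z V (Res Z W V z) = \<theta> y (germ X y T V (Res T W V r))"
      using germ_res[OF Zp n V(1,3), of z] germ_res[OF T n V(1,3), of r] G y V(3) by auto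
  qed (use G res_closed[OF T V] res_closed[OF Zp V] in auto)
  let ?P = "\<lambda>x C. \<exists>W r z. nbhd W x \<and> C = germ X x T W r \<and> ?G W r z"
  have P: "?P x C" if x: "x \<in> topspace X" and C: "C \<in> carrier (stalk X x T)" for x C
  proof -
    interpret S: Module.module k "stalk X x T" by (rule stalk_module[OF T x])
    let ?S = "{stalk_bilinear X x E F T \<beta> C D | C D. C \<in> carrier (stalk X x E) \<and> D \<in> carrier (stalk X x F)}"
    have Ss: "?S \<subseteq> carrier (stalk X x T)" using bilinear_closed[OF tensor_pairing_bilinear[OF tp[OF x]]] by auto
    have "C \<in> S.span ?S" unfolding tensor_pairing_span[OF tp[OF x]] by (rule C)
    then show ?thesis using Ss
    proof (induction rule: S.span_induct)
      case zero
      have o: "openin X (topspace X)" "nbhd (topspace X) x" using x by auto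
      interpret TX: Module.module k "Sec T (topspace X)" by (rule sec_module[OF T o(1)])
      interpret ZX: Module.module k "Sec Z (topspace X)" by (rule sec_module[OF Zp o(1)])
      have "germ X y Z (topspace X) \<zero>\<^bsub>Sec Z (topspace X)\<^esub> = \<theta> y (germ X y T (topspace X) \<zero>\<^bsub>Sec T (topspace X)\<^esub>)"
        if y: "y \<in> topspace X" for y
        using lin_zero[OF stalk_module[OF T y] stalk_module[OF Zp y] \<theta>[OF y]]
          germ_zero[OF T, of "topspace X" y] germ_zero[OF Zp, of "topspace X" y] y by simp
      then show ?case
        by (intro exI[of _ "topspace X"] exI[of _ "\<zero>\<^bsub>Sec T (topspace X)\<^esub>"] exI[of _ "\<zero>\<^bsub>Sec Z (topspace X)\<^esub>"] conjI ballI)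
          (use o germ_zero[OF T o(2)] in auto)
    next
      case (base B)
      then obtain C D where C: "C \<in> carrier (stalk X x E)" and D: "D \<in> carrier (stalk X x F)"
        and B: "B = stalk_bilinear X x E F T \<beta> C D" by blast
      obtain V s r where V: "nbhd V x" "s \<in> carrier (Sec E V)" "r \<in> carrier (Sec F V)"
        "C = germ X x E V s" "D = germ X x F V r" using stalkE_pair[OF E F C D] .
      have Vo: "openin X V" using V by simp
      have "B = germ X x T V (\<beta> V s r)" unfolding B V(4,5) by (rule stalk_bilinear_germ[OF E F T \<beta> V(1-3)])
      moreover have "?G V (\<beta> V s r) (\<gamma> V s r)"
        using bilinear_closed[OF sheaf_bilinearD(1)[OF \<beta> Vo] V(2,3)]
          bilinear_closed[OF sheaf_bilinearD(1)[OF \<gamma> Vo] V(2,3)] \<theta>g[OF _ V(2,3)] Vo by simp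
      ultimately show ?case using V(1) by blast
    next
      case (add B B')
      then obtain W r z W' r' z' where W: "nbhd W x" "B = germ X x T W r" "?G W r z"
        and W': "nbhd W' x" "B' = germ X x T W' r'" "?G W' r' z'" by (elim exE conjE) blast
      let ?V = "W \<inter> W'"
      have V: "openin X ?V" "nbhd ?V x" and o: "openin X W" "openin X W'" and sub: "?V \<subseteq> W" "?V \<subseteq> W'"
        using W(1) W'(1) by auto
      interpret TV: Module.module k "Sec T ?V" by (rule sec_module[OF T V(1)])
      interpret ZV: Module.module k "Sec Z ?V" by (rule sec_module[OF Zp V(1)])
      define a a' b b' where "a = Res T W ?V r" and "a' = Res T W' ?V r'" and "b = Res Z W ?V z" and "b' = Res Z W' ?V z'"
      have G: "?G ?V a b" "?G ?V a' b'" unfolding a_def a'_def b_def b'_def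
        using res[OF W(3) o(1) V(1) sub(1)] res[OF W'(3) o(2) V(1) sub(2)] .
      have ac: "a \<in> carrier (Sec T ?V)" "a' \<in> carrier (Sec T ?V)" and bc: "b \<in> carrier (Sec Z ?V)" "b' \<in> carrier (Sec Z ?V)"
        using G by auto
      have Ba: "B = germ X x T ?V a" "B' = germ X x T ?V a'" unfolding a_def a'_def W(2) W'(2)
        using germ_res[OF T V(2) o(1) sub(1), of r] germ_res[OF T V(2) o(2) sub(2), of r'] W(3) W'(3) by auto
      have "B \<oplus>\<^bsub>stalk X x T\<^esub> B' = germ X x T ?V (a \<oplus>\<^bsub>Sec T ?V\<^esub> a')"
        unfolding Ba by (rule germ_add[OF T V(2) ac])
      moreover have "germ X y Z ?V (b \<oplus>\<^bsub>Sec Z ?V\<^esub> b') = \<theta> y (germ X y T ?V (a \<oplus>\<^bsub>Sec T ?V\<^esub> a'))" if y: "y \<in> ?V" for y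
      proof -
        have n: "nbhd ?V y" using V(1) y by simp
        have "germ X y Z ?V b = \<theta> y (germ X y T ?V a)" "germ X y Z ?V b' = \<theta> y (germ X y T ?V a')"
          using G y by blast+
        then show ?thesis
          using lin_add[OF \<theta>[OF point[OF V(1) y]] germ_closed[OF T n ac(1)] germ_closed[OF T n ac(2)]]
          unfolding germ_add[OF T n ac] germ_add[OF Zp n bc, symmetric] by simp
      qed
      ultimately show ?case
        by (intro exI[of _ ?V] exI[of _ "a \<oplus>\<^bsub>Sec T ?V\<^esub> a'"] exI[of _ "b \<oplus>\<^bsub>Sec Z ?V\<^esub> b'"] conjI ballI)
          (use V(2) ac bc in auto)
    next
      case (smult c B)
      then obtain W r z where W: "nbhd W x" "B = germ X x T W r" "?G W r z" by (elim exE conjE) blast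
      have o: "openin X W" using W(1) by simp
      interpret TV: Module.module k "Sec T W" by (rule sec_module[OF T o])
      interpret ZV: Module.module k "Sec Z W" by (rule sec_module[OF Zp o])
      have ac: "r \<in> carrier (Sec T W)" and bc: "z \<in> carrier (Sec Z W)" using W(3) by auto
      have "c \<odot>\<^bsub>stalk X x T\<^esub> B = germ X x T W (c \<odot>\<^bsub>Sec T W\<^esub> r)"
        unfolding W(2) by (rule germ_smult[OF T W(1) ac smult(1)])
      moreover have "germ X y Z W (c \<odot>\<^bsub>Sec Z W\<^esub> z) = \<theta> y (germ X y T W (c \<odot>\<^bsub>Sec T W\<^esub> r))" if y: "y \<in> W" for y
      proof -
        have n: "nbhd W y" using o y by simp
        have "germ X y Z W z = \<theta> y (germ X y T W r)" using W(3) y by blast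
        then show ?thesis
          using lin_smult[OF \<theta>[OF point[OF o y]] smult(1) germ_closed[OF T n ac]]
          unfolding germ_smult[OF T n ac smult(1)] germ_smult[OF Zp n bc smult(1), symmetric] by simp
      qed
      ultimately show ?case
        by (intro exI[of _ W] exI[of _ "c \<odot>\<^bsub>Sec T W\<^esub> r"] exI[of _ "c \<odot>\<^bsub>Sec Z W\<^esub> z"] conjI ballI)
          (use W(1) ac bc smult(1) in auto)
    qed
  qed
  have loc: "\<exists>W t. nbhd W x \<and> W \<subseteq> U \<and> t \<in> carrier (Sec Z W) \<and> (\<forall>y\<in>W. germ X y Z W t = \<theta> y (germ X y T U s))"
    if U: "nbhd U x" and s: "s \<in> carrier (Sec T U)" for U s x
  proof -
    have xt: "x \<in> topspace X" using U point by blast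
    obtain W r z where W: "nbhd W x" "germ X x T U s = germ X x T W r" "?G W r z"
      using P[OF xt germ_closed[OF T U s]] by (elim exE conjE) blast
    have r: "r \<in> carrier (Sec T W)" using W(3) by simp
    obtain V where V: "nbhd V x" "V \<subseteq> U \<inter> W" "Res T U V s = Res T W V r"
      using germ_eqD[OF T W(1) r W(2)] .
    have o: "openin X W" "openin X V" "V \<subseteq> W" using V W by auto
    have G: "?G V (Res T W V r) (Res Z W V z)" by (rule res[OF W(3) o])
    have "germ X y Z V (Res Z W V z) = \<theta> y (germ X y T U s)" if y: "y \<in> V" for y
    proof -
      have "germ X y T V (Res T U V s) = germ X y T U s"
        by (rule germ_res[OF T]) (use y V U s in auto)
      then show ?thesis using G y V(3) by auto
    qed
    then show ?thesis using V(1,2) G by blast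
  qed
  obtain h where h: "sheaf_morphism k X T Z h"
    and hg: "\<forall>U s x. nbhd U x \<longrightarrow> s \<in> carrier (Sec T U) \<longrightarrow> germ X x Z U (h U s) = \<theta> x (germ X x T U s)"
  proof -
    have "\<exists>h. sheaf_morphism k X T Z h \<and>
      (\<forall>U s x. nbhd U x \<longrightarrow> s \<in> carrier (Sec T U) \<longrightarrow> germ X x Z U (h U s) = \<theta> x (germ X x T U s))"
      by (rule morphism_from_stalks[OF T Z]) (rule \<theta> loc, assumption+)+
    then show thesis using that by (elim exE conjE)
  qed
  have h\<beta>: "h U (\<beta> U s t) = \<gamma> U s t" if U: "openin X U" and s: "s \<in> carrier (Sec E U)" and t: "t \<in> carrier (Sec F U)" for U s t
  proof -
    have b: "\<beta> U s t \<in> carrier (Sec T U)" by (rule bilinear_closed[OF sheaf_bilinearD(1)[OF \<beta> U] s t])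
    show ?thesis
    proof (rule sheaf_sections_eq[OF Z U lin_closed[OF sheaf_morphismD(1)[OF h U] b]
          bilinear_closed[OF sheaf_bilinearD(1)[OF \<gamma> U] s t]])
      fix x assume x: "x \<in> U"
      have n: "nbhd U x" using U x by simp
      show "germ X x Z U (h U (\<beta> U s t)) = germ X x Z U (\<gamma> U s t)"
        using hg[rule_format, OF n b] \<theta>g[OF n s t] by simp
    qed
  qed
  show "\<exists>h. sheaf_morphism k X T Z h \<and>
      (\<forall>U. openin X U \<longrightarrow> (\<forall>s\<in>carrier (Sec E U). \<forall>t\<in>carrier (Sec F U). h U (\<beta> U s t) = \<gamma> U s t)) \<and>
      (\<forall>h'. sheaf_morphism k X T Z h' \<and>
        (\<forall>U. openin X U \<longrightarrow> (\<forall>s\<in>carrier (Sec E U). \<forall>t\<in>carrier (Sec F U). h' U (\<beta> U s t) = \<gamma> U s t)) \<longrightarrow>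
        (\<forall>U. openin X U \<longrightarrow> (\<forall>t\<in>carrier (Sec T U). h' U t = h U t)))"
  proof (intro exI[of _ h] conjI allI impI ballI h h\<beta>)
    fix h' U t
    assume a: "sheaf_morphism k X T Z h' \<and>
        (\<forall>U. openin X U \<longrightarrow> (\<forall>s\<in>carrier (Sec E U). \<forall>t\<in>carrier (Sec F U). h' U (\<beta> U s t) = \<gamma> U s t))"
      and U: "openin X U" and t: "t \<in> carrier (Sec T U)"
    show "h' U t = h U t"
    proof (rule tensor_hom_eq[OF Z conjunct1[OF a] h _ U t])
      fix V s r assume V: "openin X V" "s \<in> carrier (Sec E V)" "r \<in> carrier (Sec F V)"
      have "h' V (\<beta> V s r) = \<gamma> V s r" using conjunct2[OF a] V by blast
      then show "h' V (\<beta> V s r) = h V (\<beta> V s r)" using h\<beta>[OF V] by simp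
    qed
  qed
qed

end

end

section \<open>Existence of tensor products of local systems\<close>

context sheaf_base
begin

context
  fixes e :: "('x \<Rightarrow> nat \<Rightarrow> 'k) \<Rightarrow> 's"
  assumes e: "inj e"
begin

text \<open>The tensor products of the stalks are glued by the tensor products of charts for \<open>E\<close> and \<open>F\<close>.\<close>

lemma local_system_tensor_exists:
  fixes E F :: "('x, 'k, 's) presheaf"
  assumes E: "local_system k X E" and F: "local_system k X F"
  shows "\<exists>(T :: ('x, 'k, 's) presheaf) \<beta>. local_system k X T \<and> sheaf_bilinear k X E F T \<beta> \<and>
    (\<forall>x\<in>topspace X. tensor_pairing k (stalk X x E) (stalk X x F) (stalk X x T) (stalk_bilinear X x E F T \<beta>))"
proof -
  note Ep = local_systemD(2)[OF E] and Fp = local_systemD(2)[OF F]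
  note fdE = local_system_stalk_fd[OF E] and fdF = local_system_stalk_fd[OF F]
  have "\<forall>y\<in>topspace X. \<exists>m :: ('k, nat \<Rightarrow> 'k) module \<times> _.
      fd_space k (fst m) \<and> tensor_pairing k (stalk X y E) (stalk X y F) (fst m) (snd m)"
  proof
    fix y assume y: "y \<in> topspace X"
    obtain M :: "('k, nat \<Rightarrow> 'k) module" and \<tau> where "fd_space k M" "tensor_pairing k (stalk X y E) (stalk X y F) M \<tau>"
      using tensor_pairing_exists[OF fdE[OF y] fdF[OF y]] by (elim exE conjE)
    then show "\<exists>m :: ('k, nat \<Rightarrow> 'k) module \<times> _.
      fd_space k (fst m) \<and> tensor_pairing k (stalk X y E) (stalk X y F) (fst m) (snd m)"
      by (intro exI[of _ "(M, \<tau>)"]) simp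
  qed
  from bchoice[OF this] obtain m :: "'x \<Rightarrow> ('k, nat \<Rightarrow> 'k) module \<times> _" where
    m: "\<forall>y\<in>topspace X. fd_space k (fst (m y)) \<and> tensor_pairing k (stalk X y E) (stalk X y F) (fst (m y)) (snd (m y))"
    by (elim exE)
  define M \<tau> where "M y = fst (m y)" and "\<tau> y = snd (m y)" for y
  have M: "fd_space k (M y)" and \<tau>: "tensor_pairing k (stalk X y E) (stalk X y F) (M y) (\<tau> y)" if "y \<in> topspace X" for y
    using m that by (simp_all add: M_def \<tau>_def)
  \<comment> \<open>a chart \<open>(N, Q, J)\<close> with \<open>Q = V \<otimes> W\<close>, where \<open>V\<close> and \<open>W\<close> are charts for \<open>E\<close> and \<open>F\<close>, and \<open>J\<close> is the
    tensor product of the identifications with the stalks\<close>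
  define D where "D N Q J V W j j' \<mu> \<longleftrightarrow> sheaf_chart E N V j \<and> sheaf_chart F N W j' \<and> fd_space k Q \<and>
      tensor_pairing k V W Q \<mu> \<and> (\<forall>y\<in>N. lin_iso k Q (M y) (J y) \<and>
        (\<forall>v\<in>carrier V. \<forall>w\<in>carrier W. J y (\<mu> v w) = \<tau> y (germ X y E N (j v)) (germ X y F N (j' w))))"
    for N and Q V W :: "('k, nat \<Rightarrow> 'k) module" and J j j' \<mu>
  define \<C> where "\<C> = {(N, Q, J). \<exists>V W j j' \<mu>. D N Q J V W j j' \<mu>}"
  have \<C>: "(N, Q, J) \<in> \<C> \<Longrightarrow> \<exists>V W j j' \<mu>. D N Q J V W j j' \<mu>" for N Q J by (simp add: \<C>_def)
  have DD: "sheaf_chart E N V j" "sheaf_chart F N W j'" "fd_space k Q" "tensor_pairing k V W Q \<mu>"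
    "y \<in> N \<Longrightarrow> lin_iso k Q (M y) (J y)"
    "y \<in> N \<Longrightarrow> v \<in> carrier V \<Longrightarrow> w \<in> carrier W \<Longrightarrow> J y (\<mu> v w) = \<tau> y (germ X y E N (j v)) (germ X y F N (j' w))"
    if "D N Q J V W j j' \<mu>" for N Q J V W j j' \<mu> y v w
    using that by (simp_all add: D_def)
  have cov: "\<exists>N Q J V W j j' \<mu>. D N Q J V W j j' \<mu> \<and> x \<in> N" if x: "x \<in> topspace X" for x
  proof -
    obtain N1 and V :: "('k, nat \<Rightarrow> 'k) module" and j1 where c1: "x \<in> N1" "sheaf_chart E N1 V j1"
      using local_system_chart[OF E x] by (elim exE conjE)
    obtain N2 and W :: "('k, nat \<Rightarrow> 'k) module" and j2 where c2: "x \<in> N2" "sheaf_chart F N2 W j2"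
      using local_system_chart[OF F x] by (elim exE conjE)
    let ?N = "N1 \<inter> N2"
    have No: "openin X ?N" using sheaf_chartD(1)[OF c1(2)] sheaf_chartD(1)[OF c2(2)] by blast
    obtain j where j: "sheaf_chart E ?N V j" using sheaf_chart_restrict[OF Ep c1(2) No] by blast
    obtain j' where j': "sheaf_chart F ?N W j'" using sheaf_chart_restrict[OF Fp c2(2) No] by blast
    note V = sheaf_chartD(2)[OF j] and W = sheaf_chartD(2)[OF j']
    obtain Q :: "('k, nat \<Rightarrow> 'k) module" and \<mu> where Q: "fd_space k Q" "tensor_pairing k V W Q \<mu>"
      using tensor_pairing_exists[OF V W] by (elim exE conjE)
    have "\<forall>y\<in>?N. \<exists>J. lin_iso k Q (M y) J \<and>
        (\<forall>v\<in>carrier V. \<forall>w\<in>carrier W. J (\<mu> v w) = \<tau> y (germ X y E ?N (j v)) (germ X y F ?N (j' w)))"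
    proof
      fix y assume y: "y \<in> ?N"
      note yt = point[OF No y]
      show "\<exists>J. lin_iso k Q (M y) J \<and>
        (\<forall>v\<in>carrier V. \<forall>w\<in>carrier W. J (\<mu> v w) = \<tau> y (germ X y E ?N (j v)) (germ X y F ?N (j' w)))"
        by (rule tensor_pairing_map_iso[OF V W Q(1) fdE[OF yt] fdF[OF yt] M[OF yt] Q(2) \<tau>[OF yt]
              sheaf_chartD(4)[OF j y] sheaf_chartD(4)[OF j' y]])
    qed
    from bchoice[OF this] obtain J where J: "\<forall>y\<in>?N. lin_iso k Q (M y) (J y) \<and>
        (\<forall>v\<in>carrier V. \<forall>w\<in>carrier W. J y (\<mu> v w) = \<tau> y (germ X y E ?N (j v)) (germ X y F ?N (j' w)))"
      by (elim exE)
    have "D ?N Q J V W j j' \<mu>" unfolding D_def by (intro conjI j j' Q J)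
    then show ?thesis using c1(1) c2(1) by blast
  qed
  have cf: "chart_family k X M \<C> e"
  proof (intro chart_family.intro chart_family_axioms.intro sheaf_base_axioms e)
    show "Module.module k (M y)" if "y \<in> topspace X" for y by (rule fd_module[OF M[OF that]])
    show "openin X N" if "(N, Q, J) \<in> \<C>" for N Q J
      using \<C>[OF that] by (elim exE) (rule sheaf_chartD(1)[OF DD(1)])
    show "fd_space k Q" if "(N, Q, J) \<in> \<C>" for N Q J
      using \<C>[OF that] by (elim exE) (rule DD(3))
    show "lin_iso k Q (M y) (J y)" if "(N, Q, J) \<in> \<C>" "y \<in> N" for N Q J y
      using \<C>[OF that(1)] by (elim exE) (rule DD(5)[OF _ that(2)])
    show "\<exists>N Q J. (N, Q, J) \<in> \<C> \<and> x \<in> N" if "x \<in> topspace X" for x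
      using cov[OF that] unfolding \<C>_def by blast
    fix N Q J N' Q' J' x q
    assume "(N, Q, J) \<in> \<C>" "(N', Q', J') \<in> \<C>" and x: "x \<in> N \<inter> N'" and q: "q \<in> carrier Q"
    obtain V W j i \<mu> where d: "D N Q J V W j i \<mu>" using \<C>[OF \<open>(N, Q, J) \<in> \<C>\<close>] by (elim exE)
    obtain V' W' j' i' \<mu>' where d': "D N' Q' J' V' W' j' i' \<mu>'" using \<C>[OF \<open>(N', Q', J') \<in> \<C>\<close>] by (elim exE)
    note dd = DD[OF d] and dd' = DD[OF d']
    have No: "openin X N" "openin X N'" by (rule sheaf_chartD(1)[OF dd(1)], rule sheaf_chartD(1)[OF dd'(1)])
    have xN: "nbhd N x" "x \<in> N'" using x No by auto
    have Mm: "Module.module k (M y)" if "y \<in> N" for y by (rule fd_module[OF M[OF point[OF No(1) that]]])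
    let ?S = "{\<mu> v w | v w. v \<in> carrier V \<and> w \<in> carrier W}"
    have Ss: "?S \<subseteq> carrier Q" using bilinear_closed[OF tensor_pairing_bilinear[OF dd(4)]] by auto
    have q': "q \<in> LinearCombinations.module.span k Q ?S" unfolding tensor_pairing_span[OF dd(4)] by (rule q)
    show "\<exists>q'\<in>carrier Q'. \<exists>P. nbhd P x \<and> P \<subseteq> N \<inter> N' \<and> (\<forall>y\<in>P. J y q = J' y q')"
    proof (rule locally_equal_span[OF fd_module[OF dd(3)] fd_module[OF dd'(3)] No x Mm
          lin_isoD(1)[OF dd(5)] lin_isoD(1)[OF dd'(5)] Ss q'])
      fix s assume "s \<in> ?S"
      then obtain v w where v: "v \<in> carrier V" and w: "w \<in> carrier W" and s: "s = \<mu> v w" by blast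
      obtain v' P where v': "v' \<in> carrier V'" "nbhd P x" "P \<subseteq> N \<inter> N'" "\<forall>y\<in>P. germ X y E N (j v) = germ X y E N' (j' v')"
        using sheaf_chart_local[OF Ep dd'(1) xN(1) lin_closed[OF sheaf_chartD(3)[OF dd(1)] v] xN(2)]
        by (elim bexE exE conjE) blast
      obtain w' R where w': "w' \<in> carrier W'" "nbhd R x" "R \<subseteq> N \<inter> N'" "\<forall>y\<in>R. germ X y F N (i w) = germ X y F N' (i' w')"
        using sheaf_chart_local[OF Fp dd'(2) xN(1) lin_closed[OF sheaf_chartD(3)[OF dd(2)] w] xN(2)]
        by (elim bexE exE conjE) blast
      have "J y s = J' y (\<mu>' v' w')" if y: "y \<in> P \<inter> R" for y
      proof -
        have yN: "y \<in> N" "y \<in> N'" using y v'(3) by auto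
        have "germ X y E N (j v) = germ X y E N' (j' v')" "germ X y F N (i w) = germ X y F N' (i' w')"
          using y v'(4) w'(4) by blast+
        then show ?thesis unfolding s dd(6)[OF yN(1) v w] dd'(6)[OF yN(2) v'(1) w'(1)] by simp
      qed
      then show "\<exists>s'\<in>carrier Q'. \<exists>P. nbhd P x \<and> P \<subseteq> N \<inter> N' \<and> (\<forall>y\<in>P. J y s = J' y s')"
        by (intro bexI[OF _ bilinear_closed[OF tensor_pairing_bilinear[OF dd'(4)] v'(1) w'(1)]] exI[of _ "P \<inter> R"])
          (use v'(2,3) w'(2,3) in auto)
    qed
  qed
  obtain T :: "('x, 'k, 's) presheaf" and \<iota> where T: "local_system k X T"
    and \<iota>iso: "\<forall>y\<in>topspace X. lin_iso k (stalk X y T) (M y) (\<iota> y)"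
    and sec: "\<forall>N V j v. (N, V, j) \<in> \<C> \<longrightarrow> v \<in> carrier V \<longrightarrow> (\<exists>s\<in>carrier (Sec T N). \<forall>y\<in>N. \<iota> y (germ X y T N s) = j y v)"
    using chart_family.associated_local_system[OF cf] by (elim exE conjE)
  note Tp = local_systemD(2)[OF T]
  note \<iota> = lin_isoD[OF bspec[OF \<iota>iso]]
  let ?\<kappa> = "\<lambda>y C D. inv_into (carrier (stalk X y T)) (\<iota> y) (\<tau> y C D)"
  have inv: "lin_iso k (M y) (stalk X y T) (inv_into (carrier (stalk X y T)) (\<iota> y))" if y: "y \<in> topspace X" for y
    by (rule lin_iso_inv[OF stalk_module[OF Tp y] bspec[OF \<iota>iso y]])
  have \<kappa>: "?\<kappa> y \<in> bilinear_maps k (stalk X y E) (stalk X y F) (stalk X y T)" if y: "y \<in> topspace X" for y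
    by (rule bilinear_post[OF tensor_pairing_bilinear[OF \<tau>[OF y]] lin_isoD(1)[OF inv[OF y]]])
  have loc: "\<exists>P r. nbhd P x \<and> P \<subseteq> U \<and> r \<in> carrier (Sec T P) \<and>
      (\<forall>y\<in>P. germ X y T P r = ?\<kappa> y (germ X y E U s) (germ X y F U t))"
    if U: "nbhd U x" and s: "s \<in> carrier (Sec E U)" and t: "t \<in> carrier (Sec F U)" for U s t x
  proof -
    have xt: "x \<in> topspace X" using U point by blast
    obtain N Q J V W j i \<mu> where d: "D N Q J V W j i \<mu>" and x: "x \<in> N" using cov[OF xt] by (elim exE conjE)
    note dd = DD[OF d]
    have No: "openin X N" by (rule sheaf_chartD(1)[OF dd(1)])
    have c: "(N, Q, J) \<in> \<C>" unfolding \<C>_def using d by blast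
    obtain v P where v: "v \<in> carrier V" "nbhd P x" "P \<subseteq> U \<inter> N" "\<forall>y\<in>P. germ X y E U s = germ X y E N (j v)"
      using sheaf_chart_local[OF Ep dd(1) U s x] by (elim bexE exE conjE) blast
    obtain w R where w: "w \<in> carrier W" "nbhd R x" "R \<subseteq> U \<inter> N" "\<forall>y\<in>R. germ X y F U t = germ X y F N (i w)"
      using sheaf_chart_local[OF Fp dd(2) U t x] by (elim bexE exE conjE) blast
    have mc: "\<mu> v w \<in> carrier Q" by (rule bilinear_closed[OF tensor_pairing_bilinear[OF dd(4)] v(1) w(1)])
    obtain r where r: "r \<in> carrier (Sec T N)" "\<forall>y\<in>N. \<iota> y (germ X y T N r) = J y (\<mu> v w)"
      using sec[rule_format, OF c mc] by (elim bexE)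
    let ?P = "P \<inter> R"
    have Po: "openin X ?P" "nbhd ?P x" "?P \<subseteq> N" "?P \<subseteq> U" using v(2,3) w(2,3) by auto
    have "germ X y T ?P (Res T N ?P r) = ?\<kappa> y (germ X y E U s) (germ X y F U t)" if y: "y \<in> ?P" for y
    proof -
      have yN: "y \<in> N" "nbhd N y" "nbhd ?P y" using y Po No by auto
      note yt = point[OF No yN(1)]
      have "germ X y E U s = germ X y E N (j v)" "germ X y F U t = germ X y F N (i w)" using y v(4) w(4) by blast+
      then have "\<tau> y (germ X y E U s) (germ X y F U t) = \<iota> y (germ X y T N r)"
        using dd(6)[OF yN(1) v(1) w(1)] bspec[OF r(2) yN(1)] by simp
      then show ?thesis
        using \<iota>(4)[OF yt germ_closed[OF Tp yN(2) r(1)]] germ_res[OF Tp yN(3) No Po(3) r(1)] by simp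
    qed
    then show ?thesis using Po res_closed[OF Tp No Po(1,3) r(1)] by blast
  qed
  have "\<exists>\<beta>. sheaf_bilinear k X E F T \<beta> \<and>
    (\<forall>U s t x. nbhd U x \<longrightarrow> s \<in> carrier (Sec E U) \<longrightarrow> t \<in> carrier (Sec F U) \<longrightarrow>
       germ X x T U (\<beta> U s t) = ?\<kappa> x (germ X x E U s) (germ X x F U t))"
    by (rule bilinear_from_stalks[OF Ep Fp local_systemD(1)[OF T]]) (rule \<kappa> loc, assumption+)+
  then obtain \<beta> where \<beta>: "sheaf_bilinear k X E F T \<beta>"
    and \<beta>g: "\<forall>U s t x. nbhd U x \<longrightarrow> s \<in> carrier (Sec E U) \<longrightarrow> t \<in> carrier (Sec F U) \<longrightarrow>
       germ X x T U (\<beta> U s t) = ?\<kappa> x (germ X x E U s) (germ X x F U t)" by (elim exE conjE)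
  have "tensor_pairing k (stalk X x E) (stalk X x F) (stalk X x T) (stalk_bilinear X x E F T \<beta>)"
    if x: "x \<in> topspace X" for x
  proof (rule tensor_pairing_iso[OF fd_module[OF M[OF x]] \<tau>[OF x] inv[OF x] stalk_module[OF Tp x] _
        stalk_module[OF Ep x] stalk_module[OF Fp x]])
    fix C D assume C: "C \<in> carrier (stalk X x E)" and D: "D \<in> carrier (stalk X x F)"
    obtain U s t where U: "nbhd U x" "s \<in> carrier (Sec E U)" "t \<in> carrier (Sec F U)"
      "C = germ X x E U s" "D = germ X x F U t" using stalkE_pair[OF Ep Fp C D] .
    show "stalk_bilinear X x E F T \<beta> C D = ?\<kappa> x C D"
      unfolding U(4,5) stalk_bilinear_germ[OF Ep Fp Tp \<beta> U(1-3)] by (rule \<beta>g[rule_format, OF U(1-3)])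
  qed
  then show ?thesis using T \<beta> by blast
qed

text \<open>Tensor products of sheaves are unique up to isomorphism, so it is enough to know the stalks of the one
  that has been constructed.\<close>

lemma sheaf_tensor_product_stalks:
  fixes E F T :: "('x, 'k, 's) presheaf"
  assumes E: "local_system k X E" and F: "local_system k X F" and T: "local_system k X T"
    and tp: "is_sheaf_tensor_product k X E F T \<beta>" and x: "x \<in> topspace X"
  shows "tensor_pairing k (stalk X x E) (stalk X x F) (stalk X x T) (stalk_bilinear X x E F T \<beta>)"
proof -
  note Ep = local_systemD(2)[OF E] and Fp = local_systemD(2)[OF F] and Tp = local_systemD(2)[OF T]
  note \<beta> = sheaf_tensor_productD(1)[OF tp]
  obtain T' :: "('x, 'k, 's) presheaf" and \<beta>' where T': "local_system k X T'" and \<beta>': "sheaf_bilinear k X E F T' \<beta>'"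
    and st: "\<forall>x\<in>topspace X. tensor_pairing k (stalk X x E) (stalk X x F) (stalk X x T') (stalk_bilinear X x E F T' \<beta>')"
    using local_system_tensor_exists[OF E F] by (elim exE conjE)
  note Tp' = local_systemD(2)[OF T']
  note Ts = local_systemD(1)[OF T] and Ts' = local_systemD(1)[OF T']
  have tp': "is_sheaf_tensor_product k X E F T' \<beta>'"
    by (rule tensor_product_from_stalks[OF Ep Fp Tp' \<beta>'])
      (rule bspec[OF st] local_system_stalk_fd[OF E] local_system_stalk_fd[OF F], assumption)+
  obtain h where h: "sheaf_morphism k X T T' h"
    and hb: "\<forall>U. openin X U \<longrightarrow> (\<forall>s\<in>carrier (Sec E U). \<forall>t\<in>carrier (Sec F U). h U (\<beta> U s t) = \<beta>' U s t)"
    using sheaf_tensor_productD(2)[OF tp Ts' \<beta>'] by (elim exE conjE)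
  obtain g where g: "sheaf_morphism k X T' T g"
    and gb: "\<forall>U. openin X U \<longrightarrow> (\<forall>s\<in>carrier (Sec E U). \<forall>t\<in>carrier (Sec F U). g U (\<beta>' U s t) = \<beta> U s t)"
    using sheaf_tensor_productD(2)[OF tp' Ts \<beta>] by (elim exE conjE)
  obtain i where iu: "\<forall>h'. sheaf_morphism k X T T h' \<and>
          (\<forall>U. openin X U \<longrightarrow> (\<forall>s\<in>carrier (Sec E U). \<forall>t\<in>carrier (Sec F U). h' U (\<beta> U s t) = \<beta> U s t)) \<longrightarrow>
          (\<forall>U. openin X U \<longrightarrow> (\<forall>t\<in>carrier (Sec T U). h' U t = i U t))"
    using sheaf_tensor_productD(2)[OF tp Ts \<beta>] by (elim exE conjE)
  have hb': "h U (\<beta> U s t) = \<beta>' U s t" and gb': "g U (\<beta>' U s t) = \<beta> U s t"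
    if "openin X U" "s \<in> carrier (Sec E U)" "t \<in> carrier (Sec F U)" for U s t
    using hb gb that by blast+
  have gh: "g U (h U t) = t" if U: "openin X U" and t: "t \<in> carrier (Sec T U)" for U t
  proof -
    have "\<forall>U. openin X U \<longrightarrow> (\<forall>t\<in>carrier (Sec T U). g U (h U t) = i U t)"
      by (rule mp[OF spec[OF iu, of "\<lambda>U s. g U (h U s)"]]) (simp add: sheaf_morphism_compose[OF h g] hb' gb')
    moreover have "\<forall>U. openin X U \<longrightarrow> (\<forall>t\<in>carrier (Sec T U). t = i U t)"
      by (rule mp[OF spec[OF iu, of "\<lambda>U s. s"]]) (simp add: sheaf_morphism_id)
    ultimately show ?thesis using U t by metis
  qed
  have hg: "h U (g U t) = t" if U: "openin X U" and t: "t \<in> carrier (Sec T' U)" for U t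
    by (rule tensor_hom_eq[OF Ep Fp Tp' \<beta>' bspec[OF st] Ts' sheaf_morphism_compose[OF g h] sheaf_morphism_id _ U t])
      (simp_all add: hb' gb')
  have smg: "stalk_map X x T g (germ X x T' U t) = germ X x T U (g U t)" if "nbhd U x" "t \<in> carrier (Sec T' U)" for U t
    by (rule stalk_map_on_germ[OF Tp' Tp g that])
  have smh: "stalk_map X x T' h (germ X x T U t) = germ X x T' U (h U t)" if "nbhd U x" "t \<in> carrier (Sec T U)" for U t
    by (rule stalk_map_on_germ[OF Tp Tp' h that])
  have iso: "lin_iso k (stalk X x T') (stalk X x T) (stalk_map X x T g)"
  proof (rule lin_isoI[OF stalk_map_lin[OF Tp' Tp g] stalk_map_lin[OF Tp Tp' h]])
    fix C assume "C \<in> carrier (stalk X x T')"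
    then obtain U t where U: "nbhd U x" "t \<in> carrier (Sec T' U)" "C = germ X x T' U t" by (rule stalkE[OF Tp'])
    have Uo: "openin X U" using U by simp
    show "stalk_map X x T' h (stalk_map X x T g C) = C"
      unfolding U(3) smg[OF U(1,2)] smh[OF U(1) lin_closed[OF sheaf_morphismD(1)[OF g Uo] U(2)]] hg[OF Uo U(2)] ..
  next
    fix C assume "C \<in> carrier (stalk X x T)"
    then obtain U t where U: "nbhd U x" "t \<in> carrier (Sec T U)" "C = germ X x T U t" by (rule stalkE[OF Tp])
    have Uo: "openin X U" using U by simp
    show "stalk_map X x T g (stalk_map X x T' h C) = C"
      unfolding U(3) smh[OF U(1,2)] smg[OF U(1) lin_closed[OF sheaf_morphismD(1)[OF h Uo] U(2)]] gh[OF Uo U(2)] ..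
  qed
  show ?thesis
  proof (rule tensor_pairing_iso[OF stalk_module[OF Tp' x] bspec[OF st x] iso stalk_module[OF Tp x] _
        stalk_module[OF Ep x] stalk_module[OF Fp x]])
    fix C D assume C: "C \<in> carrier (stalk X x E)" and D: "D \<in> carrier (stalk X x F)"
    obtain U s t where U: "nbhd U x" "s \<in> carrier (Sec E U)" "t \<in> carrier (Sec F U)"
      "C = germ X x E U s" "D = germ X x F U t" using stalkE_pair[OF Ep Fp C D] .
    have Uo: "openin X U" using U by simp
    show "stalk_bilinear X x E F T \<beta> C D = stalk_map X x T g (stalk_bilinear X x E F T' \<beta>' C D)"
      unfolding U(4,5) stalk_bilinear_germ[OF Ep Fp Tp \<beta> U(1-3)] stalk_bilinear_germ[OF Ep Fp Tp' \<beta>' U(1-3)]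
        smg[OF U(1) bilinear_closed[OF sheaf_bilinearD(1)[OF \<beta>' Uo] U(2,3)]] gb'[OF Uo U(2,3)] ..
  qed
qed

end

end

section \<open>Powers in tensor powers of local systems\<close>

context sheaf_base
begin

text \<open>The subspaces \<open>M y\<close> spanned by the powers in the stalks of \<open>U \<otimes> \<dots> \<otimes> U\<close> form a local system: over a
  chart with fibre \<open>V\<close> they are all identified with the span of the powers in \<open>V \<otimes> \<dots> \<otimes> V\<close>. A family of
  linear maps \<open>\<rho> y\<close> to the stalks of a sheaf \<open>Z\<close> is a morphism on \<open>P\<close> if it takes the powers of sections
  of \<open>U\<close> to sections.\<close>

lemma power_subsystem:
  fixes U :: "('x, 'k, 's) presheaf" and e :: "('x \<Rightarrow> nat \<Rightarrow> 'k) \<Rightarrow> 's"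
  assumes e: "inj e" and U: "local_system k X U" and T: "\<And>n. local_system k X (T n)" and T0: "T 0 = U"
    and \<beta>: "\<And>n. sheaf_bilinear k X U (T n) (T (Suc n)) (\<beta> n)"
    and tw_all: "\<forall>y\<in>topspace X. tensor_tower k (stalk X y U) (\<lambda>n. stalk X y (T n))
      (\<lambda>n. stalk_bilinear X y U (T n) (T (Suc n)) (\<beta> n))"
    and pw: "\<And>y. pw y = tpow (\<lambda>n. stalk_bilinear X y U (T n) (T (Suc n)) (\<beta> n)) q"
    and M: "\<And>y. M y = (stalk X y (T q))
      \<lparr>carrier := LinearCombinations.module.span k (stalk X y (T q)) (pw y ` carrier (stalk X y U))\<rparr>"
  shows "\<exists>(P :: ('x, 'k, 's) presheaf) \<theta>. local_system k X P \<and>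
    (\<forall>y\<in>topspace X. lin_iso k (stalk X y P) (M y) (\<theta> y)) \<and>
    (\<forall>(Z :: ('x, 'k, 's) presheaf) \<rho>. sheaf_of_spaces k X Z \<longrightarrow>
       (\<forall>y\<in>topspace X. \<rho> y \<in> lin k (stalk X y (T q)) (stalk X y Z)) \<longrightarrow>
       (\<forall>N s. openin X N \<longrightarrow> s \<in> carrier (Sec U N) \<longrightarrow>
          (\<exists>z\<in>carrier (Sec Z N). \<forall>y\<in>N. germ X y Z N z = \<rho> y (pw y (germ X y U N s)))) \<longrightarrow>
       (\<exists>h. sheaf_morphism k X P Z h \<and>
          (\<forall>y\<in>topspace X. \<forall>C\<in>carrier (stalk X y P). stalk_map X y Z h C = \<rho> y (\<theta> y C))))"
proof -
  note Up = local_systemD(2)[OF U] and Tp = local_systemD(2)[OF T] and tw = bspec[OF tw_all]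
  have fdT: "fd_space k (stalk X y (T n))" if "y \<in> topspace X" for y n
    by (rule local_system_stalk_fd[OF T that])
  have pwc: "pw y C \<in> carrier (stalk X y (T q))" if "y \<in> topspace X" "C \<in> carrier (stalk X y U)" for y C
    unfolding pw by (rule tpow_closed[OF tw[OF that(1)] that(2)])
  have pws: "pw y ` carrier (stalk X y U) \<subseteq> carrier (stalk X y (T q))" if "y \<in> topspace X" for y
    using pwc[OF that] by blast
  \<comment> \<open>\<open>T0 q\<close> is \<open>V \<otimes> \<dots> \<otimes> V\<close>, and \<open>\<Psi> y\<close> is the \<open>(q + 1)\<close>-fold tensor power of the identification of \<open>V\<close>
    with the stalk of \<open>U\<close> at \<open>y\<close>\<close>
  define D where "D N Q \<Psi> V j T0 b0 \<longleftrightarrow> sheaf_chart U N V j \<and> tensor_tower k V T0 b0 \<and>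
      Q = (T0 q)\<lparr>carrier := LinearCombinations.module.span k (T0 q) (tpow b0 q ` carrier V)\<rparr> \<and>
      (\<forall>y\<in>N. lin_iso k (T0 q) (stalk X y (T q)) (\<Psi> y) \<and>
         (\<forall>v\<in>carrier V. \<Psi> y (tpow b0 q v) = pw y (germ X y U N (j v))))"
    for N and Q V :: "('k, nat \<Rightarrow> 'k) module" and \<Psi> j T0 b0
  define \<C> where "\<C> = {(N, Q, \<Psi>). \<exists>V j T0 b0. D N Q \<Psi> V j T0 b0}"
  have \<C>: "(N, Q, \<Psi>) \<in> \<C> \<Longrightarrow> \<exists>V j T0 b0. D N Q \<Psi> V j T0 b0" for N Q \<Psi> by (simp add: \<C>_def)
  have DD: "sheaf_chart U N V j" "tensor_tower k V T0 b0"
    "Q = (T0 q)\<lparr>carrier := LinearCombinations.module.span k (T0 q) (tpow b0 q ` carrier V)\<rparr>"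
    "y \<in> N \<Longrightarrow> lin_iso k (T0 q) (stalk X y (T q)) (\<Psi> y)"
    "y \<in> N \<Longrightarrow> v \<in> carrier V \<Longrightarrow> \<Psi> y (tpow b0 q v) = pw y (germ X y U N (j v))"
    "openin X N" "fd_space k (T0 q)" "tpow b0 q ` carrier V \<subseteq> carrier (T0 q)"
    if "D N Q \<Psi> V j T0 b0" for N Q \<Psi> V j T0 b0 y v
  proof -
    show 1: "sheaf_chart U N V j" "tensor_tower k V T0 b0"
      "Q = (T0 q)\<lparr>carrier := LinearCombinations.module.span k (T0 q) (tpow b0 q ` carrier V)\<rparr>"
      "y \<in> N \<Longrightarrow> lin_iso k (T0 q) (stalk X y (T q)) (\<Psi> y)"
      "y \<in> N \<Longrightarrow> v \<in> carrier V \<Longrightarrow> \<Psi> y (tpow b0 q v) = pw y (germ X y U N (j v))"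
      using that by (simp_all add: D_def)
    show "openin X N" by (rule sheaf_chartD(1)[OF 1(1)])
    show "fd_space k (T0 q)" using 1(2) by (simp add: tensor_tower_def)
    show "tpow b0 q ` carrier V \<subseteq> carrier (T0 q)" using tpow_closed[OF 1(2)] by blast
  qed
  have cov: "\<exists>N Q \<Psi> V j T0 b0. D N Q \<Psi> V j T0 b0 \<and> x \<in> N" if x: "x \<in> topspace X" for x
  proof -
    obtain N and V :: "('k, nat \<Rightarrow> 'k) module" and j where c: "x \<in> N" "sheaf_chart U N V j"
      using local_system_chart[OF U x] by (elim exE conjE)
    note cD = sheaf_chartD[OF c(2)]
    obtain T0 b0 where tw0: "tensor_tower k V T0 b0" using tensor_tower_exists[OF cD(2)] by (elim exE)
    have "\<forall>y\<in>N. \<exists>\<Psi>. lin_iso k (T0 q) (stalk X y (T q)) \<Psi> \<and>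
        (\<forall>v\<in>carrier V. \<Psi> (tpow b0 q v) = pw y (germ X y U N (j v)))"
    proof
      fix y assume y: "y \<in> N"
      show "\<exists>\<Psi>. lin_iso k (T0 q) (stalk X y (T q)) \<Psi> \<and>
          (\<forall>v\<in>carrier V. \<Psi> (tpow b0 q v) = pw y (germ X y U N (j v)))"
        unfolding pw by (rule tensor_tower_map_iso[OF tw0 tw[OF point[OF cD(1) y]] cD(4)[OF y]])
    qed
    from bchoice[OF this] obtain \<Psi> where "\<forall>y\<in>N. lin_iso k (T0 q) (stalk X y (T q)) (\<Psi> y) \<and>
        (\<forall>v\<in>carrier V. \<Psi> y (tpow b0 q v) = pw y (germ X y U N (j v)))" by (elim exE)
    then have "D N ((T0 q)\<lparr>carrier := LinearCombinations.module.span k (T0 q) (tpow b0 q ` carrier V)\<rparr>) \<Psi> V j T0 b0"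
      unfolding D_def by (intro conjI c(2) tw0 refl)
    then show ?thesis using c(1) by blast
  qed
  have cf: "chart_family k X M \<C> e"
  proof (intro chart_family.intro chart_family_axioms.intro sheaf_base_axioms e)
    show "Module.module k (M y)" if "y \<in> topspace X" for y
      unfolding M by (rule fd_module[OF span_fd_space[OF fdT[OF that] pws[OF that]]])
    show "openin X N" if "(N, Q, \<Psi>) \<in> \<C>" for N Q \<Psi>
      using \<C>[OF that] by (elim exE) (rule DD(6))
    show "fd_space k Q" if c: "(N, Q, \<Psi>) \<in> \<C>" for N Q \<Psi>
    proof -
      obtain V j T0 b0 where d: "D N Q \<Psi> V j T0 b0" using \<C>[OF c] by (elim exE)
      show ?thesis unfolding DD(3)[OF d] by (rule span_fd_space[OF DD(7,8)[OF d]])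
    qed
    show "lin_iso k Q (M y) (\<Psi> y)" if c: "(N, Q, \<Psi>) \<in> \<C>" and y: "y \<in> N" for N Q \<Psi> y
    proof -
      obtain V j T0 b0 where d: "D N Q \<Psi> V j T0 b0" using \<C>[OF c] by (elim exE)
      note dd = DD[OF d]
      have "\<Psi> y ` tpow b0 q ` carrier V = pw y ` (\<lambda>v. germ X y U N (j v)) ` carrier V"
        unfolding image_image by (rule image_cong[OF refl dd(5)[OF y]])
      then have im: "\<Psi> y ` tpow b0 q ` carrier V = pw y ` carrier (stalk X y U)"
        unfolding lin_isoD(3)[OF sheaf_chartD(4)[OF dd(1) y]] .
      show ?thesis
        using lin_iso_span[OF fd_module[OF dd(7)] stalk_module[OF Tp point[OF dd(6) y]] dd(4)[OF y] dd(8)]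
        unfolding im dd(3) M .
    qed
    show "\<exists>N Q J. (N, Q, J) \<in> \<C> \<and> x \<in> N" if "x \<in> topspace X" for x
      using cov[OF that] unfolding \<C>_def by blast
    fix N Q \<Psi> N' Q' \<Psi>' x a
    assume "(N, Q, \<Psi>) \<in> \<C>" "(N', Q', \<Psi>') \<in> \<C>" and x: "x \<in> N \<inter> N'" and a: "a \<in> carrier Q"
    obtain V j T0 b0 where d: "D N Q \<Psi> V j T0 b0" using \<C>[OF \<open>(N, Q, \<Psi>) \<in> \<C>\<close>] by (elim exE)
    obtain V' j' T0' b0' where d': "D N' Q' \<Psi>' V' j' T0' b0'" using \<C>[OF \<open>(N', Q', \<Psi>') \<in> \<C>\<close>] by (elim exE)
    note dd = DD[OF d] and dd' = DD[OF d']
    have No: "openin X N" "openin X N'" by (rule dd(6), rule dd'(6))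
    have xN: "nbhd N x" "x \<in> N'" using x No by auto
    have Mm: "Module.module k (stalk X y (T q))" if "y \<in> N" for y by (rule stalk_module[OF Tp point[OF No(1) that]])
    have T0': "Module.module k (T0' q)" by (rule fd_module[OF dd'(7)])
    have cQ': "carrier Q' = LinearCombinations.module.span k (T0' q) (tpow b0' q ` carrier V')" unfolding dd'(3) by simp
    have Q'm: "Module.module k Q'" unfolding dd'(3) by (rule fd_module[OF span_fd_space[OF dd'(7,8)]])
    have "(\<lambda>v. v) \<in> lin k Q' (T0' q)"
      unfolding dd'(3) by (rule subspace_inclusion[OF LinearCombinations.module.span_is_subset2[OF T0' dd'(8)]])
    note \<Psi>l' = lin_compose[OF this lin_isoD(1)[OF dd'(4)]]
    have a': "a \<in> LinearCombinations.module.span k (T0 q) (tpow b0 q ` carrier V)" using a unfolding dd(3) by simp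
    show "\<exists>a'\<in>carrier Q'. \<exists>P. nbhd P x \<and> P \<subseteq> N \<inter> N' \<and> (\<forall>y\<in>P. \<Psi> y a = \<Psi>' y a')"
    proof (rule locally_equal_span[OF fd_module[OF dd(7)] Q'm No x Mm lin_isoD(1)[OF dd(4)] \<Psi>l' dd(8) a'])
      fix s assume "s \<in> tpow b0 q ` carrier V"
      then obtain v where v: "v \<in> carrier V" and s: "s = tpow b0 q v" by blast
      obtain v' P where v': "v' \<in> carrier V'" "nbhd P x" "P \<subseteq> N \<inter> N'" "\<forall>y\<in>P. germ X y U N (j v) = germ X y U N' (j' v')"
        using sheaf_chart_local[OF Up dd'(1) xN(1) lin_closed[OF sheaf_chartD(3)[OF dd(1)] v] xN(2)]
        by (elim bexE exE conjE) blast
      have "\<Psi> y s = \<Psi>' y (tpow b0' q v')" if y: "y \<in> P" for y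
      proof -
        have yN: "y \<in> N" "y \<in> N'" using y v'(3) by auto
        have "germ X y U N (j v) = germ X y U N' (j' v')" using y v'(4) by blast
        then show ?thesis unfolding s dd(5)[OF yN(1) v] dd'(5)[OF yN(2) v'(1)] by simp
      qed
      moreover have "tpow b0' q v' \<in> carrier Q'"
        unfolding cQ' by (rule subsetD[OF LinearCombinations.module.in_own_span[OF T0' dd'(8)] imageI[OF v'(1)]])
      ultimately show "\<exists>s'\<in>carrier Q'. \<exists>P. nbhd P x \<and> P \<subseteq> N \<inter> N' \<and> (\<forall>y\<in>P. \<Psi> y s = \<Psi>' y s')"
        using v'(2,3) by (intro bexI[of _ "tpow b0' q v'"] exI[of _ P]) auto
    qed
  qed
  obtain P :: "('x, 'k, 's) presheaf" and \<theta> where P: "local_system k X P"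
    and \<theta>iso: "\<forall>y\<in>topspace X. lin_iso k (stalk X y P) (M y) (\<theta> y)"
    and \<theta>loc: "\<forall>U s x N V j. nbhd U x \<longrightarrow> s \<in> carrier (Sec P U) \<longrightarrow> (N, V, j) \<in> \<C> \<longrightarrow> x \<in> N \<longrightarrow>
       (\<exists>v\<in>carrier V. \<exists>W. nbhd W x \<and> W \<subseteq> N \<inter> U \<and> (\<forall>y\<in>W. \<theta> y (germ X y P U s) = j y v))"
    using chart_family.associated_local_system[OF cf] by (elim exE conjE)
  note Pp = local_systemD(2)[OF P]
  have "\<exists>h. sheaf_morphism k X P Z h \<and>
          (\<forall>y\<in>topspace X. \<forall>C\<in>carrier (stalk X y P). stalk_map X y Z h C = \<rho> y (\<theta> y C))"
    if Z: "sheaf_of_spaces k X Z" and \<rho>: "\<forall>y\<in>topspace X. \<rho> y \<in> lin k (stalk X y (T q)) (stalk X y Z)"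
      and zs: "\<forall>N s. openin X N \<longrightarrow> s \<in> carrier (Sec U N) \<longrightarrow>
          (\<exists>z\<in>carrier (Sec Z N). \<forall>y\<in>N. germ X y Z N z = \<rho> y (pw y (germ X y U N s)))"
    for Z :: "('x, 'k, 's) presheaf" and \<rho>
  proof -
    note Zp = sheaf_imp_presheaf[OF Z]
    have lin: "(\<lambda>C. \<rho> y (\<theta> y C)) \<in> lin k (stalk X y P) (stalk X y Z)" if y: "y \<in> topspace X" for y
    proof -
      have "(\<lambda>v. v) \<in> lin k (M y) (stalk X y (T q))"
        unfolding M by (rule subspace_inclusion[OF LinearCombinations.module.span_is_subset2[OF stalk_module[OF Tp y] pws[OF y]]])
      from lin_compose[OF lin_compose[OF lin_isoD(1)[OF bspec[OF \<theta>iso y]] this] bspec[OF \<rho> y]] show ?thesis .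
    qed
    have loc: "\<exists>W t. nbhd W x \<and> W \<subseteq> Y \<and> t \<in> carrier (Sec Z W) \<and> (\<forall>y\<in>W. germ X y Z W t = \<rho> y (\<theta> y (germ X y P Y s)))"
      if Y: "nbhd Y x" and s: "s \<in> carrier (Sec P Y)" for Y s x
    proof -
      have xt: "x \<in> topspace X" using Y point by blast
      obtain N Q \<Psi> V j T0 b0 where d: "D N Q \<Psi> V j T0 b0" and x: "x \<in> N" using cov[OF xt] by (elim exE conjE)
      note dd = DD[OF d]
      have c: "(N, Q, \<Psi>) \<in> \<C>" unfolding \<C>_def using d by blast
      obtain a W where a: "a \<in> carrier Q" and W: "nbhd W x" "W \<subseteq> N \<inter> Y"
        and aW: "\<forall>y\<in>W. \<theta> y (germ X y P Y s) = \<Psi> y a"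
        using \<theta>loc[rule_format, OF Y s c x] by (elim bexE exE conjE) blast
      interpret A: Module.module k "T0 q" by (rule fd_module[OF dd(7)])
      interpret ZN: Module.module k "Sec Z N" by (rule sec_module[OF Zp dd(6)])
      have \<rho>\<Psi>: "(\<lambda>a. \<rho> y (\<Psi> y a)) \<in> lin k (T0 q) (stalk X y Z)" if y: "y \<in> N" for y
        by (rule lin_compose[OF lin_isoD(1)[OF dd(4)[OF y]] bspec[OF \<rho> point[OF dd(6) y]]])
      have "a \<in> A.span (tpow b0 q ` carrier V)" using a unfolding dd(3) by simp
      then have "\<exists>z\<in>carrier (Sec Z N). \<forall>y\<in>N. germ X y Z N z = \<rho> y (\<Psi> y a)"
        using dd(8)
      proof (induction rule: A.span_induct)
        case zero
        have "germ X y Z N \<zero>\<^bsub>Sec Z N\<^esub> = \<rho> y (\<Psi> y \<zero>\<^bsub>T0 q\<^esub>)" if y: "y \<in> N" for y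
          using lin_zero[OF A.module_axioms stalk_module[OF Zp point[OF dd(6) y]] \<rho>\<Psi>[OF y]]
            germ_zero[OF Zp, of N y] dd(6) y by simp
        then show ?case by (intro bexI[of _ "\<zero>\<^bsub>Sec Z N\<^esub>"]) auto
      next
        case (base b)
        then obtain v where v: "v \<in> carrier V" and b: "b = tpow b0 q v" by blast
        obtain z where z: "z \<in> carrier (Sec Z N)" "\<forall>y\<in>N. germ X y Z N z = \<rho> y (pw y (germ X y U N (j v)))"
          using zs[rule_format, OF dd(6) lin_closed[OF sheaf_chartD(3)[OF dd(1)] v]] by (elim bexE)
        have "germ X y Z N z = \<rho> y (\<Psi> y b)" if "y \<in> N" for y
          unfolding b dd(5)[OF that v] by (rule bspec[OF z(2) that])
        then show ?case using z(1) by blast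
      next
        case (add a b)
        then obtain z z' where z: "z \<in> carrier (Sec Z N)" "\<forall>y\<in>N. germ X y Z N z = \<rho> y (\<Psi> y a)"
          and z': "z' \<in> carrier (Sec Z N)" "\<forall>y\<in>N. germ X y Z N z' = \<rho> y (\<Psi> y b)" by (elim bexE)
        have "germ X y Z N (z \<oplus>\<^bsub>Sec Z N\<^esub> z') = \<rho> y (\<Psi> y (a \<oplus>\<^bsub>T0 q\<^esub> b))" if y: "y \<in> N" for y
          using lin_add[OF \<rho>\<Psi>[OF y] add(1,2)] germ_add[OF Zp, of N y z z'] dd(6) y z z' by simp
        then show ?case using z(1) z'(1) by (intro bexI[of _ "z \<oplus>\<^bsub>Sec Z N\<^esub> z'"]) auto
      next
        case (smult c a)
        then obtain z where z: "z \<in> carrier (Sec Z N)" "\<forall>y\<in>N. germ X y Z N z = \<rho> y (\<Psi> y a)" by (elim bexE)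
        have "germ X y Z N (c \<odot>\<^bsub>Sec Z N\<^esub> z) = \<rho> y (\<Psi> y (c \<odot>\<^bsub>T0 q\<^esub> a))" if y: "y \<in> N" for y
          using lin_smult[OF \<rho>\<Psi>[OF y] smult(1,2)] germ_smult[OF Zp, of N y z c] dd(6) y z smult(1) by simp
        then show ?case using z(1) smult(1) by (intro bexI[of _ "c \<odot>\<^bsub>Sec Z N\<^esub> z"]) auto
      qed
      then obtain z where z: "z \<in> carrier (Sec Z N)" "\<forall>y\<in>N. germ X y Z N z = \<rho> y (\<Psi> y a)" by (elim bexE)
      have WN: "openin X W" "W \<subseteq> N" "W \<subseteq> Y" using W by auto
      have "germ X y Z W (Res Z N W z) = \<rho> y (\<theta> y (germ X y P Y s))" if y: "y \<in> W" for y
        using germ_res[OF Zp, of W y N z] WN y dd(6) z(1) bspec[OF z(2), of y] bspec[OF aW y] by auto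
      then show ?thesis using W(1) WN(3) res_closed[OF Zp dd(6) WN(1,2) z(1)] by blast
    qed
    have "\<exists>h. sheaf_morphism k X P Z h \<and>
        (\<forall>Y s x. nbhd Y x \<longrightarrow> s \<in> carrier (Sec P Y) \<longrightarrow> germ X x Z Y (h Y s) = \<rho> x (\<theta> x (germ X x P Y s)))"
      by (rule morphism_from_stalks[OF Pp Z, of "\<lambda>x C. \<rho> x (\<theta> x C)"]) (rule lin loc, assumption+)+
    then obtain h where h: "sheaf_morphism k X P Z h"
      and hg: "\<forall>Y s x. nbhd Y x \<longrightarrow> s \<in> carrier (Sec P Y) \<longrightarrow> germ X x Z Y (h Y s) = \<rho> x (\<theta> x (germ X x P Y s))"
      by (elim exE conjE)
    have "stalk_map X y Z h C = \<rho> y (\<theta> y C)" if C: "C \<in> carrier (stalk X y P)" for y C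
    proof -
      obtain Y s where Y: "nbhd Y y" "s \<in> carrier (Sec P Y)" "C = germ X y P Y s" using stalkE[OF Pp C] .
      show ?thesis unfolding Y(3) stalk_map_on_germ[OF Pp Zp h Y(1,2)] by (rule hg[rule_format, OF Y(1,2)])
    qed
    then show ?thesis using h by blast
  qed
  then show ?thesis using P \<theta>iso by (intro exI[of _ P] exI[of _ \<theta>] conjI allI impI) simp_all
qed

end

section \<open>The twist of a sheaf\<close>

definition sheaf_twist :: "('k \<Rightarrow> 'k) \<Rightarrow> ('x, 'k, 's) presheaf \<Rightarrow> ('x, 'k, 's) presheaf" where
  "sheaf_twist \<sigma> F = F\<lparr>Sec := (\<lambda>U. twist \<sigma> (Sec F U))\<rparr>"

lemma sheaf_twist_simps[simp]:
  "Sec (sheaf_twist \<sigma> F) U = twist \<sigma> (Sec F U)" "Res (sheaf_twist \<sigma> F) = Res F"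
  by (simp_all add: sheaf_twist_def)

lemma germ_twist[simp]: "germ X x (sheaf_twist \<sigma> F) U s = germ X x F U s"
  by (simp add: germ_def)

lemma stalk_twist: "stalk X x (sheaf_twist \<sigma> F) = twist \<sigma> (stalk X x F)"
  by (simp add: stalk_def twist_def)

lemma stalk_map_twist: "stalk_map X x (sheaf_twist \<sigma> F) h = stalk_map X x F h"
  by (simp add: stalk_map_def)

lemma stalk_bilinear_twist:
  "stalk_bilinear X x (sheaf_twist \<sigma> E) (sheaf_twist \<sigma> F) (sheaf_twist \<sigma> T) \<beta> = stalk_bilinear X x E F T \<beta>"
  by (simp add: stalk_bilinear_def)

lemma constant_sheaf_twist: "constant_sheaf X (twist \<sigma> V) = sheaf_twist \<sigma> (constant_sheaf X V)"
  by (simp add: constant_sheaf_def sheaf_twist_def twist_def)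

lemma constant_sheaf_carrier:
  "f \<in> carrier (Sec (constant_sheaf X V) U) \<longleftrightarrow> f \<in> U \<rightarrow>\<^sub>E carrier V \<and>
     (\<forall>x\<in>U. \<exists>N. openin X N \<and> x \<in> N \<and> N \<subseteq> U \<and> (\<forall>y\<in>N. f y = f x))"
  by (simp add: constant_sheaf_def)

lemma constant_sheaf_comp:
  assumes f: "f \<in> carrier (Sec (constant_sheaf X V) U)" and g: "\<And>v. v \<in> carrier V \<Longrightarrow> g v \<in> carrier W"
  shows "(\<lambda>x\<in>U. g (f x)) \<in> carrier (Sec (constant_sheaf X W) U)"
  unfolding constant_sheaf_carrier
proof (intro conjI ballI)
  have f1: "f \<in> U \<rightarrow>\<^sub>E carrier V" and f2: "\<forall>x\<in>U. \<exists>N. openin X N \<and> x \<in> N \<and> N \<subseteq> U \<and> (\<forall>y\<in>N. f y = f x)"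
    using f unfolding constant_sheaf_carrier by auto
  show "(\<lambda>x\<in>U. g (f x)) \<in> U \<rightarrow>\<^sub>E carrier W" using g PiE_mem[OF f1] by auto
  fix x assume x: "x \<in> U"
  obtain N where N: "openin X N" "x \<in> N" "N \<subseteq> U" "\<forall>y\<in>N. f y = f x"
    using bspec[OF f2 x] by (elim exE conjE)
  have "(\<lambda>x\<in>U. g (f x)) y = (\<lambda>x\<in>U. g (f x)) x" if "y \<in> N" for y
    using bspec[OF N(4) that] subsetD[OF N(3) that] x by simp
  then show "\<exists>N. openin X N \<and> x \<in> N \<and> N \<subseteq> U \<and> (\<forall>y\<in>N. (\<lambda>x\<in>U. g (f x)) y = (\<lambda>x\<in>U. g (f x)) x)"
    using N(1-3) by blast
qed

lemma bilinear_twist: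
  assumes "\<beta> \<in> bilinear_maps k V W T" "\<And>c. c \<in> carrier k \<Longrightarrow> \<sigma> c \<in> carrier k"
  shows "\<beta> \<in> bilinear_maps k (twist \<sigma> V) (twist \<sigma> W) (twist \<sigma> T)"
  by (rule bilinear_mapsI)
    (use lin_twist[OF bilinear_lin2[OF assms(1)]] lin_twist[OF bilinear_lin1[OF assms(1)]] assms(2) in auto)

context perfect_char
begin

lemma sheaf_twist_presheaf:
  fixes F :: "('x, 'k, 's) presheaf"
  assumes F: "presheaf_of_spaces k X F" and \<sigma>: "\<And>c. c \<in> carrier k \<Longrightarrow> \<sigma> c \<in> carrier k"
    and vs: "\<And>V. vectorspace k V \<Longrightarrow> vectorspace k (twist \<sigma> (V :: ('k, 's) module))"
  shows "presheaf_of_spaces k X (sheaf_twist \<sigma> (F :: ('x, 'k, 's) presheaf))"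
  using F \<sigma> vs unfolding presheaf_of_spaces_def by (simp add: lin_twist)

lemma sheaf_twist_sheaf:
  fixes F :: "('x, 'k, 's) presheaf"
  assumes F: "sheaf_of_spaces k X F" and \<sigma>: "\<And>c. c \<in> carrier k \<Longrightarrow> \<sigma> c \<in> carrier k"
    and vs: "\<And>V. vectorspace k V \<Longrightarrow> vectorspace k (twist \<sigma> (V :: ('k, 's) module))"
  shows "sheaf_of_spaces k X (sheaf_twist \<sigma> (F :: ('x, 'k, 's) presheaf))"
  unfolding sheaf_of_spaces_def sheaf_twist_simps twist_simps
proof
  show "presheaf_of_spaces k X (sheaf_twist \<sigma> F)"
    by (rule sheaf_twist_presheaf[OF _ \<sigma> vs]) (use F in \<open>simp_all add: sheaf_of_spaces_def\<close>)
qed (rule conjunct2[OF F[unfolded sheaf_of_spaces_def]])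

lemma sheaf_twist_morphism:
  fixes E :: "('x, 'k, 's) presheaf" and F :: "('x, 'k, 't) presheaf"
  shows "sheaf_morphism k X E F h \<Longrightarrow> sheaf_morphism k X (sheaf_twist frob E) (sheaf_twist frob F) h"
  unfolding sheaf_morphism_def by (simp add: lin_twist)

lemma sheaf_twist_isomorphism:
  fixes E :: "('x, 'k, 's) presheaf" and F :: "('x, 'k, 't) presheaf"
  shows "sheaf_isomorphism k X E F h \<Longrightarrow> sheaf_isomorphism k X (sheaf_twist frob E) (sheaf_twist frob F) h"
  unfolding sheaf_isomorphism_def by (simp add: sheaf_twist_morphism)

lemma sheaf_twist_local_system:
  fixes F :: "('x, 'k, 's) presheaf"
  assumes "local_system k X F"
  shows "local_system k X (sheaf_twist frob F)"
  unfolding local_system_def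
proof (intro conjI ballI)
  have F: "sheaf_of_spaces k X F"
    and loc: "\<forall>x\<in>topspace X. \<exists>U. openin X U \<and> x \<in> U \<and> (\<exists>(V :: ('k, 's) module) h. fd_space k V \<and>
           sheaf_isomorphism k (subtopology X U) F (constant_sheaf (subtopology X U) V) h)"
    using assms unfolding local_system_def by auto
  show "sheaf_of_spaces k X (sheaf_twist frob F)" by (rule sheaf_twist_sheaf[OF F frob_closed twist_vectorspace])
  fix x assume x: "x \<in> topspace X"
  obtain U and V :: "('k, 's) module" and h where U: "openin X U" "x \<in> U" and V: "fd_space k V"
    and h: "sheaf_isomorphism k (subtopology X U) F (constant_sheaf (subtopology X U) V) h"
    using bspec[OF loc x] by (elim exE conjE)
  have "sheaf_isomorphism k (subtopology X U) (sheaf_twist frob F) (constant_sheaf (subtopology X U) (twist frob V)) h"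
    unfolding constant_sheaf_twist by (rule sheaf_twist_isomorphism[OF h])
  then show "\<exists>U. openin X U \<and> x \<in> U \<and> (\<exists>(V :: ('k, 's) module) h. fd_space k V \<and>
           sheaf_isomorphism k (subtopology X U) (sheaf_twist frob F) (constant_sheaf (subtopology X U) V) h)"
    using U twist_fd_space[OF V] by blast
qed

lemma sheaf_twist_adjoint:
  fixes E F T Z :: "('x, 'k, 's) presheaf"
  shows "sheaf_morphism k X (sheaf_twist frob T) Z h \<longleftrightarrow> sheaf_morphism k X T (sheaf_twist root Z) h"
  "sheaf_bilinear k X (sheaf_twist frob E) (sheaf_twist frob F) Z \<gamma> \<longleftrightarrow> sheaf_bilinear k X E F (sheaf_twist root Z) \<gamma>"
  unfolding sheaf_morphism_def sheaf_bilinear_def bilinear_maps_def by (simp_all add: lin_twist_adjoint)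

text \<open>By adjunction, maps from the twisted sheaves to \<open>Z\<close> are maps from the original sheaves to
  \<open>sheaf_twist root Z\<close>.\<close>

lemma sheaf_twist_tensor_product:
  fixes E F T :: "('x, 'k, 's) presheaf"
  assumes tp: "is_sheaf_tensor_product k X E F T \<beta>"
  shows "is_sheaf_tensor_product k X (sheaf_twist frob E) (sheaf_twist frob F) (sheaf_twist frob T) \<beta>"
  unfolding is_sheaf_tensor_product_def
proof (intro conjI allI impI)
  have "sheaf_bilinear k X E F T \<beta>" using tp unfolding is_sheaf_tensor_product_def by (rule conjunct1)
  then show "sheaf_bilinear k X (sheaf_twist frob E) (sheaf_twist frob F) (sheaf_twist frob T) \<beta>"
    unfolding sheaf_bilinear_def by (simp add: bilinear_twist)
  fix Z :: "('x, 'k, 's) presheaf" and \<gamma>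
  assume *: "sheaf_of_spaces k X Z \<and> sheaf_bilinear k X (sheaf_twist frob E) (sheaf_twist frob F) Z \<gamma>"
  have Z': "sheaf_of_spaces k X (sheaf_twist root Z)"
    by (rule sheaf_twist_sheaf[OF conjunct1[OF *] root_closed untwist_vectorspace])
  have "sheaf_bilinear k X E F (sheaf_twist root Z) \<gamma>" using * unfolding sheaf_twist_adjoint by (rule conjunct2)
  with Z' have "sheaf_of_spaces k X (sheaf_twist root Z) \<and> sheaf_bilinear k X E F (sheaf_twist root Z) \<gamma>" by (rule conjI)
  from mp[OF spec[OF spec[OF conjunct2[OF tp[unfolded is_sheaf_tensor_product_def]]]] this]
  show "\<exists>h. sheaf_morphism k X (sheaf_twist frob T) Z h \<and>
        (\<forall>U. openin X U \<longrightarrow> (\<forall>s\<in>carrier (Sec (sheaf_twist frob E) U). \<forall>t\<in>carrier (Sec (sheaf_twist frob F) U).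
           h U (\<beta> U s t) = \<gamma> U s t)) \<and>
        (\<forall>h'. sheaf_morphism k X (sheaf_twist frob T) Z h' \<and>
           (\<forall>U. openin X U \<longrightarrow> (\<forall>s\<in>carrier (Sec (sheaf_twist frob E) U). \<forall>t\<in>carrier (Sec (sheaf_twist frob F) U).
              h' U (\<beta> U s t) = \<gamma> U s t)) \<longrightarrow>
           (\<forall>U. openin X U \<longrightarrow> (\<forall>t\<in>carrier (Sec (sheaf_twist frob T) U). h' U t = h U t)))"
    unfolding sheaf_twist_adjoint sheaf_twist_simps twist_simps .
qed

text \<open>The Frobenius map of \<open>k\<close> is a linear isomorphism from \<open>k\<close> to its twist. So the twist of the unit object
  is again a unit object.\<close>

lemma constant_sheaf_frob:
  "sheaf_isomorphism k X (constant_sheaf X (regular_module k))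
     (sheaf_twist frob (constant_sheaf X (regular_module k))) (\<lambda>U f. \<lambda>x\<in>U. frob (f x))"
proof -
  let ?C = "constant_sheaf X (regular_module k)"
  have fc: "(\<lambda>x\<in>U. frob (f x)) \<in> carrier (Sec ?C U)" if "f \<in> carrier (Sec ?C U)" for f U
    by (rule constant_sheaf_comp[OF that]) simp
  have rc: "(\<lambda>x\<in>U. root (f x)) \<in> carrier (Sec ?C U)" if "f \<in> carrier (Sec ?C U)" for f U
    by (rule constant_sheaf_comp[OF that]) simp
  have val: "f x \<in> carrier k" if "f \<in> carrier (Sec ?C U)" "x \<in> U" for f U x
    using that unfolding constant_sheaf_carrier by auto
  have ext: "f \<in> extensional U" if "f \<in> carrier (Sec ?C U)" for f U
    using that unfolding constant_sheaf_carrier by (auto simp: PiE_def)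
  have ops: "f \<oplus>\<^bsub>Sec ?C U\<^esub> g = (\<lambda>x\<in>U. f x \<oplus> g x)" "c \<odot>\<^bsub>Sec ?C U\<^esub> f = (\<lambda>x\<in>U. c \<otimes> f x)" for f g c U
    by (simp_all add: constant_sheaf_def)
  have lin: "(\<lambda>f. \<lambda>x\<in>U. frob (f x)) \<in> lin k (Sec ?C U) (twist frob (Sec ?C U))" for U
  proof (rule linI)
    fix f assume f: "f \<in> carrier (Sec ?C U)"
    show "(\<lambda>x\<in>U. frob (f x)) \<in> carrier (twist frob (Sec ?C U))" using fc[OF f] by simp
    show "(\<lambda>x\<in>U. frob ((c \<odot>\<^bsub>Sec ?C U\<^esub> f) x)) = c \<odot>\<^bsub>twist frob (Sec ?C U)\<^esub> (\<lambda>x\<in>U. frob (f x))" if "c \<in> carrier k" for c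
      unfolding twist_simps ops by (rule restrict_ext) (simp add: frob_mult that val[OF f])
    fix g assume g: "g \<in> carrier (Sec ?C U)"
    show "(\<lambda>x\<in>U. frob ((f \<oplus>\<^bsub>Sec ?C U\<^esub> g) x)) = (\<lambda>x\<in>U. frob (f x)) \<oplus>\<^bsub>twist frob (Sec ?C U)\<^esub> (\<lambda>x\<in>U. frob (g x))"
      unfolding twist_simps ops by (rule restrict_ext) (simp add: frob_add val[OF f] val[OF g])
  qed
  have bij: "bij_betw (\<lambda>f. \<lambda>x\<in>U. frob (f x)) (carrier (Sec ?C U)) (carrier (Sec ?C U))" for U
  proof (rule bij_betw_byWitness[of _ "\<lambda>f. \<lambda>x\<in>U. root (f x)"])
    show "\<forall>f\<in>carrier (Sec ?C U). (\<lambda>x\<in>U. root ((\<lambda>x\<in>U. frob (f x)) x)) = f"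
      by (intro ballI extensionalityI[of _ U]) (simp_all add: ext val)
    show "\<forall>f\<in>carrier (Sec ?C U). (\<lambda>x\<in>U. frob ((\<lambda>x\<in>U. root (f x)) x)) = f"
      by (intro ballI extensionalityI[of _ U]) (simp_all add: ext val)
  qed (use fc rc in blast)+
  have res: "(\<lambda>x\<in>V. frob (Res ?C U V f x)) = Res ?C U V (\<lambda>x\<in>U. frob (f x))" if "V \<subseteq> U" for U V f
    using that by (auto simp: constant_sheaf_def fun_eq_iff restrict_def)
  show ?thesis
    unfolding sheaf_isomorphism_def sheaf_morphism_def sheaf_twist_simps twist_simps
    by (intro conjI allI impI ballI lin bij res) simp
qed

end

section \<open>The fibre functor of local systems\<close>

lemma Loc_simps:
  "Obj (Loc t k X x) = {F. local_system k X F}" "Fib (Loc t k X x) = stalk X x"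
  "Mor (Loc t k X x) E F = {stalk_map X x F h | h. sheaf_morphism k X E F h}"
  "Tens (Loc t k X x) E F T = {stalk_bilinear X x E F T \<beta> | \<beta>. is_sheaf_tensor_product k X E F T \<beta>}"
  "Unit (Loc t k X x) F = {germ X x F (topspace X) (h (topspace X) (\<lambda>x\<in>topspace X. \<one>\<^bsub>k\<^esub>)) | h.
     sheaf_isomorphism k X (constant_sheaf X (regular_module k)) F h}"
  by (simp_all add: Loc_def)

lemma (in sheaf_base) section_tpow:
  assumes T: "\<And>n. presheaf_of_spaces k X (T n)" and \<beta>: "\<And>n. sheaf_bilinear k X (T 0) (T n) (T (Suc n)) (\<beta> n)"
    and N: "openin X N" and s: "s \<in> carrier (Sec (T 0) N)"
  shows "tpow (\<lambda>n. \<beta> n N) n s \<in> carrier (Sec (T n) N)"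
    and "y \<in> N \<Longrightarrow> germ X y (T n) N (tpow (\<lambda>n. \<beta> n N) n s) =
      tpow (\<lambda>n. stalk_bilinear X y (T 0) (T n) (T (Suc n)) (\<beta> n)) n (germ X y (T 0) N s)"
proof -
  show c: "tpow (\<lambda>n. \<beta> n N) n s \<in> carrier (Sec (T n) N)" for n
  proof (induction n)
    case (Suc n)
    then show ?case using bilinear_closed[OF sheaf_bilinearD(1)[OF \<beta> N] s] by simp
  qed (simp add: s)
  assume y: "y \<in> N"
  have n: "nbhd N y" using N y by simp
  show "germ X y (T n) N (tpow (\<lambda>n. \<beta> n N) n s) =
      tpow (\<lambda>n. stalk_bilinear X y (T 0) (T n) (T (Suc n)) (\<beta> n)) n (germ X y (T 0) N s)"
  proof (induction n)
    case (Suc n)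
    then show ?case using stalk_bilinear_germ[OF T T T \<beta> n s c, of n] by simp
  qed simp
qed

text \<open>The retractions \<open>r y\<close> of the tensor powers of all stalks give the morphism from \<open>P\<close> to \<open>V\<close>: at \<open>y\<close> they
  take the power of a section \<open>s\<close> of \<open>\<tau> V\<close> back to the germ of \<open>s\<close>, and \<open>s\<close> is also a section of \<open>V\<close>.\<close>

lemma (in perfect_char) Loc_twisted_fibre_functor:
  fixes X :: "'x topology"
  assumes large: "large_for_local_systems TYPE('s) k X" and x0: "x\<^sub>0 \<in> topspace X"
  shows "twisted_fibre_functor k p (Loc TYPE('s) k X x\<^sub>0) (sheaf_twist frob)"
proof (intro twisted_fibre_functor.intro perfect_char_axioms twisted_fibre_functor_axioms.intro)
  interpret sheaf_base k X by (rule sheaf_base.intro) (rule field_axioms)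
  obtain e :: "('x \<Rightarrow> nat \<Rightarrow> 'k) \<Rightarrow> 's" where e: "inj e" using large unfolding large_for_local_systems_def by blast
  let ?L = "Loc TYPE('s) k X x\<^sub>0"
  note L = Loc_simps mem_Collect_eq
  fix V W T :: "('x, 'k, 's) presheaf"
  assume V0: "V \<in> Obj ?L"
  then have V: "local_system k X V" unfolding L .
  note Vp = local_systemD(2)[OF V]
  show "fd_space k (Fib ?L V)" unfolding L by (rule local_system_stalk_fd[OF V x0])
  show "sheaf_twist frob V \<in> Obj ?L" unfolding L by (rule sheaf_twist_local_system[OF V])
  show "Fib ?L (sheaf_twist frob V) = twist frob (Fib ?L V)" unfolding L by (rule stalk_twist)
  show "u \<in> Unit ?L (sheaf_twist frob V)" if u: "u \<in> Unit ?L V" for u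
  proof -
    obtain h where h: "sheaf_isomorphism k X (constant_sheaf X (regular_module k)) V h"
      and u: "u = germ X x\<^sub>0 V (topspace X) (h (topspace X) (\<lambda>x\<in>topspace X. \<one>))"
      using u unfolding L by (elim exE conjE)
    let ?C = "constant_sheaf X (regular_module k)" and ?\<phi> = "\<lambda>U f. \<lambda>x\<in>U. frob (f x)"
    have h': "sheaf_isomorphism k X (sheaf_twist frob ?C) (sheaf_twist frob V) h" by (rule sheaf_twist_isomorphism[OF h])
    have "sheaf_morphism k X ?C (sheaf_twist frob V) (\<lambda>U f. h U (?\<phi> U f))"
      by (rule sheaf_morphism_compose[OF conjunct1[OF constant_sheaf_frob[unfolded sheaf_isomorphism_def]]
            conjunct1[OF h'[unfolded sheaf_isomorphism_def]]])
    moreover have "bij_betw (\<lambda>f. h U (?\<phi> U f)) (carrier (Sec ?C U)) (carrier (Sec (sheaf_twist frob V) U))"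
      if "openin X U" for U
      using bij_betw_trans[of "?\<phi> U" _ "carrier (Sec (sheaf_twist frob ?C) U)" "h U"] h' constant_sheaf_frob[of X] that
      unfolding sheaf_isomorphism_def o_def by blast
    ultimately have "sheaf_isomorphism k X ?C (sheaf_twist frob V) (\<lambda>U f. h U (?\<phi> U f))"
      unfolding sheaf_isomorphism_def by blast
    moreover have "?\<phi> (topspace X) (\<lambda>x\<in>topspace X. \<one>) = (\<lambda>x\<in>topspace X. \<one>)"
      by (rule restrict_ext) (simp add: frob_def)
    ultimately show ?thesis
      unfolding L u germ_twist by (intro exI[of _ "\<lambda>U f. h U (?\<phi> U f)"] conjI) simp_all
  qed
  show "\<exists>P\<in>Obj ?L. \<exists>\<iota>\<in>Mor ?L P (Ts (p - 1)). \<exists>\<pi>\<in>Mor ?L P V.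
        \<iota> ` carrier (Fib ?L P) = LinearCombinations.module.span k (Fib ?L (Ts (p - 1))) (tpow bs (p - 1) ` carrier (Fib ?L V)) \<and>
        (\<forall>r\<in>lin k (Fib ?L (Ts (p - 1))) (Fib ?L V). (\<forall>v\<in>carrier (Fib ?L V). r (tpow bs (p - 1) v) = v) \<longrightarrow>
           (\<forall>t\<in>carrier (Fib ?L P). \<pi> t = r (\<iota> t)))"
    if T0: "Ts 0 = sheaf_twist frob V" and To: "\<And>n. Ts n \<in> Obj ?L"
      and bs: "\<And>n. bs n \<in> Tens ?L (sheaf_twist frob V) (Ts n) (Ts (Suc n))" for Ts bs
  proof -
    let ?U = "sheaf_twist frob V" and ?q = "p - 1"
    have T: "local_system k X (Ts n)" for n using To[of n] unfolding L .
    note Tp = local_systemD(2)[OF T]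
    note U = sheaf_twist_local_system[OF V]
    have "\<forall>n. \<exists>\<beta>. is_sheaf_tensor_product k X ?U (Ts n) (Ts (Suc n)) \<beta> \<and>
        bs n = stalk_bilinear X x\<^sub>0 ?U (Ts n) (Ts (Suc n)) \<beta>" using bs unfolding L by blast
    from choice[OF this] obtain \<beta> where tp: "\<And>n. is_sheaf_tensor_product k X ?U (Ts n) (Ts (Suc n)) (\<beta> n)"
      and bs_eq: "\<And>n. bs n = stalk_bilinear X x\<^sub>0 ?U (Ts n) (Ts (Suc n)) (\<beta> n)" by blast
    note \<beta> = sheaf_tensor_productD(1)[OF tp]
    define pw where "pw y = tpow (\<lambda>n. stalk_bilinear X y ?U (Ts n) (Ts (Suc n)) (\<beta> n)) ?q" for y
    have tw_all: "\<forall>y\<in>topspace X. tensor_tower k (stalk X y ?U) (\<lambda>n. stalk X y (Ts n))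
        (\<lambda>n. stalk_bilinear X y ?U (Ts n) (Ts (Suc n)) (\<beta> n))"
    proof
      fix y assume y: "y \<in> topspace X"
      show "tensor_tower k (stalk X y ?U) (\<lambda>n. stalk X y (Ts n))
        (\<lambda>n. stalk_bilinear X y ?U (Ts n) (Ts (Suc n)) (\<beta> n))"
        unfolding tensor_tower_def
        by (intro conjI allI local_system_stalk_fd[OF T y] sheaf_tensor_product_stalks[OF e U T T tp y]) (simp add: T0)
    qed
    note tw = bspec[OF tw_all]
    have pw0: "pw x\<^sub>0 = tpow bs ?q"
    proof -
      have "bs = (\<lambda>n. stalk_bilinear X x\<^sub>0 ?U (Ts n) (Ts (Suc n)) (\<beta> n))" by (rule ext) (rule bs_eq)
      then show ?thesis unfolding pw_def by simp
    qed
    define M where "M y = (stalk X y (Ts ?q))\<lparr>carrier :=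
        LinearCombinations.module.span k (stalk X y (Ts ?q)) (pw y ` carrier (stalk X y ?U))\<rparr>" for y
    obtain P :: "('x, 'k, 's) presheaf" and \<theta> where P: "local_system k X P"
      and \<theta>iso: "\<forall>y\<in>topspace X. lin_iso k (stalk X y P) (M y) (\<theta> y)"
      and univ: "\<forall>(Z :: ('x, 'k, 's) presheaf) \<rho>. sheaf_of_spaces k X Z \<longrightarrow>
       (\<forall>y\<in>topspace X. \<rho> y \<in> lin k (stalk X y (Ts ?q)) (stalk X y Z)) \<longrightarrow>
       (\<forall>N s. openin X N \<longrightarrow> s \<in> carrier (Sec ?U N) \<longrightarrow>
          (\<exists>z\<in>carrier (Sec Z N). \<forall>y\<in>N. germ X y Z N z = \<rho> y (pw y (germ X y ?U N s)))) \<longrightarrow>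
       (\<exists>h. sheaf_morphism k X P Z h \<and>
          (\<forall>y\<in>topspace X. \<forall>C\<in>carrier (stalk X y P). stalk_map X y Z h C = \<rho> y (\<theta> y C)))"
      using power_subsystem[OF e U T T0 \<beta> tw_all pw_def M_def] by (elim exE conjE)
    have sec: "\<exists>z\<in>carrier (Sec (Ts ?q) N). \<forall>y\<in>N. germ X y (Ts ?q) N z = pw y (germ X y ?U N s)"
      if N: "openin X N" "s \<in> carrier (Sec ?U N)" for N s
      using section_tpow[where T = Ts and \<beta> = \<beta> and N = N and s = s and n = ?q, unfolded T0, OF Tp \<beta> N] unfolding pw_def
      by (intro bexI[of _ "tpow (\<lambda>n. \<beta> n N) ?q s"] ballI)
    obtain h where h: "sheaf_morphism k X P (Ts ?q) h"
      and h\<theta>: "\<forall>y\<in>topspace X. \<forall>C\<in>carrier (stalk X y P). stalk_map X y (Ts ?q) h C = \<theta> y C"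
    proof -
      have "\<exists>h. sheaf_morphism k X P (Ts ?q) h \<and>
          (\<forall>y\<in>topspace X. \<forall>C\<in>carrier (stalk X y P). stalk_map X y (Ts ?q) h C = (\<lambda>y C. C) y (\<theta> y C))"
        by (rule univ[rule_format, OF local_systemD(1)[OF T]]) (use sec lin_id in auto)
      then show thesis using that by (elim exE conjE) simp
    qed
    have "\<forall>y\<in>topspace X. \<exists>r. r \<in> lin k (stalk X y (Ts ?q)) (stalk X y V) \<and> (\<forall>v\<in>carrier (stalk X y V). r (pw y v) = v)"
    proof
      fix y assume y: "y \<in> topspace X"
      from tensor_power_retraction[OF local_system_stalk_fd[OF V y] tw[OF y, unfolded stalk_twist[of X y frob V]]]
      show "\<exists>r. r \<in> lin k (stalk X y (Ts ?q)) (stalk X y V) \<and> (\<forall>v\<in>carrier (stalk X y V). r (pw y v) = v)"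
        unfolding pw_def by (simp only: Bex_def)
    qed
    from bchoice[OF this] obtain r where r: "\<And>y. y \<in> topspace X \<Longrightarrow> r y \<in> lin k (stalk X y (Ts ?q)) (stalk X y V)"
      and rpw: "\<And>y v. y \<in> topspace X \<Longrightarrow> v \<in> carrier (stalk X y V) \<Longrightarrow> r y (pw y v) = v" by blast
    obtain g where g: "sheaf_morphism k X P V g"
      and g\<theta>: "\<forall>y\<in>topspace X. \<forall>C\<in>carrier (stalk X y P). stalk_map X y V g C = r y (\<theta> y C)"
    proof -
      have sec': "\<exists>z\<in>carrier (Sec V N). \<forall>y\<in>N. germ X y V N z = r y (pw y (germ X y ?U N s))"
        if N: "openin X N" "s \<in> carrier (Sec ?U N)" for N s
      proof (rule bexI[of _ s], rule ballI)
        show s: "s \<in> carrier (Sec V N)" using N(2) by simp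
        fix y assume y: "y \<in> N"
        have "germ X y V N s \<in> carrier (stalk X y V)" by (rule germ_closed[OF Vp _ s]) (use N y in simp)
        then show "germ X y V N s = r y (pw y (germ X y ?U N s))"
          using rpw[OF point[OF N(1) y]] by simp
      qed
      have "\<exists>h. sheaf_morphism k X P V h \<and>
          (\<forall>y\<in>topspace X. \<forall>C\<in>carrier (stalk X y P). stalk_map X y V h C = r y (\<theta> y C))"
        by (rule univ[rule_format, OF local_systemD(1)[OF V]]) (use sec' r in blast)+
      then show thesis using that by (elim exE conjE)
    qed
    let ?\<iota> = "stalk_map X x\<^sub>0 (Ts ?q) h" and ?\<pi> = "stalk_map X x\<^sub>0 V g"
    have \<iota>: "?\<iota> C = \<theta> x\<^sub>0 C" and \<pi>: "?\<pi> C = r x\<^sub>0 (\<theta> x\<^sub>0 C)" if "C \<in> carrier (stalk X x\<^sub>0 P)" for C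
      using h\<theta> g\<theta> x0 that by blast+
    let ?S = "tpow bs ?q ` carrier (stalk X x\<^sub>0 V)"
    have cM: "carrier (M x\<^sub>0) = LinearCombinations.module.span k (stalk X x\<^sub>0 (Ts ?q)) ?S"
      unfolding M_def pw0 stalk_twist by simp
    have im: "?\<iota> ` carrier (stalk X x\<^sub>0 P) = LinearCombinations.module.span k (stalk X x\<^sub>0 (Ts ?q)) ?S"
      unfolding cM[symmetric] lin_isoD(3)[OF bspec[OF \<theta>iso x0], symmetric] by (rule image_cong[OF refl \<iota>])
    have S: "?S \<subseteq> carrier (stalk X x\<^sub>0 (Ts ?q))"
      using tpow_closed[OF tw[OF x0], of _ ?q] unfolding pw_def[symmetric] pw0 stalk_twist by auto
    have \<pi>r: "?\<pi> t = r' (?\<iota> t)"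
      if r': "r' \<in> lin k (stalk X x\<^sub>0 (Ts ?q)) (stalk X x\<^sub>0 V)" "\<forall>v\<in>carrier (stalk X x\<^sub>0 V). r' (tpow bs ?q v) = v"
        and t: "t \<in> carrier (stalk X x\<^sub>0 P)" for r' t
      unfolding \<pi>[OF t] \<iota>[OF t]
    proof (rule lin_eq_on_span[OF stalk_module[OF Tp x0] stalk_module[OF Vp x0] r[OF x0] r'(1) S])
      show "r x\<^sub>0 s = r' s" if "s \<in> ?S" for s
        using that rpw[OF x0] r'(2) unfolding pw0 by auto
      show "\<theta> x\<^sub>0 t \<in> LinearCombinations.module.span k (stalk X x\<^sub>0 (Ts ?q)) ?S"
        unfolding im[symmetric] using \<iota>[OF t] t by (metis imageI)
    qed
    show ?thesis
      unfolding L
    proof (rule bexI[of _ P], rule bexI[of _ ?\<iota>], rule bexI[of _ ?\<pi>], intro conjI ballI impI im)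
      show "?\<pi> t = r' (?\<iota> t)"
        if "r' \<in> lin k (stalk X x\<^sub>0 (Ts ?q)) (stalk X x\<^sub>0 V)" "\<forall>v\<in>carrier (stalk X x\<^sub>0 V). r' (tpow bs ?q v) = v"
          "t \<in> carrier (stalk X x\<^sub>0 P)" for r' t
        by (rule \<pi>r[OF that])
      show "?\<pi> \<in> {stalk_map X x\<^sub>0 V h | h. sheaf_morphism k X P V h}" using g by (intro CollectI exI[of _ g] conjI refl)
      show "?\<iota> \<in> {stalk_map X x\<^sub>0 (Ts ?q) h' | h'. sheaf_morphism k X P (Ts ?q) h'}"
        using h by (intro CollectI exI[of _ h] conjI refl)
    qed (simp add: P)
  qed
  assume "W \<in> Obj ?L"
  then have W: "local_system k X W" unfolding L .
  note Wp = local_systemD(2)[OF W]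
  show "f \<in> lin k (Fib ?L V) (Fib ?L W)" if f: "f \<in> Mor ?L V W" for f
  proof -
    obtain h where "sheaf_morphism k X V W h" "f = stalk_map X x\<^sub>0 W h" using f unfolding L by (elim exE conjE)
    then show ?thesis unfolding L using stalk_map_lin[OF Vp Wp] by simp
  qed
  show "f \<in> Mor ?L (sheaf_twist frob V) (sheaf_twist frob W)" if f: "f \<in> Mor ?L V W" for f
  proof -
    obtain h where h: "sheaf_morphism k X V W h" "f = stalk_map X x\<^sub>0 W h" using f unfolding L by (elim exE conjE)
    show ?thesis unfolding L h(2) stalk_map_twist using sheaf_twist_morphism[OF h(1)] by blast
  qed
  show "\<exists>T\<in>Obj ?L. \<exists>\<beta>\<in>Tens ?L V W T. tensor_pairing k (Fib ?L V) (Fib ?L W) (Fib ?L T) \<beta>"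
  proof -
    obtain T :: "('x, 'k, 's) presheaf" and \<beta> where T: "local_system k X T" and \<beta>: "sheaf_bilinear k X V W T \<beta>"
      and st: "\<forall>x\<in>topspace X. tensor_pairing k (stalk X x V) (stalk X x W) (stalk X x T) (stalk_bilinear X x V W T \<beta>)"
      using local_system_tensor_exists[OF e V W] by (elim exE conjE)
    have "is_sheaf_tensor_product k X V W T \<beta>"
      by (rule tensor_product_from_stalks[OF Vp Wp local_systemD(2)[OF T] \<beta>])
        (rule bspec[OF st] local_system_stalk_fd[OF V] local_system_stalk_fd[OF W], assumption)+
    then show ?thesis unfolding L using T bspec[OF st x0]
      by (intro bexI[of _ T] bexI[of _ "stalk_bilinear X x\<^sub>0 V W T \<beta>"]) blast+
  qed
  assume "T \<in> Obj ?L"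
  show "\<beta> \<in> Tens ?L (sheaf_twist frob V) (sheaf_twist frob W) (sheaf_twist frob T)" if b: "\<beta> \<in> Tens ?L V W T" for \<beta>
  proof -
    obtain b where b: "is_sheaf_tensor_product k X V W T b" "\<beta> = stalk_bilinear X x\<^sub>0 V W T b"
      using b unfolding L by (elim exE conjE)
    show ?thesis unfolding L b(2)
      using sheaf_twist_tensor_product[OF b(1)] stalk_bilinear_twist[of X x\<^sub>0 frob V W T b] by metis
  qed
qed

theorem corollary4p3:
  fixes k :: "'k ring" and p :: nat
  assumes "perfect_field k" and "p > 0" and "has_characteristic k p"
  shows
    "(\<forall>(\<Gamma> :: 'g monoid) (A :: ('k, 'a) module) G.
        group \<Gamma> \<and> large_for_spaces TYPE('v) k \<and>
        is_proalgebraic_completion TYPE('v) k \<Gamma> A G \<longrightarrow>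
        perfect_group_scheme p k A G) \<and>
     (\<forall>(X :: 'x topology) x\<^sub>0 (A :: ('k, 'b) module) G.
        connected_space X \<and> x\<^sub>0 \<in> topspace X \<and> large_for_local_systems TYPE('s) k X \<and>
        is_proalgebraic_fundamental_group TYPE('s) k X x\<^sub>0 A G \<longrightarrow>
        perfect_group_scheme p k A G)"
proof -
  interpret perfect_char k p by (rule perfect_field_imp_perfect_char[OF assms])
  show ?thesis
    unfolding is_proalgebraic_completion_def is_proalgebraic_fundamental_group_def
  proof (intro conjI allI impI; elim conjE)
    fix \<Gamma> :: "'g monoid" and A :: "('k, 'a) module" and G
    assume "group \<Gamma>" "large_for_spaces TYPE('v) k" "tannakian_dual k (Rep TYPE('v) k \<Gamma>) A G"
    then show "perfect_group_scheme p k A G"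
      by (intro twisted_fibre_functor.tannakian_dual_perfect[OF Rep_twisted_fibre_functor])
  next
    fix X :: "'x topology" and x\<^sub>0 and A :: "('k, 'b) module" and G
    assume "x\<^sub>0 \<in> topspace X" "large_for_local_systems TYPE('s) k X" "tannakian_dual k (Loc TYPE('s) k X x\<^sub>0) A G"
    then show "perfect_group_scheme p k A G"
      by (intro twisted_fibre_functor.tannakian_dual_perfect[OF Loc_twisted_fibre_functor])
  qed
qed

end
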